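(* Let $n\ge1$, let $s>0$ be a real number, and let $B,Q$ be real $n\times n$ matrices with $Q$ symmetric positive semidefinite. Let $\mathcal P=\frac12\operatorname{Tr}^s(-Q\nabla_x^2)+\langle Bx,\nabla_x\rangle$ be the associated fractional Ornstein-Uhlenbeck operator on $L^2(\mathbb R^n)$, equipped with the domain $D(\mathcal P)=\{u\in L^2(\mathbb R^n):\mathcal Pu\in L^2(\mathbb R^n)\}$. Let $S=\bigcap_{j=0}^{n-1}\operatorname{Ker}\big(\sqrt Q(B^T)^j\big)$ and let $0\le r\le n-1$ be the smallest integer such that $S=\bigcap_{j=0}^{r}\operatorname{Ker}\big(\sqrt Q(B^T)^j\big)$. Then there exists a constant $c>0$ such that for all $u\in D(\mathcal P)$, $$\sum_{k=0}^r\big\Vert\langle\sqrt Q(B^T)^kD_x\rangle^{\frac{2s}{1+2ks}}u\big\Vert_{L^2}\le c\big(\Vert\mathcal Pu\Vert_{L^2}+\Vert u\Vert_{L^2}\big).$$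
   Context: The operator $\operatorname{Tr}^s(-Q\nabla_x^2)$ is the Fourier multiplier with symbol $\xi\mapsto\langle Q\xi,\xi\rangle^s$ (with $\langle\cdot,\cdot\rangle$ the canonical Euclidean scalar product), and $\langle Bx,\nabla_x\rangle=\sum_{i=1}^n\sum_{j=1}^nB_{i,j}x_j\partial_{x_i}$ with $B=(B_{i,j})$. The expression $\mathcal Pu$ for $u\in L^2(\mathbb R^n)$ is understood in the sense of distributions. $\sqrt Q$ is the positive semidefinite square root of $Q$. For $\eta\in\mathbb R^n$, $\langle\eta\rangle=\sqrt{1+|\eta|^2}$ is the Japanese bracket, and for a continuous function $F:\mathbb R^n\to\mathbb C$, $F(D_x)$ denotes the Fourier multiplier with symbol $F(\xi)$ (with $D_x=-i\nabla_x$); thus $\langle\sqrt Q(B^T)^kD_x\rangle^{p}$ is the Fourier multiplier with symbol $(1+|\sqrt Q(B^T)^k\xi|^2)^{p/2}$. *)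

theory Defs
  imports "HOL-Analysis.Analysis"
begin

text \<open>The ring operations inherited by the vector types are componentwise, so
  \<open>A ^ k\<close> is not the power of a square matrix with respect to \<open>**\<close>.\<close>

primrec mat_pow :: "real^'n^'n \<Rightarrow> nat \<Rightarrow> real^'n^'n" where
  "mat_pow A 0 = mat 1"
| "mat_pow A (Suc k) = A ** mat_pow A k"

definition pos_semidef :: "real^'n^'n \<Rightarrow> bool" where
  "pos_semidef A \<longleftrightarrow> transpose A = A \<and> (\<forall>x. 0 \<le> (A *v x) \<bullet> x)"

definition mat_sqrt :: "real^'n^'n \<Rightarrow> real^'n^'n" where
  "mat_sqrt Q = (THE R. pos_semidef R \<and> R ** R = Q)"

definition mat_ker :: "real^'n^'n \<Rightarrow> (real^'n) set" where
  "mat_ker A = {x. A *v x = 0}"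

definition japanese :: "real^'n \<Rightarrow> real" where
  "japanese \<eta> = sqrt (1 + (norm \<eta>)\<^sup>2)"

text \<open>Elements of \<open>L\<^sup>2\<close> are represented by Borel functions; two functions that agree almost
  everywhere represent the same element.\<close>

definition L2 :: "(real^'n \<Rightarrow> complex) set" where
  "L2 = {f. f \<in> borel_measurable lborel \<and> integrable lborel (\<lambda>x. (cmod (f x))\<^sup>2)}"

definition L2_norm :: "(real^'n \<Rightarrow> complex) \<Rightarrow> real" where
  "L2_norm f = sqrt (\<integral>x. (cmod (f x))\<^sup>2 \<partial>lborel)"

definition partial :: "'n \<Rightarrow> (real^'n \<Rightarrow> complex) \<Rightarrow> real^'n \<Rightarrow> complex" where
  "partial i f x = frechet_derivative f (at x) (axis i 1)"

text \<open>The list \<open>\<alpha>\<close> plays the role of a multi-index. Differentiability of all iterated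
  partial derivatives amounts to smoothness.\<close>

definition schwartz :: "(real^'n \<Rightarrow> complex) set" where
  "schwartz = {\<phi>. \<forall>\<alpha>.
     (\<forall>x. foldr partial \<alpha> \<phi> differentiable (at x)) \<and>
     (\<forall>N::nat. bounded (range (\<lambda>x. (1 + norm x) ^ N *\<^sub>R foldr partial \<alpha> \<phi> x)))}"

definition fourier :: "(real^'n \<Rightarrow> complex) \<Rightarrow> real^'n \<Rightarrow> complex" where
  "fourier \<phi> \<xi> = (\<integral>x. cis (- (x \<bullet> \<xi>)) * \<phi> x \<partial>lborel)"

definition inv_fourier :: "(real^'n \<Rightarrow> complex) \<Rightarrow> real^'n \<Rightarrow> complex" where
  "inv_fourier \<phi> x =
     complex_of_real (1 / (2 * pi) ^ CARD('n)) * (\<integral>\<xi>. cis (x \<bullet> \<xi>) * \<phi> \<xi> \<partial>lborel)"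

text \<open>A tempered distribution is given by its values on \<^const>\<open>schwartz\<close>; values elsewhere are
  irrelevant. All pairings are bilinear (no complex conjugation).\<close>

type_synonym 'n distr = "(real^'n \<Rightarrow> complex) \<Rightarrow> complex"

definition distr_of :: "(real^'n \<Rightarrow> complex) \<Rightarrow> 'n distr" where
  "distr_of f \<phi> = (\<integral>x. f x * \<phi> x \<partial>lborel)"

definition distr_eq :: "'n::finite distr \<Rightarrow> 'n distr \<Rightarrow> bool" where
  "distr_eq T U \<longleftrightarrow> (\<forall>\<phi>\<in>schwartz. T \<phi> = U \<phi>)"

definition distr_partial :: "'n::finite \<Rightarrow> 'n distr \<Rightarrow> 'n distr" where
  "distr_partial i T \<phi> = - T (partial i \<phi>)"

definition distr_mult :: "(real^'n \<Rightarrow> complex) \<Rightarrow> 'n distr \<Rightarrow> 'n distr" where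
  "distr_mult a T \<phi> = T (\<lambda>x. a x * \<phi> x)"

definition distr_fourier :: "'n::finite distr \<Rightarrow> 'n distr" where
  "distr_fourier T \<phi> = T (fourier \<phi>)"

definition distr_inv_fourier :: "'n::finite distr \<Rightarrow> 'n distr" where
  "distr_inv_fourier T \<phi> = T (inv_fourier \<phi>)"

definition distr_in_L2 :: "'n::finite distr \<Rightarrow> bool" where
  "distr_in_L2 T \<longleftrightarrow> (\<exists>f\<in>L2. distr_eq T (distr_of f))"

text \<open>The function representing a distribution is unique up to null sets, so the infimum is
  the \<open>L\<^sup>2\<close> norm of that function; it is \<open>\<infinity>\<close> if the distribution is not in \<open>L\<^sup>2\<close>.\<close>

definition distr_L2_norm :: "'n::finite distr \<Rightarrow> ennreal" where
  "distr_L2_norm T = (INF f\<in>{f\<in>L2. distr_eq T (distr_of f)}. ennreal (L2_norm f))"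

text \<open>The Fourier transform of \<open>u \<in> L\<^sup>2\<close>, taken in the sense of tempered distributions, is again
  a function in \<open>L\<^sup>2\<close> (Plancherel), unique up to null sets.\<close>

definition fourier_L2 :: "(real^'n \<Rightarrow> complex) \<Rightarrow> real^'n \<Rightarrow> complex" where
  "fourier_L2 u = (SOME v. v \<in> L2 \<and> distr_eq (distr_fourier (distr_of u)) (distr_of v))"

text \<open>\<open>F(D\<^sub>x)u\<close> for \<open>u \<in> L\<^sup>2\<close> and a continuous symbol \<open>F\<close> of at most polynomial growth: the
  symbol need not be smooth, so it multiplies the function \<open>\<xi> \<mapsto> fourier_L2 u \<xi>\<close>, not a general
  tempered distribution.\<close>

definition fourier_multiplier ::
    "(real^'n \<Rightarrow> complex) \<Rightarrow> (real^'n \<Rightarrow> complex) \<Rightarrow> 'n distr" where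
  "fourier_multiplier F u = distr_inv_fourier (distr_of (\<lambda>\<xi>. F \<xi> * fourier_L2 u \<xi>))"

definition frac_diffusion ::
    "real \<Rightarrow> real^'n^'n \<Rightarrow> (real^'n \<Rightarrow> complex) \<Rightarrow> 'n distr" where
  "frac_diffusion s Q =
     fourier_multiplier (\<lambda>\<xi>. complex_of_real (((Q *v \<xi>) \<bullet> \<xi>) powr s))"

definition drift :: "real^'n^'n \<Rightarrow> (real^'n \<Rightarrow> complex) \<Rightarrow> 'n distr" where
  "drift B u \<phi> = (\<Sum>i\<in>UNIV. \<Sum>j\<in>UNIV. complex_of_real (B $ i $ j) *
     distr_mult (\<lambda>x. complex_of_real (x $ j)) (distr_partial i (distr_of u)) \<phi>)"

definition frac_OU ::
    "real \<Rightarrow> real^'n^'n \<Rightarrow> real^'n^'n \<Rightarrow> (real^'n \<Rightarrow> complex) \<Rightarrow> 'n distr" where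
  "frac_OU s B Q u \<phi> = 1/2 * frac_diffusion s Q u \<phi> + drift B u \<phi>"

definition frac_OU_domain ::
    "real \<Rightarrow> real^'n^'n \<Rightarrow> real^'n^'n \<Rightarrow> (real^'n \<Rightarrow> complex) set" where
  "frac_OU_domain s B Q = {u \<in> L2. distr_in_L2 (frac_OU s B Q u)}"

end

theory Submission imports Defs "HOL-Probability.Probability" begin

text \<open>Let \<open>v\<close> be the Fourier transform of \<open>u\<close>, \<open>q \<xi> = \<langle>Q\<xi>, \<xi>\<rangle>\<close>, \<open>g\<close> the transform of \<open>P u\<close> and \<open>X\<close> the
  derivative along the linear field \<open>B\<^sup>T \<xi>\<close>. The equation becomes the transport equation
  \<open>X v = 1/2 q\<^sup>s v - Tr(B) v - g\<close>, and \<open>\<eta>\<^sub>k = \<surd>Q (B\<^sup>T)\<^sup>k \<xi>\<close> satisfies \<open>X \<eta>\<^sub>k = \<eta>\<^sub>k\<^sub>+\<^sub>1\<close>, while \<open>\<eta>\<^sub>r\<^sub>+\<^sub>1\<close> is bounded by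
  \<open>\<eta>\<^sub>0, \<dots>, \<eta>\<^sub>r\<close> because the chain of kernels stops at \<open>r\<close>. With \<open>p\<^sub>k = k + 1/(2s)\<close> there is a multiplier \<open>M\<close>
  comparable to the sum of the weights \<open>(1 + |\<eta>\<^sub>k|\<^sup>2)\<close> to the power \<open>1/(2 p\<^sub>k)\<close> such that
  \<open>X M + M q\<^sup>s \<ge> c M\<^sup>2 - D\<close>: the growth along the flow comes from the cross terms \<open>\<langle>\<eta>\<^sub>k, \<eta>\<^sub>k\<^sub>+\<^sub>1\<rangle>\<close>, whose
  derivatives contain \<open>|\<eta>\<^sub>k\<^sub>+\<^sub>1|\<^sup>2\<close>. Integrating \<open>X (M |v|\<^sup>2)\<close> then bounds \<open>M v\<close> in \<open>L\<^sup>2\<close>.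

  To make this rigorous, \<open>u\<close> is multiplied by a Gaussian, so that \<open>v\<close> is mollified by a heat kernel; the
  drift only produces a harmless commutator, and the commutator of \<open>q\<^sup>s\<close> with the heat kernel vanishes in
  the limit once \<open>M\<close> is cut off polynomially. Only the Plancherel inequality is needed, not the
  equality.\<close>


section \<open>Square roots of positive semidefinite matrices and kernels\<close>

text \<open>Two facts shape the analysis. \<open>u\<close> is only known to lie in the maximal
  domain, so neither X v nor M v may be assumed square integrable; and q^s need not be
  differentiable, so its commutator with the mollifier cannot be expanded by Taylor's formula. It is
  written through the differences q^s(\<zeta>) - q^s(\<xi>), for which continuity and polynomial
  growth suffice; the price is that it becomes small only against a decaying weight. This weight, a
  negative power of 1 + \<delta> |\<xi>|^2, fits linear fields: its logarithmic derivative along B^T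
  \<xi> is bounded independently of \<delta>, so cutting off costs a multiple of M |v|^2, which M^2
  absorbs. The mollification is removed first, with \<delta> fixed, and \<delta> afterwards; the
  constants of the final estimate depend on neither parameter.

  The inequality for X M has the square M^2 as its gain because the trace of B, the cutoff and the
  source all enter linearly in M: Young's inequality then pays for all of them at once.\<close>

lemma symmetric_eigenvector_exists:
  fixes f :: "'a::euclidean_space \<Rightarrow> 'a"
  assumes lin: "linear f" and sym: "\<And>x y. f x \<bullet> y = x \<bullet> f y"
    and V: "subspace V" and inv: "\<And>x. x \<in> V \<Longrightarrow> f x \<in> V" and nz: "V \<noteq> {0}"
  shows "\<exists>v\<in>V. norm v = 1 \<and> (\<exists>l. f v = l *\<^sub>R v)"
proof -
  let ?S = "sphere 0 1 \<inter> V"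
  have "compact ?S" using V by (simp add: closed_subspace compact_Int_closed)
  moreover have "?S \<noteq> {}"
  proof -
    obtain x where "x \<in> V" "x \<noteq> 0" using nz V subspace_0 by blast
    then have "(1 / norm x) *\<^sub>R x \<in> ?S" using V by (simp add: subspace_scale)
    then show ?thesis by blast
  qed
  moreover have "continuous_on ?S (\<lambda>x. f x \<bullet> x)"
    using lin by (intro continuous_intros linear_continuous_on linear_conv_bounded_linear[THEN iffD1])
  \<comment> \<open>Rayleigh's principle: a maximiser of the quadratic form on the unit sphere of
    \<open>V\<close> is an eigenvector, because the first variation in every direction of
    \<open>V\<close> vanishes there.\<close>
  ultimately obtain v where v: "v \<in> ?S" and max: "\<And>y. y \<in> ?S \<Longrightarrow> f y \<bullet> y \<le> f v \<bullet> v"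
    using continuous_attains_sup[of ?S "\<lambda>x. f x \<bullet> x"] by blast
  define l where "l = f v \<bullet> v"
  have vV: "v \<in> V" and nv: "v \<bullet> v = 1" using v by (auto simp: norm_eq_1)
  have quad: "f y \<bullet> y \<le> l * (y \<bullet> y)" if "y \<in> V" for y
  proof (cases "y = 0")
    case True then show ?thesis by simp
  next
    case False
    let ?y = "(1 / norm y) *\<^sub>R y"
    have "?y \<in> ?S" using False that V by (simp add: subspace_scale)
    from max[OF this] have "(f y \<bullet> y) / (norm y)\<^sup>2 \<le> l"
      by (simp add: l_def linear_scale[OF lin] power2_eq_square)
    then show ?thesis using False by (simp add: power2_norm_eq_inner[symmetric] divide_simps)
  qed
  have ortho: "(f v - l *\<^sub>R v) \<bullet> y = 0" if y: "y \<in> V" for y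
  proof -
    define a where "a = (f v - l *\<^sub>R v) \<bullet> y"
    define b where "b = l * (y \<bullet> y) - f y \<bullet> y"
    have b0: "b \<ge> 0" using quad[OF y] by (simp add: b_def)
    have key: "2 * t * a \<le> t\<^sup>2 * b" for t
    proof -
      have "v + t *\<^sub>R y \<in> V" using vV y V by (simp add: subspace_add subspace_scale)
      from quad[OF this] have "f v \<bullet> v + 2 * t * (f v \<bullet> y) + t\<^sup>2 * (f y \<bullet> y)
          \<le> l * (v \<bullet> v + 2 * t * (v \<bullet> y) + t\<^sup>2 * (y \<bullet> y))"
        using sym[of y v]
        by (simp add: linear_add[OF lin] linear_scale[OF lin] inner_add_left inner_add_right
             inner_commute power2_eq_square algebra_simps)
      then show ?thesis using nv
        by (simp add: a_def b_def l_def inner_diff_left algebra_simps)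
    qed
    have "a = 0"
    proof (rule ccontr)
      assume "a \<noteq> 0"
      then have a2: "a\<^sup>2 > 0" by simp
      \<comment> \<open>A short step in the direction \<open>y\<close>: the term linear in t then
        exceeds the quadratic one. Adding 1 to \<open>b\<close> keeps the denominator positive when
        \<open>b\<close> is 0.\<close>
      have "2 * (a / (b + 1)) * a \<le> (a / (b + 1))\<^sup>2 * b" by (rule key)
      then have "2 * a\<^sup>2 * (b + 1) \<le> a\<^sup>2 * b" using b0
        by (simp add: power2_eq_square divide_simps)
      then show False using a2 b0 by (simp add: mult.assoc) 
    qed
    then show ?thesis by (simp add: a_def)
  qed
  have "f v - l *\<^sub>R v \<in> V" using vV inv V by (simp add: subspace_diff subspace_scale)
  from ortho[OF this] have "f v = l *\<^sub>R v" by simp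
  then show ?thesis using vV v by (auto intro!: bexI[of _ v])
qed

text \<open>Spectral theorem by induction on the dimension: one unit eigenvector is split off, and
  symmetry makes its orthogonal complement in \<open>V\<close> invariant again. The form for
  invariant subspaces is what this induction needs.\<close>

lemma symmetric_eigenbasis_subspace:
  fixes f :: "'a::euclidean_space \<Rightarrow> 'a"
  assumes lin: "linear f" and sym: "\<And>x y. f x \<bullet> y = x \<bullet> f y"
  shows "subspace V \<Longrightarrow> (\<And>x. x \<in> V \<Longrightarrow> f x \<in> V) \<Longrightarrow>
    \<exists>E. finite E \<and> E \<subseteq> V \<and> V \<subseteq> span E \<and> pairwise orthogonal E \<and>
       (\<forall>v\<in>E. norm v = 1 \<and> (\<exists>l. f v = l *\<^sub>R v))"
proof (induction "dim V" arbitrary: V rule: less_induct)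
  case less
  show ?case
  proof (cases "V = {0}")
    case True
    then show ?thesis by (intro exI[of _ "{}"]) auto
  next
    case False
    obtain v l where v: "v \<in> V" "norm v = 1" "f v = l *\<^sub>R v"
      using symmetric_eigenvector_exists[OF lin sym less.prems False] by blast
    define W where "W = {x \<in> V. v \<bullet> x = 0}"
    have W: "subspace W" unfolding W_def using less.prems(1)
      by (auto simp: subspace_def inner_add_right)
    have "v \<notin> W" using v by (auto simp: W_def)
    then have WV: "W \<subset> V" using v(1) unfolding W_def by blast
    have "dim W < dim V"
      using WV W less.prems(1) by (metis dim_subset order_less_le psubset_imp_subset subspace_dim_equal)
    moreover have "f x \<in> W" if "x \<in> W" for x
      using that less.prems(2) sym[of v x] v by (auto simp: W_def)
    ultimately obtain E where E: "finite E" "E \<subseteq> W" "W \<subseteq> span E" "pairwise orthogonal E"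
       "\<forall>v\<in>E. norm v = 1 \<and> (\<exists>l. f v = l *\<^sub>R v)"
      using less.hyps[of W] W by blast
    have "V \<subseteq> span (insert v E)"
    proof
      fix x assume x: "x \<in> V"
      have "x - (v \<bullet> x) *\<^sub>R v \<in> W" unfolding W_def using x v less.prems(1)
        by (auto simp: subspace_diff subspace_scale inner_diff_right norm_eq_1)
      then have "x - (v \<bullet> x) *\<^sub>R v \<in> span E" using E by blast
      then show "x \<in> span (insert v E)" by (rule span_breakdown_eq[THEN iffD2, OF exI])
    qed
    moreover have "pairwise orthogonal (insert v E)"
      using E by (auto simp: pairwise_insert W_def orthogonal_def inner_commute)
    ultimately show ?thesis using E v WV
      by (intro exI[of _ "insert v E"]) auto
  qed
qed

text \<open>From (R + sqrt l)(R - sqrt l) v = 0, the vector w = (R - sqrt l) v satisfies R w = -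
  sqrt l w, which positivity of \<open>R\<close> forbids unless w = 0. As it determines
  \<open>R\<close> on an eigenbasis of \<open>Q\<close>, this is the uniqueness half of the square
  root.\<close>

lemma pos_semidef_eigen_sqrt:
  assumes R: "pos_semidef R" and RR: "R ** R = Q" and v: "Q *v v = l *\<^sub>R v" and l: "l \<ge> 0"
  shows "R *v v = sqrt l *\<^sub>R v"
proof -
  have sym: "(R *v x) \<bullet> y = x \<bullet> (R *v y)" for x y
    using R dot_lmul_matrix[of x R y] by (simp add: pos_semidef_def) (metis transpose_matrix_vector)
  have R2: "R *v (R *v x) = Q *v x" for x by (simp add: matrix_vector_mul_assoc RR)
  define w where "w = R *v v - sqrt l *\<^sub>R v"
  have "R *v w = - sqrt l *\<^sub>R w"
    by (simp add: w_def matrix_vector_mult_diff_distrib R2 v matrix_vector_mult_scaleR algebra_simps l)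
  moreover have "0 \<le> (R *v w) \<bullet> w" using R by (simp add: pos_semidef_def)
  ultimately have le: "sqrt l * (w \<bullet> w) \<le> 0" by simp
  have "w = 0"
  proof (cases "l = 0")
    \<comment> \<open>For \<open>l = 0\<close> the inequality \<open>le\<close> carries no
      information; instead |R v|^2 = <R R v, v> = 0.\<close>
    case True
    have "(R *v v) \<bullet> (R *v v) = 0" using sym[of v "R *v v"] by (simp add: R2 v True)
    then show ?thesis by (simp add: w_def True)
  next
    case False
    then have "sqrt l > 0" using l by simp
    with le have "w \<bullet> w \<le> 0" by (simp add: mult_le_0_iff)
    then show ?thesis by (metis inner_ge_zero inner_eq_zero_iff order_antisym)
  qed
  then show ?thesis by (simp add: w_def)
qed

text \<open>The definite description in \<open>mat_sqrt\<close> needs existence and uniqueness. An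
  orthonormal eigenbasis gives both: the root multiplies each eigenvector by the square root of its
  eigenvalue, and every other root is forced to do the same.\<close>

lemma mat_sqrt_works:
  fixes Q :: "real^'n^'n"
  assumes "pos_semidef Q"
  shows "pos_semidef (mat_sqrt Q) \<and> mat_sqrt Q ** mat_sqrt Q = Q"
  unfolding mat_sqrt_def
proof (rule theI')
  have sym: "(Q *v x) \<bullet> y = x \<bullet> (Q *v y)" for x y
    using assms dot_lmul_matrix[of x Q y] by (simp add: pos_semidef_def) (metis transpose_matrix_vector)
  obtain E where E: "finite E" "UNIV \<subseteq> span E" "pairwise orthogonal E"
       "\<forall>v\<in>E. norm v = 1 \<and> (\<exists>l. Q *v v = l *\<^sub>R v)"
    using symmetric_eigenbasis_subspace[of "(*v) Q" UNIV] sym by (auto simp: subspace_UNIV)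
  obtain l where l: "\<And>v. v \<in> E \<Longrightarrow> Q *v v = l v *\<^sub>R v" using E(4) by metis
  have nE: "v \<bullet> v = 1" if "v \<in> E" for v using E(4) that by (auto simp: norm_eq_1)
  have oE: "v \<bullet> w = 0" if "v \<in> E" "w \<in> E" "v \<noteq> w" for v w
    using E(3) that by (auto simp: pairwise_def orthogonal_def)
  have l0: "l v \<ge> 0" if "v \<in> E" for v
    using assms nE[OF that] l[OF that] by (auto simp: pos_semidef_def dest: spec[of _ v])
  have ext: "A = B" if "\<And>v. v \<in> E \<Longrightarrow> A *v v = B *v v" for A B :: "real^'n^'n"
  proof -
    have "A *v x = B *v x" for x
      using linear_eq_on_span[of "(*v) A" "(*v) B" E] that E(2) by auto
    then show ?thesis by (simp add: matrix_eq)
  qed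
  define g where "g x = (\<Sum>v\<in>E. (sqrt (l v) * (v \<bullet> x)) *\<^sub>R v)" for x
  have lg: "linear g" unfolding g_def
    by (auto intro!: linearI simp: inner_add_right scaleR_add_left algebra_simps sum.distrib scaleR_sum_right)
  define R where "R = matrix g"
  have Rg: "R *v x = g x" for x by (simp add: R_def lg)
  have gv: "g v = sqrt (l v) *\<^sub>R v" if "v \<in> E" for v
  proof -
    have "g v = (\<Sum>w\<in>E. if w = v then sqrt (l v) *\<^sub>R v else 0)"
      unfolding g_def by (rule sum.cong) (auto simp: nE oE that)
    then show ?thesis using that E(1) by simp
  qed
  have gs: "g x \<bullet> y = x \<bullet> g y" for x y
    by (simp add: g_def inner_sum_left inner_sum_right inner_commute algebra_simps)
  have gp: "g x \<bullet> x \<ge> 0" for x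
    unfolding g_def inner_sum_left by (intro sum_nonneg) (simp add: l0 mult.assoc)
  have psR: "pos_semidef R"
    unfolding pos_semidef_def
  proof
    have "(transpose R *v x) \<bullet> y = (R *v x) \<bullet> y" for x y
      using dot_lmul_matrix[of x R y] by (simp add: Rg gs transpose_matrix_vector)
    then have "transpose R *v x = R *v x" for x by (metis vector_eq_rdot)
    then show "transpose R = R" by (simp add: matrix_eq)
  qed (simp add: Rg gp)
  have RR: "R ** R = Q"
    by (rule ext) (simp add: matrix_vector_mul_assoc[symmetric] Rg gv linear_scale[OF lg] l l0)
  show "\<exists>!R. pos_semidef R \<and> R ** R = Q"
  proof (rule ex1I[of _ R])
    show "pos_semidef R \<and> R ** R = Q" using psR RR by simp
    fix R' assume "pos_semidef R' \<and> R' ** R' = Q"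
    then show "R' = R"
      by (intro ext) (simp add: pos_semidef_eigen_sqrt[OF _ _ l l0] Rg gv)
  qed
qed

text \<open>Identifies the symbol of the diffusion with a power of |\<eta> 0|, the first member of
  the chain on which the multiplier is built.\<close>

lemma quadratic_form_mat_sqrt:
  assumes "pos_semidef Q"
  shows "(Q *v x) \<bullet> x = (norm (mat_sqrt Q *v x))\<^sup>2"
proof -
  let ?R = "mat_sqrt Q"
  have R: "transpose ?R = ?R" "?R ** ?R = Q"
    using mat_sqrt_works[OF assms] by (auto simp: pos_semidef_def)
  have "(norm (?R *v x))\<^sup>2 = (?R *v x) \<bullet> (?R *v x)" by (simp add: power2_norm_eq_inner)
  also have "\<dots> = x \<bullet> (?R *v (?R *v x))"
    using dot_lmul_matrix[of x ?R "?R *v x"] R(1) by (metis transpose_matrix_vector)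
  finally show ?thesis by (simp add: matrix_vector_mul_assoc R(2) inner_commute)
qed

text \<open>The Gram map, the sum of the \<open>transpose (A j) ** A j\<close>, is injective on the
  orthogonal complement of the common kernel, hence bounded below there by finite dimension; the
  component inside the kernel is invisible to \<open>T\<close> as well as to all
  \<open>A j\<close>.\<close>

lemma norm_le_sum_norm_of_kernel:
  fixes A :: "nat \<Rightarrow> real^'n^'n" and T :: "real^'n^'n"
  assumes ker: "(\<Inter>j\<in>{0..r}. mat_ker (A j)) \<subseteq> mat_ker T"
  shows "\<exists>c. \<forall>x. norm (T *v x) \<le> c * (\<Sum>j=0..r. norm (A j *v x))"
proof -
  define f where "f x = (\<Sum>j=0..r. transpose (A j) *v (A j *v x))" for x
  have linf: "linear f" unfolding f_def
    by (intro linear_compose_sum ballI)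
      (auto intro!: linearI simp del: transpose_matrix_vector
        simp: matrix_vector_right_distrib matrix_vector_mult_scaleR)
  have fx: "f x \<bullet> x = (\<Sum>j=0..r. (norm (A j *v x))\<^sup>2)" for x
  proof -
    have "(transpose (A j) *v (A j *v x)) \<bullet> x = (norm (A j *v x))\<^sup>2" for j
      using dot_lmul_matrix[of "A j *v x" "A j" x] by (simp add: power2_norm_eq_inner transpose_matrix_vector)
    then show ?thesis by (simp add: f_def inner_sum_left)
  qed
  define V where "V = (\<Inter>j\<in>{0..r}. mat_ker (A j))"
  have subV: "subspace V" unfolding V_def
    by (intro subspace_Inter) (auto simp: mat_ker_def subspace_def matrix_vector_right_distrib matrix_vector_mult_scaleR)
  define W where "W = {y. \<forall>x\<in>V. orthogonal x y}"
  have W: "subspace W" unfolding W_def by (auto simp: subspace_def orthogonal_def inner_add_right)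
  have inj: "x = 0" if "x \<in> W" "f x = 0" for x
  proof -
    have "(\<Sum>j=0..r. (norm (A j *v x))\<^sup>2) = 0" using fx[of x] that by simp
    then have "\<forall>j\<in>{0..r}. A j *v x = 0" by (subst (asm) sum_nonneg_eq_0_iff) auto
    then have "x \<in> V" by (auto simp: V_def mat_ker_def)
    then show ?thesis using that by (auto simp: W_def orthogonal_def)
  qed
  have "\<exists>e>0. \<forall>x\<in>W. norm (f x) \<ge> e * norm x"
    using injective_imp_isometric[of W f] W linf inj closed_subspace linear_conv_bounded_linear by blast
  then obtain e where e: "e > 0" "\<And>x. x \<in> W \<Longrightarrow> norm (f x) \<ge> e * norm x" by blast
  have "\<forall>j. \<exists>K. \<forall>y. norm (transpose (A j) *v y) \<le> norm y * K"
    using matrix_vector_mul_bounded_linear[THEN bounded_linear.bounded] by blast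
  then obtain b where b: "\<And>j y. norm (transpose (A j) *v y) \<le> norm y * b j" by metis
  obtain t where t: "t > 0" "\<And>y. norm (T *v y) \<le> norm y * t" 
    using matrix_vector_mul_bounded_linear[THEN bounded_linear.pos_bounded] by metis
  define bb where "bb = (\<Sum>j=0..r. \<bar>b j\<bar>)"
  have ff: "norm (f x) \<le> bb * (\<Sum>j=0..r. norm (A j *v x))" for x
  proof -
    have "norm (f x) \<le> (\<Sum>j=0..r. norm (transpose (A j) *v (A j *v x)))" unfolding f_def by (rule norm_sum)
    also have "\<dots> \<le> (\<Sum>j=0..r. bb * norm (A j *v x))"
    proof (rule sum_mono)
      fix j assume j: "j \<in> {0..r}"
      have "b j \<le> \<bar>b j\<bar>" by simp
      also have "\<dots> \<le> bb" unfolding bb_def using j by (intro member_le_sum) auto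
      finally have "norm (A j *v x) * b j \<le> norm (A j *v x) * bb" by (intro mult_left_mono) auto
      then show "norm (transpose (A j) *v (A j *v x)) \<le> bb * norm (A j *v x)"
        using b[of j "A j *v x"] by (simp add: mult.commute)
    qed
    finally show ?thesis by (simp add: sum_distrib_left)
  qed
  show ?thesis
  proof (intro exI[of _ "t * bb / e"] allI)
    fix x
    obtain y z where yz: "y \<in> V" "z \<in> W" "x = y + z"
      using orthogonal_subspace_decomp_exists[of V x] subV[folded V_def]
      using subV by (simp add: W_def span_eq_iff[THEN iffD2]) (metis orthogonal_commute)
    have Ty: "T *v x = T *v z" and Ay: "\<And>j. j \<in> {0..r} \<Longrightarrow> A j *v x = A j *v z"
      using yz ker by (auto simp: V_def mat_ker_def matrix_vector_right_distrib)
    have "norm (T *v x) \<le> norm z * t" using t by (simp add: Ty)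
    also have "\<dots> \<le> (norm (f z) / e) * t" using e t yz
      by (intro mult_right_mono) (auto simp: field_simps)
    also have "\<dots> \<le> (bb * (\<Sum>j=0..r. norm (A j *v z)) / e) * t" using e(1) t(1) ff[of z]
      by (intro mult_right_mono divide_right_mono) auto
    also have "\<dots> = t * bb / e * (\<Sum>j=0..r. norm (A j *v x))" using Ay by simp
    finally show "norm (T *v x) \<le> t * bb / e * (\<Sum>j=0..r. norm (A j *v x))" .
  qed
qed

section \<open>Stabilisation of the chain of kernels\<close>

lemma mat_pow_Suc_right: "mat_pow A (Suc k) = mat_pow A k ** A"
  by (induction k) (simp_all add: matrix_mul_assoc)

text \<open>Once two consecutive kernels agree, the decreasing chain is constant from there on.
  Hence all inclusions before \<open>r\<close> are strict, and dimensions bound the number of strict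
  inclusions.\<close>

lemma kernel_chain_stabilises:
  fixes R C :: "real^'n^'n"
  defines "K \<equiv> \<lambda>m. \<Inter>j\<in>{0..m}. mat_ker (R ** mat_pow C j)"
  defines "r \<equiv> LEAST m. m \<le> CARD('n) - 1 \<and> K (CARD('n) - 1) = K m"
  shows "K r \<subseteq> mat_ker (R ** mat_pow C (Suc r))"
proof -
  let ?n = "CARD('n)"
  have subK: "subspace (K m)" for m unfolding K_def
    by (intro subspace_Inter) (auto simp: mat_ker_def subspace_def matrix_vector_right_distrib matrix_vector_mult_scaleR)
  have dec: "K (Suc m) \<subseteq> K m" for m by (auto simp: K_def)
  \<comment> \<open>A one-step recursion for membership: \<open>K (Suc m)\<close> depends only on
    \<open>K m\<close>, which makes an equality of neighbours propagate.\<close>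
  have K_Suc: "x \<in> K (Suc m) \<longleftrightarrow> x \<in> K 0 \<and> C *v x \<in> K m" for x m
  proof -
    have ball_split: "(\<forall>j\<in>{0..Suc m}. P j) \<longleftrightarrow> P 0 \<and> (\<forall>j\<in>{0..m}. P (Suc j))" for P
      using All_less_Suc2[of "Suc m" P] by (simp add: Ball_def less_Suc_eq_le)
    have "x \<in> K (Suc m) \<longleftrightarrow> R *v x = 0 \<and> (\<forall>j\<in>{0..m}. (R ** mat_pow C (Suc j)) *v x = 0)"
      by (simp add: K_def mat_ker_def ball_split del: mat_pow.simps(2))
    then show ?thesis
      by (simp add: K_def mat_ker_def mat_pow_Suc_right matrix_vector_mul_assoc matrix_mul_assoc
          del: mat_pow.simps(2))
  qed
  have stab: "K (Suc (m + i)) = K (m + i)" if "K (Suc m) = K m" for m i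
  proof (induction i)
    case 0 then show ?case using that by simp
  next
    case (Suc i) then show ?case by (auto simp: K_Suc set_eq_iff)
  qed
  have r: "r \<le> ?n - 1" "K (?n - 1) = K r"
    unfolding r_def by (rule LeastI2[of _ "?n - 1"]; simp)+
  have rmin: "K (?n - 1) \<noteq> K m" if "m < r" for m
    using not_less_Least[of m "\<lambda>m. m \<le> ?n - 1 \<and> K (?n - 1) = K m"] that r(1)
    by (auto simp: r_def)
  have "K (Suc r) = K r"
  proof (cases "r < ?n - 1")
    case True
    have "K (?n - 1) \<subseteq> K (Suc r)"
      by (rule lift_Suc_antimono_le[of K]) (use dec True in auto)
    then show ?thesis using r dec by auto
  next
    case False
    \<comment> \<open>Here \<open>Suc r\<close> lies beyond the indices in the definition of
      \<open>r\<close>, so a dimension count decides: if \<open>K 0\<close> is proper, its dimension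
      is at most n - 1, and r = n - 1 strict drops leave only 0. If \<open>K 0\<close> is the whole
      space, the chain is constant.\<close>
    then have rn: "r = ?n - 1" using r by simp
    have strict: "K (Suc m) \<subset> K m" if "m < r" for m
    proof (rule psubsetI[OF dec], rule notI)
      assume "K (Suc m) = K m"
      from stab[OF this] have "K (m + i) = K m" for i by (induction i) auto
      from this[of "r - m"] have "K r = K m" using that by simp
      then show False using rmin[OF that] r by simp
    qed
    have dims: "dim (K m) + m \<le> dim (K 0)" if "m \<le> r" for m
      using that
    proof (induction m)
      case (Suc m)
      have "dim (K (Suc m)) < dim (K m)"
        using strict[of m] Suc.prems subK by (metis Suc_le_lessD dim_subset order_less_le psubset_imp_subset subspace_dim_equal)
      then show ?case using Suc by simp
    qed simp
    show ?thesis
    proof (cases "K 0 = UNIV")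
      case True
      then have "K (Suc 0) = K 0" by (auto simp: K_Suc)
      with stab[of 0 r] show ?thesis by simp
    next
      case False
      then have "dim (K 0) < ?n"
        using subK by (metis DIM_cart DIM_real dim_subset_UNIV dim_eq_full mult.right_neutral order_less_le span_eq_iff)
      with dims[of r] rn have "dim (K r) = 0" by linarith
      then have "K r \<subseteq> {0}" by (simp only: dim_eq_0)
      then show ?thesis using dec[of r] subspace_0[OF subK] by blast
    qed
  qed
  then show ?thesis by (force simp: K_def)
qed

section \<open>The hypocoercive multiplier\<close>

text \<open>Here \<open>a k\<close> stands for the normalised size of \<open>\<eta> k\<close>: the derivative of the \<open>k\<close>-th cross term gains
  \<open>(a (Suc k))\<^sup>2\<close> and loses at most a multiple of \<open>a k\<close>, and \<open>a 0\<close> is controlled by the dissipation.\<close>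

lemma descending_weights_exist:
  fixes c0 C :: real
  assumes "c0 > 0" "C \<ge> 0"
  shows "\<exists>\<theta> c1 C1. (\<forall>k::nat. \<theta> k > (0::real)) \<and> c1 > 0 \<and> C1 > 0 \<and>
    (\<forall>a::nat \<Rightarrow> real. (\<forall>k\<le>r. 0 \<le> a k \<and> a k \<le> 1) \<longrightarrow> (\<exists>k\<le>r. c0 \<le> a k) \<longrightarrow>
       c1 - C1 * a 0 \<le> (\<Sum>k<r. \<theta> k * ((a (Suc k))\<^sup>2 - C * a k)))"
proof (induction r)
  case 0
  show ?case using assms
    by (intro exI[of _ "\<lambda>_. 1"] exI[of _ 1] exI[of _ "1 / c0"]) (auto simp: field_simps)
next
  case (Suc r)
  then obtain \<theta> c1 C1 where \<theta>: "\<And>k. \<theta> k > 0" and c1: "c1 > 0" and C1: "C1 > 0"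
    and IH: "\<And>a::nat \<Rightarrow> real. (\<forall>k\<le>r. 0 \<le> a k \<and> a k \<le> 1) \<Longrightarrow> (\<exists>k\<le>r. c0 \<le> a k) \<Longrightarrow>
       c1 - C1 * a 0 \<le> (\<Sum>k<r. \<theta> k * ((a (Suc k))\<^sup>2 - C * a k))"
    by blast
  \<comment> \<open>The induction adds the new index at the front. \<open>t\<close> is the value for
    which t y^2 - C1 y + c1/2 is a perfect square, so the new gain t (a 1)^2 absorbs the loss - C1
    (a 1) of the shifted sequence at the cost of half of \<open>c1\<close>.\<close>
  define t where "t = C1\<^sup>2 / (2 * c1)"
  define \<theta>' where "\<theta>' k = (case k of 0 \<Rightarrow> t | Suc k \<Rightarrow> \<theta> k)" for k
  define T where "T = (\<Sum>k<Suc r. \<theta>' k)"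
  define D where "D = t * C + (c1 / 2 + C * T) / c0"
  have t0: "t > 0" using c1 C1 by (simp add: t_def)
  have \<theta>'0: "\<theta>' k > 0" for k using t0 \<theta> by (simp add: \<theta>'_def split: nat.split)
  have T0: "T \<ge> 0" unfolding T_def by (intro sum_nonneg) (simp add: \<theta>'0 less_imp_le)
  have quad: "t * y\<^sup>2 - C1 * y \<ge> - c1 / 2" for y
  proof -
    have "t * y\<^sup>2 - C1 * y + c1 / 2 = (C1 * y - c1)\<^sup>2 / (2 * c1)"
      using c1 by (simp add: t_def power2_eq_square field_simps)
    also have "\<dots> \<ge> 0" using c1 by simp
    finally show ?thesis by simp
  qed
  \<comment> \<open>If some later entry is large, the hypothesis applies to the shifted sequence.
    Otherwise \<open>a 0\<close> is at least \<open>c0\<close>, and \<open>D\<close> is large enough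
    for the left side to lie below the worst value - C T of the sum.\<close>
  have "c1 / 2 - D * a 0 \<le> (\<Sum>k<Suc r. \<theta>' k * ((a (Suc k))\<^sup>2 - C * a k))"
    if a: "\<forall>k\<le>Suc r. 0 \<le> a k \<and> a k \<le> 1" and ex: "\<exists>k\<le>Suc r. c0 \<le> a k" for a :: "nat \<Rightarrow> real"
  proof (cases "\<exists>k\<le>r. c0 \<le> a (Suc k)")
    case True
    have "c1 - C1 * a (Suc 0) \<le> (\<Sum>k<r. \<theta> k * ((a (Suc (Suc k)))\<^sup>2 - C * a (Suc k)))"
      using IH[of "\<lambda>k. a (Suc k)"] a True by auto
    moreover have "(\<Sum>k<Suc r. \<theta>' k * ((a (Suc k))\<^sup>2 - C * a k))
        = t * ((a (Suc 0))\<^sup>2 - C * a 0) + (\<Sum>k<r. \<theta> k * ((a (Suc (Suc k)))\<^sup>2 - C * a (Suc k)))"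
      by (subst sum.lessThan_Suc_shift) (simp add: \<theta>'_def)
    moreover have "D * a 0 \<ge> t * C * a 0" using a c1 assms T0 by (intro mult_right_mono) (auto simp: D_def)
    ultimately show ?thesis using quad[of "a (Suc 0)"] by (simp add: algebra_simps)
  next
    case False
    then have a0: "c0 \<le> a 0" using ex by (metis Suc_le_mono old.nat.exhaust)
    have "(c1 / 2 + C * T) / c0 * c0 \<le> (c1 / 2 + C * T) / c0 * a 0"
      using a0 assms c1 T0 by (intro mult_left_mono) auto
    moreover have "0 \<le> t * C * a 0" using t0 assms a by simp
    moreover have "(c1 / 2 + C * T) / c0 * c0 = c1 / 2 + C * T" using assms by simp
    moreover have "D * a 0 = t * C * a 0 + (c1 / 2 + C * T) / c0 * a 0" by (simp add: D_def algebra_simps)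
    ultimately have "c1 / 2 - D * a 0 \<le> - (C * T)" by linarith
    also have "\<dots> = (\<Sum>k<Suc r. \<theta>' k * (0 - C * 1))"
      unfolding T_def sum_distrib_right[symmetric] by simp
    also have "\<dots> \<le> (\<Sum>k<Suc r. \<theta>' k * ((a (Suc k))\<^sup>2 - C * a k))"
      using a assms \<theta>'0 by (intro sum_mono mult_left_mono diff_mono mult_left_mono) (auto simp: less_imp_le)
    finally show ?thesis .
  qed
  moreover have "D > 0" using t0 c1 T0 assms by (simp add: D_def add_nonneg_pos add_pos_nonneg)
  ultimately show ?case using \<theta>'0 c1
    by (intro exI[of _ \<theta>'] exI[of _ "c1 / 2"] exI[of _ D]) auto
qed

text \<open>One application of the flow raises the order by \<open>1\<close>, so \<open>\<eta> k\<close> has order \<open>rate s k\<close> in the scale where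
  the multiplier has order \<open>1\<close>; the dissipation \<open>|\<eta> 0|\<^sup>2\<^sup>s\<close> then has order \<open>1\<close> as well. The exponents below
  make \<open>weight_base\<close> of order \<open>2 * rate s r\<close> and \<open>cross\<close> of order \<open>0\<close>. Primed versions are derivatives
  in the direction \<open>\<zeta>\<close>.\<close>

definition rate :: "real \<Rightarrow> nat \<Rightarrow> real" where
  "rate s k = real k + 1 / (2 * s)"

definition weight_base :: "real \<Rightarrow> nat \<Rightarrow> real \<Rightarrow> (nat \<Rightarrow> 'a::real_inner) \<Rightarrow> real" where
  "weight_base s r H \<eta> = H + (\<Sum>k\<le>r. (1 + \<eta> k \<bullet> \<eta> k) powr (rate s r / rate s k))"

definition weight_base' :: "real \<Rightarrow> nat \<Rightarrow> (nat \<Rightarrow> 'a::real_inner) \<Rightarrow> (nat \<Rightarrow> 'a) \<Rightarrow> real" where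
  "weight_base' s r \<eta> \<zeta> = (\<Sum>k\<le>r. rate s r / rate s k * (1 + \<eta> k \<bullet> \<eta> k) powr (rate s r / rate s k - 1) *
      (\<zeta> k \<bullet> \<eta> k + \<eta> k \<bullet> \<zeta> k))"

definition cross_exp :: "real \<Rightarrow> nat \<Rightarrow> nat \<Rightarrow> real" where
  "cross_exp s r k = - (rate s k + rate s (Suc k)) / (2 * rate s r)"

definition cross :: "real \<Rightarrow> nat \<Rightarrow> real \<Rightarrow> (nat \<Rightarrow> 'a::real_inner) \<Rightarrow> nat \<Rightarrow> real" where
  "cross s r H \<eta> k = (\<eta> k \<bullet> \<eta> (Suc k)) * weight_base s r H \<eta> powr cross_exp s r k"

definition cross' :: "real \<Rightarrow> nat \<Rightarrow> real \<Rightarrow> (nat \<Rightarrow> 'a::real_inner) \<Rightarrow> (nat \<Rightarrow> 'a) \<Rightarrow> nat \<Rightarrow> real" where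
  "cross' s r H \<eta> \<zeta> k = (\<zeta> k \<bullet> \<eta> (Suc k) + \<eta> k \<bullet> \<zeta> (Suc k)) * weight_base s r H \<eta> powr cross_exp s r k
     + (\<eta> k \<bullet> \<eta> (Suc k)) *
       (cross_exp s r k * weight_base s r H \<eta> powr (cross_exp s r k - 1) * weight_base' s r \<eta> \<zeta>)"

text \<open>The cross terms stand in an exponential: since each of them is bounded, the weight stays
  positive and comparable to the power of \<open>weight_base\<close> whatever the coefficients
  \<open>\<theta>\<close> are, and its logarithmic derivative is linear in \<open>\<theta>\<close>.
  The coefficients can then be taken as large as the gain requires.\<close>

definition weight :: "real \<Rightarrow> nat \<Rightarrow> real \<Rightarrow> (nat \<Rightarrow> real) \<Rightarrow> (nat \<Rightarrow> 'a::real_inner) \<Rightarrow> real" where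
  "weight s r H \<theta> \<eta> = weight_base s r H \<eta> powr (1 / (2 * rate s r)) * exp (\<Sum>k<r. \<theta> k * cross s r H \<eta> k)"

definition weight' ::
  "real \<Rightarrow> nat \<Rightarrow> real \<Rightarrow> (nat \<Rightarrow> real) \<Rightarrow> (nat \<Rightarrow> 'a::real_inner) \<Rightarrow> (nat \<Rightarrow> 'a) \<Rightarrow> real" where
  "weight' s r H \<theta> \<eta> \<zeta> =
     (1 / (2 * rate s r) * weight_base s r H \<eta> powr (1 / (2 * rate s r) - 1) * weight_base' s r \<eta> \<zeta>)
       * exp (\<Sum>k<r. \<theta> k * cross s r H \<eta> k)
     + weight_base s r H \<eta> powr (1 / (2 * rate s r)) *
       (exp (\<Sum>k<r. \<theta> k * cross s r H \<eta> k) * (\<Sum>k<r. \<theta> k * cross' s r H \<eta> \<zeta> k))"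

section \<open>Pointwise inequalities in powers of the scale \<Lambda>\<close>

lemma rate_pos: "s > 0 \<Longrightarrow> rate s k > 0"
  by (simp add: rate_def add_nonneg_pos)

lemma rate_mono: "k \<le> l \<Longrightarrow> rate s k \<le> rate s l"
  by (simp add: rate_def)

lemma rate_Suc: "rate s (Suc k) = rate s k + 1"
  by (simp add: rate_def)

text \<open>Everything is measured in powers of the single order-one quantity \<Lambda>, so
  estimates reduce to adding exponents. The facts of this locale hold without any information on
  \<open>\<eta> (Suc r)\<close>; they are themselves used to derive such a bound for linear
  forms.\<close>

locale weight_scale =
  fixes s :: real and r :: nat and H :: real and \<eta> :: "nat \<Rightarrow> 'a::real_inner" and \<Lambda> :: real
  assumes s: "s > 0" and H: "H \<ge> 1"
  defines "\<Lambda> \<equiv> weight_base s r H \<eta> powr (1 / (2 * rate s r))"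
begin

abbreviation "p \<equiv> rate s"
abbreviation "L \<equiv> weight_base s r H \<eta>"
abbreviation "XL \<equiv> weight_base' s r \<eta> (\<lambda>k. \<eta> (Suc k))"
abbreviation "a k \<equiv> norm (\<eta> k) / \<Lambda> powr p k"

lemma p_pos [simp]: "p k > 0" "p k \<noteq> 0" "0 \<le> p k"
  using rate_pos[OF s, of k] by auto

lemma L_ge: "L \<ge> H" "L \<ge> 1" "L > 0"
proof -
  show "L \<ge> H" by (simp add: weight_base_def sum_nonneg)
  then show "L \<ge> 1" "L > 0" using H by auto
qed

lemma \<Lambda>_ge_1: "\<Lambda> \<ge> 1"
  using L_ge by (simp add: \<Lambda>_def ge_one_powr_ge_zero)

lemma \<Lambda>_pos [simp]: "\<Lambda> > 0" "\<Lambda> \<noteq> 0" "0 \<le> \<Lambda>"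
  using \<Lambda>_ge_1 by auto

lemma L_powr: "L powr e = \<Lambda> powr (2 * p r * e)"
  by (simp add: \<Lambda>_def powr_powr)

lemma L_eq: "L = \<Lambda> powr (2 * p r)"
  using L_powr[of 1] L_ge by simp

lemma y_le: "k \<le> r \<Longrightarrow> 1 + \<eta> k \<bullet> \<eta> k \<le> \<Lambda> powr (2 * p k)"
proof -
  assume k: "k \<le> r"
  have "(1 + \<eta> k \<bullet> \<eta> k) powr (p r / p k) \<le> (\<Sum>k\<le>r. (1 + \<eta> k \<bullet> \<eta> k) powr (p r / p k))"
    using k by (intro member_le_sum) auto
  also have "\<dots> \<le> L" using H by (simp add: weight_base_def)
  finally have "((1 + \<eta> k \<bullet> \<eta> k) powr (p r / p k)) powr (p k / p r) \<le> L powr (p k / p r)"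
    by (intro powr_mono2) auto
  then show ?thesis by (simp add: powr_powr L_powr add_nonneg_nonneg mult.commute)
qed

lemma japanese_le:
  assumes "k \<le> r"
  shows "sqrt (1 + \<eta> k \<bullet> \<eta> k) \<le> \<Lambda> powr p k"
proof (rule real_le_lsqrt)
  show "1 + \<eta> k \<bullet> \<eta> k \<le> (\<Lambda> powr p k)\<^sup>2"
    using y_le[OF assms] by (simp add: powr_power mult.commute)
qed (auto intro: add_nonneg_nonneg)

lemma \<eta>_le_init: "k \<le> r \<Longrightarrow> norm (\<eta> k) \<le> \<Lambda> powr p k"
  using order_trans[OF real_sqrt_le_mono[of "\<eta> k \<bullet> \<eta> k" "1 + \<eta> k \<bullet> \<eta> k"] japanese_le[of k]]
  by (simp add: norm_eq_sqrt_inner)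

end

text \<open>\<open>weight_base\<close> does not contain \<open>\<eta> (Suc r)\<close>, so its size
  has to be assumed. With this bound the family is closed under the flow, which sends
  \<open>\<eta> k\<close> to \<open>\<eta> (Suc k)\<close>.\<close>

locale weight_point = weight_scale +
  assumes last: "norm (\<eta> (Suc r)) \<le> \<Lambda> powr rate s (Suc r)"
begin

lemma \<eta>_le: "k \<le> Suc r \<Longrightarrow> norm (\<eta> k) \<le> \<Lambda> powr p k"
  using last \<eta>_le_init[of k] by (cases "k = Suc r") auto

lemma a_bounds: "k \<le> Suc r \<Longrightarrow> 0 \<le> a k \<and> a k \<le> 1"
  using \<eta>_le[of k] by (simp add: divide_simps)

text \<open>Homogeneity: \<open>weight_base\<close> has order 2 p r, and one derivative along the
  flow raises the order by one, that is, costs a factor \<Lambda>.\<close>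

lemma XL_le: "\<bar>XL\<bar> \<le> (\<Sum>k\<le>r. 2 * p r / p k) * \<Lambda> * L"
proof -
  have "\<bar>XL\<bar> \<le> (\<Sum>k\<le>r. \<bar>p r / p k * (1 + \<eta> k \<bullet> \<eta> k) powr (p r / p k - 1) * (\<eta> (Suc k) \<bullet> \<eta> k + \<eta> k \<bullet> \<eta> (Suc k))\<bar>)"
    unfolding weight_base'_def by (rule sum_abs)
  also have "\<dots> \<le> (\<Sum>k\<le>r. 2 * p r / p k * (\<Lambda> * L))"
  proof (rule sum_mono)
    fix k assume "k \<in> {..r}"
    then have k: "k \<le> r" by simp
    have "1 \<le> p r / p k" using rate_mono[OF k, of s] by (simp add: field_simps)
    then have A: "(1 + \<eta> k \<bullet> \<eta> k) powr (p r / p k - 1) \<le> (\<Lambda> powr (2 * p k)) powr (p r / p k - 1)"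
      using y_le[OF k] by (intro powr_mono2) (auto intro: add_nonneg_nonneg)
    have "\<bar>\<eta> (Suc k) \<bullet> \<eta> k + \<eta> k \<bullet> \<eta> (Suc k)\<bar> \<le> 2 * (norm (\<eta> k) * norm (\<eta> (Suc k)))"
      using Cauchy_Schwarz_ineq2[of "\<eta> k" "\<eta> (Suc k)"] by (simp add: inner_commute)
    also have "\<dots> \<le> 2 * (\<Lambda> powr p k * \<Lambda> powr p (Suc k))"
      using \<eta>_le[of k] \<eta>_le[of "Suc k"] k by (intro mult_left_mono mult_mono) auto
    finally have B: "\<bar>\<eta> (Suc k) \<bullet> \<eta> k + \<eta> k \<bullet> \<eta> (Suc k)\<bar> \<le> 2 * (\<Lambda> powr p k * \<Lambda> powr p (Suc k))" .
    have "\<bar>p r / p k * (1 + \<eta> k \<bullet> \<eta> k) powr (p r / p k - 1) * (\<eta> (Suc k) \<bullet> \<eta> k + \<eta> k \<bullet> \<eta> (Suc k))\<bar>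
        = p r / p k * (1 + \<eta> k \<bullet> \<eta> k) powr (p r / p k - 1) * \<bar>\<eta> (Suc k) \<bullet> \<eta> k + \<eta> k \<bullet> \<eta> (Suc k)\<bar>"
      by (simp add: abs_mult)
    also have "\<dots> \<le> p r / p k * ((\<Lambda> powr (2 * p k)) powr (p r / p k - 1)) * (2 * (\<Lambda> powr p k * \<Lambda> powr p (Suc k)))"
      using A B by (intro mult_mono mult_left_mono) auto
    also have "\<dots> = 2 * p r / p k * \<Lambda> powr (2 * p k * (p r / p k - 1) + p k + p (Suc k))"
      by (simp add: powr_powr powr_add)
    also have "2 * p k * (p r / p k - 1) + p k + p (Suc k) = 1 + 2 * p r"
      by (simp add: rate_Suc algebra_simps)
    also have "\<Lambda> powr (1 + 2 * p r) = \<Lambda> * L" by (simp add: powr_add L_eq)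
    finally show "\<bar>p r / p k * (1 + \<eta> k \<bullet> \<eta> k) powr (p r / p k - 1) * (\<eta> (Suc k) \<bullet> \<eta> k + \<eta> k \<bullet> \<eta> (Suc k))\<bar>
        \<le> 2 * p r / p k * (\<Lambda> * L)" .
  qed
  finally show ?thesis by (simp only: sum_distrib_right[symmetric] mult.assoc)
qed

lemma cross_exp_L: "L powr cross_exp s r k = \<Lambda> powr (- p k - p (Suc k))"
  by (simp add: L_powr cross_exp_def)

lemma inner_cross_le: "\<bar>\<eta> k \<bullet> \<eta> l\<bar> \<le> a k * a l * \<Lambda> powr (p k + p l)"
proof -
  have "\<bar>\<eta> k \<bullet> \<eta> l\<bar> \<le> norm (\<eta> k) * norm (\<eta> l)" by (rule Cauchy_Schwarz_ineq2)
  also have "\<dots> = a k * a l * \<Lambda> powr (p k + p l)" by (simp add: powr_add)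
  finally show ?thesis .
qed

lemma cross_le_1: "k < r \<Longrightarrow> \<bar>cross s r H \<eta> k\<bar> \<le> 1"
proof -
  assume k: "k < r"
  have "\<bar>cross s r H \<eta> k\<bar> \<le> a k * a (Suc k) * \<Lambda> powr (p k + p (Suc k)) * \<Lambda> powr (- p k - p (Suc k))"
    unfolding cross_def abs_mult cross_exp_L by (intro mult_mono inner_cross_le) auto
  also have "\<dots> = a k * a (Suc k) * \<Lambda> powr ((p k + p (Suc k)) + (- p k - p (Suc k)))"
    by (subst powr_add) simp
  also have "\<dots> \<le> 1" using mult_mono[of "a k" 1 "a (Suc k)" 1] a_bounds[of k] a_bounds[of "Suc k"] k by simp
  finally show ?thesis .
qed

text \<open>The derivative of <\<eta> k, \<eta> (k+1)> contains |\<eta> (k+1)|^2, which is the gain.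
  The remaining inner product <\<eta> k, \<eta> (k+2)> and the derivative of the normalising power
  both retain a factor \<open>\<eta> k\<close>, so together they lose at most a multiple of
  \<open>a k\<close>.\<close>

lemma cross'_ge:
  assumes k: "k < r"
  shows "\<Lambda> * ((a (Suc k))\<^sup>2 - (1 + (\<Sum>k\<le>r. 2 * p r / p k)) * a k) \<le> cross' s r H \<eta> (\<lambda>k. \<eta> (Suc k)) k"
proof -
  let ?C0 = "\<Sum>k\<le>r. 2 * p r / p k"
  let ?e = "- p k - p (Suc k)"
  have C0: "?C0 \<ge> 0" by (intro sum_nonneg) simp
  have 1: "(\<eta> (Suc k) \<bullet> \<eta> (Suc k)) * \<Lambda> powr ?e = \<Lambda> * (a (Suc k))\<^sup>2"
  proof -
    have "(\<eta> (Suc k) \<bullet> \<eta> (Suc k)) * \<Lambda> powr ?e = (a (Suc k))\<^sup>2 * ((\<Lambda> powr p (Suc k))\<^sup>2 * \<Lambda> powr ?e)"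
      by (simp add: power2_norm_eq_inner[symmetric] power_divide)
    also have "(\<Lambda> powr p (Suc k))\<^sup>2 * \<Lambda> powr ?e = \<Lambda> powr (p (Suc k) + p (Suc k) + ?e)"
      by (simp only: powr_add power2_eq_square)
    also have "p (Suc k) + p (Suc k) + ?e = 1" by (simp add: rate_Suc)
    finally show ?thesis by simp
  qed
  have 2: "\<bar>(\<eta> k \<bullet> \<eta> (Suc (Suc k))) * \<Lambda> powr ?e\<bar> \<le> \<Lambda> * a k"
  proof -
    have "\<bar>(\<eta> k \<bullet> \<eta> (Suc (Suc k))) * \<Lambda> powr ?e\<bar> \<le> a k * a (Suc (Suc k)) * \<Lambda> powr (p k + p (Suc (Suc k))) * \<Lambda> powr ?e"
      unfolding abs_mult by (intro mult_mono inner_cross_le) auto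
    also have "\<dots> = a k * a (Suc (Suc k)) * \<Lambda> powr (p k + p (Suc (Suc k)) + ?e)"
      by (simp only: powr_add mult.assoc)
    also have "p k + p (Suc (Suc k)) + ?e = 1" by (simp add: rate_Suc)
    also have "a k * a (Suc (Suc k)) * \<Lambda> powr 1 \<le> a k * 1 * \<Lambda> powr 1"
      using a_bounds[of k] a_bounds[of "Suc (Suc k)"] k by (intro mult_right_mono mult_left_mono) auto
    finally show ?thesis by (simp add: mult.commute)
  qed
  have 3: "\<bar>(\<eta> k \<bullet> \<eta> (Suc k)) * (cross_exp s r k * L powr (cross_exp s r k - 1) * XL)\<bar> \<le> \<Lambda> * (?C0 * a k)"
  proof -
    have ce: "\<bar>cross_exp s r k\<bar> \<le> 1"
    proof -
      have "p k + p (Suc k) \<le> 2 * p r" using rate_mono[of k r s] rate_mono[of "Suc k" r s] k by simp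
      moreover have "\<bar>cross_exp s r k\<bar> = (p k + p (Suc k)) / (2 * p r)"
        unfolding cross_exp_def abs_divide abs_minus_cancel
        using p_pos(1)[of k] p_pos(1)[of "Suc k"] p_pos(1)[of r] by simp
      ultimately show ?thesis by simp
    qed
    have "L powr (cross_exp s r k - 1) * \<bar>XL\<bar> \<le> (\<Lambda> powr ?e / L) * (?C0 * \<Lambda> * L)"
      using XL_le L_ge by (intro mult_mono) (auto simp: powr_diff cross_exp_L)
    also have "\<dots> = \<Lambda> powr ?e * (?C0 * \<Lambda>)" using L_ge by simp
    finally have A: "L powr (cross_exp s r k - 1) * \<bar>XL\<bar> \<le> \<Lambda> powr ?e * (?C0 * \<Lambda>)" .
    have "\<bar>(\<eta> k \<bullet> \<eta> (Suc k)) * (cross_exp s r k * L powr (cross_exp s r k - 1) * XL)\<bar>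
       = \<bar>\<eta> k \<bullet> \<eta> (Suc k)\<bar> * (\<bar>cross_exp s r k\<bar> * (L powr (cross_exp s r k - 1) * \<bar>XL\<bar>))"
      by (simp add: abs_mult)
    also have "\<dots> \<le> (a k * a (Suc k) * \<Lambda> powr (p k + p (Suc k))) * (1 * (\<Lambda> powr ?e * (?C0 * \<Lambda>)))"
      by (intro mult_mono[OF inner_cross_le] mult_mono[OF ce] A mult_nonneg_nonneg abs_ge_zero
          norm_ge_zero powr_ge_zero divide_nonneg_nonneg zero_le_one)
    also have "\<dots> = (a k * a (Suc k)) * (\<Lambda> powr ((p k + p (Suc k)) + ?e)) * (?C0 * \<Lambda>)"
      by (simp only: powr_add mult.assoc mult_1)
    also have "\<dots> = (a k * a (Suc k)) * (?C0 * \<Lambda>)" by simp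
    also have "\<dots> \<le> (a k * 1) * (?C0 * \<Lambda>)"
      using a_bounds[of k] a_bounds[of "Suc k"] k C0 by (intro mult_right_mono mult_left_mono) auto
    finally show ?thesis by (simp add: mult_ac)
  qed
  have "cross' s r H \<eta> (\<lambda>k. \<eta> (Suc k)) k = (\<eta> (Suc k) \<bullet> \<eta> (Suc k)) * \<Lambda> powr ?e
     + (\<eta> k \<bullet> \<eta> (Suc (Suc k))) * \<Lambda> powr ?e
     + (\<eta> k \<bullet> \<eta> (Suc k)) * (cross_exp s r k * L powr (cross_exp s r k - 1) * XL)"
    by (simp add: cross'_def cross_exp_L distrib_right)
  then have "cross' s r H \<eta> (\<lambda>k. \<eta> (Suc k)) k \<ge> \<Lambda> * (a (Suc k))\<^sup>2 - \<Lambda> * a k - \<Lambda> * (?C0 * a k)"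
    using 1 2 3 by linarith
  then show ?thesis by (simp add: algebra_simps)
qed

text \<open>If all \<open>a k\<close> were below \<open>c0\<close>, each summand of L would be at
  most 2 c0^2 L, so their sum at most L / 4 by the value of \<open>c0\<close>; together with H at
  most L / 2 this contradicts L > 0. The two lower bounds on \<Lambda> make the constants 1 and H
  negligible.\<close>

lemma some_a_large:
  assumes c0: "c0 > 0" "c0\<^sup>2 = 1 / (8 * (real r + 1))"
    and big1: "(1 / c0\<^sup>2) powr s \<le> \<Lambda>" and big2: "(2 * H) powr (1 / (2 * p r)) \<le> \<Lambda>"
  shows "\<exists>k\<le>r. c0 \<le> a k"
proof (rule ccontr)
  assume "\<not> ?thesis"
  then have small: "a k < c0" if "k \<le> r" for k using that by auto
  have each: "(1 + \<eta> k \<bullet> \<eta> k) powr (p r / p k) \<le> 2 * c0\<^sup>2 * L" if k: "k \<le> r" for k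
  proof -
    have "norm (\<eta> k) \<le> c0 * \<Lambda> powr p k" using small[OF k] by (simp add: field_simps)
    then have "(norm (\<eta> k))\<^sup>2 \<le> (c0 * \<Lambda> powr p k)\<^sup>2" by (rule power_mono) simp
    then have y: "\<eta> k \<bullet> \<eta> k \<le> c0\<^sup>2 * \<Lambda> powr (2 * p k)"
      by (simp add: power2_norm_eq_inner power_mult_distrib powr_power mult.commute)
    \<comment> \<open>Since 2 p k is at least 1 / s, the first bound on \<Lambda> makes the summand
      1 no larger than c0^2 \<Lambda>^(2 p k).\<close>
    have "1 / c0\<^sup>2 = ((1 / c0\<^sup>2) powr s) powr (1 / s)" using s c0 by (simp add: powr_powr)
    also have "\<dots> \<le> \<Lambda> powr (1 / s)" using big1 s by (intro powr_mono2) auto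
    also have "\<dots> \<le> \<Lambda> powr (2 * p k)"
      using \<Lambda>_ge_1 by (intro powr_mono) (auto simp: rate_def)
    finally have "c0\<^sup>2 * (1 / c0\<^sup>2) \<le> c0\<^sup>2 * \<Lambda> powr (2 * p k)" by (intro mult_left_mono) auto
    then have "1 \<le> c0\<^sup>2 * \<Lambda> powr (2 * p k)" using c0(1) by simp
    with y have "1 + \<eta> k \<bullet> \<eta> k \<le> 2 * c0\<^sup>2 * \<Lambda> powr (2 * p k)" by simp
    then have "(1 + \<eta> k \<bullet> \<eta> k) powr (p r / p k) \<le> (2 * c0\<^sup>2 * \<Lambda> powr (2 * p k)) powr (p r / p k)"
      by (intro powr_mono2) (auto intro: add_nonneg_nonneg)
    also have "\<dots> = (2 * c0\<^sup>2) powr (p r / p k) * L"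
      by (simp add: powr_mult powr_powr L_eq)
    \<comment> \<open>The base 2 c0^2 is below 1 and the exponent p r / p k is at least 1, so the
      power does not exceed the base.\<close>
    also have "(2 * c0\<^sup>2) powr (p r / p k) \<le> (2 * c0\<^sup>2) powr 1"
      using rate_mono[OF k, of s] by (intro powr_mono') (simp_all add: c0(2))
    finally show ?thesis using L_ge c0 by (simp add: mult_right_mono)
  qed
  have "2 * H = ((2 * H) powr (1 / (2 * p r))) powr (2 * p r)" using H by (simp add: powr_powr)
  also have "\<dots> \<le> \<Lambda> powr (2 * p r)" using big2 by (intro powr_mono2) auto
  finally have H2: "2 * H \<le> L" by (simp add: L_eq)
  have "L = H + (\<Sum>k\<le>r. (1 + \<eta> k \<bullet> \<eta> k) powr (p r / p k))" by (simp add: weight_base_def)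
  also have "\<dots> \<le> H + (\<Sum>k\<le>r. 2 * c0\<^sup>2 * L)" using each by (intro add_left_mono sum_mono) auto
  also have "\<dots> = H + (2 * c0\<^sup>2 * (real r + 1)) * L" by (simp add: algebra_simps)
  also have "2 * c0\<^sup>2 * (real r + 1) = 1 / 4" by (simp add: c0(2) divide_simps)
  finally show False using H2 L_ge by simp
qed

lemma q_eq: "norm (\<eta> 0) powr (2 * s) = a 0 powr (2 * s) * \<Lambda>"
proof -
  have "norm (\<eta> 0) powr (2 * s) = (a 0 * \<Lambda> powr p 0) powr (2 * s)" by simp
  also have "\<dots> = a 0 powr (2 * s) * \<Lambda> powr (p 0 * (2 * s))" by (subst powr_mult) (simp add: powr_powr)
  also have "p 0 * (2 * s) = 1" using s by (simp add: rate_def)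
  finally show ?thesis by simp
qed

end

text \<open>The order of the quantifiers matters: only the additive constant may depend on
  \<open>H\<close>, because \<open>H\<close> is later chosen in terms of \<open>K\<close>. For large
  \<Lambda> the logarithmic derivative plus the dissipation is at least \<Lambda>, and
  multiplication by the comparable weight gives its square; for bounded \<Lambda> all terms are
  bounded.\<close>

lemma weight_hypocoercive_point:
  fixes s :: real
  assumes s: "s > 0"
  shows "\<exists>\<theta> K b c. K \<ge> 1 \<and> b \<ge> 1 \<and> c > 0 \<and> (\<forall>H\<ge>1. \<exists>C. \<forall>\<eta> :: nat \<Rightarrow> 'a::real_inner.
    norm (\<eta> (Suc r)) \<le> (weight_base s r H \<eta> powr (1 / (2 * rate s r))) powr rate s (Suc r) \<longrightarrow>
      (\<forall>k<r. \<bar>\<theta> k * cross s r H \<eta> k\<bar> \<le> b) \<and>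
      weight_base s r H \<eta> powr (1 / (2 * rate s r)) \<le> b * weight s r H \<theta> \<eta> \<and>
      c * (weight s r H \<theta> \<eta>)\<^sup>2 - C \<le>
        weight' s r H \<theta> \<eta> (\<lambda>k. \<eta> (Suc k)) + K * weight s r H \<theta> \<eta> * norm (\<eta> 0) powr (2 * s))"
proof -
  let ?p = "rate s"
  define c0 where "c0 = sqrt (1 / (8 * (real r + 1)))"
  have c0: "c0 > 0" "c0\<^sup>2 = 1 / (8 * (real r + 1))" by (auto simp: c0_def)
  define C0 where "C0 = (\<Sum>k\<le>r. 2 * ?p r / ?p k)"
  have C0: "C0 \<ge> 0" unfolding C0_def using rate_pos[OF s] by (intro sum_nonneg) (simp add: less_imp_le)
  obtain \<theta>0 c1 C1 where \<theta>0: "\<And>k. \<theta>0 k > 0" and c1: "c1 > 0" and C1: "C1 > 0"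
    and low: "\<And>a::nat \<Rightarrow> real. (\<forall>k\<le>r. 0 \<le> a k \<and> a k \<le> 1) \<Longrightarrow> (\<exists>k\<le>r. c0 \<le> a k) \<Longrightarrow>
       c1 - C1 * a 0 \<le> (\<Sum>k<r. \<theta>0 k * ((a (Suc k))\<^sup>2 - (1 + C0) * a k))"
    using descending_weights_exist[OF c0(1), of "1 + C0" r] C0 by auto
  define C3 where "C3 = C0 / (2 * ?p r)"
  have C3: "C3 \<ge> 0" using C0 rate_pos[OF s] by (simp add: C3_def less_imp_le)
  \<comment> \<open>Scaling makes the gain \<kappa> c1 equal to C3 + 2: C3 compensates the
    derivative of the power of \<open>weight_base\<close>, one unit is spent in the choice of
    \<open>K\<close>, and one unit remains as the lower bound.\<close>
  define \<kappa> where "\<kappa> = (C3 + 2) / c1"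
  have \<kappa>: "\<kappa> > 0" using C3 c1 by (simp add: \<kappa>_def)
  define \<theta> where "\<theta> k = \<kappa> * \<theta>0 k" for k
  have \<theta>: "\<theta> k > 0" for k using \<kappa> \<theta>0 by (simp add: \<theta>_def)
  define T where "T = (\<Sum>k<r. \<theta> k)"
  have T: "T \<ge> 0" unfolding T_def by (intro sum_nonneg) (simp add: \<theta> less_imp_le)
  \<comment> \<open>The loss is linear in \<open>a 0\<close> but the dissipation has exponent 2s.
    This \<open>K\<close> gives K (a 0)^(2s) >= \<kappa> C1 (a 0) - 1: the right side is at most 0
    unless \<kappa> C1 (a 0) > 1, and then (\<kappa> C1 a 0)^(2s) >= 1.\<close>
  define K where "K = \<kappa> * C1 * (\<kappa> * C1) powr (2 * s) + 1"
  have K: "K \<ge> 1" using \<kappa> C1 by (simp add: K_def)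
  show ?thesis
  proof (rule exI[of _ \<theta>], rule exI[of _ K], rule exI[of _ "exp T"], rule exI[of _ "exp (- T)"],
      intro conjI allI impI K)
    show "exp T \<ge> 1" "exp (- T) > 0" using T by auto
    fix H :: real assume H: "H \<ge> 1"
    \<comment> \<open>The threshold is the one that \<open>some_a_large\<close> asks for;
      \<open>C\<close> below bounds all terms in the remaining region, where \<Lambda> is
      smaller.\<close>
    define \<Lambda>0 where "\<Lambda>0 = max ((1 / c0\<^sup>2) powr s) ((2 * H) powr (1 / (2 * ?p r)))"
    define C where "C = exp T * \<Lambda>0\<^sup>2 * (C3 + (1 + C0) * T) + exp (- T) * (exp T * \<Lambda>0)\<^sup>2"
    have C: "C \<ge> 0" using C0 C3 T by (simp add: C_def)
    show "\<exists>C. \<forall>\<eta> :: nat \<Rightarrow> 'a.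
      norm (\<eta> (Suc r)) \<le> (weight_base s r H \<eta> powr (1 / (2 * rate s r))) powr rate s (Suc r) \<longrightarrow>
      (\<forall>k<r. \<bar>\<theta> k * cross s r H \<eta> k\<bar> \<le> exp T) \<and>
      weight_base s r H \<eta> powr (1 / (2 * rate s r)) \<le> exp T * weight s r H \<theta> \<eta> \<and>
      exp (- T) * (weight s r H \<theta> \<eta>)\<^sup>2 - C \<le>
        weight' s r H \<theta> \<eta> (\<lambda>k. \<eta> (Suc k)) + K * weight s r H \<theta> \<eta> * norm (\<eta> 0) powr (2 * s)"
    proof (rule exI[of _ C], intro allI impI conjI)
      fix \<eta> :: "nat \<Rightarrow> 'a"
      assume last: "norm (\<eta> (Suc r)) \<le> (weight_base s r H \<eta> powr (1 / (2 * rate s r))) powr rate s (Suc r)"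
      define \<Lambda> where "\<Lambda> = weight_base s r H \<eta> powr (1 / (2 * rate s r))"
      interpret weight_point s r H \<eta> \<Lambda>
        unfolding \<Lambda>_def by unfold_locales (use s H last in auto)
      define m where "m = (\<Sum>k<r. \<theta> k * cross s r H \<eta> k)"
      define W where "W = weight s r H \<theta> \<eta>"
      have W: "W = \<Lambda> * exp m" by (simp add: W_def weight_def \<Lambda>_def m_def)
      have mk: "\<bar>\<theta> k * cross s r H \<eta> k\<bar> \<le> \<theta> k" if "k < r" for k
        using cross_le_1[OF that] \<theta>[of k] by (simp add: abs_mult)
      have mT: "\<bar>m\<bar> \<le> T" unfolding m_def T_def
        using mk by (intro order_trans[OF sum_abs] sum_mono) auto
      show "\<bar>\<theta> k * cross s r H \<eta> k\<bar> \<le> exp T" if "k < r" for k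
      proof -
        have "\<theta> k \<le> T" unfolding T_def using that \<theta> by (intro member_le_sum) (auto simp: less_imp_le)
        also have "\<dots> \<le> exp T" using exp_ge_add_one_self[of T] by linarith
        finally show ?thesis using mk[OF that] by simp
      qed
      have low_W: "\<Lambda> \<le> exp T * W"
      proof -
        have "1 \<le> exp (T + m)" using mT by simp
        then have "\<Lambda> * 1 \<le> \<Lambda> * exp (T + m)" by (intro mult_left_mono) auto
        then show ?thesis by (simp add: W exp_add mult_ac)
      qed
      then show "weight_base s r H \<eta> powr (1 / (2 * rate s r)) \<le> exp T * weight s r H \<theta> \<eta>"
        by (simp add: \<Lambda>_def W_def)
      have W0: "W > 0" by (simp add: W)
      have high_W: "W \<le> exp T * \<Lambda>"
      proof -
        have "\<Lambda> * exp m \<le> \<Lambda> * exp T" using mT by (intro mult_left_mono) auto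
        then show ?thesis by (simp add: W mult.commute)
      qed
      let ?b = "\<lambda>k. (a (Suc k))\<^sup>2 - (1 + C0) * a k"
      have XL3: "XL / (2 * p r * L) \<ge> - C3 * \<Lambda>"
      proof -
        have "- (C0 * \<Lambda> * L) \<le> XL" using XL_le by (auto simp: C0_def abs_le_iff)
        then have "- (C0 * \<Lambda> * L) / (2 * p r * L) \<le> XL / (2 * p r * L)"
          using L_ge by (intro divide_right_mono) auto
        then show ?thesis using L_ge by (simp add: C3_def)
      qed
      have crosses: "\<Lambda> * (\<Sum>k<r. \<theta> k * ?b k) \<le> (\<Sum>k<r. \<theta> k * cross' s r H \<eta> (\<lambda>k. \<eta> (Suc k)) k)"
        unfolding sum_distrib_left
      proof (rule sum_mono)
        fix k assume "k \<in> {..<r}"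
        then have "\<Lambda> * ?b k \<le> cross' s r H \<eta> (\<lambda>k. \<eta> (Suc k)) k" using cross'_ge[of k] by (simp add: C0_def)
        then have "\<theta> k * (\<Lambda> * ?b k) \<le> \<theta> k * cross' s r H \<eta> (\<lambda>k. \<eta> (Suc k)) k"
          using \<theta>[of k] by (intro mult_left_mono) auto
        then show "\<Lambda> * (\<theta> k * ?b k) \<le> \<theta> k * cross' s r H \<eta> (\<lambda>k. \<eta> (Suc k)) k" by (simp add: mult_ac)
      qed
      have "weight' s r H \<theta> \<eta> (\<lambda>k. \<eta> (Suc k))
          = W * (XL / (2 * p r * L) + (\<Sum>k<r. \<theta> k * cross' s r H \<eta> (\<lambda>k. \<eta> (Suc k)) k))"
        using L_ge unfolding weight'_def W m_def \<Lambda>_def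
        by (simp add: powr_diff algebra_simps)
      also have "\<dots> \<ge> W * (- C3 * \<Lambda> + \<Lambda> * (\<Sum>k<r. \<theta> k * ?b k))"
        using XL3 crosses W0 by (intro mult_left_mono add_mono) auto
      finally have W': "weight' s r H \<theta> \<eta> (\<lambda>k. \<eta> (Suc k)) \<ge> W * \<Lambda> * (- C3 + (\<Sum>k<r. \<theta> k * ?b k))"
        by (simp add: algebra_simps)
      show "exp (- T) * (weight s r H \<theta> \<eta>)\<^sup>2 - C \<le>
        weight' s r H \<theta> \<eta> (\<lambda>k. \<eta> (Suc k)) + K * weight s r H \<theta> \<eta> * norm (\<eta> 0) powr (2 * s)"
      proof (cases "\<Lambda> \<ge> \<Lambda>0")
        case True
        then have "\<exists>k\<le>r. c0 \<le> a k" using some_a_large[OF c0] by (simp add: \<Lambda>0_def)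
        then have "c1 - C1 * a 0 \<le> (\<Sum>k<r. \<theta>0 k * ?b k)"
          using low[of a] a_bounds by simp
        then have "\<kappa> * (c1 - C1 * a 0) \<le> \<kappa> * (\<Sum>k<r. \<theta>0 k * ?b k)"
          using \<kappa> by (intro mult_left_mono) auto
        moreover have "\<kappa> * c1 = C3 + 2" using c1 by (simp add: \<kappa>_def)
        moreover have "\<kappa> * (\<Sum>k<r. \<theta>0 k * ?b k) = (\<Sum>k<r. \<theta> k * ?b k)"
          by (simp only: \<theta>_def sum_distrib_left mult.assoc)
        ultimately have "(C3 + 2) - \<kappa> * C1 * a 0 \<le> (\<Sum>k<r. \<theta> k * ?b k)"
          by (simp only: right_diff_distrib mult.assoc)
        moreover have "K * a 0 powr (2 * s) \<ge> \<kappa> * C1 * a 0 - 1"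
        proof (cases "\<kappa> * C1 * a 0 \<le> 1")
          case True
          have "K * a 0 powr (2 * s) \<ge> 0" using K by simp
          then show ?thesis using True by linarith
        next
          case False
          have "1 \<le> (\<kappa> * C1 * a 0) powr (2 * s)" using False s by (intro ge_one_powr_ge_zero) auto
          also have "\<dots> = (\<kappa> * C1) powr (2 * s) * a 0 powr (2 * s)" by (rule powr_mult)
          finally have "\<kappa> * C1 * 1 \<le> \<kappa> * C1 * ((\<kappa> * C1) powr (2 * s) * a 0 powr (2 * s))"
            using \<kappa> C1 by (intro mult_left_mono) auto
          moreover have "\<kappa> * C1 * a 0 \<le> \<kappa> * C1 * 1" using \<kappa> C1 a_bounds[of 0] by (intro mult_left_mono) auto
          moreover have "K * a 0 powr (2 * s) = \<kappa> * C1 * ((\<kappa> * C1) powr (2 * s) * a 0 powr (2 * s)) + a 0 powr (2 * s)"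
            by (simp add: K_def algebra_simps)
          ultimately show ?thesis using powr_ge_zero[of "a 0" "2 * s"] by linarith
        qed
        ultimately have "1 \<le> - C3 + (\<Sum>k<r. \<theta> k * ?b k) + K * a 0 powr (2 * s)" by linarith
        then have "W * \<Lambda> * 1 \<le> W * \<Lambda> * (- C3 + (\<Sum>k<r. \<theta> k * ?b k) + K * a 0 powr (2 * s))"
          using W0 by (intro mult_left_mono) auto
        also have "\<dots> \<le> weight' s r H \<theta> \<eta> (\<lambda>k. \<eta> (Suc k)) + K * W * norm (\<eta> 0) powr (2 * s)"
          using W' unfolding q_eq by (simp add: algebra_simps)
        finally have "W * \<Lambda> \<le> weight' s r H \<theta> \<eta> (\<lambda>k. \<eta> (Suc k)) + K * W * norm (\<eta> 0) powr (2 * s)" by simp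
        moreover have "exp (- T) * W\<^sup>2 \<le> W * \<Lambda>"
        proof -
          have "W * (exp (- T) * W) \<le> W * (exp (- T) * (exp T * \<Lambda>))"
            using high_W W0 by (intro mult_left_mono) auto
          then show ?thesis by (simp add: power2_eq_square exp_minus field_simps)
        qed
        ultimately show ?thesis using C by (simp add: W_def)
      next
        case False
        then have small: "\<Lambda> \<le> \<Lambda>0" by simp
        have "- ((1 + C0) * T) = (\<Sum>k<r. \<theta> k * (0 - (1 + C0) * 1))"
          unfolding T_def sum_distrib_right[symmetric] by (simp add: algebra_simps)
        also have "\<dots> \<le> (\<Sum>k<r. \<theta> k * ?b k)"
          using a_bounds \<theta> C0 by (intro sum_mono mult_left_mono diff_mono mult_left_mono) (auto simp: less_imp_le)
        finally have "W * \<Lambda> * (- C3 - (1 + C0) * T) \<le> W * \<Lambda> * (- C3 + (\<Sum>k<r. \<theta> k * ?b k))"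
          using W0 by (intro mult_left_mono) auto
        with W' have 1: "- (W * \<Lambda> * (C3 + (1 + C0) * T)) \<le> weight' s r H \<theta> \<eta> (\<lambda>k. \<eta> (Suc k))"
          by (simp add: algebra_simps)
        have W\<Lambda>0: "W \<le> exp T * \<Lambda>0" using high_W small by (meson exp_ge_zero mult_left_mono order_trans)
        then have "W * \<Lambda> \<le> (exp T * \<Lambda>0) * \<Lambda>0" using small W0 by (intro mult_mono) auto
        then have "W * \<Lambda> * (C3 + (1 + C0) * T) \<le> (exp T * \<Lambda>0) * \<Lambda>0 * (C3 + (1 + C0) * T)"
          using C3 C0 T by (intro mult_right_mono) auto
        moreover have "exp (- T) * W\<^sup>2 \<le> exp (- T) * (exp T * \<Lambda>0)\<^sup>2"
          using W\<Lambda>0 W0 by (intro mult_left_mono power_mono) auto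
        moreover have "K * W * norm (\<eta> 0) powr (2 * s) \<ge> 0" using K W0 by simp
        moreover have "C = (exp T * \<Lambda>0) * \<Lambda>0 * (C3 + (1 + C0) * T) + exp (- T) * (exp T * \<Lambda>0)\<^sup>2"
          by (simp add: C_def power2_eq_square mult.assoc)
        ultimately show ?thesis using 1 unfolding W_def by linarith
      qed
    qed
  qed
qed

text \<open>One exponent bounds a function and its derivative, and it may be negative: the same
  predicate describes the growing multiplier, the decaying cutoff and their integrable products. The
  derivative is carried along explicitly so that it can be evaluated on a linear vector
  field.\<close>

definition tame :: "real \<Rightarrow> ('a::euclidean_space \<Rightarrow> real) \<Rightarrow> ('a \<Rightarrow> 'a \<Rightarrow> real) \<Rightarrow> bool" where
  "tame p f f' \<longleftrightarrow> (\<forall>x. (f has_derivative f' x) (at x)) \<and>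
     (\<exists>C\<ge>1. \<forall>x. \<bar>f x\<bar> \<le> C * (1 + norm x) powr p \<and> (\<forall>h. \<bar>f' x h\<bar> \<le> C * (1 + norm x) powr p * norm h))"

lemma tameI:
  assumes "\<And>x. (f has_derivative f' x) (at x)"
    and "\<And>x. \<bar>f x\<bar> \<le> C * (1 + norm x) powr p" "\<And>x h. \<bar>f' x h\<bar> \<le> C * (1 + norm x) powr p * norm h"
  shows "tame p f f'"
proof -
  have "C * (1 + norm x) powr p \<le> max 1 C * (1 + norm x) powr p" for x :: 'a
    by (intro mult_right_mono) auto
  then have "\<bar>f x\<bar> \<le> max 1 C * (1 + norm x) powr p \<and> (\<forall>h. \<bar>f' x h\<bar> \<le> max 1 C * (1 + norm x) powr p * norm h)" for x
    using assms(2)[of x] assms(3)[of x] by (meson mult_right_mono norm_ge_zero order_trans)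
  then show ?thesis using assms(1) unfolding tame_def by (intro conjI allI exI[of _ "max 1 C"]) auto
qed

lemma tame_mono:
  assumes "tame p f f'" "p \<le> q"
  shows "tame q f f'"
proof -
  obtain C where C: "C \<ge> 1" "\<And>x. (f has_derivative f' x) (at x)"
    "\<And>x. \<bar>f x\<bar> \<le> C * (1 + norm x) powr p" "\<And>x h. \<bar>f' x h\<bar> \<le> C * (1 + norm x) powr p * norm h"
    using assms(1) unfolding tame_def by blast
  have "C * (1 + norm x) powr p \<le> C * (1 + norm x) powr q" for x :: 'a
    using C assms by (intro mult_left_mono powr_mono) auto
  then show ?thesis
    using C by (intro tameI[of f f' C]) (blast intro: order_trans mult_right_mono norm_ge_zero)+
qed

lemma tame_add:
  assumes "tame p f f'" "tame p g g'"
  shows "tame p (\<lambda>x. f x + g x) (\<lambda>x h. f' x h + g' x h)"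
proof -
  obtain C where C: "C \<ge> 1" "\<And>x. (f has_derivative f' x) (at x)"
    "\<And>x. \<bar>f x\<bar> \<le> C * (1 + norm x) powr p" "\<And>x h. \<bar>f' x h\<bar> \<le> C * (1 + norm x) powr p * norm h"
    using assms(1) unfolding tame_def by blast
  obtain D where D: "D \<ge> 1" "\<And>x. (g has_derivative g' x) (at x)"
    "\<And>x. \<bar>g x\<bar> \<le> D * (1 + norm x) powr p" "\<And>x h. \<bar>g' x h\<bar> \<le> D * (1 + norm x) powr p * norm h"
    using assms(2) unfolding tame_def by blast
  show ?thesis
  proof (rule tameI[of _ _ "C + D"])
    show "((\<lambda>x. f x + g x) has_derivative (\<lambda>h. f' x h + g' x h)) (at x)" for x
      by (intro has_derivative_add C D)
    show "\<bar>f x + g x\<bar> \<le> (C + D) * (1 + norm x) powr p" for x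
      using C(3)[of x] D(3)[of x] by (simp add: distrib_right)
    show "\<bar>f' x h + g' x h\<bar> \<le> (C + D) * (1 + norm x) powr p * norm h" for x h
      using C(4)[of x h] D(4)[of x h] by (simp add: distrib_right)
  qed
qed

lemma tame_mult:
  assumes "tame p f f'" "tame q g g'"
  shows "tame (p + q) (\<lambda>x. f x * g x) (\<lambda>x h. f' x h * g x + f x * g' x h)"
proof -
  obtain C where C: "C \<ge> 1" "\<And>x. (f has_derivative f' x) (at x)"
    "\<And>x. \<bar>f x\<bar> \<le> C * (1 + norm x) powr p" "\<And>x h. \<bar>f' x h\<bar> \<le> C * (1 + norm x) powr p * norm h"
    using assms(1) unfolding tame_def by blast
  obtain D where D: "D \<ge> 1" "\<And>x. (g has_derivative g' x) (at x)"
    "\<And>x. \<bar>g x\<bar> \<le> D * (1 + norm x) powr q" "\<And>x h. \<bar>g' x h\<bar> \<le> D * (1 + norm x) powr q * norm h"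
    using assms(2) unfolding tame_def by blast
  show ?thesis
  proof (rule tameI[of _ _ "2 * C * D"])
    show "((\<lambda>x. f x * g x) has_derivative (\<lambda>h. f' x h * g x + f x * g' x h)) (at x)" for x
      using has_derivative_mult[OF C(2)[of x] D(2)[of x]] by (simp add: add.commute)
    have prod: "(C * (1 + norm x) powr p) * (D * (1 + norm x) powr q) = C * D * (1 + norm x) powr (p + q)" for x :: 'a
      by (simp add: powr_add)
    show "\<bar>f x * g x\<bar> \<le> 2 * C * D * (1 + norm x) powr (p + q)" for x
    proof -
      have "\<bar>f x * g x\<bar> \<le> (C * (1 + norm x) powr p) * (D * (1 + norm x) powr q)"
        unfolding abs_mult using C D by (intro mult_mono) auto
      also have "\<dots> \<le> 2 * (C * D * (1 + norm x) powr (p + q))" using C D by (simp add: prod)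
      finally show ?thesis by (simp add: mult.assoc)
    qed
    show "\<bar>f' x h * g x + f x * g' x h\<bar> \<le> 2 * C * D * (1 + norm x) powr (p + q) * norm h" for x h
    proof -
      have "\<bar>f' x h * g x\<bar> \<le> (C * (1 + norm x) powr p * norm h) * (D * (1 + norm x) powr q)"
        unfolding abs_mult using C D by (intro mult_mono) auto
      moreover have "\<bar>f x * g' x h\<bar> \<le> (C * (1 + norm x) powr p) * (D * (1 + norm x) powr q * norm h)"
        unfolding abs_mult using C D by (intro mult_mono) auto
      moreover have "(C * (1 + norm x) powr p * norm h) * (D * (1 + norm x) powr q) = C * D * (1 + norm x) powr (p + q) * norm h"
        "(C * (1 + norm x) powr p) * (D * (1 + norm x) powr q * norm h) = C * D * (1 + norm x) powr (p + q) * norm h"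
        by (simp_all add: powr_add)
      ultimately show ?thesis using abs_triangle_ineq[of "f' x h * g x" "f x * g' x h"] by simp
    qed
  qed
qed

lemma tame_const: "tame 0 (\<lambda>_. c) (\<lambda>_ _. 0)"
proof (rule tameI[of _ _ "\<bar>c\<bar>"])
  show "\<bar>c\<bar> \<le> \<bar>c\<bar> * (1 + norm x) powr 0" for x :: 'a
    using norm_ge_zero[of x] by (simp add: add_nonneg_eq_0_iff)
qed auto

lemma tame_cmult: "tame p f f' \<Longrightarrow> tame p (\<lambda>x. c * f x) (\<lambda>x h. c * f' x h)"
  using tame_mult[OF tame_const[of c], of p f f'] by simp

lemma tame_bilinear:
  fixes A B :: "real^'n^'m"
  shows "tame 2 (\<lambda>x. (A *v x) \<bullet> (B *v x)) (\<lambda>x h. (A *v h) \<bullet> (B *v x) + (A *v x) \<bullet> (B *v h))"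
proof -
  obtain a where a: "a > 0" "\<And>x. norm (A *v x) \<le> norm x * a"
    using bounded_linear.pos_bounded[OF matrix_vector_mul_bounded_linear] by metis
  obtain b where b: "b > 0" "\<And>x. norm (B *v x) \<le> norm x * b"
    using bounded_linear.pos_bounded[OF matrix_vector_mul_bounded_linear] by metis
  have ab: "\<bar>(A *v x) \<bullet> (B *v y)\<bar> \<le> a * b * (norm x * norm y)" for x y
  proof -
    have "\<bar>(A *v x) \<bullet> (B *v y)\<bar> \<le> norm (A *v x) * norm (B *v y)" by (rule Cauchy_Schwarz_ineq2)
    also have "\<dots> \<le> (norm x * a) * (norm y * b)" using a b by (intro mult_mono) auto
    finally show ?thesis by (simp add: mult_ac)
  qed
  show ?thesis
  proof (rule tameI[of _ _ "2 * a * b"])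
    show "((\<lambda>x. (A *v x) \<bullet> (B *v x)) has_derivative (\<lambda>h. (A *v h) \<bullet> (B *v x) + (A *v x) \<bullet> (B *v h))) (at x)" for x
      by (auto intro!: derivative_eq_intros bounded_linear.has_derivative[OF matrix_vector_mul_bounded_linear])
    have pw: "(1 + norm x) powr 2 = (1 + norm x)\<^sup>2" for x :: "real^'n" by (simp add: powr_numeral)
    show "\<bar>(A *v x) \<bullet> (B *v x)\<bar> \<le> 2 * a * b * (1 + norm x) powr 2" for x
    proof -
      have "\<bar>(A *v x) \<bullet> (B *v x)\<bar> \<le> a * b * (norm x * norm x)" by (rule ab)
      also have "\<dots> \<le> (2 * a * b) * (1 + norm x) powr 2" unfolding pw
        using a b by (intro mult_mono) (auto simp: power2_eq_square algebra_simps)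
      finally show ?thesis .
    qed
    show "\<bar>(A *v h) \<bullet> (B *v x) + (A *v x) \<bullet> (B *v h)\<bar> \<le> 2 * a * b * (1 + norm x) powr 2 * norm h" for x h
    proof -
      have "\<bar>(A *v h) \<bullet> (B *v x) + (A *v x) \<bullet> (B *v h)\<bar> \<le> a * b * (norm h * norm x) + a * b * (norm x * norm h)"
        by (rule order_trans[OF abs_triangle_ineq add_mono[OF ab ab]])
      also have "\<dots> = 2 * a * b * norm x * norm h" by simp
      also have "\<dots> \<le> 2 * a * b * (1 + norm x) powr 2 * norm h" unfolding pw
        using a b by (intro mult_right_mono mult_left_mono) (auto simp: power2_eq_square algebra_simps)
      finally show ?thesis .
    qed
  qed
qed

text \<open>As f is at least 1, both f^a and f^(a-1) are at most f^|a|. The resulting exponent is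
  crude, but only its finiteness matters for the choice of the cutoff.\<close>

lemma tame_powr:
  assumes f: "tame p f f'" and p: "p \<ge> 0" and ge: "\<And>x. f x \<ge> 1"
  shows "tame (p * \<bar>a\<bar> + p) (\<lambda>x. f x powr a) (\<lambda>x h. a * f x powr (a - 1) * f' x h)"
proof -
  obtain C where C: "C \<ge> 1" "\<And>x. (f has_derivative f' x) (at x)"
    "\<And>x. \<bar>f x\<bar> \<le> C * (1 + norm x) powr p" "\<And>x h. \<bar>f' x h\<bar> \<le> C * (1 + norm x) powr p * norm h"
    using f unfolding tame_def by blast
  have bd: "f x powr b \<le> C powr \<bar>a\<bar> * (1 + norm x) powr (p * \<bar>a\<bar>)" if "b \<le> \<bar>a\<bar>" for x b
  proof -
    have "f x powr b \<le> f x powr \<bar>a\<bar>" using ge that by (intro powr_mono) auto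
    also have "\<dots> \<le> (C * (1 + norm x) powr p) powr \<bar>a\<bar>"
      using C(3)[of x] ge[of x] by (intro powr_mono2) auto
    also have "\<dots> = C powr \<bar>a\<bar> * (1 + norm x) powr (p * \<bar>a\<bar>)" using C by (simp add: powr_mult powr_powr)
    finally show ?thesis .
  qed
  show ?thesis
  proof (rule tameI[of _ _ "max 1 \<bar>a\<bar> * C powr \<bar>a\<bar> * C"])
    show "((\<lambda>x. f x powr a) has_derivative (\<lambda>h. a * f x powr (a - 1) * f' x h)) (at x)" for x
    proof -
      have pos: "f x > 0" using ge[of x] by simp
      show ?thesis
        using has_derivative_powr[OF C(2)[of x] has_derivative_const[of a] pos] pos
        by (simp add: powr_diff divide_simps mult_ac)
    qed
    show "\<bar>f x powr a\<bar> \<le> max 1 \<bar>a\<bar> * C powr \<bar>a\<bar> * C * (1 + norm x) powr (p * \<bar>a\<bar> + p)" for x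
    proof -
      have "f x powr a * (1 * 1) \<le> (C powr \<bar>a\<bar> * (1 + norm x) powr (p * \<bar>a\<bar>)) * ((max 1 \<bar>a\<bar> * C) * (1 + norm x) powr p)"
        using bd[of a x] C(1) p mult_mono[of 1 "max 1 \<bar>a\<bar>" 1 C]
        by (intro mult_mono ge_one_powr_ge_zero) auto
      then show ?thesis by (simp add: powr_add mult_ac)
    qed
    show "\<bar>a * f x powr (a - 1) * f' x h\<bar> \<le> max 1 \<bar>a\<bar> * C powr \<bar>a\<bar> * C * (1 + norm x) powr (p * \<bar>a\<bar> + p) * norm h" for x h
    proof -
      have "\<bar>a * f x powr (a - 1) * f' x h\<bar> = \<bar>a\<bar> * (f x powr (a - 1) * \<bar>f' x h\<bar>)" by (simp add: abs_mult)
      also have "\<dots> \<le> max 1 \<bar>a\<bar> * ((C powr \<bar>a\<bar> * (1 + norm x) powr (p * \<bar>a\<bar>)) * (C * (1 + norm x) powr p * norm h))"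
        using bd[of "a - 1" x] C by (intro mult_mono) auto
      also have "\<dots> = max 1 \<bar>a\<bar> * C powr \<bar>a\<bar> * C * (1 + norm x) powr (p * \<bar>a\<bar> + p) * norm h"
        by (simp add: powr_add mult_ac)
      finally show ?thesis .
    qed
  qed
qed

lemma tame_exp:
  assumes f: "tame p f f'" and p: "p \<ge> 0" and le: "\<And>x. f x \<le> b"
  shows "tame p (\<lambda>x. exp (f x)) (\<lambda>x h. exp (f x) * f' x h)"
proof -
  obtain C where C: "C \<ge> 1" "\<And>x. (f has_derivative f' x) (at x)"
    "\<And>x. \<bar>f x\<bar> \<le> C * (1 + norm x) powr p" "\<And>x h. \<bar>f' x h\<bar> \<le> C * (1 + norm x) powr p * norm h"
    using f unfolding tame_def by blast
  show ?thesis
  proof (rule tameI[of _ _ "exp b * C"])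
    show "((\<lambda>x. exp (f x)) has_derivative (\<lambda>h. exp (f x) * f' x h)) (at x)" for x
      using has_derivative_exp[OF C(2)[of x]] by (simp add: mult.commute)
    show "\<bar>exp (f x)\<bar> \<le> exp b * C * (1 + norm x) powr p" for x
    proof -
      have "exp (f x) * (1 * 1) \<le> exp b * (C * (1 + norm x) powr p)"
        using le C p by (intro mult_mono ge_one_powr_ge_zero) auto
      then show ?thesis by simp
    qed
    show "\<bar>exp (f x) * f' x h\<bar> \<le> exp b * C * (1 + norm x) powr p * norm h" for x h
    proof -
      have "\<bar>exp (f x) * f' x h\<bar> \<le> exp b * (C * (1 + norm x) powr p * norm h)"
        unfolding abs_mult using le C by (intro mult_mono) auto
      then show ?thesis by (simp add: mult.assoc)
    qed
  qed
qed

lemma tame_sum: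
  assumes "finite I" "\<And>i. i \<in> I \<Longrightarrow> \<exists>p\<ge>0. tame p (f i) (f' i)"
  shows "\<exists>p\<ge>0. tame p (\<lambda>x. \<Sum>i\<in>I. f i x) (\<lambda>x h. \<Sum>i\<in>I. f' i x h)"
  using assms
proof (induction I rule: finite_induct)
  case empty
  show ?case using tame_const[of 0] by auto
next
  case (insert i I)
  obtain p q where "p \<ge> 0" "tame p (f i) (f' i)" "q \<ge> 0" "tame q (\<lambda>x. \<Sum>i\<in>I. f i x) (\<lambda>x h. \<Sum>i\<in>I. f' i x h)"
    using insert by blast
  then have "tame (max p q) (\<lambda>x. f i x + (\<Sum>i\<in>I. f i x)) (\<lambda>x h. f' i x h + (\<Sum>i\<in>I. f' i x h))"
    by (intro tame_add) (auto intro: tame_mono)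
  then show ?case using insert \<open>p \<ge> 0\<close> by (intro exI[of _ "max p q"]) auto
qed

lemma tame_weight_base:
  fixes A :: "nat \<Rightarrow> real^'n^'m"
  assumes "H \<ge> 1"
  shows "\<exists>p\<ge>0. tame p (\<lambda>x. weight_base s r H (\<lambda>k. A k *v x)) (\<lambda>x h. weight_base' s r (\<lambda>k. A k *v x) (\<lambda>k. A k *v h))"
proof -
  have each: "\<exists>p\<ge>0. tame p (\<lambda>x. (1 + (A k *v x) \<bullet> (A k *v x)) powr e)
    (\<lambda>x h. e * (1 + (A k *v x) \<bullet> (A k *v x)) powr (e - 1) * ((A k *v h) \<bullet> (A k *v x) + (A k *v x) \<bullet> (A k *v h)))" for k e
  proof -
    have "tame 2 (\<lambda>x. 1 + (A k *v x) \<bullet> (A k *v x)) (\<lambda>x h. 0 + ((A k *v h) \<bullet> (A k *v x) + (A k *v x) \<bullet> (A k *v h)))"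
      by (intro tame_add tame_bilinear tame_mono[OF tame_const]) auto
    from tame_powr[OF this, of e] show ?thesis
      by (intro exI[of _ "2 * \<bar>e\<bar> + 2"]) (auto simp: mult_ac)
  qed
  have "\<exists>p\<ge>0. tame p (\<lambda>x. \<Sum>k\<le>r. (1 + (A k *v x) \<bullet> (A k *v x)) powr (rate s r / rate s k))
     (\<lambda>x h. weight_base' s r (\<lambda>k. A k *v x) (\<lambda>k. A k *v h))"
    unfolding weight_base'_def by (rule tame_sum[OF finite_atMost each])
  then obtain p where p: "p \<ge> 0" "tame p (\<lambda>x. \<Sum>k\<le>r. (1 + (A k *v x) \<bullet> (A k *v x)) powr (rate s r / rate s k))
     (\<lambda>x h. weight_base' s r (\<lambda>k. A k *v x) (\<lambda>k. A k *v h))" by blast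
  from tame_add[OF tame_mono[OF tame_const[of H] p(1)] p(2)] p(1) show ?thesis
    by (auto simp: weight_base_def)
qed

lemma weight_base_ge_1: "H \<ge> 1 \<Longrightarrow> weight_base s r H \<eta> \<ge> 1"
  unfolding weight_base_def by (simp add: add_increasing2 sum_nonneg)

lemma tame_weight_base_powr:
  fixes A :: "nat \<Rightarrow> real^'n^'m"
  assumes "H \<ge> 1"
  shows "\<exists>p\<ge>0. tame p (\<lambda>x. weight_base s r H (\<lambda>k. A k *v x) powr e)
    (\<lambda>x h. e * weight_base s r H (\<lambda>k. A k *v x) powr (e - 1) * weight_base' s r (\<lambda>k. A k *v x) (\<lambda>k. A k *v h))"
proof -
  obtain p where p: "p \<ge> 0" "tame p (\<lambda>x. weight_base s r H (\<lambda>k. A k *v x)) (\<lambda>x h. weight_base' s r (\<lambda>k. A k *v x) (\<lambda>k. A k *v h))"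
    using tame_weight_base[OF assms] by blast
  from tame_powr[OF p(2,1) weight_base_ge_1[OF assms], of e] p(1) show ?thesis
    by (intro exI[of _ "p * \<bar>e\<bar> + p"]) auto
qed

lemma tame_weight:
  fixes A :: "nat \<Rightarrow> real^'n^'m"
  assumes "H \<ge> 1" and bd: "\<And>k x. k < r \<Longrightarrow> \<theta> k * cross s r H (\<lambda>k. A k *v x) k \<le> b"
  shows "\<exists>p\<ge>0. tame p (\<lambda>x. weight s r H \<theta> (\<lambda>k. A k *v x)) (\<lambda>x h. weight' s r H \<theta> (\<lambda>k. A k *v x) (\<lambda>k. A k *v h))"
proof -
  have "\<exists>p\<ge>0. tame p (\<lambda>x. \<theta> k * cross s r H (\<lambda>k. A k *v x) k) (\<lambda>x h. \<theta> k * cross' s r H (\<lambda>k. A k *v x) (\<lambda>k. A k *v h) k)" for k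
  proof -
    obtain p where p: "p \<ge> 0" "tame p (\<lambda>x. weight_base s r H (\<lambda>k. A k *v x) powr cross_exp s r k)
       (\<lambda>x h. cross_exp s r k * weight_base s r H (\<lambda>k. A k *v x) powr (cross_exp s r k - 1) * weight_base' s r (\<lambda>k. A k *v x) (\<lambda>k. A k *v h))"
      using tame_weight_base_powr[OF assms(1)] by blast
    from tame_cmult[OF tame_mult[OF tame_bilinear[of "A k" "A (Suc k)"] p(2)], of "\<theta> k"] p(1)
    show ?thesis by (auto simp: cross_def cross'_def intro!: exI[of _ "2 + p"])
  qed
  then have "\<exists>p\<ge>0. tame p (\<lambda>x. \<Sum>k<r. \<theta> k * cross s r H (\<lambda>k. A k *v x) k) (\<lambda>x h. \<Sum>k<r. \<theta> k * cross' s r H (\<lambda>k. A k *v x) (\<lambda>k. A k *v h) k)"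
    by (intro tame_sum) auto
  then obtain p where p: "p \<ge> 0" "tame p (\<lambda>x. \<Sum>k<r. \<theta> k * cross s r H (\<lambda>k. A k *v x) k) (\<lambda>x h. \<Sum>k<r. \<theta> k * cross' s r H (\<lambda>k. A k *v x) (\<lambda>k. A k *v h) k)"
    by blast
  obtain q where q: "q \<ge> 0" "tame q (\<lambda>x. weight_base s r H (\<lambda>k. A k *v x) powr (1 / (2 * rate s r)))
       (\<lambda>x h. 1 / (2 * rate s r) * weight_base s r H (\<lambda>k. A k *v x) powr (1 / (2 * rate s r) - 1) * weight_base' s r (\<lambda>k. A k *v x) (\<lambda>k. A k *v h))"
    using tame_weight_base_powr[OF assms(1)] by blast
  have "(\<Sum>k<r. \<theta> k * cross s r H (\<lambda>k. A k *v x) k) \<le> (\<Sum>k<r. b)" for x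
    using bd by (intro sum_mono) auto
  from tame_mult[OF q(2) tame_exp[OF p(2,1) this]] p(1) q(1) show ?thesis
    by (intro exI[of _ "q + p"]) (auto simp: weight_def weight'_def)
qed

text \<open>By \<open>step\<close>, the derivative of A k x in the direction C x is A (k+1) x, so
  the abstract shift becomes a derivative along a linear field. The kernel condition enters through
  \<open>last\<close> alone.\<close>

theorem hypocoercive_multiplier:
  fixes A :: "nat \<Rightarrow> real^'n^'n" and C :: "real^'n^'n"
  assumes s: "s > 0" and step: "\<And>k. A (Suc k) = A k ** C"
    and last: "\<And>x. norm (A (Suc r) *v x) \<le> c1 * (\<Sum>j=0..r. norm (A j *v x))"
  shows "\<exists>M M' p c D. p \<ge> 0 \<and> c > 0 \<and> tame p M M' \<and> (\<forall>x. M x > 0) \<and>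
    (\<forall>k\<le>r. \<forall>x. c * japanese (A k *v x) powr (2 * s / (1 + 2 * real k * s)) \<le> M x) \<and>
    (\<forall>x. c * (M x)\<^sup>2 - D \<le> M' x (C *v x) + M x * norm (A 0 *v x) powr (2 * s))"
proof -
  obtain \<theta> K b c where K: "K \<ge> 1" and b: "b \<ge> 1" and c: "c > 0"
    and main: "\<And>H. H \<ge> 1 \<Longrightarrow> \<exists>D. \<forall>\<eta> :: nat \<Rightarrow> real^'n.
    norm (\<eta> (Suc r)) \<le> (weight_base s r H \<eta> powr (1 / (2 * rate s r))) powr rate s (Suc r) \<longrightarrow>
      (\<forall>k<r. \<bar>\<theta> k * cross s r H \<eta> k\<bar> \<le> b) \<and>
      weight_base s r H \<eta> powr (1 / (2 * rate s r)) \<le> b * weight s r H \<theta> \<eta> \<and>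
      c * (weight s r H \<theta> \<eta>)\<^sup>2 - D \<le>
        weight' s r H \<theta> \<eta> (\<lambda>k. \<eta> (Suc k)) + K * weight s r H \<theta> \<eta> * norm (\<eta> 0) powr (2 * s)"
    using weight_hypocoercive_point[OF s, of r, where 'a="real^'n"] by blast
  \<comment> \<open>This replaces the field \<open>C\<close> by \<open>K *\<^sub>R C\<close>, which normalises the constant in front of the
    dissipation to \<open>1\<close>.\<close>
  define A' where "A' k = K ^ k *\<^sub>R A k" for k
  define \<eta> where "\<eta> x k = A' k *v x" for x k
  define c2 where "c2 = K ^ Suc r * \<bar>c1\<bar>"
  \<comment> \<open>\<open>H\<close> forces \<Lambda> to be at least c2 (r + 1). Since p (r+1) = p r
    + 1, the spare factor \<Lambda> absorbs this constant in the bound for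
    \<open>\<eta> x (Suc r)\<close>.\<close>
  define H where "H = max 1 ((c2 * (real r + 1)) powr (2 * rate s r))"
  have H: "H \<ge> 1" by (simp add: H_def)
  have c2: "c2 \<ge> 0" using K by (simp add: c2_def)
  have norm\<eta>: "norm (\<eta> x k) = K ^ k * norm (A k *v x)" for x k
    using K by (simp add: \<eta>_def A'_def scaleR_matrix_vector_assoc[symmetric])
  obtain D where D: "\<And>\<eta> :: nat \<Rightarrow> real^'n.
    norm (\<eta> (Suc r)) \<le> (weight_base s r H \<eta> powr (1 / (2 * rate s r))) powr rate s (Suc r) \<Longrightarrow>
      (\<forall>k<r. \<bar>\<theta> k * cross s r H \<eta> k\<bar> \<le> b) \<and>
      weight_base s r H \<eta> powr (1 / (2 * rate s r)) \<le> b * weight s r H \<theta> \<eta> \<and>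
      c * (weight s r H \<theta> \<eta>)\<^sup>2 - D \<le>
        weight' s r H \<theta> \<eta> (\<lambda>k. \<eta> (Suc k)) + K * weight s r H \<theta> \<eta> * norm (\<eta> 0) powr (2 * s)"
    using main[OF H] by blast
  have last\<eta>: "norm (\<eta> x (Suc r)) \<le> (weight_base s r H (\<eta> x) powr (1 / (2 * rate s r))) powr rate s (Suc r)" for x
  proof -
    define \<Lambda> where "\<Lambda> = weight_base s r H (\<eta> x) powr (1 / (2 * rate s r))"
    interpret weight_scale s r H "\<eta> x" \<Lambda>
      unfolding \<Lambda>_def by unfold_locales (use s H in auto)
    have "norm (\<eta> x (Suc r)) = K ^ Suc r * norm (A (Suc r) *v x)" by (rule norm\<eta>)
    also have "\<dots> \<le> K ^ Suc r * (c1 * (\<Sum>j=0..r. norm (A j *v x)))"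
      using K by (intro mult_left_mono last) auto
    also have "\<dots> \<le> K ^ Suc r * (\<bar>c1\<bar> * (\<Sum>j=0..r. norm (A j *v x)))"
      using K by (intro mult_left_mono mult_right_mono sum_nonneg) auto
    also have "\<dots> = c2 * (\<Sum>j=0..r. norm (A j *v x))" by (simp add: c2_def mult.assoc)
    also have "\<dots> \<le> c2 * (\<Sum>j=0..r. \<Lambda> powr p r)"
    proof (intro mult_left_mono sum_mono c2)
      fix j assume "j \<in> {0..r}"
      then have j: "j \<le> r" by simp
      have "1 * norm (A j *v x) \<le> K ^ j * norm (A j *v x)" using K by (intro mult_right_mono) auto
      also have "\<dots> = norm (\<eta> x j)" by (simp add: norm\<eta>)
      also have "\<dots> \<le> \<Lambda> powr p j" using \<eta>_le_init[OF j] .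
      also have "\<dots> \<le> \<Lambda> powr p r" using \<Lambda>_ge_1 rate_mono[OF j] by (intro powr_mono) auto
      finally show "norm (A j *v x) \<le> \<Lambda> powr p r" by simp
    qed
    also have "\<dots> = (c2 * (real r + 1)) * \<Lambda> powr p r" by simp
    also have "\<dots> \<le> \<Lambda> * \<Lambda> powr p r"
    proof (rule mult_right_mono)
      have "c2 * (real r + 1) = ((c2 * (real r + 1)) powr (2 * p r)) powr (1 / (2 * p r))"
        using c2 by (simp add: powr_powr)
      also have "\<dots> \<le> L powr (1 / (2 * p r))" using L_ge(1) by (intro powr_mono2) (auto simp: H_def)
      finally show "c2 * (real r + 1) \<le> \<Lambda>" by (simp add: \<Lambda>_def)
    qed simp
    also have "\<dots> = \<Lambda> powr p (Suc r)" by (simp add: rate_Suc powr_add)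
    finally show ?thesis unfolding \<Lambda>_def .
  qed
  define M where "M x = weight s r H \<theta> (\<eta> x)" for x
  define M' where "M' x h = weight' s r H \<theta> (\<eta> x) (\<lambda>k. A' k *v h)" for x h
  have "\<exists>p\<ge>0. tame p M M'"
    unfolding M_def M'_def \<eta>_def
    by (rule tame_weight[OF H, of r \<theta> s _ b]) (use D[OF last\<eta>] in \<open>force simp: \<eta>_def abs_le_iff\<close>)
  then obtain p where p: "p \<ge> 0" "tame p M M'" by blast
  have M0: "M x > 0" for x
    using weight_base_ge_1[OF H, of s r "\<eta> x"] by (simp add: M_def weight_def)
  \<comment> \<open>One constant for both conclusions: 1 / b comes from comparing \<Lambda> with the
    weight, c / K from undoing the rescaling of the field.\<close>
  define c' where "c' = min (1 / b) (c / K)"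
  have c': "c' > 0" using b c K by (simp add: c'_def)
  show ?thesis
  proof (rule exI[of _ M], rule exI[of _ M'], rule exI[of _ p], rule exI[of _ c'], rule exI[of _ "D / K"],
      intro conjI allI impI p c' M0)
    fix k x assume k: "k \<le> r"
    define \<Lambda> where "\<Lambda> = weight_base s r H (\<eta> x) powr (1 / (2 * rate s r))"
    interpret weight_scale s r H "\<eta> x" \<Lambda>
      unfolding \<Lambda>_def by unfold_locales (use s H in auto)
    have "1 * norm (A k *v x) \<le> norm (\<eta> x k)" unfolding norm\<eta> using K by (intro mult_right_mono) auto
    then have "japanese (A k *v x) \<le> sqrt (1 + \<eta> x k \<bullet> \<eta> x k)"
      by (simp add: japanese_def power2_norm_eq_inner[symmetric] power_mono)
    also have "\<dots> \<le> \<Lambda> powr rate s k" by (rule japanese_le[OF k])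
    finally have "japanese (A k *v x) powr (1 / rate s k) \<le> (\<Lambda> powr rate s k) powr (1 / rate s k)"
      by (intro powr_mono2) (auto simp: japanese_def)
    also have "\<dots> = \<Lambda>" by (simp add: powr_powr)
    also have "\<Lambda> \<le> b * M x" using D[OF last\<eta>[of x]] by (simp add: \<Lambda>_def M_def)
    also have "1 / rate s k = 2 * s / (1 + 2 * real k * s)" using s by (simp add: rate_def field_simps)
    finally have *: "japanese (A k *v x) powr (2 * s / (1 + 2 * real k * s)) \<le> b * M x" .
    have "c' * japanese (A k *v x) powr (2 * s / (1 + 2 * real k * s)) \<le> (1 / b) * (b * M x)"
      using * b by (intro mult_mono) (auto simp: c'_def)
    then show "c' * japanese (A k *v x) powr (2 * s / (1 + 2 * real k * s)) \<le> M x" using b by simp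
  next
    fix x
    have lin: "linear (M' x)" using p(2) by (auto simp: tame_def intro: has_derivative_linear)
    have shift: "(\<lambda>k. A' k *v (K *\<^sub>R (C *v x))) = (\<lambda>k. \<eta> x (Suc k))"
      by (rule ext) (simp add: \<eta>_def A'_def step matrix_vector_mul_assoc[symmetric]
          scaleR_matrix_vector_assoc[symmetric] matrix_vector_mult_scaleR)
    have "K * M' x (C *v x) = M' x (K *\<^sub>R (C *v x))" by (simp add: linear_scale[OF lin])
    also have "\<dots> = weight' s r H \<theta> (\<eta> x) (\<lambda>k. \<eta> x (Suc k))" by (simp add: M'_def shift)
    finally have "c * (M x)\<^sup>2 - D \<le> K * M' x (C *v x) + K * M x * norm (A 0 *v x) powr (2 * s)"
      using D[OF last\<eta>[of x]] by (simp add: M_def norm\<eta>)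
    then have "(c * (M x)\<^sup>2 - D) / K \<le> (K * M' x (C *v x) + K * M x * norm (A 0 *v x) powr (2 * s)) / K"
      using K by (intro divide_right_mono) auto
    then have "c / K * (M x)\<^sup>2 - D / K \<le> M' x (C *v x) + M x * norm (A 0 *v x) powr (2 * s)"
      using K by (simp add: diff_divide_distrib add_divide_distrib)
    moreover have "c' * (M x)\<^sup>2 \<le> c / K * (M x)\<^sup>2" by (intro mult_right_mono) (auto simp: c'_def)
    ultimately show "c' * (M x)\<^sup>2 - D / K \<le> M' x (C *v x) + M x * norm (A 0 *v x) powr (2 * s)" by linarith
  qed
qed

section \<open>Gaussian integrals\<close>

lemma lborel_integral_prod:
  fixes f :: "'a::euclidean_space \<Rightarrow> real \<Rightarrow> 'c::{real_normed_field,banach,second_countable_topology}"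
  assumes f: "\<And>b. b \<in> Basis \<Longrightarrow> integrable lborel (f b)"
  shows "integrable lborel (\<lambda>x::'a. \<Prod>b\<in>Basis. f b (x \<bullet> b))"
    and "(\<integral>x. (\<Prod>b\<in>Basis. f b (x \<bullet> b)) \<partial>lborel) = (\<Prod>b\<in>Basis. \<integral>t. f b t \<partial>lborel)"
proof -
  interpret product_sigma_finite "\<lambda>_::'a. lborel :: real measure" by standard
  have [measurable]: "f b \<in> borel_measurable borel" if "b \<in> Basis" for b
    using f[OF that] by (auto dest: borel_measurable_integrable)
  have m: "(\<lambda>x::'a. \<Prod>b\<in>Basis. f b (x \<bullet> b)) \<in> borel_measurable borel" by measurable
  have T: "(\<lambda>g. \<Sum>b\<in>Basis. g b *\<^sub>R b) \<in> measurable (\<Pi>\<^sub>M b\<in>(Basis::'a set). lborel) borel" by measurable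
  have inner: "(\<Sum>b'\<in>Basis. g b' *\<^sub>R b') \<bullet> b = g b" if "b \<in> Basis" for g and b :: 'a
    using that by (simp add: inner_sum_left_Basis)
  have I: "integrable (\<Pi>\<^sub>M b\<in>(Basis::'a set). lborel) (\<lambda>g. \<Prod>b\<in>Basis. f b (g b))"
    by (rule product_integrable_prod) (use f in auto)
  show "integrable lborel (\<lambda>x::'a. \<Prod>b\<in>Basis. f b (x \<bullet> b))"
    unfolding lborel_eq[where 'a='a] by (subst integrable_distr_eq[OF T m]) (use I in \<open>simp add: inner\<close>)
  show "(\<integral>x. (\<Prod>b\<in>Basis. f b (x \<bullet> b)) \<partial>lborel) = (\<Prod>b\<in>Basis. \<integral>t. f b t \<partial>lborel)"
    unfolding lborel_eq[where 'a='a] by (subst integral_distr[OF T m])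
      (simp add: inner product_integral_prod[OF _ f])
qed

lemma lborel_integrable_affine:
  fixes f :: "'a::euclidean_space \<Rightarrow> 'c::{banach,second_countable_topology}"
  assumes "integrable lborel f" "c \<noteq> 0"
  shows "integrable lborel (\<lambda>x. f (t + c *\<^sub>R x))"
proof -
  have [measurable]: "f \<in> borel_measurable borel" using assms by (auto dest: borel_measurable_integrable)
  have "integrable (density (distr lborel borel (\<lambda>x. t + c *\<^sub>R x)) (\<lambda>_. ennreal (\<bar>c\<bar> ^ DIM('a)))) f"
    using assms lborel_affine[of c t] by (simp add: ennreal_power)
  then have "integrable lborel (\<lambda>x. (\<bar>c\<bar> ^ DIM('a)) *\<^sub>R f (t + c *\<^sub>R x))"
    by (subst (asm) integrable_density) (auto simp: integrable_distr_eq)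
  then have "integrable lborel (\<lambda>x. (1 / \<bar>c\<bar> ^ DIM('a)) *\<^sub>R ((\<bar>c\<bar> ^ DIM('a)) *\<^sub>R f (t + c *\<^sub>R x)))"
    by (rule integrable_scaleR_right)
  then show ?thesis using assms(2) by simp
qed

lemma lborel_integral_affine:
  fixes f :: "'a::euclidean_space \<Rightarrow> 'c::{banach,second_countable_topology}"
  assumes f: "f \<in> borel_measurable lborel" and "c \<noteq> 0"
  shows "(\<integral>x. f x \<partial>lborel) = (\<bar>c\<bar> ^ DIM('a)) *\<^sub>R (\<integral>x. f (t + c *\<^sub>R x) \<partial>lborel)"
proof -
  have [measurable]: "f \<in> borel_measurable borel" using f by simp
  show ?thesis
    by (subst lborel_affine[OF assms(2), of t]) (simp add: integral_density integral_distr)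
qed

lemma lborel_nn_integral_affine:
  fixes f :: "'a::euclidean_space \<Rightarrow> ennreal"
  assumes f: "f \<in> borel_measurable lborel" and "c \<noteq> 0"
  shows "(\<integral>\<^sup>+x. f x \<partial>lborel) = ennreal (\<bar>c\<bar> ^ DIM('a)) * (\<integral>\<^sup>+x. f (t + c *\<^sub>R x) \<partial>lborel)"
proof -
  have [measurable]: "f \<in> borel_measurable borel" using f by simp
  show ?thesis
    by (subst lborel_affine[OF assms(2), of t])
      (simp add: nn_integral_density nn_integral_distr nn_integral_cmult)
qed

lemma lborel_integrable_shift:
  fixes f :: "'a::euclidean_space \<Rightarrow> 'c::{banach,second_countable_topology}"
  shows "integrable lborel f \<Longrightarrow> integrable lborel (\<lambda>x. f (x + t))"
  using lborel_integrable_affine[of f 1 t] by (simp add: add.commute)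

lemma lborel_integral_shift:
  fixes f :: "'a::euclidean_space \<Rightarrow> 'c::{banach,second_countable_topology}"
  shows "f \<in> borel_measurable lborel \<Longrightarrow> (\<integral>x. f (x + t) \<partial>lborel) = (\<integral>x. f x \<partial>lborel)"
  using lborel_integral_affine[of f 1 t] by (simp add: add.commute)

lemma lborel_nn_integral_shift:
  fixes f :: "'a::euclidean_space \<Rightarrow> ennreal"
  shows "f \<in> borel_measurable lborel \<Longrightarrow> (\<integral>\<^sup>+x. f (x + t) \<partial>lborel) = (\<integral>\<^sup>+x. f x \<partial>lborel)"
  using lborel_nn_integral_affine[of f 1 t] by (simp add: add.commute)

text \<open>Comparison with the product over the coordinates of 1 / (1 + x_b^2), each factor of
  which is at least (1 + |x|)^(-2); this is where the exponent - 2 n comes from.\<close>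

lemma integrable_decay:
  assumes "p \<le> - 2 * real DIM('a)"
  shows "integrable lborel (\<lambda>x::'a::euclidean_space. (1 + norm x) powr p)"
proof (rule Bochner_Integration.integrable_bound)
  have "integrable lborel (\<lambda>t::real. inverse (1 + t\<^sup>2))"
    using integrable_inverse_1_plus_square by (simp add: set_integrable_def einterval_def)
  then show "integrable lborel (\<lambda>x::'a. \<Prod>b\<in>Basis. inverse (1 + (x \<bullet> b)\<^sup>2))"
    by (rule lborel_integral_prod)
  show "AE x::'a in lborel. norm ((1 + norm x) powr p) \<le> norm (\<Prod>b\<in>Basis. inverse (1 + (x \<bullet> b)\<^sup>2))"
  proof (rule AE_I2)
    fix x :: 'a
    have ge1: "1 \<le> 1 + (x \<bullet> b)\<^sup>2" for b by simp
    have prod_pos: "0 < (\<Prod>b\<in>Basis. 1 + (x \<bullet> b)\<^sup>2)" by (intro prod_pos) (simp add: add_pos_nonneg)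
    have le: "1 + (x \<bullet> b)\<^sup>2 \<le> (1 + norm x)\<^sup>2" if "b \<in> Basis" for b
    proof -
      have "\<bar>x \<bullet> b\<bar> \<le> norm x" using Basis_le_norm[OF that] .
      then have "(x \<bullet> b)\<^sup>2 \<le> (norm x)\<^sup>2" by (metis abs_ge_zero power2_abs power_mono)
      moreover have "0 \<le> 2 * norm x" by simp
      ultimately show ?thesis by (simp add: power2_sum del: norm_ge_zero zero_le_mult_iff)
    qed
    have "(\<Prod>b\<in>Basis. 1 + (x \<bullet> b)\<^sup>2) \<le> (\<Prod>b\<in>(Basis::'a set). (1 + norm x)\<^sup>2)"
      using le by (intro prod_mono) (auto simp: add_nonneg_nonneg)
    also have "\<dots> = (1 + norm x) powr (2 * real DIM('a))"
      using powr_realpow[of "1 + norm x" "2 * DIM('a)"]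
      by (simp add: add_pos_nonneg power_mult[symmetric] del: power_mult)
    also have "\<dots> \<le> (1 + norm x) powr (- p)" using assms by (intro powr_mono) auto
    finally have "inverse ((1 + norm x) powr (- p)) \<le> inverse (\<Prod>b\<in>Basis. 1 + (x \<bullet> b)\<^sup>2)"
      using prod_pos by (intro le_imp_inverse_le) auto
    also have "\<dots> = (\<Prod>b\<in>Basis. inverse (1 + (x \<bullet> b)\<^sup>2))" by (simp add: prod_inversef[symmetric] comp_def)
    finally show "norm ((1 + norm x) powr p) \<le> norm (\<Prod>b\<in>Basis. inverse (1 + (x \<bullet> b)\<^sup>2))"
      by (simp add: powr_minus)
  qed
qed measurable

lemma gaussian_moment_bound:
  assumes "c > (0::real)"
  shows "\<exists>C\<ge>0. \<forall>t\<ge>0. (1 + t) ^ m * exp (- c * t\<^sup>2) \<le> C"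
\<comment> \<open>The witness combines (1 + t)^m <= m! exp (1 + t), one term of the power series,
  with t - c t^2 <= 1 / (4 c), a completed square.\<close>
proof (intro exI[of _ "fact m * exp (1 + 1 / (4 * c))"] conjI allI impI)
  fix t :: real assume t: "t \<ge> 0"
  have "(1 + t) ^ m / fact m \<le> exp (1 + t)"
  proof -
    have "(1 + t) ^ m / fact m = (\<Sum>k\<in>{m}. (1 + t) ^ k /\<^sub>R fact k)" by (simp add: divide_inverse mult.commute)
    also have "\<dots> \<le> (\<Sum>k. (1 + t) ^ k /\<^sub>R fact k)" using t by (intro sum_le_suminf summable_exp_generic) auto
    finally show ?thesis by (simp add: exp_def)
  qed
  then have "(1 + t) ^ m \<le> fact m * exp (1 + t)" by (simp add: field_simps)
  then have "(1 + t) ^ m * exp (- c * t\<^sup>2) \<le> fact m * exp (1 + t) * exp (- c * t\<^sup>2)" by (intro mult_right_mono) auto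
  also have "\<dots> = fact m * exp (1 + t - c * t\<^sup>2)" by (simp add: exp_add[symmetric])
  also have "1 + t - c * t\<^sup>2 \<le> 1 + 1 / (4 * c)"
  proof -
    have "1 / (4 * c) - t + c * t\<^sup>2 = (1 - 2 * c * t)\<^sup>2 / (4 * c)" using assms by (simp add: power2_eq_square field_simps)
    also have "\<dots> \<ge> 0" using assms by simp
    finally show ?thesis by simp
  qed
  finally show "(1 + t) ^ m * exp (- c * t\<^sup>2) \<le> fact m * exp (1 + 1 / (4 * c))" by simp
qed simp

lemma integrable_poly_gaussian:
  assumes "c > (0::real)"
  shows "integrable lborel (\<lambda>x::'a::euclidean_space. (1 + norm x) ^ m * exp (- c * (norm x)\<^sup>2))"
proof -
  let ?d = "2 * DIM('a)"
  obtain C where C: "C \<ge> 0" "\<And>t. t \<ge> 0 \<Longrightarrow> (1 + t) ^ (m + ?d) * exp (- c * t\<^sup>2) \<le> C"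
    using gaussian_moment_bound[OF assms] by blast
  show ?thesis
  proof (rule Bochner_Integration.integrable_bound)
    show "integrable lborel (\<lambda>x::'a. C * (1 + norm x) powr (- 2 * real DIM('a)))"
      by (intro integrable_mult_right integrable_decay) simp
    show "AE x::'a in lborel. norm ((1 + norm x) ^ m * exp (- c * (norm x)\<^sup>2))
        \<le> norm (C * (1 + norm x) powr (- 2 * real DIM('a)))"
    proof (rule AE_I2)
      fix x :: 'a
      have pos: "1 + norm x > 0" by (simp add: add_pos_nonneg)
      have "(1 + norm x) ^ m * exp (- c * (norm x)\<^sup>2) * (1 + norm x) ^ ?d \<le> C"
        using C(2)[of "norm x"] by (simp add: power_add mult_ac)
      then have "(1 + norm x) ^ m * exp (- c * (norm x)\<^sup>2) \<le> C / (1 + norm x) ^ ?d"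
        using pos by (simp add: pos_le_divide_eq)
      also have "\<dots> = C * (1 + norm x) powr (- real ?d)"
        unfolding powr_minus powr_realpow[OF pos] by (simp add: divide_inverse)
      finally show "norm ((1 + norm x) ^ m * exp (- c * (norm x)\<^sup>2)) \<le> norm (C * (1 + norm x) powr (- 2 * real DIM('a)))"
        using C by (simp add: abs_mult power_abs add_nonneg_nonneg)
    qed
  qed measurable
qed

text \<open>A modulated Gaussian centred at \<open>b\<close>. With \<open>b = 0\<close> it is the
  test function that reads off the Fourier transform of a damped function at \<open>\<xi>\<close>;
  with \<open>\<xi> = 0\<close> it is an unnormalised heat kernel. The Fourier transform exchanges
  the two roles.\<close>

definition gauss_wave :: "real \<Rightarrow> 'a::euclidean_space \<Rightarrow> 'a \<Rightarrow> 'a \<Rightarrow> complex" where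
  "gauss_wave c b \<xi> x = of_real (exp (- (c / 2) * (norm (x - b))\<^sup>2)) * cis (- (x \<bullet> \<xi>))"

lemma gauss_wave_measurable [measurable]: "gauss_wave c b \<xi> \<in> borel_measurable borel"
proof -
  have "continuous_on UNIV (gauss_wave c b \<xi>)"
    unfolding gauss_wave_def cis_conv_exp by (intro continuous_intros)
  then show ?thesis by (rule borel_measurable_continuous_onI)
qed

lemma norm_gauss_wave: "norm (gauss_wave c b \<xi> x) = exp (- (c / 2) * (norm (x - b))\<^sup>2)"
  by (simp add: gauss_wave_def norm_mult)

lemma integrable_gaussian:
  assumes "c > 0"
  shows "integrable lborel (\<lambda>x::'a::euclidean_space. exp (- (c / 2) * (norm (x - b))\<^sup>2))"
  using lborel_integrable_shift[OF integrable_poly_gaussian[of "c / 2" 0], of "- b"] assms by simp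

lemma integrable_gauss_wave:
  assumes "c > 0"
  shows "integrable lborel (gauss_wave c b \<xi>)"
  by (rule Bochner_Integration.integrable_bound[OF integrable_gaussian[OF assms, of b]])
    (auto simp: norm_gauss_wave)

text \<open>A rescaling of the characteristic function of the standard normal distribution.\<close>

lemma gauss_wave_integral_real:
  assumes c: "c > (0::real)"
  shows "(\<integral>x. gauss_wave c 0 t x \<partial>lborel) = of_real (sqrt (2 * pi / c) * exp (- t\<^sup>2 / (2 * c)))"
proof -
  define f where "f x = std_normal_density x *\<^sub>R iexp ((- t / sqrt c) * x)" for x
  have "char std_normal_distribution (- t / sqrt c) = (\<integral>x. f x \<partial>lborel)"
    unfolding char_def f_def by (subst integral_density) auto
  then have "(\<integral>x. f x \<partial>lborel) = of_real (exp (- ((t / sqrt c)\<^sup>2) / 2))"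
    by (simp add: char_std_normal_distribution)
  also have "(t / sqrt c)\<^sup>2 = t\<^sup>2 / c" using c by (simp add: power_divide)
  also have "(\<integral>x. f x \<partial>lborel) = sqrt c *\<^sub>R (\<integral>x. f (0 + sqrt c * x) \<partial>lborel)"
    using c by (subst lborel_integral_real_affine[of "sqrt c" _ 0]) auto
  also have "(\<lambda>x. f (0 + sqrt c * x)) = (\<lambda>x. of_real (1 / sqrt (2 * pi)) * gauss_wave c 0 t x)"
  proof
    fix x
    have "(sqrt c * x)\<^sup>2 = c * x\<^sup>2" using c by (simp add: power_mult_distrib)
    then have 1: "std_normal_density (sqrt c * x) = 1 / sqrt (2 * pi) * exp (- (c / 2) * (norm (x - 0))\<^sup>2)"
      by (simp add: std_normal_density_def)
    have "(- t / sqrt c) * (sqrt c * x) = - (x * t)" using c by simp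
    then have 2: "iexp ((- t / sqrt c) * (sqrt c * x)) = cis (- (x \<bullet> t))"
      by (simp only: cis_conv_exp inner_real_def)
    show "f (0 + sqrt c * x) = of_real (1 / sqrt (2 * pi)) * gauss_wave c 0 t x"
      unfolding f_def gauss_wave_def add_0 1 2 by (simp only: scaleR_conv_of_real of_real_mult mult.assoc)
  qed
  finally have "of_real (sqrt c / sqrt (2 * pi)) * (\<integral>x. gauss_wave c 0 t x \<partial>lborel) = complex_of_real (exp (- (t\<^sup>2 / c) / 2))"
    by (simp only: integral_mult_right_zero scaleR_conv_of_real mult.assoc[symmetric] of_real_mult[symmetric]
        times_divide_eq_right mult_1_right)
  note eq = this
  have "complex_of_real (sqrt (2 * pi / c)) * of_real (sqrt c / sqrt (2 * pi)) = 1"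
    using c by (simp only: of_real_mult[symmetric]) (simp add: real_sqrt_divide)
  then have "(\<integral>x. gauss_wave c 0 t x \<partial>lborel)
      = (complex_of_real (sqrt (2 * pi / c)) * of_real (sqrt c / sqrt (2 * pi))) * (\<integral>x. gauss_wave c 0 t x \<partial>lborel)"
    by simp
  also have "\<dots> = complex_of_real (sqrt (2 * pi / c)) * complex_of_real (exp (- (t\<^sup>2 / c) / 2))"
    unfolding mult.assoc eq ..
  also have "- (t\<^sup>2 / c) / 2 = - t\<^sup>2 / (2 * c)" by simp
  finally show ?thesis unfolding of_real_mult .
qed

lemma gauss_wave_prod: "gauss_wave c 0 \<xi> x = (\<Prod>b\<in>Basis. gauss_wave c 0 (\<xi> \<bullet> b) (x \<bullet> b))"
proof -
  have e: "gauss_wave c 0 \<xi> x = exp (of_real (- (c / 2) * (norm x)\<^sup>2) + \<i> * of_real (- (x \<bullet> \<xi>)))"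
    for \<xi> x :: "'b::euclidean_space"
    by (simp only: gauss_wave_def exp_add cis_conv_exp exp_of_real diff_zero)
  have n: "(norm x)\<^sup>2 = (\<Sum>b\<in>Basis. (x \<bullet> b)\<^sup>2)"
    unfolding power2_norm_eq_inner by (subst euclidean_inner) (simp only: power2_eq_square)
  have i: "x \<bullet> \<xi> = (\<Sum>b\<in>Basis. (x \<bullet> b) * (\<xi> \<bullet> b))" by (rule euclidean_inner)
  have "gauss_wave c 0 (\<xi> \<bullet> b) (x \<bullet> b) = exp (of_real (- (c / 2) * (x \<bullet> b)\<^sup>2) + \<i> * of_real (- ((x \<bullet> b) * (\<xi> \<bullet> b))))" for b
    by (subst e) simp
  then have "(\<Prod>b\<in>Basis. gauss_wave c 0 (\<xi> \<bullet> b) (x \<bullet> b))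
     = exp (\<Sum>b\<in>Basis. of_real (- (c / 2) * (x \<bullet> b)\<^sup>2) + \<i> * of_real (- ((x \<bullet> b) * (\<xi> \<bullet> b))))"
    by (simp add: exp_sum)
  also have "(\<Sum>b\<in>Basis. complex_of_real (- (c / 2) * (x \<bullet> b)\<^sup>2) + \<i> * of_real (- ((x \<bullet> b) * (\<xi> \<bullet> b))))
     = of_real (- (c / 2) * (norm x)\<^sup>2) + \<i> * of_real (- (x \<bullet> \<xi>))"
    unfolding n i by (simp add: sum_subtractf sum_distrib_left sum_negf)
  finally show ?thesis by (simp only: e)
qed

lemma gauss_wave_integral0:
  fixes \<xi> :: "'a::euclidean_space"
  assumes c: "c > 0"
  shows "(\<integral>x. gauss_wave c 0 \<xi> x \<partial>lborel) = of_real (sqrt (2 * pi / c) ^ DIM('a) * exp (- (norm \<xi>)\<^sup>2 / (2 * c)))"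
proof -
  have "(\<integral>x. gauss_wave c 0 \<xi> x \<partial>lborel) = (\<Prod>b\<in>Basis. \<integral>t. gauss_wave c 0 (\<xi> \<bullet> b) t \<partial>lborel)"
    unfolding gauss_wave_prod[of c \<xi>] by (rule lborel_integral_prod(2)) (rule integrable_gauss_wave[OF c])
  also have "\<dots> = of_real (\<Prod>b\<in>Basis. sqrt (2 * pi / c) * exp (- (\<xi> \<bullet> b)\<^sup>2 / (2 * c)))"
    by (simp add: gauss_wave_integral_real[OF c])
  also have "(\<Prod>b\<in>Basis. sqrt (2 * pi / c) * exp (- (\<xi> \<bullet> b)\<^sup>2 / (2 * c))) =
     sqrt (2 * pi / c) ^ DIM('a) * exp (\<Sum>b\<in>Basis. - (\<xi> \<bullet> b)\<^sup>2 / (2 * c))"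
    by (simp add: prod.distrib exp_sum)
  also have "(\<Sum>b\<in>Basis. - (\<xi> \<bullet> b)\<^sup>2 / (2 * c)) = - (norm \<xi>)\<^sup>2 / (2 * c)"
    unfolding power2_norm_eq_inner euclidean_inner[of \<xi> \<xi>]
    by (simp add: power2_eq_square sum_divide_distrib sum_negf)
  finally show ?thesis .
qed

lemma gauss_wave_integral:
  fixes \<xi> b :: "'a::euclidean_space"
  assumes c: "c > 0"
  shows "(\<integral>x. gauss_wave c b \<xi> x \<partial>lborel)
    = of_real (sqrt (2 * pi / c) ^ DIM('a) * exp (- (norm \<xi>)\<^sup>2 / (2 * c))) * cis (- (b \<bullet> \<xi>))"
proof -
  have "(\<integral>x. gauss_wave c b \<xi> x \<partial>lborel) = (\<integral>x. gauss_wave c b \<xi> (x + b) \<partial>lborel)"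
    by (rule lborel_integral_shift[symmetric]) simp
  also have "\<dots> = (\<integral>x. gauss_wave c 0 \<xi> x * cis (- (b \<bullet> \<xi>)) \<partial>lborel)"
    by (simp add: gauss_wave_def inner_add_left cis_mult mult.assoc)
  finally show ?thesis by (simp add: gauss_wave_integral0[OF c])
qed

lemma cis_gauss_wave: "cis (- (x \<bullet> \<zeta>)) * gauss_wave c b \<xi> x = gauss_wave c b (\<xi> + \<zeta>) x"
  by (simp add: gauss_wave_def inner_add_right cis_mult mult.left_commute add.commute)

text \<open>The centred Gaussian density of variance c in each coordinate. With this
  parametrisation, multiplication by exp (- c |x|^2 / 2) on one side corresponds to averaging with
  \<open>heat c\<close> on the other, with the same c.\<close>

definition heat :: "real \<Rightarrow> 'a::euclidean_space \<Rightarrow> real" where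
  "heat c y = (1 / sqrt (2 * pi * c)) ^ DIM('a) * exp (- (norm y)\<^sup>2 / (2 * c))"

lemma heat_measurable [measurable]: "heat c \<in> borel_measurable borel"
  unfolding heat_def by measurable

lemma heat_nonneg: "c > 0 \<Longrightarrow> heat c y \<ge> 0"
  by (simp add: heat_def)

lemma heat_eq_gauss_wave:
  "of_real (heat c (y - b)) = of_real ((1 / sqrt (2 * pi * c)) ^ DIM('a)) * gauss_wave (1 / c) b 0 (y::'a::euclidean_space)"
  by (simp add: heat_def gauss_wave_def)

lemma fourier_gauss_wave:
  fixes b :: "real^'n"
  assumes "c > 0"
  shows "fourier (gauss_wave c b \<xi>) \<zeta> =
     of_real (sqrt (2 * pi / c) ^ CARD('n) * exp (- (norm (\<xi> + \<zeta>))\<^sup>2 / (2 * c))) * cis (- (b \<bullet> (\<xi> + \<zeta>)))"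
  unfolding fourier_def cis_gauss_wave using gauss_wave_integral[OF assms, of b "\<xi> + \<zeta>"] by simp

lemma heat_const: "c > 0 \<Longrightarrow> sqrt (2 * pi * c) ^ n * (1 / sqrt (2 * pi * c)) ^ n = (1::real)"
  by (simp add: power_mult_distrib[symmetric])

lemma fourier_heat:
  fixes b :: "real^'n"
  assumes c: "c > 0"
  shows "fourier (\<lambda>\<zeta>. of_real (heat c (\<zeta> - b))) x = gauss_wave c 0 b x"
proof -
  have "fourier (\<lambda>\<zeta>. of_real (heat c (\<zeta> - b))) x
     = of_real ((1 / sqrt (2 * pi * c)) ^ CARD('n)) * fourier (gauss_wave (1 / c) b 0) x"
    unfolding heat_eq_gauss_wave fourier_def mult.left_commute[of "cis _"] by simp
  also have "fourier (gauss_wave (1 / c) b 0) x =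
      of_real (sqrt (2 * pi * c) ^ CARD('n)) * gauss_wave c 0 b x"
    using c by (simp add: fourier_gauss_wave gauss_wave_def inner_commute mult.commute)
  finally have "fourier (\<lambda>\<zeta>. of_real (heat c (\<zeta> - b))) x =
      of_real (sqrt (2 * pi * c) ^ CARD('n) * (1 / sqrt (2 * pi * c)) ^ CARD('n)) * gauss_wave c 0 b x"
    by (simp only: of_real_mult mult_ac)
  then show ?thesis unfolding heat_const[OF c] by simp
qed

lemma inv_fourier_eq_fourier:
  "inv_fourier (\<phi> :: real^'n \<Rightarrow> complex) x = of_real (1 / (2 * pi) ^ CARD('n)) * fourier \<phi> (- x)"
  by (simp add: inv_fourier_def fourier_def inner_commute)

text \<open>The reason for testing with Gaussian waves: a Fourier multiplier paired with one becomes
  an average of symbol times transform against a probability density centred at \<xi>.\<close>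

lemma inv_fourier_gauss_wave:
  fixes \<xi> :: "real^'n"
  assumes c: "c > 0"
  shows "inv_fourier (gauss_wave c 0 \<xi>) \<zeta> = of_real (heat c (\<zeta> - \<xi>))"
proof -
  have "sqrt (2 * pi / c) * sqrt (2 * pi * c) = 2 * pi"
  proof -
    have "(2 * pi / c) * (2 * pi * c) = (2 * pi)\<^sup>2" using c by (simp add: power2_eq_square)
    then show ?thesis by (simp only: real_sqrt_mult[symmetric] real_sqrt_abs) simp
  qed
  then have "sqrt (2 * pi / c) ^ CARD('n) * sqrt (2 * pi * c) ^ CARD('n) = (2 * pi) ^ CARD('n)"
    by (simp only: power_mult_distrib[symmetric])
  note ST = this
  have aux: "1 / (S * T) * S = 1 / T" if "S \<noteq> 0" for S T :: real using that by simp
  have eq: "1 / (2 * pi) ^ CARD('n) * sqrt (2 * pi / c) ^ CARD('n) = (1 / sqrt (2 * pi * c)) ^ CARD('n)"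
    unfolding ST[symmetric] power_one_over by (rule aux) (use c in simp)
  have "inv_fourier (gauss_wave c 0 \<xi>) \<zeta> = of_real (1 / (2 * pi) ^ CARD('n)) *
     of_real (sqrt (2 * pi / c) ^ CARD('n) * exp (- (norm (\<zeta> - \<xi>))\<^sup>2 / (2 * c)))"
    unfolding inv_fourier_eq_fourier fourier_gauss_wave[OF c] by (simp add: norm_minus_commute)
  also have "\<dots> = of_real (1 / (2 * pi) ^ CARD('n) * sqrt (2 * pi / c) ^ CARD('n) * exp (- (norm (\<zeta> - \<xi>))\<^sup>2 / (2 * c)))"
    unfolding of_real_mult mult.assoc ..
  also have "\<dots> = of_real (heat c (\<zeta> - \<xi>))" unfolding eq heat_def by simp
  finally show ?thesis .
qed

lemma integrable_heat: "c > 0 \<Longrightarrow> integrable lborel (heat c)"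
  unfolding heat_def using integrable_gaussian[of "1 / c" 0] by (simp add: mult.commute)

lemma integral_heat: "c > 0 \<Longrightarrow> (\<integral>y. heat c y \<partial>(lborel::'a::euclidean_space measure)) = 1"
proof -
  assume c: "c > 0"
  have "complex_of_real (\<integral>y. heat c y \<partial>(lborel::'a measure)) = (\<integral>y. of_real (heat c ((y::'a) - 0)) \<partial>lborel)"
    by simp
  also have "\<dots> = of_real ((1 / sqrt (2 * pi * c)) ^ DIM('a) * sqrt (2 * pi * c) ^ DIM('a))"
    unfolding heat_eq_gauss_wave using c gauss_wave_integral[of "1 / c" 0 "0::'a"] by simp
  also have "\<dots> = 1" using heat_const[OF c, of "DIM('a)"] by (simp add: mult.commute)
  finally show ?thesis by simp
qed

lemma heat_scale:
  assumes "c > 0"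
  shows "heat c (sqrt c *\<^sub>R (y::'a::euclidean_space)) * sqrt c ^ DIM('a) = heat 1 y"
proof -
  have "heat c (sqrt c *\<^sub>R y) * sqrt c ^ DIM('a)
      = (1 / sqrt (2 * pi * c) * sqrt c) ^ DIM('a) * exp (- (norm (sqrt c *\<^sub>R y))\<^sup>2 / (2 * c))"
    by (simp only: heat_def power_mult_distrib mult_ac)
  also have "1 / sqrt (2 * pi * c) * sqrt c = 1 / sqrt (2 * pi)" using assms by (simp add: real_sqrt_mult)
  also have "(norm (sqrt c *\<^sub>R y))\<^sup>2 = c * (norm y)\<^sup>2" using assms by (simp add: power_mult_distrib)
  finally show ?thesis using assms by (simp add: heat_def)
qed

section \<open>The space of square-integrable functions\<close>

lemma L2D:
  assumes "f \<in> L2"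
  shows "f \<in> borel_measurable borel" "integrable lborel (\<lambda>x. (cmod (f x))\<^sup>2)"
  using assms by (auto simp: L2_def)

lemma L2I:
  assumes "f \<in> borel_measurable borel" "(\<integral>\<^sup>+x. ennreal ((cmod (f x))\<^sup>2) \<partial>lborel) \<le> ennreal B"
  shows "f \<in> L2" and "B \<ge> 0 \<Longrightarrow> (\<integral>x. (cmod (f x))\<^sup>2 \<partial>lborel) \<le> B"
proof -
  have [measurable]: "f \<in> borel_measurable borel" by fact
  have "(\<integral>\<^sup>+x. ennreal (norm ((cmod (f x))\<^sup>2)) \<partial>lborel) < \<infinity>"
    using assms(2) by (simp add: le_less_trans[OF _ ennreal_less_top])
  then have "integrable lborel (\<lambda>x. (cmod (f x))\<^sup>2)" by (intro integrableI_bounded) auto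
  then show "f \<in> L2" by (simp add: L2_def)
  show "(\<integral>x. (cmod (f x))\<^sup>2 \<partial>lborel) \<le> B" if "B \<ge> 0"
  proof -
    have "ennreal (\<integral>x. (cmod (f x))\<^sup>2 \<partial>lborel) = (\<integral>\<^sup>+x. ennreal ((cmod (f x))\<^sup>2) \<partial>lborel)"
      using \<open>integrable lborel _\<close> by (intro nn_integral_eq_integral[symmetric]) auto
    then have "ennreal (\<integral>x. (cmod (f x))\<^sup>2 \<partial>lborel) \<le> ennreal B" using assms(2) by simp
    then show ?thesis using that by simp
  qed
qed

lemma norm_integral_le_nn_integral:
  fixes f :: "'a \<Rightarrow> 'b::{banach,second_countable_topology}"
  shows "ennreal (norm (\<integral>x. f x \<partial>M)) \<le> (\<integral>\<^sup>+x. ennreal (norm (f x)) \<partial>M)"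
  by (cases "integrable M f") (auto simp: not_integrable_integral_eq intro: integral_norm_bound_ennreal)

lemma cnj_measurable [measurable]: "cnj \<in> borel_measurable borel"
  by (intro borel_measurable_continuous_onI continuous_intros)

lemma L2_nn_integral:
  "f \<in> L2 \<Longrightarrow> (\<integral>\<^sup>+x. ennreal ((cmod (f x))\<^sup>2) \<partial>lborel) = ennreal (\<integral>x. (cmod (f x))\<^sup>2 \<partial>lborel)"
  by (intro nn_integral_eq_integral) (auto dest: L2D)

lemma L2_dominated:
  assumes g: "g \<in> L2" and f: "f \<in> borel_measurable borel" and le: "\<And>x. cmod (f x) \<le> C * cmod (g x)"
  shows "f \<in> L2" "(\<integral>x. (cmod (f x))\<^sup>2 \<partial>lborel) \<le> C\<^sup>2 * (\<integral>x. (cmod (g x))\<^sup>2 \<partial>lborel)"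
proof -
  have [measurable]: "f \<in> borel_measurable borel" by fact
  have sq: "(cmod (f x))\<^sup>2 \<le> C\<^sup>2 * (cmod (g x))\<^sup>2" for x
    using power_mono[OF le[of x], of 2] by (simp add: power_mult_distrib)
  have gi: "integrable lborel (\<lambda>x. C\<^sup>2 * (cmod (g x))\<^sup>2)" using L2D[OF g] by auto
  have fi: "integrable lborel (\<lambda>x. (cmod (f x))\<^sup>2)"
    by (rule Bochner_Integration.integrable_bound[OF gi]) (auto intro: order_trans[OF sq])
  then show "f \<in> L2" using f by (simp add: L2_def)
  have "(\<integral>x. (cmod (f x))\<^sup>2 \<partial>lborel) \<le> (\<integral>x. C\<^sup>2 * (cmod (g x))\<^sup>2 \<partial>lborel)"
    by (rule integral_mono[OF fi gi sq])
  then show "(\<integral>x. (cmod (f x))\<^sup>2 \<partial>lborel) \<le> C\<^sup>2 * (\<integral>x. (cmod (g x))\<^sup>2 \<partial>lborel)" by simp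
qed

lemma sq_add_le: "(cmod (a + b))\<^sup>2 \<le> 2 * (cmod a)\<^sup>2 + 2 * (cmod b)\<^sup>2"
proof -
  have "(cmod (a + b))\<^sup>2 \<le> (cmod a + cmod b)\<^sup>2" by (intro power_mono norm_triangle_ineq) auto
  also have "\<dots> \<le> 2 * (cmod a)\<^sup>2 + 2 * (cmod b)\<^sup>2"
    using sum_squares_bound[of "cmod a" "cmod b"] by (simp add: power2_sum)
  finally show ?thesis .
qed

lemma L2_add:
  assumes "f \<in> L2" "g \<in> L2"
  shows "(\<lambda>x. f x + g x) \<in> L2"
    "(\<integral>x. (cmod (f x + g x))\<^sup>2 \<partial>lborel) \<le> 2 * (\<integral>x. (cmod (f x))\<^sup>2 \<partial>lborel) + 2 * (\<integral>x. (cmod (g x))\<^sup>2 \<partial>lborel)"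
proof -
  note [measurable] = L2D(1)[OF assms(1)] L2D(1)[OF assms(2)]
  have i: "integrable lborel (\<lambda>x. 2 * (cmod (f x))\<^sup>2 + 2 * (cmod (g x))\<^sup>2)" using L2D(2)[OF assms(1)] L2D(2)[OF assms(2)] by auto
  have fi: "integrable lborel (\<lambda>x. (cmod (f x + g x))\<^sup>2)"
    by (rule Bochner_Integration.integrable_bound[OF i]) (auto intro: order_trans[OF sq_add_le])
  then show "(\<lambda>x. f x + g x) \<in> L2" by (simp add: L2_def)
  show "(\<integral>x. (cmod (f x + g x))\<^sup>2 \<partial>lborel) \<le> 2 * (\<integral>x. (cmod (f x))\<^sup>2 \<partial>lborel) + 2 * (\<integral>x. (cmod (g x))\<^sup>2 \<partial>lborel)"
    using integral_mono[OF fi i sq_add_le] L2D(2)[OF assms(1)] L2D(2)[OF assms(2)] by simp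
qed

lemma L2_cmult: "f \<in> L2 \<Longrightarrow> (\<lambda>x. c * f x) \<in> L2"
  using L2_dominated(1)[of f "\<lambda>x. c * f x" "cmod c"] L2D(1)[of f] by (simp add: norm_mult)

lemma L2_diff: "f \<in> L2 \<Longrightarrow> g \<in> L2 \<Longrightarrow> (\<lambda>x. f x - g x) \<in> L2"
  using L2_add(1)[of f "\<lambda>x. (-1) * g x"] L2_cmult[of g "-1"] by simp

lemma L2_reflect:
  assumes "f \<in> L2" shows "(\<lambda>x. f (- x)) \<in> L2"
    and "(\<integral>x. (cmod (f (- x)))\<^sup>2 \<partial>lborel) = (\<integral>x. (cmod (f x))\<^sup>2 \<partial>lborel)"
proof -
  note [measurable] = L2D(1)[OF assms]
  show "(\<lambda>x. f (- x)) \<in> L2"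
    using lborel_integrable_affine[OF L2D(2)[OF assms], of "-1" 0] by (simp add: L2_def)
  show "(\<integral>x. (cmod (f (- x)))\<^sup>2 \<partial>lborel) = (\<integral>x. (cmod (f x))\<^sup>2 \<partial>lborel)"
    using lborel_integral_affine[of "\<lambda>x. (cmod (f x))\<^sup>2" "-1" 0] by simp
qed

lemma L2_mult_integrable:
  assumes "f \<in> L2" "g \<in> L2"
  shows "integrable lborel (\<lambda>x. f x * g x)"
proof (rule Bochner_Integration.integrable_bound)
  note [measurable] = L2D(1)[OF assms(1)] L2D(1)[OF assms(2)]
  show "integrable lborel (\<lambda>x. (cmod (f x))\<^sup>2 + (cmod (g x))\<^sup>2)" using L2D(2)[OF assms(1)] L2D(2)[OF assms(2)] by auto
  show "(\<lambda>x. f x * g x) \<in> borel_measurable lborel" by measurable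
  have "cmod (f x) * cmod (g x) \<le> (cmod (f x))\<^sup>2 + (cmod (g x))\<^sup>2" for x
  proof -
    have "2 * (cmod (f x) * cmod (g x)) \<le> (cmod (f x))\<^sup>2 + (cmod (g x))\<^sup>2"
      using sum_squares_bound[of "cmod (f x)" "cmod (g x)"] by (simp add: mult.assoc)
    moreover have "0 \<le> cmod (f x) * cmod (g x)" by simp
    ultimately show ?thesis by linarith
  qed
  then show "AE x in lborel. norm (f x * g x) \<le> norm ((cmod (f x))\<^sup>2 + (cmod (g x))\<^sup>2)"
    by (simp add: norm_mult)
qed

lemma L2_Cauchy_Schwarz:
  assumes "f \<in> L2" "g \<in> L2"
  shows "(cmod (\<integral>x. f x * g x \<partial>lborel))\<^sup>2 \<le> (\<integral>x. (cmod (f x))\<^sup>2 \<partial>lborel) * (\<integral>x. (cmod (g x))\<^sup>2 \<partial>lborel)"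
proof -
  note [measurable] = L2D(1)[OF assms(1)] L2D(1)[OF assms(2)]
  have i: "integrable lborel (\<lambda>x. cmod (f x) * cmod (g x))"
    using integrable_norm[OF L2_mult_integrable[OF assms]] by (simp add: norm_mult)
  have "ennreal ((cmod (\<integral>x. f x * g x \<partial>lborel))\<^sup>2) \<le> ennreal ((\<integral>x. cmod (f x) * cmod (g x) \<partial>lborel)\<^sup>2)"
    using integral_norm_bound[of lborel "\<lambda>x. f x * g x"]
    by (intro ennreal_leI power_mono) (auto simp: norm_mult)
  also have "\<dots> = (\<integral>\<^sup>+x. ennreal (cmod (f x)) * ennreal (cmod (g x)) \<partial>lborel)\<^sup>2"
    by (simp add: ennreal_mult[symmetric] nn_integral_eq_integral[OF i] ennreal_power)
  also have "\<dots> \<le> (\<integral>\<^sup>+x. (ennreal (cmod (f x)))\<^sup>2 \<partial>lborel) * (\<integral>\<^sup>+x. (ennreal (cmod (g x)))\<^sup>2 \<partial>lborel)"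
    by (rule Cauchy_Schwarz_nn_integral) auto
  also have "\<dots> = ennreal ((\<integral>x. (cmod (f x))\<^sup>2 \<partial>lborel) * (\<integral>x. (cmod (g x))\<^sup>2 \<partial>lborel))"
    by (simp add: ennreal_power L2_nn_integral assms ennreal_mult)
  finally show ?thesis by (subst (asm) ennreal_le_iff) auto
qed

text \<open>Riesz-Fischer: a fast subsequence converges almost everywhere, and Fatou's lemma turns
  the Cauchy property of the whole sequence into convergence to its limit.\<close>

lemma L2_complete:
  fixes f :: "nat \<Rightarrow> real^'n \<Rightarrow> complex"
  assumes f: "\<And>k. f k \<in> L2"
    and Cauchy: "\<And>e. e > 0 \<Longrightarrow> \<exists>N. \<forall>m\<ge>N. \<forall>n\<ge>N. (\<integral>x. (cmod (f m x - f n x))\<^sup>2 \<partial>lborel) < e"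
  shows "\<exists>v\<in>L2. (\<lambda>k. \<integral>x. (cmod (f k x - v x))\<^sup>2 \<partial>lborel) \<longlonglongrightarrow> 0"
proof -
  have [measurable]: "f k \<in> borel_measurable borel" for k using L2D[OF f] by blast
  have "\<forall>k. \<exists>N. \<forall>m\<ge>N. \<forall>n\<ge>N. (\<integral>x. (cmod (f m x - f n x))\<^sup>2 \<partial>lborel) < (1 / 8) ^ k"
    using Cauchy by simp
  from choice[OF this] obtain N where
    N: "\<And>k m n. m \<ge> N k \<Longrightarrow> n \<ge> N k \<Longrightarrow> (\<integral>x. (cmod (f m x - f n x))\<^sup>2 \<partial>lborel) < (1 / 8) ^ k"
    by blast
  \<comment> \<open>Summing the thresholds and adding \<open>k\<close> makes the indices strictly
    increasing and keeps them above \<open>N k\<close>.\<close>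
  define r where "r k = (\<Sum>i\<le>k. N i) + k" for k
  have r_ge: "r k \<ge> N k" for k unfolding r_def by (intro trans_le_add1 member_le_sum) auto
  have r_Suc: "r (Suc k) \<ge> r k" for k by (simp add: r_def)
  have r_mono: "strict_mono r" unfolding strict_mono_Suc_iff by (simp add: r_def)
  define D where "D k x = f (r (Suc k)) x - f (r k) x" for k x
  have [measurable]: "D k \<in> borel_measurable borel" for k unfolding D_def by measurable
  have D2: "(\<integral>\<^sup>+x. ennreal ((cmod (D k x))\<^sup>2) \<partial>lborel) \<le> ennreal ((1 / 8) ^ k)" for k
    unfolding D_def using L2_nn_integral[OF L2_diff[OF f f]] N[of k "r (Suc k)" "r k"] r_ge[of k] r_Suc[of k]
    by (auto intro!: ennreal_leI)
  \<comment> \<open>The weight 4^k still leaves a convergent series against 8^(-k). Where the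
    weighted series is finite its terms are bounded, so |D k| decays like 2^(-k) and the telescoping
    series converges.\<close>
  have "(\<integral>\<^sup>+x. (\<Sum>k. ennreal (4 ^ k * (cmod (D k x))\<^sup>2)) \<partial>lborel) = (\<Sum>k. \<integral>\<^sup>+x. ennreal (4 ^ k * (cmod (D k x))\<^sup>2) \<partial>lborel)"
    by (intro nn_integral_suminf) auto
  also have "\<dots> \<le> (\<Sum>k. ennreal ((1 / 2) ^ k))"
  proof (intro suminf_le summableI allI)
    fix k
    have "(\<integral>\<^sup>+x. ennreal (4 ^ k * (cmod (D k x))\<^sup>2) \<partial>lborel) = ennreal (4 ^ k) * (\<integral>\<^sup>+x. ennreal ((cmod (D k x))\<^sup>2) \<partial>lborel)"
      by (simp add: ennreal_mult nn_integral_cmult)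
    also have "\<dots> \<le> ennreal (4 ^ k) * ennreal ((1 / 8) ^ k)" by (intro mult_left_mono D2) auto
    also have "\<dots> = ennreal ((4 * (1 / 8)) ^ k)"
      unfolding power_mult_distrib by (rule ennreal_mult[symmetric]) auto
    also have "(4 * (1 / 8) :: real) = 1 / 2" by simp
    finally show "(\<integral>\<^sup>+x. ennreal (4 ^ k * (cmod (D k x))\<^sup>2) \<partial>lborel) \<le> ennreal ((1 / 2) ^ k)" .
  qed
  also have "\<dots> < \<infinity>"
  proof -
    have "summable (\<lambda>k. (1 / 2 :: real) ^ k)" by (rule summable_geometric) simp
    then have "(\<Sum>k. ennreal ((1 / 2) ^ k)) = ennreal (\<Sum>k. (1 / 2) ^ k)" by (intro suminf_ennreal2) simp_all
    then show ?thesis by simp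
  qed
  finally have "AE x in lborel. (\<Sum>k. ennreal (4 ^ k * (cmod (D k x))\<^sup>2)) \<noteq> \<infinity>"
    by (intro nn_integral_noteq_infinite) auto
  then have conv: "AE x in lborel. convergent (\<lambda>k. f (r k) x)"
  proof eventually_elim
    case (elim x)
    have "summable (\<lambda>k. 4 ^ k * (cmod (D k x))\<^sup>2)"
      using elim by (intro summable_suminf_not_top) auto
    then have "(\<lambda>k. 4 ^ k * (cmod (D k x))\<^sup>2) \<longlonglongrightarrow> 0" by (rule summable_LIMSEQ_zero)
    then have "Bseq (\<lambda>k. 4 ^ k * (cmod (D k x))\<^sup>2)" by (intro convergent_imp_Bseq convergentI)
    then obtain S where S: "\<And>k. 4 ^ k * (cmod (D k x))\<^sup>2 \<le> S" by (auto simp: Bseq_def)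
    have D_le: "cmod (D k x) \<le> sqrt S * (1 / 2) ^ k" for k
    proof -
      have "((2::real) ^ k)\<^sup>2 = (2 * 2) ^ k" by (simp only: power2_eq_square power_mult_distrib)
      then have "(2 ^ k * cmod (D k x))\<^sup>2 \<le> S" using S[of k] by (simp add: power_mult_distrib)
      then have "2 ^ k * cmod (D k x) \<le> sqrt S" by (rule real_le_rsqrt)
      then have "(2 ^ k * cmod (D k x)) * (1 / 2) ^ k \<le> sqrt S * (1 / 2) ^ k" by (rule mult_right_mono) simp
      moreover have "(2 ^ k * cmod (D k x)) * (1 / 2) ^ k = (2 * (1 / 2)) ^ k * cmod (D k x)"
        unfolding power_mult_distrib by (simp only: mult_ac)
      ultimately show ?thesis by (simp only: nonzero_mult_div_cancel_left times_divide_eq_right mult_1_right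
          zero_neq_numeral not_False_eq_True div_self power_one mult_1_left)
    qed
    have "summable (\<lambda>k. sqrt S * (1 / 2) ^ k)"
      by (intro summable_mult summable_geometric) simp
    then have "summable (\<lambda>k. D k x)"
      by (rule summable_comparison_test') (rule D_le)
    then have "convergent (\<lambda>n. \<Sum>k<n. D k x)" by (simp add: summable_iff_convergent)
    moreover have "(\<Sum>k<n. D k x) = f (r n) x - f (r 0) x" for n
      unfolding D_def by (rule sum_lessThan_telescope)
    ultimately have "convergent (\<lambda>n. (f (r n) x - f (r 0) x) + f (r 0) x)"
      by (intro convergent_add convergent_const) simp
    then show ?case by simp
  qed
  define v where "v x = lim (\<lambda>k. f (r k) x)" for x
  have [measurable]: "v \<in> borel_measurable borel" unfolding v_def by measurable
  have lim: "AE x in lborel. (\<lambda>k. f (r k) x) \<longlonglongrightarrow> v x"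
    using conv unfolding v_def by eventually_elim (simp add: convergent_LIMSEQ_iff)
  have close: "(\<integral>\<^sup>+x. ennreal ((cmod (f m x - v x))\<^sup>2) \<partial>lborel) \<le> ennreal ((1 / 8) ^ k)" if "m \<ge> N k" for m k
  proof -
    have "(\<integral>\<^sup>+x. ennreal ((cmod (f m x - v x))\<^sup>2) \<partial>lborel)
      = (\<integral>\<^sup>+x. liminf (\<lambda>j. ennreal ((cmod (f m x - f (r j) x))\<^sup>2)) \<partial>lborel)"
    proof (rule nn_integral_cong_AE)
      show "AE x in lborel. ennreal ((cmod (f m x - v x))\<^sup>2) = liminf (\<lambda>j. ennreal ((cmod (f m x - f (r j) x))\<^sup>2))"
        using lim
      proof eventually_elim
        case (elim x)
        have "(\<lambda>j. ennreal ((cmod (f m x - f (r j) x))\<^sup>2)) \<longlonglongrightarrow> ennreal ((cmod (f m x - v x))\<^sup>2)"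
          by (intro tendsto_intros elim)
        from lim_imp_Liminf[OF sequentially_bot this] show ?case by (rule sym)
      qed
    qed
    also have "\<dots> \<le> liminf (\<lambda>j. \<integral>\<^sup>+x. ennreal ((cmod (f m x - f (r j) x))\<^sup>2) \<partial>lborel)"
      by (intro nn_integral_liminf) auto
    also have "\<dots> \<le> ennreal ((1 / 8) ^ k)"
    proof (rule Liminf_le)
      show "\<forall>\<^sub>F j in sequentially. (\<integral>\<^sup>+x. ennreal ((cmod (f m x - f (r j) x))\<^sup>2) \<partial>lborel) \<le> ennreal ((1 / 8) ^ k)"
        using eventually_ge_at_top[of "N k"]
      proof eventually_elim
        case (elim j)
        then have "r j \<ge> N k" using seq_suble[OF r_mono, of j] by simp
        then show ?case using N[OF that, of "r j"] unfolding L2_nn_integral[OF L2_diff[OF f f]]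
          by (intro ennreal_leI) simp
      qed
    qed simp
    finally show ?thesis .
  qed
  have fv: "(\<lambda>x. f (N 0) x - v x) \<in> L2" by (rule L2I(1)[OF _ close[OF order_refl]]) measurable
  have v: "v \<in> L2" using L2_diff[OF f[of "N 0"] fv] by simp
  have "(\<lambda>k. \<integral>x. (cmod (f k x - v x))\<^sup>2 \<partial>lborel) \<longlonglongrightarrow> 0"
  proof (rule LIMSEQ_I)
    fix e :: real assume "e > 0"
    then obtain k where k: "(1 / 8 :: real) ^ k < e" using real_arch_pow_inv[of e "1 / 8"] by auto
    show "\<exists>no. \<forall>m\<ge>no. norm ((\<integral>x. (cmod (f m x - v x))\<^sup>2 \<partial>lborel) - 0) < e"
    proof (intro exI[of _ "N k"] allI impI)
      fix m assume "m \<ge> N k"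
      from L2I(2)[OF _ close[OF this]] have "(\<integral>x. (cmod (f m x - v x))\<^sup>2 \<partial>lborel) \<le> (1 / 8) ^ k" by simp
      then show "norm ((\<integral>x. (cmod (f m x - v x))\<^sup>2 \<partial>lborel) - 0) < e" using k by simp
    qed
  qed
  then show ?thesis using v by blast
qed

section \<open>The Plancherel inequality\<close>

lemma integrable_product:
  fixes f g :: "'a::euclidean_space \<Rightarrow> complex"
  assumes f: "integrable lborel f" and g: "integrable lborel g"
  shows "integrable (lborel \<Otimes>\<^sub>M lborel) (\<lambda>(x, y). f x * g y)"
proof -
  note [measurable] = borel_measurable_integrable[OF f] borel_measurable_integrable[OF g]
  show ?thesis
    by (rule lborel_pair.Fubini_integrable)
      (use f g in \<open>auto simp: norm_mult intro!: integrable_mult_left\<close>)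
qed

lemma cis_measurable [measurable]: "cis \<in> borel_measurable borel"
  by (intro borel_measurable_continuous_onI continuous_intros)

lemma fourier_measurable:
  fixes f :: "real^'n \<Rightarrow> complex"
  assumes [measurable]: "f \<in> borel_measurable borel"
  shows "fourier f \<in> borel_measurable borel"
proof -
  have "(\<lambda>\<xi>. \<integral>x. cis (- (x \<bullet> \<xi>)) * f x \<partial>lborel) \<in> borel_measurable lborel"
    by (rule lborel.borel_measurable_lebesgue_integral) measurable
  then show ?thesis unfolding fourier_def[abs_def] by simp
qed

lemma fourier_integrand:
  fixes f :: "real^'n \<Rightarrow> complex"
  assumes "integrable lborel f"
  shows "integrable lborel (\<lambda>x. cis (- (x \<bullet> \<xi>)) * f x)"
proof -
  note [measurable] = borel_measurable_integrable[OF assms]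
  show ?thesis by (rule Bochner_Integration.integrable_bound[OF assms]) (auto simp: norm_mult)
qed

lemma fourier_bound: "cmod (fourier f \<xi>) \<le> (\<integral>x. cmod (f x) \<partial>lborel)"
  using integral_norm_bound[of lborel "\<lambda>x. cis (- (x \<bullet> \<xi>)) * f x"] by (simp add: fourier_def norm_mult)

lemma fourier_diff:
  assumes "integrable lborel f" "integrable lborel g"
  shows "fourier (\<lambda>x. f x - g x) \<xi> = fourier f \<xi> - fourier g \<xi>"
  unfolding fourier_def right_diff_distrib
  by (intro Bochner_Integration.integral_diff fourier_integrand assms)

lemma fourier_multiplication_formula:
  fixes f g :: "real^'n \<Rightarrow> complex"
  assumes f: "integrable lborel f" and g: "integrable lborel g"
  shows "(\<integral>x. fourier f x * g x \<partial>lborel) = (\<integral>x. f x * fourier g x \<partial>lborel)"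
proof -
  note [measurable] = borel_measurable_integrable[OF f] borel_measurable_integrable[OF g]
  have i: "integrable (lborel \<Otimes>\<^sub>M lborel) (\<lambda>(x, y). cis (- (y \<bullet> x)) * f y * g x)"
    by (rule Bochner_Integration.integrable_bound[OF integrable_product[OF g f]]) (auto simp: norm_mult)
  have "(\<integral>x. fourier f x * g x \<partial>lborel) = (\<integral>x. \<integral>y. cis (- (y \<bullet> x)) * f y * g x \<partial>lborel \<partial>lborel)"
    by (simp add: fourier_def)
  also have "\<dots> = (\<integral>y. \<integral>x. cis (- (y \<bullet> x)) * f y * g x \<partial>lborel \<partial>lborel)"
    using lborel_pair.Fubini_integral[OF i] by simp
  also have "\<dots> = (\<integral>y. f y * fourier g y \<partial>lborel)"
    by (simp add: fourier_def mult.assoc mult.left_commute[of "cis _" "f _"] inner_commute)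
  finally show ?thesis .
qed

lemma heat_symmetric: "heat c (x - y) = heat c (y - x)"
  by (simp add: heat_def norm_minus_commute)

text \<open>Schur's test for a symmetric kernel of mass one: |f x| |f y| is at most half of |f x|^2
  + |f y|^2, and each half is integrated in the other variable first. The bound does not depend on
  \<open>c\<close>.\<close>

lemma heat_form_bound:
  fixes f :: "real^'n \<Rightarrow> complex"
  assumes f: "f \<in> L2" and c: "c > 0"
  shows "cmod (\<integral>x. f x * cnj (\<integral>y. f y * of_real (heat c (y - x)) \<partial>lborel) \<partial>lborel) \<le> (\<integral>x. (cmod (f x))\<^sup>2 \<partial>lborel)"
proof -
  note [measurable] = L2D(1)[OF f]
  let ?I = "\<integral>x. (cmod (f x))\<^sup>2 \<partial>lborel"
  have h1: "(\<integral>\<^sup>+y. ennreal (heat c (y - x)) \<partial>lborel) = 1" for x :: "real^'n"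
  proof -
    have "(\<integral>\<^sup>+y. ennreal (heat c (y - x)) \<partial>lborel) = (\<integral>\<^sup>+y. ennreal (heat c (y::real^'n)) \<partial>lborel)"
      using lborel_nn_integral_shift[of "\<lambda>y. ennreal (heat c y)" "- x"] by simp
    also have "\<dots> = ennreal (\<integral>y. heat c (y::real^'n) \<partial>lborel)"
      by (intro nn_integral_eq_integral integrable_heat c) (simp add: heat_nonneg c)
    finally show ?thesis by (simp add: integral_heat[OF c])
  qed
  have "ennreal (cmod (\<integral>x. f x * cnj (\<integral>y. f y * of_real (heat c (y - x)) \<partial>lborel) \<partial>lborel))
     \<le> (\<integral>\<^sup>+x. ennreal (cmod (f x * cnj (\<integral>y. f y * of_real (heat c (y - x)) \<partial>lborel))) \<partial>lborel)"
    by (rule norm_integral_le_nn_integral) 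
  also have "\<dots> \<le> (\<integral>\<^sup>+x. \<integral>\<^sup>+y. ennreal (cmod (f x) * cmod (f y) * heat c (y - x)) \<partial>lborel \<partial>lborel)"
  proof (rule nn_integral_mono)
    fix x
    have "ennreal (cmod (f x * cnj (\<integral>y. f y * of_real (heat c (y - x)) \<partial>lborel)))
       = ennreal (cmod (f x)) * ennreal (cmod (\<integral>y. f y * of_real (heat c (y - x)) \<partial>lborel))"
      by (simp add: norm_mult ennreal_mult)
    also have "\<dots> \<le> ennreal (cmod (f x)) * (\<integral>\<^sup>+y. ennreal (cmod (f y * of_real (heat c (y - x)))) \<partial>lborel)"
      by (intro mult_left_mono norm_integral_le_nn_integral) auto
    also have "\<dots> = (\<integral>\<^sup>+y. ennreal (cmod (f x) * cmod (f y) * heat c (y - x)) \<partial>lborel)"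
    proof (subst nn_integral_cmult[symmetric])
      show "(\<integral>\<^sup>+y. ennreal (cmod (f x)) * ennreal (cmod (f y * of_real (heat c (y - x)))) \<partial>lborel)
         = (\<integral>\<^sup>+y. ennreal (cmod (f x) * cmod (f y) * heat c (y - x)) \<partial>lborel)"
        by (intro nn_integral_cong, subst ennreal_mult[symmetric])
          (auto simp: norm_mult mult.assoc abs_of_nonneg[OF heat_nonneg[OF c]] intro!: mult_nonneg_nonneg heat_nonneg[OF c])
    qed measurable
    finally show "ennreal (cmod (f x * cnj (\<integral>y. f y * of_real (heat c (y - x)) \<partial>lborel)))
       \<le> (\<integral>\<^sup>+y. ennreal (cmod (f x) * cmod (f y) * heat c (y - x)) \<partial>lborel)" .
  qed
  also have "\<dots> \<le> (\<integral>\<^sup>+x. \<integral>\<^sup>+y. ennreal ((1/2) * (cmod (f x))\<^sup>2) * ennreal (heat c (y - x))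
      + ennreal ((1/2) * (cmod (f y))\<^sup>2) * ennreal (heat c (x - y)) \<partial>lborel \<partial>lborel)"
  proof (intro nn_integral_mono)
    fix x y
    have "cmod (f x) * cmod (f y) \<le> (1/2) * (cmod (f x))\<^sup>2 + (1/2) * (cmod (f y))\<^sup>2"
      using sum_squares_bound[of "cmod (f x)" "cmod (f y)"] by simp
    then have "cmod (f x) * cmod (f y) * heat c (y - x) \<le> ((1/2) * (cmod (f x))\<^sup>2 + (1/2) * (cmod (f y))\<^sup>2) * heat c (y - x)"
      by (intro mult_right_mono heat_nonneg c)
    then show "ennreal (cmod (f x) * cmod (f y) * heat c (y - x)) \<le> ennreal ((1/2) * (cmod (f x))\<^sup>2) * ennreal (heat c (y - x))
      + ennreal ((1/2) * (cmod (f y))\<^sup>2) * ennreal (heat c (x - y))"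
      using heat_nonneg[OF c, of "y - x"] heat_symmetric[of c x y]
      by (simp add: ennreal_mult[symmetric] ennreal_plus[symmetric] distrib_right del: ennreal_plus)
  qed
  also have "\<dots> = (\<integral>\<^sup>+x. \<integral>\<^sup>+y. ennreal ((1/2) * (cmod (f x))\<^sup>2) * ennreal (heat c (y - x)) \<partial>lborel \<partial>lborel)
     + (\<integral>\<^sup>+x. \<integral>\<^sup>+y. ennreal ((1/2) * (cmod (f y))\<^sup>2) * ennreal (heat c (x - y)) \<partial>lborel \<partial>lborel)"
    by (subst nn_integral_add[symmetric]) (auto simp: nn_integral_add)
  also have "(\<integral>\<^sup>+x. \<integral>\<^sup>+y. ennreal ((1/2) * (cmod (f y))\<^sup>2) * ennreal (heat c (x - y)) \<partial>lborel \<partial>lborel)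
     = (\<integral>\<^sup>+y. \<integral>\<^sup>+x. ennreal ((1/2) * (cmod (f y))\<^sup>2) * ennreal (heat c (x - y)) \<partial>lborel \<partial>lborel)"
    by (rule lborel_pair.Fubini') measurable
  also have "(\<integral>\<^sup>+x. \<integral>\<^sup>+y. ennreal ((1/2) * (cmod (f x))\<^sup>2) * ennreal (heat c (y - x)) \<partial>lborel \<partial>lborel)
     = (\<integral>\<^sup>+x. ennreal ((1/2) * (cmod (f x))\<^sup>2) \<partial>lborel)"
    by (subst nn_integral_cmult) (auto simp: h1)
  also have "(\<integral>\<^sup>+x. ennreal ((1/2) * (cmod (f x))\<^sup>2) \<partial>lborel) + (\<integral>\<^sup>+x. ennreal ((1/2) * (cmod (f x))\<^sup>2) \<partial>lborel)
     = ennreal ?I"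
    proof -
      have "(\<integral>\<^sup>+x. ennreal ((1/2) * (cmod (f x))\<^sup>2) \<partial>lborel) = ennreal ((1/2) * ?I)"
        using L2D(2)[OF f] by (subst nn_integral_eq_integral) auto
      then show ?thesis by (simp add: ennreal_plus[symmetric] del: ennreal_plus)
    qed
  finally show ?thesis by simp
qed

text \<open>With a Gaussian factor inserted, the integral of |fourier f|^2 equals (2 pi)^n times the
  heat form of f, which is bounded uniformly in the width of the Gaussian; Fatou's lemma removes the
  factor.\<close>

lemma Plancherel_inequality:
  fixes f :: "real^'n \<Rightarrow> complex"
  assumes f: "f \<in> L2" and fi: "integrable lborel f"
  shows "fourier f \<in> L2"
    and "(\<integral>x. (cmod (fourier f x))\<^sup>2 \<partial>lborel) \<le> (2 * pi) ^ CARD('n) * (\<integral>x. (cmod (f x))\<^sup>2 \<partial>lborel)"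
proof -
  note [measurable] = L2D(1)[OF f]
  note Fm [measurable] = fourier_measurable[OF L2D(1)[OF f]]
  let ?I = "\<integral>x. (cmod (f x))\<^sup>2 \<partial>lborel" and ?P = "(2 * pi) ^ CARD('n)"
  define B where "B = (\<integral>x. cmod (f x) \<partial>lborel)"
  have FB: "cmod (fourier f \<xi>) \<le> B" for \<xi> unfolding B_def by (rule fourier_bound)
  have reg: "(\<integral>\<^sup>+\<xi>. ennreal (exp (- (c / 2) * (norm \<xi>)\<^sup>2) * (cmod (fourier f \<xi>))\<^sup>2) \<partial>lborel) \<le> ennreal (?P * ?I)"
    if c: "c > 0" for c
  proof -
    define e where "e \<xi> = exp (- (c / 2) * (norm \<xi>)\<^sup>2)" for \<xi> :: "real^'n"
    have [measurable]: "e \<in> borel_measurable borel" unfolding e_def by measurable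
    have e_int: "integrable lborel e" unfolding e_def using integrable_gaussian[OF c, of 0] by simp
    have e0: "e \<xi> \<ge> 0" for \<xi> by (simp add: e_def)
    \<comment> \<open>Chosen so that \<open>fourier f \<xi> * g \<xi>\<close> is the regularised
      |fourier f|^2, while the transform of \<open>g\<close> is the conjugate of a heat average of
      f.\<close>
    define g where "g \<xi> = of_real (e \<xi>) * cnj (fourier f \<xi>)" for \<xi>
    have B0: "B \<ge> 0" unfolding B_def by simp
    have g_int: "integrable lborel g" unfolding g_def
      by (rule Bochner_Integration.integrable_bound[OF integrable_mult_left[OF e_int, of B]])
        (use B0 in \<open>auto simp: norm_mult e0 intro!: mult_left_mono FB\<close>)
    have sq_int: "integrable lborel (\<lambda>\<xi>. e \<xi> * (cmod (fourier f \<xi>))\<^sup>2)"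
      by (rule Bochner_Integration.integrable_bound[OF integrable_mult_left[OF e_int, of "B\<^sup>2"]])
        (use FB in \<open>auto simp: abs_mult e0 intro!: mult_left_mono power_mono\<close>)
    have Fg: "fourier g x = of_real ?P * cnj (\<integral>y. f y * of_real (heat c (y - x)) \<partial>lborel)" for x
    proof -
      have "cnj (fourier g x) = (\<integral>\<xi>. cnj (cis (- (\<xi> \<bullet> x)) * g \<xi>) \<partial>lborel)"
        unfolding fourier_def
        by (rule integral_bounded_linear'[OF bounded_linear_cnj bounded_linear_cnj, symmetric]) simp
      also have "\<dots> = (\<integral>\<xi>. fourier f \<xi> * gauss_wave c 0 (- x) \<xi> \<partial>lborel)"
        by (simp add: g_def e_def gauss_wave_def mult_ac cis_cnj)
      also have "\<dots> = (\<integral>y. f y * fourier (gauss_wave c 0 (- x)) y \<partial>lborel)"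
        by (rule fourier_multiplication_formula[OF fi integrable_gauss_wave[OF c]])
      also have "\<dots> = (\<integral>y. f y * (of_real ?P * of_real (heat c (y - x))) \<partial>lborel)"
      proof (rule Bochner_Integration.integral_cong[OF refl], rule arg_cong[where f="\<lambda>z. f _ * z"])
        fix y
        have "of_real (heat c (y - x)) = of_real (1 / ?P) * fourier (gauss_wave c 0 (- x)) y"
          using inv_fourier_gauss_wave[OF c, of "x" y] inv_fourier_eq_fourier[of "gauss_wave c 0 x" y]
          by (simp add: fourier_gauss_wave[OF c] norm_minus_commute)
        then show "fourier (gauss_wave c 0 (- x)) y = of_real ?P * of_real (heat c (y - x))" by simp
      qed
      also have "(\<integral>y. f y * (of_real ?P * of_real (heat c (y - x))) \<partial>lborel) = of_real ?P * (\<integral>y. f y * of_real (heat c (y - x)) \<partial>lborel)"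
        unfolding mult.left_commute[of "f _" "of_real ?P"] by (rule integral_mult_right_zero)
      finally have "cnj (cnj (fourier g x)) = cnj (of_real ?P * (\<integral>y. f y * of_real (heat c (y - x)) \<partial>lborel))" by simp
      then show ?thesis by simp
    qed
    have "complex_of_real (\<integral>\<xi>. e \<xi> * (cmod (fourier f \<xi>))\<^sup>2 \<partial>lborel) = (\<integral>\<xi>. fourier f \<xi> * g \<xi> \<partial>lborel)"
    proof -
      have "fourier f \<xi> * g \<xi> = of_real (e \<xi> * (cmod (fourier f \<xi>))\<^sup>2)" for \<xi>
        unfolding g_def of_real_mult complex_norm_square by (simp only: mult_ac)
      then show ?thesis by (simp only: integral_complex_of_real)
    qed
    also have "\<dots> = (\<integral>x. f x * fourier g x \<partial>lborel)"
      by (rule fourier_multiplication_formula[OF fi g_int])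
    also have "\<dots> = of_real ?P * (\<integral>x. f x * cnj (\<integral>y. f y * of_real (heat c (y - x)) \<partial>lborel) \<partial>lborel)"
      unfolding Fg mult.left_commute[of "f _" "of_real ?P"] by (rule integral_mult_right_zero)
    finally have "cmod (complex_of_real (\<integral>\<xi>. e \<xi> * (cmod (fourier f \<xi>))\<^sup>2 \<partial>lborel))
      = cmod (of_real ?P) * cmod (\<integral>x. f x * cnj (\<integral>y. f y * of_real (heat c (y - x)) \<partial>lborel) \<partial>lborel)"
      by (simp only: norm_mult)
    also have "\<dots> \<le> ?P * ?I" unfolding norm_of_real using heat_form_bound[OF f c] by (intro mult_mono) auto
    finally have "(\<integral>\<xi>. e \<xi> * (cmod (fourier f \<xi>))\<^sup>2 \<partial>lborel) \<le> ?P * ?I" by simp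
    then have "(\<integral>\<^sup>+\<xi>. ennreal (e \<xi> * (cmod (fourier f \<xi>))\<^sup>2) \<partial>lborel) \<le> ennreal (?P * ?I)"
      by (subst nn_integral_eq_integral[OF sq_int]) (auto simp: e0 intro: ennreal_leI)
    then show ?thesis by (simp add: e_def)
  qed
  \<comment> \<open>The regularised integrands converge pointwise along c = 1 / (k + 1), so the
    integral of the limit is at most the common bound.\<close>
  have "(\<integral>\<^sup>+\<xi>. ennreal ((cmod (fourier f \<xi>))\<^sup>2) \<partial>lborel) =
     (\<integral>\<^sup>+\<xi>. liminf (\<lambda>k. ennreal (exp (- (inverse (real (Suc k)) / 2) * (norm \<xi>)\<^sup>2) * (cmod (fourier f \<xi>))\<^sup>2)) \<partial>lborel)"
  proof (rule nn_integral_cong)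
    fix \<xi> :: "real^'n"
    have "(\<lambda>k. ennreal (exp (- (inverse (real (Suc k)) / 2) * (norm \<xi>)\<^sup>2) * (cmod (fourier f \<xi>))\<^sup>2))
      \<longlonglongrightarrow> ennreal (exp (- (0 / 2) * (norm \<xi>)\<^sup>2) * (cmod (fourier f \<xi>))\<^sup>2)"
      by (intro tendsto_intros LIMSEQ_inverse_real_of_nat) auto
    from lim_imp_Liminf[OF sequentially_bot this] show "ennreal ((cmod (fourier f \<xi>))\<^sup>2) = liminf (\<lambda>k. ennreal (exp (- (inverse (real (Suc k)) / 2) * (norm \<xi>)\<^sup>2) * (cmod (fourier f \<xi>))\<^sup>2))"
      by (simp add: lim_imp_Liminf)
  qed
  also have "\<dots> \<le> liminf (\<lambda>k. \<integral>\<^sup>+\<xi>. ennreal (exp (- (inverse (real (Suc k)) / 2) * (norm \<xi>)\<^sup>2) * (cmod (fourier f \<xi>))\<^sup>2) \<partial>lborel)"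
    by (intro nn_integral_liminf) measurable
  also have "\<dots> \<le> ennreal (?P * ?I)"
    by (intro Liminf_le always_eventually allI reg) auto
  finally have le: "(\<integral>\<^sup>+\<xi>. ennreal ((cmod (fourier f \<xi>))\<^sup>2) \<partial>lborel) \<le> ennreal (?P * ?I)" .
  show "fourier f \<in> L2" by (rule L2I(1)[OF Fm le])
  show "(\<integral>x. (cmod (fourier f x))\<^sup>2 \<partial>lborel) \<le> ?P * ?I"
    by (rule L2I(2)[OF Fm le]) simp
qed

section \<open>Gaussian Schwartz functions\<close>

lemma schwartz_differentiable: "\<phi> \<in> schwartz \<Longrightarrow> \<phi> differentiable (at x)"
  unfolding schwartz_def by (auto dest: spec[of _ "[]"])

lemma schwartz_measurable: "\<phi> \<in> schwartz \<Longrightarrow> \<phi> \<in> borel_measurable borel"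
  by (intro borel_measurable_continuous_onI continuous_at_imp_continuous_on ballI
      differentiable_imp_continuous_within schwartz_differentiable)

lemma schwartz_decay:
  assumes "\<phi> \<in> schwartz"
  shows "\<exists>C\<ge>0. \<forall>x. cmod (\<phi> x) \<le> C * (1 + norm x) powr (- real N)"
proof -
  have "bounded (range (\<lambda>x. (1 + norm x) ^ N *\<^sub>R \<phi> x))"
    using assms unfolding schwartz_def by (auto dest: spec[of _ "[]"])
  then obtain C where C: "\<And>x. norm ((1 + norm x) ^ N *\<^sub>R \<phi> x) \<le> C" by (auto simp: bounded_iff)
  have "cmod (\<phi> x) \<le> C * (1 + norm x) powr (- real N)" for x
  proof -
    have pos: "1 + norm x > 0" by (simp add: add_pos_nonneg)
    have "(1 + norm x) ^ N * cmod (\<phi> x) \<le> C" using C[of x] pos by simp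
    then have "cmod (\<phi> x) \<le> C / (1 + norm x) ^ N" using pos by (simp add: pos_le_divide_eq mult.commute)
    also have "\<dots> = C * (1 + norm x) powr (- real N)"
      unfolding powr_minus powr_realpow[OF pos] by (rule divide_inverse)
    finally show ?thesis .
  qed
  moreover have "C \<ge> 0" using C[of 0] norm_ge_zero order_trans by blast
  ultimately show ?thesis by blast
qed

lemma schwartz_integrable:
  fixes \<phi> :: "real^'n \<Rightarrow> complex"
  assumes "\<phi> \<in> schwartz"
  shows "integrable lborel \<phi>"
proof -
  obtain C where C: "C \<ge> 0" "\<And>x. cmod (\<phi> x) \<le> C * (1 + norm x) powr (- real (2 * CARD('n)))"
    using schwartz_decay[OF assms] by blast
  show ?thesis
  proof (rule Bochner_Integration.integrable_bound)
    show "integrable lborel (\<lambda>x::real^'n. C * (1 + norm x) powr (- real (2 * CARD('n))))"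
      by (intro integrable_mult_right integrable_decay) simp
    show "AE x in lborel. norm (\<phi> x) \<le> norm (C * (1 + norm x) powr (- real (2 * CARD('n))))"
      using C by (intro AE_I2) (simp add: abs_mult)
  qed (simp add: schwartz_measurable[OF assms])
qed

lemma schwartz_L2:
  assumes "\<phi> \<in> schwartz"
  shows "\<phi> \<in> L2"
proof -
  obtain C where C: "C \<ge> 0" "\<And>x. cmod (\<phi> x) \<le> C * (1 + norm x) powr (- real 0)"
    using schwartz_decay[OF assms] by blast
  have pos: "1 + norm x > 0" for x :: "real^'a" by (simp add: add_pos_nonneg)
  have le: "cmod (\<phi> x) \<le> C" for x using C(2)[of x] pos[of x] by simp
  note [measurable] = schwartz_measurable[OF assms]
  have "integrable lborel (\<lambda>x. (cmod (\<phi> x))\<^sup>2)"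
  proof (rule Bochner_Integration.integrable_bound)
    show "integrable lborel (\<lambda>x. C * cmod (\<phi> x))" using schwartz_integrable[OF assms] by auto
    show "AE x in lborel. norm ((cmod (\<phi> x))\<^sup>2) \<le> norm (C * cmod (\<phi> x))"
      using C le by (intro AE_I2) (simp add: abs_mult power2_eq_square mult_right_mono)
  qed measurable
  then show ?thesis by (simp add: L2_def)
qed

section \<open>Polynomials times Gaussians\<close>

inductive cpoly :: "(real^'n \<Rightarrow> complex) \<Rightarrow> bool" where
  const: "cpoly (\<lambda>_. c)"
| coord: "cpoly (\<lambda>x. complex_of_real (x $ i))"
| add: "cpoly p \<Longrightarrow> cpoly q \<Longrightarrow> cpoly (\<lambda>x. p x + q x)"
| mult: "cpoly p \<Longrightarrow> cpoly q \<Longrightarrow> cpoly (\<lambda>x. p x * q x)"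

lemma cpoly_has_derivative:
  "cpoly p \<Longrightarrow> \<exists>p'. (\<forall>x. (p has_derivative p' x) (at x)) \<and> (\<forall>i. cpoly (\<lambda>x. p' x (axis i 1)))"
proof (induction rule: cpoly.induct)
  case (const c)
  show ?case by (intro exI[of _ "\<lambda>_ _. 0"]) (auto intro: cpoly.const)
next
  case (coord i)
  have "((\<lambda>x. complex_of_real (x $ i)) has_derivative (\<lambda>h. complex_of_real (h $ i))) (at x)" for x :: "real^'a"
    by (intro has_derivative_of_real bounded_linear.has_derivative[OF bounded_linear_vec_nth] has_derivative_ident)
  then show ?case by (intro exI[of _ "\<lambda>_ h. complex_of_real (h $ i)"]) (auto intro: cpoly.const)
next
  case (add p q)
  then obtain p' q' where *: "\<And>x. (p has_derivative p' x) (at x)" "\<And>i. cpoly (\<lambda>x. p' x (axis i 1))"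
    "\<And>x. (q has_derivative q' x) (at x)" "\<And>i. cpoly (\<lambda>x. q' x (axis i 1))" by blast
  show ?case
    by (intro exI[of _ "\<lambda>x h. p' x h + q' x h"] conjI allI has_derivative_add * cpoly.add)
next
  case (mult p q)
  then obtain p' q' where *: "\<And>x. (p has_derivative p' x) (at x)" "\<And>i. cpoly (\<lambda>x. p' x (axis i 1))"
    "\<And>x. (q has_derivative q' x) (at x)" "\<And>i. cpoly (\<lambda>x. q' x (axis i 1))" by blast
  show ?case
    by (intro exI[of _ "\<lambda>x h. p x * q' x h + p' x h * q x"] conjI allI has_derivative_mult * cpoly.add cpoly.mult mult)
qed

lemma cpoly_bound: "cpoly p \<Longrightarrow> \<exists>C N. C \<ge> 0 \<and> (\<forall>x. cmod (p x) \<le> C * (1 + norm x) ^ N)"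
proof (induction rule: cpoly.induct)
  case (const c)
  show ?case by (intro exI[of _ "cmod c"] exI[of _ 0]) auto
next
  case (coord i)
  have "\<bar>x $ i\<bar> \<le> 1 * (1 + norm x) ^ 1" for x :: "real^'a" using component_le_norm_cart[of x i] by simp
  then show ?case by (intro exI[of _ 1] exI[of _ 1]) auto
next
  case (add p q)
  then obtain C N D M where *: "C \<ge> 0" "\<And>x. cmod (p x) \<le> C * (1 + norm x) ^ N"
    "D \<ge> 0" "\<And>x. cmod (q x) \<le> D * (1 + norm x) ^ M" by blast
  have "cmod (p x + q x) \<le> (C + D) * (1 + norm x) ^ max N M" for x
  proof -
    have "cmod (p x + q x) \<le> C * (1 + norm x) ^ N + D * (1 + norm x) ^ M"
      using *(2)[of x] *(4)[of x] norm_triangle_ineq[of "p x" "q x"] by linarith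
    also have "\<dots> \<le> C * (1 + norm x) ^ max N M + D * (1 + norm x) ^ max N M"
      using * by (intro add_mono mult_left_mono power_increasing) auto
    finally show ?thesis by (simp add: distrib_right)
  qed
  then show ?case using * by (intro exI[of _ "C + D"] exI[of _ "max N M"]) auto
next
  case (mult p q)
  then obtain C N D M where *: "C \<ge> 0" "\<And>x. cmod (p x) \<le> C * (1 + norm x) ^ N"
    "D \<ge> 0" "\<And>x. cmod (q x) \<le> D * (1 + norm x) ^ M" by blast
  have "cmod (p x * q x) \<le> C * D * (1 + norm x) ^ (N + M)" for x
  proof -
    have "cmod (p x * q x) \<le> (C * (1 + norm x) ^ N) * (D * (1 + norm x) ^ M)"
      unfolding norm_mult using * by (intro mult_mono) auto
    then show ?thesis by (simp add: power_add mult_ac)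
  qed
  then show ?case using * by (intro exI[of _ "C * D"] exI[of _ "N + M"]) auto
qed

text \<open>The features of a Gaussian that make its polynomial multiples Schwartz: each partial
  derivative is a polynomial times the function itself, and it decays like a Gaussian. The class is
  closed under products, as required when a damped function is tested against a heat kernel.\<close>

definition exptype :: "(real^'n \<Rightarrow> complex) \<Rightarrow> bool" where
  "exptype e \<longleftrightarrow> (\<exists>e'. (\<forall>x. (e has_derivative e' x) (at x)) \<and>
      (\<forall>i. \<exists>l. cpoly l \<and> (\<forall>x. e' x (axis i 1) = l x * e x))) \<and>
    (\<exists>K c. c > 0 \<and> K \<ge> 0 \<and> (\<forall>x. cmod (e x) \<le> K * exp (- c * (norm x)\<^sup>2)))"

lemma partial_cpoly_exptype:
  assumes p: "cpoly p" and e: "exptype e"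
  shows "(\<lambda>x. p x * e x) differentiable (at x)"
    and "\<exists>q. cpoly q \<and> partial i (\<lambda>x. p x * e x) = (\<lambda>x. q x * e x)"
proof -
  obtain p' where p': "\<And>x. (p has_derivative p' x) (at x)" "\<And>i. cpoly (\<lambda>x. p' x (axis i 1))"
    using cpoly_has_derivative[OF p] by blast
  obtain e' l where e': "\<And>x. (e has_derivative e' x) (at x)" and l: "cpoly l" "\<And>x. e' x (axis i 1) = l x * e x"
    using e unfolding exptype_def by blast
  have d: "((\<lambda>x. p x * e x) has_derivative (\<lambda>h. p x * e' x h + p' x h * e x)) (at x)" for x
    by (intro has_derivative_mult p' e')
  then show "(\<lambda>x. p x * e x) differentiable (at x)" by (auto simp: differentiable_def)
  have "partial i (\<lambda>x. p x * e x) = (\<lambda>x. (p x * l x + p' x (axis i 1)) * e x)"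
    unfolding partial_def frechet_derivative_at[OF d, symmetric] by (simp add: l algebra_simps)
  then show "\<exists>q. cpoly q \<and> partial i (\<lambda>x. p x * e x) = (\<lambda>x. q x * e x)"
    by (intro exI[of _ "\<lambda>x. p x * l x + p' x (axis i 1)"]) (auto intro!: cpoly.add cpoly.mult p l p')
qed

lemma cpoly_exptype_schwartz:
  assumes p: "cpoly p" and e: "exptype e"
  shows "(\<lambda>x. p x * e x) \<in> schwartz"
proof -
  \<comment> \<open>Iterated partial derivatives never leave the form polynomial times
    \<open>e\<close>, so a single decay estimate serves all of them.\<close>
  have iter: "\<exists>q. cpoly q \<and> foldr partial \<alpha> (\<lambda>x. p x * e x) = (\<lambda>x. q x * e x)" for \<alpha>
  proof (induction \<alpha>)
    case Nil then show ?case using p by auto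
  next
    case (Cons i \<alpha>)
    then obtain q where "cpoly q" "foldr partial \<alpha> (\<lambda>x. p x * e x) = (\<lambda>x. q x * e x)" by blast
    then show ?case using partial_cpoly_exptype(2)[OF _ e] by auto
  qed
  have bdd: "bounded (range (\<lambda>x. (1 + norm x) ^ N *\<^sub>R (q x * e x)))" if q: "cpoly q" for q N
  proof -
    obtain C M where C: "C \<ge> 0" "\<And>x. cmod (q x) \<le> C * (1 + norm x) ^ M" using cpoly_bound[OF q] by blast
    obtain K c where K: "c > 0" "K \<ge> 0" "\<And>x. cmod (e x) \<le> K * exp (- c * (norm x)\<^sup>2)" using e by (auto simp: exptype_def)
    obtain D where D: "D \<ge> 0" "\<And>t. t \<ge> 0 \<Longrightarrow> (1 + t) ^ (N + M) * exp (- c * t\<^sup>2) \<le> D"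
      using gaussian_moment_bound[OF K(1)] by blast
    have "norm ((1 + norm x) ^ N *\<^sub>R (q x * e x)) \<le> C * K * D" for x
    proof -
      have "norm ((1 + norm x) ^ N *\<^sub>R (q x * e x)) = (1 + norm x) ^ N * (cmod (q x) * cmod (e x))"
        by (simp add: norm_mult add_nonneg_nonneg)
      also have "\<dots> \<le> (1 + norm x) ^ N * ((C * (1 + norm x) ^ M) * (K * exp (- c * (norm x)\<^sup>2)))"
        using C K by (intro mult_left_mono mult_mono) auto
      also have "\<dots> = C * K * ((1 + norm x) ^ (N + M) * exp (- c * (norm x)\<^sup>2))"
        by (simp only: power_add mult_ac)
      also have "\<dots> \<le> C * K * D" using D(2)[of "norm x"] C K by (intro mult_left_mono) auto
      finally show ?thesis .
    qed
    then show ?thesis by (auto simp: bounded_iff)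
  qed
  show ?thesis unfolding schwartz_def
  proof (intro CollectI allI conjI)
    fix \<alpha> x
    obtain q where q: "cpoly q" "foldr partial \<alpha> (\<lambda>x. p x * e x) = (\<lambda>x. q x * e x)" using iter by blast
    show "foldr partial \<alpha> (\<lambda>x. p x * e x) differentiable at x"
      unfolding q by (rule partial_cpoly_exptype(1)[OF q(1) e])
    show "bounded (range (\<lambda>x. (1 + norm x) ^ N *\<^sub>R foldr partial \<alpha> (\<lambda>x. p x * e x) x))" for N
      unfolding q by (rule bdd[OF q(1)])
  qed
qed

lemma exptype_mult:
  assumes "exptype e" "exptype f"
  shows "exptype (\<lambda>x. e x * f x)"
proof -
  obtain e' where e': "\<And>x. (e has_derivative e' x) (at x)" "\<And>i. \<exists>l. cpoly l \<and> (\<forall>x. e' x (axis i 1) = l x * e x)"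
    using assms(1) unfolding exptype_def by blast
  obtain f' where f': "\<And>x. (f has_derivative f' x) (at x)" "\<And>i. \<exists>l. cpoly l \<and> (\<forall>x. f' x (axis i 1) = l x * f x)"
    using assms(2) unfolding exptype_def by blast
  obtain K c where K: "c > 0" "K \<ge> 0" "\<And>x. cmod (e x) \<le> K * exp (- c * (norm x)\<^sup>2)" using assms(1) by (auto simp: exptype_def)
  obtain L d where L: "d > 0" "L \<ge> 0" "\<And>x. cmod (f x) \<le> L * exp (- d * (norm x)\<^sup>2)" using assms(2) by (auto simp: exptype_def)
  have "\<exists>l. cpoly l \<and> (\<forall>x. e x * f' x (axis i 1) + e' x (axis i 1) * f x = l x * (e x * f x))" for i
  proof -
    obtain l m where "cpoly l" "\<forall>x. e' x (axis i 1) = l x * e x" "cpoly m" "\<forall>x. f' x (axis i 1) = m x * f x"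
      using e' f' by meson
    then show ?thesis by (intro exI[of _ "\<lambda>x. m x + l x"]) (auto intro: cpoly.add simp: algebra_simps)
  qed
  moreover have "cmod (e x * f x) \<le> (K * L) * exp (- (c + d) * (norm x)\<^sup>2)" for x
  proof -
    have "cmod (e x * f x) \<le> (K * exp (- c * (norm x)\<^sup>2)) * (L * exp (- d * (norm x)\<^sup>2))"
      unfolding norm_mult using K L by (intro mult_mono) auto
    also have "\<dots> = (K * L) * (exp (- c * (norm x)\<^sup>2) * exp (- d * (norm x)\<^sup>2))" by (simp only: mult_ac)
    also have "exp (- c * (norm x)\<^sup>2) * exp (- d * (norm x)\<^sup>2) = exp (- (c + d) * (norm x)\<^sup>2)"
      by (simp add: exp_add[symmetric] algebra_simps)
    finally show ?thesis .
  qed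
  ultimately show ?thesis unfolding exptype_def
    by (intro conjI exI[of _ "\<lambda>x h. e x * f' x h + e' x h * f x"] exI[of _ "K * L"] exI[of _ "c + d"] allI
        has_derivative_mult e' f') (use K L in auto)
qed

lemma gauss_wave_has_derivative:
  "(gauss_wave c b \<xi> has_derivative
     (\<lambda>h. (of_real (- c * ((x - b) \<bullet> h)) - \<i> * of_real (h \<bullet> \<xi>)) * gauss_wave c b \<xi> x)) (at x)"
proof -
  have "gauss_wave c b \<xi> = (\<lambda>x. exp (of_real (- (c / 2) * ((x - b) \<bullet> (x - b))) + \<i> * of_real (- (x \<bullet> \<xi>))))"
    by (intro ext) (simp only: gauss_wave_def exp_add cis_conv_exp exp_of_real power2_norm_eq_inner)
  moreover have "((\<lambda>x. exp (complex_of_real (- (c / 2) * ((x - b) \<bullet> (x - b))) + \<i> * of_real (- (x \<bullet> \<xi>)))) has_derivative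
     (\<lambda>h. exp (of_real (- (c / 2) * ((x - b) \<bullet> (x - b))) + \<i> * of_real (- (x \<bullet> \<xi>))) *
        (of_real (- c * ((x - b) \<bullet> h)) - \<i> * of_real (h \<bullet> \<xi>)))) (at x)"
  proof -
    have "((\<lambda>x. - (c / 2) * ((x - b) \<bullet> (x - b))) has_derivative (\<lambda>h. - c * ((x - b) \<bullet> h))) (at x)"
      by (auto intro!: derivative_eq_intros simp: inner_commute)
    moreover have "((\<lambda>x. - (x \<bullet> \<xi>)) has_derivative (\<lambda>h. - (h \<bullet> \<xi>))) (at x)"
      by (auto intro!: derivative_eq_intros)
    ultimately have "((\<lambda>x. complex_of_real (- (c / 2) * ((x - b) \<bullet> (x - b))) + \<i> * of_real (- (x \<bullet> \<xi>))) has_derivative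
       (\<lambda>h. of_real (- c * ((x - b) \<bullet> h)) + \<i> * of_real (- (h \<bullet> \<xi>)))) (at x)"
      by (intro has_derivative_add has_derivative_mult_right has_derivative_of_real)
    then have d1: "((\<lambda>x. complex_of_real (- (c / 2) * ((x - b) \<bullet> (x - b))) + \<i> * of_real (- (x \<bullet> \<xi>))) has_derivative
       (\<lambda>h. of_real (- c * ((x - b) \<bullet> h)) - \<i> * of_real (h \<bullet> \<xi>))) (at x)"
      by simp
    have d2: "(exp has_derivative (\<lambda>z. exp (complex_of_real (- (c / 2) * ((x - b) \<bullet> (x - b))) + \<i> * of_real (- (x \<bullet> \<xi>))) * z))
       (at (complex_of_real (- (c / 2) * ((x - b) \<bullet> (x - b))) + \<i> * of_real (- (x \<bullet> \<xi>))))"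
      using DERIV_exp unfolding has_field_derivative_def .
    show ?thesis using has_derivative_compose[OF d1 d2] .
  qed
  ultimately show ?thesis by (simp only: mult.commute)
qed

lemma cpoly_inner: "cpoly (\<lambda>x. complex_of_real ((x - b) $ i))"
proof -
  have "cpoly (\<lambda>x. complex_of_real (x $ i) + - complex_of_real (b $ i))" by (intro cpoly.intros)
  then show ?thesis by simp
qed

lemma exptype_gauss_wave:
  fixes b \<xi> :: "real^'n"
  assumes c: "c > 0"
  shows "exptype (gauss_wave c b \<xi>)"
proof -
  have "\<exists>l. cpoly l \<and> (\<forall>x. (complex_of_real (- c * ((x - b) \<bullet> axis i 1)) - \<i> * of_real (axis i 1 \<bullet> \<xi>)) * gauss_wave c b \<xi> x
       = l x * gauss_wave c b \<xi> x)" for i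
    by (intro exI[of _ "\<lambda>x. (- of_real c) * complex_of_real ((x - b) $ i) + (- \<i> * of_real (\<xi> $ i))"] conjI)
      (intro cpoly.add cpoly.mult cpoly_inner cpoly.const, simp add: inner_axis inner_axis')
  \<comment> \<open>Decay is required about the origin rather than about \<open>b\<close>; |x|^2 <=
    2 |x - b|^2 + 2 |b|^2 moves the centre at the price of half the exponent.\<close>
  moreover have "cmod (gauss_wave c b \<xi> x) \<le> exp (c / 2 * (norm b)\<^sup>2) * exp (- (c / 4) * (norm x)\<^sup>2)" for x
  proof -
    have "(norm x)\<^sup>2 \<le> (norm (x - b) + norm b)\<^sup>2"
      using norm_triangle_ineq[of "x - b" b] by (intro power_mono) auto
    also have "\<dots> \<le> 2 * (norm (x - b))\<^sup>2 + 2 * (norm b)\<^sup>2"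
      using sum_squares_bound[of "norm (x - b)" "norm b"] by (simp add: power2_sum)
    finally have "c / 4 * (norm x)\<^sup>2 \<le> c / 4 * (2 * (norm (x - b))\<^sup>2 + 2 * (norm b)\<^sup>2)"
      using c by (intro mult_left_mono) auto
    then have "- (c / 2) * (norm (x - b))\<^sup>2 \<le> c / 2 * (norm b)\<^sup>2 + - (c / 4) * (norm x)\<^sup>2"
      by (simp add: algebra_simps)
    then show ?thesis unfolding norm_gauss_wave exp_add[symmetric] by simp
  qed
  ultimately show ?thesis unfolding exptype_def using c
    by (intro conjI exI[of _ "\<lambda>x h. (of_real (- c * ((x - b) \<bullet> h)) - \<i> * of_real (h \<bullet> \<xi>)) * gauss_wave c b \<xi> x"]
        exI[of _ "exp (c / 2 * (norm b)\<^sup>2)"] exI[of _ "c / 4"] allI gauss_wave_has_derivative) auto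
qed

lemma gauss_wave_schwartz: "c > 0 \<Longrightarrow> gauss_wave c b \<xi> \<in> schwartz"
  using cpoly_exptype_schwartz[OF cpoly.const[of 1] exptype_gauss_wave] by simp

lemma heat_schwartz: "c > 0 \<Longrightarrow> (\<lambda>y. of_real (heat c (y - b))) \<in> schwartz"
  unfolding heat_eq_gauss_wave
  by (intro cpoly_exptype_schwartz exptype_gauss_wave cpoly.const) auto

section \<open>Gaussian damping and limits of pairings\<close>

definition damp :: "real \<Rightarrow> (real^'n \<Rightarrow> complex) \<Rightarrow> real^'n \<Rightarrow> complex" where
  "damp c u x = gauss_wave c 0 0 x * u x"

lemma damp_eq: "damp c u x = of_real (exp (- (c / 2) * (norm x)\<^sup>2)) * u x"
  by (simp add: damp_def gauss_wave_def)

lemma damp_le: "c \<ge> 0 \<Longrightarrow> cmod (damp c u x) \<le> 1 * cmod (u x)"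
  unfolding damp_eq norm_mult by (intro mult_right_mono) auto

lemma damp_L2:
  assumes "u \<in> L2" "c > 0"
  shows "damp c u \<in> L2" "integrable lborel (damp c u)"
    "(\<integral>x. (cmod (damp c u x))\<^sup>2 \<partial>lborel) \<le> (\<integral>x. (cmod (u x))\<^sup>2 \<partial>lborel)"
proof -
  note [measurable] = L2D(1)[OF assms(1)]
  have m: "damp c u \<in> borel_measurable borel" unfolding damp_def by measurable
  from L2_dominated[OF assms(1) m damp_le] assms(2)
  show "damp c u \<in> L2" "(\<integral>x. (cmod (damp c u x))\<^sup>2 \<partial>lborel) \<le> (\<integral>x. (cmod (u x))\<^sup>2 \<partial>lborel)" by auto
  show "integrable lborel (damp c u)"
    unfolding damp_def by (intro L2_mult_integrable schwartz_L2 gauss_wave_schwartz assms)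
qed

lemma damp_tendsto:
  assumes u: "u \<in> L2"
  shows "(\<lambda>k. \<integral>x. (cmod (damp (inverse (real (Suc k))) u x - u x))\<^sup>2 \<partial>lborel) \<longlonglongrightarrow> 0"
proof -
  note [measurable] = L2D(1)[OF u]
  have "(\<lambda>k. \<integral>x. (cmod (damp (inverse (real (Suc k))) u x - u x))\<^sup>2 \<partial>lborel) \<longlonglongrightarrow> (\<integral>x. 0 \<partial>(lborel :: (real^'a) measure))"
  proof (rule integral_dominated_convergence[where w="\<lambda>x. 4 * (cmod (u x))\<^sup>2"])
    show "(\<lambda>x. (cmod (damp (inverse (real (Suc k))) u x - u x))\<^sup>2) \<in> borel_measurable lborel" for k
      unfolding damp_def by measurable
    show "integrable lborel (\<lambda>x. 4 * (cmod (u x))\<^sup>2)" using L2D(2)[OF u] by simp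
    show "AE x in lborel. (\<lambda>k. (cmod (damp (inverse (real (Suc k))) u x - u x))\<^sup>2) \<longlonglongrightarrow> 0"
    proof (rule AE_I2)
      fix x :: "real^'a"
      have "(\<lambda>k. (cmod (damp (inverse (real (Suc k))) u x - u x))\<^sup>2) \<longlonglongrightarrow> (cmod (of_real (exp (- (0 / 2) * (norm x)\<^sup>2)) * u x - u x))\<^sup>2"
        unfolding damp_eq by (intro tendsto_intros LIMSEQ_inverse_real_of_nat) auto
      then show "(\<lambda>k. (cmod (damp (inverse (real (Suc k))) u x - u x))\<^sup>2) \<longlonglongrightarrow> 0" by simp
    qed
    show "AE x in lborel. norm ((cmod (damp (inverse (real (Suc k))) u x - u x))\<^sup>2) \<le> 4 * (cmod (u x))\<^sup>2" for k
    proof (rule AE_I2)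
      fix x
      have "cmod (damp (inverse (real (Suc k))) u x - u x) \<le> cmod (damp (inverse (real (Suc k))) u x) + cmod (u x)"
        by (rule norm_triangle_ineq4)
      also have "\<dots> \<le> 2 * cmod (u x)" using damp_le[of "inverse (real (Suc k))" u x] by simp
      finally have "(cmod (damp (inverse (real (Suc k))) u x - u x))\<^sup>2 \<le> (2 * cmod (u x))\<^sup>2" by (intro power_mono) auto
      then show "norm ((cmod (damp (inverse (real (Suc k))) u x - u x))\<^sup>2) \<le> 4 * (cmod (u x))\<^sup>2"
        by (simp add: power_mult_distrib)
    qed
  qed simp
  then show ?thesis by simp
qed

lemma L2_pairing_limit:
  assumes f: "\<And>k. f k \<in> L2" and g: "g \<in> L2" and h: "h \<in> L2"
    and lim: "(\<lambda>k. \<integral>x. (cmod (f k x - g x))\<^sup>2 \<partial>lborel) \<longlonglongrightarrow> 0"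
  shows "(\<lambda>k. \<integral>x. f k x * h x \<partial>lborel) \<longlonglongrightarrow> (\<integral>x. g x * h x \<partial>lborel)"
proof (rule LIM_zero_cancel, rule tendsto_norm_zero_cancel)
  let ?H = "\<integral>x. (cmod (h x))\<^sup>2 \<partial>lborel"
  have eq: "(\<integral>x. f k x * h x \<partial>lborel) - (\<integral>x. g x * h x \<partial>lborel) = (\<integral>x. (f k x - g x) * h x \<partial>lborel)" for k
    unfolding left_diff_distrib by (intro Bochner_Integration.integral_diff[symmetric] L2_mult_integrable f g h)
  have "(\<lambda>k. (\<integral>x. (cmod (f k x - g x))\<^sup>2 \<partial>lborel) * ?H) \<longlonglongrightarrow> 0"
    using tendsto_mult_right[OF lim, of ?H] by simp
  have "(\<lambda>k. (cmod (\<integral>x. (f k x - g x) * h x \<partial>lborel))\<^sup>2) \<longlonglongrightarrow> 0"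
  proof (rule tendsto_sandwich[OF always_eventually always_eventually tendsto_const])
    show "\<forall>k. 0 \<le> (cmod (\<integral>x. (f k x - g x) * h x \<partial>lborel))\<^sup>2" by simp
    show "\<forall>k. (cmod (\<integral>x. (f k x - g x) * h x \<partial>lborel))\<^sup>2 \<le> (\<integral>x. (cmod (f k x - g x))\<^sup>2 \<partial>lborel) * ?H"
      by (intro allI L2_Cauchy_Schwarz L2_diff f g h)
  qed fact
  then have "(\<lambda>k. sqrt ((cmod (\<integral>x. (f k x - g x) * h x \<partial>lborel))\<^sup>2)) \<longlonglongrightarrow> sqrt 0" by (rule tendsto_real_sqrt)
  then show "(\<lambda>k. norm ((\<integral>x. f k x * h x \<partial>lborel) - (\<integral>x. g x * h x \<partial>lborel))) \<longlonglongrightarrow> 0"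
    unfolding eq by simp
qed

section \<open>The Fourier transform of square-integrable functions\<close>

text \<open>Transforms of damped functions form a Cauchy sequence by the Plancherel inequality, and
  the transposition formula passes to the limit against Schwartz functions. The factor 2 comes from
  \<open>sq_add_le\<close>. The convergence itself is recorded because the energy estimate is proved
  for the damped functions and must be transferred to the limit.\<close>

lemma fourier_L2_exists:
  fixes u :: "real^'n \<Rightarrow> complex"
  assumes u: "u \<in> L2"
  shows "\<exists>v\<in>L2. distr_eq (distr_fourier (distr_of u)) (distr_of v) \<and>
    (\<integral>x. (cmod (v x))\<^sup>2 \<partial>lborel) \<le> 2 * (2 * pi) ^ CARD('n) * (\<integral>x. (cmod (u x))\<^sup>2 \<partial>lborel) \<and>
    (\<lambda>k. \<integral>x. (cmod (fourier (damp (inverse (real (Suc k))) u) x - v x))\<^sup>2 \<partial>lborel) \<longlonglongrightarrow> 0"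
proof -
  define U where "U k = damp (inverse (real (Suc k))) u" for k
  let ?P = "(2 * pi) ^ CARD('n)"
  define a where "a k = (\<integral>x. (cmod (U k x - u x))\<^sup>2 \<partial>lborel)" for k
  have U: "U k \<in> L2" "integrable lborel (U k)" for k
    unfolding U_def by (intro damp_L2[OF u]; simp)+
  have U_le: "(\<integral>x. (cmod (U k x))\<^sup>2 \<partial>lborel) \<le> (\<integral>x. (cmod (u x))\<^sup>2 \<partial>lborel)" for k
    unfolding U_def by (rule damp_L2(3)[OF u]) simp
  have a: "a \<longlonglongrightarrow> 0" unfolding a_def U_def by (rule damp_tendsto[OF u])
  have F: "fourier (U k) \<in> L2" for k by (rule Plancherel_inequality(1)[OF U])
  have Fd: "(\<integral>x. (cmod (fourier (U m) x - fourier (U n) x))\<^sup>2 \<partial>lborel) \<le> ?P * (2 * a m + 2 * a n)" for m n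
  proof -
    have "(\<integral>x. (cmod (fourier (U m) x - fourier (U n) x))\<^sup>2 \<partial>lborel)
       = (\<integral>x. (cmod (fourier (\<lambda>y. U m y - U n y) x))\<^sup>2 \<partial>lborel)"
      by (simp add: fourier_diff[OF U(2) U(2)])
    also have "\<dots> \<le> ?P * (\<integral>x. (cmod (U m x - U n x))\<^sup>2 \<partial>lborel)"
      by (intro Plancherel_inequality(2) L2_diff U Bochner_Integration.integrable_diff)
    also have "(\<integral>x. (cmod (U m x - U n x))\<^sup>2 \<partial>lborel) = (\<integral>x. (cmod ((U m x - u x) + (u x - U n x)))\<^sup>2 \<partial>lborel)" by simp
    also have "\<dots> \<le> 2 * (\<integral>x. (cmod (U m x - u x))\<^sup>2 \<partial>lborel) + 2 * (\<integral>x. (cmod (u x - U n x))\<^sup>2 \<partial>lborel)"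
      by (intro L2_add(2) L2_diff U u)
    also have "\<dots> = 2 * a m + 2 * a n" by (simp add: a_def norm_minus_commute)
    finally show ?thesis by simp
  qed
  have "\<exists>N. \<forall>m\<ge>N. \<forall>n\<ge>N. (\<integral>x. (cmod (fourier (U m) x - fourier (U n) x))\<^sup>2 \<partial>lborel) < e" if e: "e > 0" for e
  proof -
    have "e / (4 * ?P) > 0" using e by simp
    then obtain N where N: "\<And>n. n \<ge> N \<Longrightarrow> \<bar>a n\<bar> < e / (4 * ?P)" using LIMSEQ_D[OF a] by force
    have "(\<integral>x. (cmod (fourier (U m) x - fourier (U n) x))\<^sup>2 \<partial>lborel) < e" if "m \<ge> N" "n \<ge> N" for m n
    proof -
      have "2 * a m + 2 * a n < 4 * (e / (4 * ?P))" using N[OF that(1)] N[OF that(2)] by linarith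
      then have "?P * (2 * a m + 2 * a n) < ?P * (4 * (e / (4 * ?P)))" by (intro mult_strict_left_mono) auto
      then show ?thesis using Fd[of m n] by simp
    qed
    then show ?thesis by blast
  qed
  from L2_complete[OF F this] obtain v where v: "v \<in> L2" and lim: "(\<lambda>k. \<integral>x. (cmod (fourier (U k) x - v x))\<^sup>2 \<partial>lborel) \<longlonglongrightarrow> 0"
    by blast
  have "distr_eq (distr_fourier (distr_of u)) (distr_of v)"
    unfolding distr_eq_def distr_fourier_def distr_of_def
  proof
    fix \<phi> :: "real^'n \<Rightarrow> complex" assume \<phi>: "\<phi> \<in> schwartz"
    have "(\<lambda>k. \<integral>x. fourier (U k) x * \<phi> x \<partial>lborel) \<longlonglongrightarrow> (\<integral>x. v x * \<phi> x \<partial>lborel)"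
      by (rule L2_pairing_limit[OF F v schwartz_L2[OF \<phi>] lim])
    moreover have "(\<lambda>k. \<integral>x. U k x * fourier \<phi> x \<partial>lborel) \<longlonglongrightarrow> (\<integral>x. u x * fourier \<phi> x \<partial>lborel)"
      by (rule L2_pairing_limit[OF U(1) u Plancherel_inequality(1)[OF schwartz_L2[OF \<phi>] schwartz_integrable[OF \<phi>]] a[unfolded a_def]])
    moreover have "(\<integral>x. fourier (U k) x * \<phi> x \<partial>lborel) = (\<integral>x. U k x * fourier \<phi> x \<partial>lborel)" for k
      by (rule fourier_multiplication_formula[OF U(2) schwartz_integrable[OF \<phi>]])
    ultimately show "(\<integral>x. u x * fourier \<phi> x \<partial>lborel) = (\<integral>x. v x * \<phi> x \<partial>lborel)"
      by (simp only: LIMSEQ_unique)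
  qed
  moreover have "(\<integral>x. (cmod (v x))\<^sup>2 \<partial>lborel) \<le> 2 * ?P * (\<integral>x. (cmod (u x))\<^sup>2 \<partial>lborel)"
  proof (rule LIMSEQ_le_const)
    show "(\<lambda>k. 2 * (\<integral>x. (cmod (fourier (U k) x - v x))\<^sup>2 \<partial>lborel) + 2 * ?P * (\<integral>x. (cmod (u x))\<^sup>2 \<partial>lborel))
       \<longlonglongrightarrow> 2 * ?P * (\<integral>x. (cmod (u x))\<^sup>2 \<partial>lborel)"
      by (rule tendsto_eq_intros lim refl)+ simp
    show "\<exists>N. \<forall>k\<ge>N. (\<integral>x. (cmod (v x))\<^sup>2 \<partial>lborel) \<le>
       2 * (\<integral>x. (cmod (fourier (U k) x - v x))\<^sup>2 \<partial>lborel) + 2 * ?P * (\<integral>x. (cmod (u x))\<^sup>2 \<partial>lborel)"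
    proof (intro exI[of _ 0] allI impI)
      fix k :: nat
      have "(\<integral>x. (cmod (v x))\<^sup>2 \<partial>lborel) = (\<integral>x. (cmod ((v x - fourier (U k) x) + fourier (U k) x))\<^sup>2 \<partial>lborel)" by simp
      also have "\<dots> \<le> 2 * (\<integral>x. (cmod (v x - fourier (U k) x))\<^sup>2 \<partial>lborel) + 2 * (\<integral>x. (cmod (fourier (U k) x))\<^sup>2 \<partial>lborel)"
        by (intro L2_add(2) L2_diff F v)
      also have "(\<integral>x. (cmod (fourier (U k) x))\<^sup>2 \<partial>lborel) \<le> ?P * (\<integral>x. (cmod (u x))\<^sup>2 \<partial>lborel)"
        using Plancherel_inequality(2)[OF U, of k] U_le[of k]
        by (meson mult_left_mono order_trans pi_ge_zero zero_le_mult_iff zero_le_numeral zero_le_power)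
      finally show "(\<integral>x. (cmod (v x))\<^sup>2 \<partial>lborel) \<le>
         2 * (\<integral>x. (cmod (fourier (U k) x - v x))\<^sup>2 \<partial>lborel) + 2 * ?P * (\<integral>x. (cmod (u x))\<^sup>2 \<partial>lborel)"
        by (simp add: norm_minus_commute mult.assoc)
    qed
  qed
  ultimately show ?thesis using v lim unfolding U_def by blast
qed

section \<open>Heat averages and uniqueness of square-integrable densities\<close>

lemma heat_average:
  fixes k :: "'a::euclidean_space \<Rightarrow> real"
  assumes c: "c > 0" and [measurable]: "k \<in> borel_measurable borel"
  shows "(\<integral>b. k b * heat c (x - b) \<partial>lborel) = (\<integral>y. k (x + sqrt c *\<^sub>R y) * heat 1 y \<partial>lborel)"
proof -
  \<comment> \<open>The substitution b = x + sqrt c y moves the parameter from the kernel into the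
    argument of \<open>k\<close>; limits as c tends to 0 then have the fixed density
    \<open>heat 1\<close> for domination.\<close>
  have "(\<integral>b. k b * heat c (x - b) \<partial>lborel)
     = (sqrt c ^ DIM('a)) *\<^sub>R (\<integral>y. k (x + sqrt c *\<^sub>R y) * heat c (x - (x + sqrt c *\<^sub>R y)) \<partial>lborel)"
    using c by (subst lborel_integral_affine[of _ "sqrt c" x]) auto
  also have "\<dots> = (\<integral>y. (sqrt c ^ DIM('a)) *\<^sub>R (k (x + sqrt c *\<^sub>R y) * heat c (x - (x + sqrt c *\<^sub>R y))) \<partial>lborel)"
    by (rule integral_scaleR_right[symmetric])
  also have "\<dots> = (\<integral>y. k (x + sqrt c *\<^sub>R y) * heat 1 y \<partial>lborel)"
  proof (rule Bochner_Integration.integral_cong[OF refl])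
    fix y :: 'a
    have "heat c (x - (x + sqrt c *\<^sub>R y)) = heat c (sqrt c *\<^sub>R y)" by (simp add: heat_def)
    then show "(sqrt c ^ DIM('a)) *\<^sub>R (k (x + sqrt c *\<^sub>R y) * heat c (x - (x + sqrt c *\<^sub>R y))) = k (x + sqrt c *\<^sub>R y) * heat 1 y"
      unfolding heat_scale[OF c, symmetric, of y] by simp
  qed
  finally show ?thesis .
qed

lemma heat_average_tendsto:
  fixes k :: "'a::euclidean_space \<Rightarrow> real"
  assumes k: "continuous_on UNIV k" and B: "\<And>x. \<bar>k x\<bar> \<le> B"
  shows "(\<lambda>j. \<integral>b. k b * heat (inverse (real (Suc j))) (x - b) \<partial>lborel) \<longlonglongrightarrow> k x"
proof -
  have [measurable]: "k \<in> borel_measurable borel" by (rule borel_measurable_continuous_onI[OF k])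
  have B0: "B \<ge> 0" using B[of x] by linarith
  have "(\<lambda>j. \<integral>y. k (x + sqrt (inverse (real (Suc j))) *\<^sub>R y) * heat 1 y \<partial>lborel) \<longlonglongrightarrow> (\<integral>y. k x * heat 1 (y::'a) \<partial>lborel)"
  proof (rule integral_dominated_convergence[where w="\<lambda>y. B * heat 1 y"])
    show "integrable lborel (\<lambda>y::'a. B * heat 1 y)" by (intro integrable_mult_right integrable_heat) simp
    show "AE y in lborel. (\<lambda>j. k (x + sqrt (inverse (real (Suc j))) *\<^sub>R y) * heat 1 y) \<longlonglongrightarrow> k x * heat 1 y"
    proof (rule AE_I2)
      fix y
      have "(\<lambda>j. x + sqrt (inverse (real (Suc j))) *\<^sub>R y) \<longlonglongrightarrow> x + sqrt 0 *\<^sub>R y"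
        by (intro tendsto_intros LIMSEQ_inverse_real_of_nat)
      moreover have "isCont k x" using k by (simp add: continuous_on_eq_continuous_at)
      ultimately have "(\<lambda>j. k (x + sqrt (inverse (real (Suc j))) *\<^sub>R y)) \<longlonglongrightarrow> k x"
        using isCont_tendsto_compose[of x k "\<lambda>j. x + sqrt (inverse (real (Suc j))) *\<^sub>R y" sequentially] by simp
      then show "(\<lambda>j. k (x + sqrt (inverse (real (Suc j))) *\<^sub>R y) * heat 1 y) \<longlonglongrightarrow> k x * heat 1 y"
        by (intro tendsto_intros)
    qed
    show "AE y in lborel. norm (k (x + sqrt (inverse (real (Suc j))) *\<^sub>R y) * heat 1 y) \<le> B * heat 1 y" for j
      by (intro AE_I2) (simp add: abs_mult heat_nonneg mult_right_mono B)
  qed measurable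
  then show ?thesis by (subst heat_average) (auto simp: integral_heat)
qed

text \<open>Damping makes \<open>w\<close> integrable; translated Gaussians are Schwartz functions, and averages of them
  approximate every bounded continuous function.\<close>

lemma L2_eq_0_of_schwartz:
  fixes w :: "real^'n \<Rightarrow> complex"
  assumes w: "w \<in> L2" and zero: "\<And>\<phi>. \<phi> \<in> schwartz \<Longrightarrow> (\<integral>x. w x * \<phi> x \<partial>lborel) = 0"
  shows "AE x in lborel. w x = 0"
proof -
  define W where "W = damp 1 w"
  have W_int: "integrable lborel W" unfolding W_def by (rule damp_L2(2)[OF w]) simp
  note [measurable] = borel_measurable_integrable[OF W_int]
  \<comment> \<open>The damping Gaussian is moved to the test function, where its product with the
    heat kernel is again Schwartz.\<close>
  have heat0: "(\<integral>x. W x * of_real (heat c (x - b)) \<partial>lborel) = 0" if c: "c > 0" for c b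
  proof -
    have "(\<lambda>x. of_real ((1 / sqrt (2 * pi * c)) ^ CARD('n)) * (gauss_wave 1 0 0 x * gauss_wave (1 / c) b 0 x)) \<in> schwartz"
      using c by (intro cpoly_exptype_schwartz cpoly.const exptype_mult exptype_gauss_wave) auto
    from zero[OF this] show ?thesis
      unfolding heat_eq_gauss_wave by (simp add: W_def damp_def mult_ac)
  qed
  have cont0: "(\<integral>x. W x * of_real (k x) \<partial>lborel) = 0"
    if k: "continuous_on UNIV k" and B: "\<And>x. \<bar>k x\<bar> \<le> B" for k :: "real^'n \<Rightarrow> real" and B
  proof -
    have [measurable]: "k \<in> borel_measurable borel" by (rule borel_measurable_continuous_onI[OF k])
    have B0: "B \<ge> 0" using B[of 0] by linarith
    have kh: "integrable lborel (\<lambda>b. k b * heat c (x - b))" if c: "c > 0" for c and x :: "real^'n"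
    proof (rule Bochner_Integration.integrable_bound)
      show "integrable lborel (\<lambda>b. B * heat c (b - x))"
        using lborel_integrable_shift[OF integrable_heat[OF c], of "- x"] by simp
      show "AE b in lborel. norm (k b * heat c (x - b)) \<le> norm (B * heat c (b - x))"
        using B0 B by (intro AE_I2) (simp add: abs_mult heat_symmetric[of c x] mult_right_mono)
    qed measurable
    have kh_le: "\<bar>\<integral>b. k b * heat c (x - b) \<partial>lborel\<bar> \<le> B"
      "(\<integral>b. \<bar>k b * heat c (x - b)\<bar> \<partial>lborel) \<le> B" if c: "c > 0" for c and x :: "real^'n"
    proof -
      have "(\<integral>b. \<bar>k b * heat c (x - b)\<bar> \<partial>lborel) \<le> (\<integral>b. B * heat c (b - x) \<partial>lborel)"
      proof (rule integral_mono)
        show "integrable lborel (\<lambda>b. \<bar>k b * heat c (x - b)\<bar>)" by (rule integrable_abs[OF kh[OF c]])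
        show "integrable lborel (\<lambda>b. B * heat c (b - x))"
          using lborel_integrable_shift[OF integrable_heat[OF c], of "- x"] by simp
        show "\<bar>k b * heat c (x - b)\<bar> \<le> B * heat c (b - x)" for b
          unfolding abs_mult heat_symmetric[of c x] abs_of_nonneg[OF heat_nonneg[OF c]]
          by (intro mult_right_mono B heat_nonneg c)
      qed
      also have "\<dots> = B" using lborel_integral_shift[of "\<lambda>b. heat c (b::real^'n)" "- x"] integral_heat[OF c, where 'a="real^'n"] by simp
      finally show 1: "(\<integral>b. \<bar>k b * heat c (x - b)\<bar> \<partial>lborel) \<le> B" .
      show "\<bar>\<integral>b. k b * heat c (x - b) \<partial>lborel\<bar> \<le> B"
        using integral_abs_bound[of lborel "\<lambda>b. k b * heat c (x - b)"] 1 by linarith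
    qed
    \<comment> \<open>Fubini exchanges the averaging with the pairing, after which
      \<open>heat0\<close> annihilates every inner integral.\<close>
    have reg: "(\<integral>x. W x * of_real (\<integral>b. k b * heat c (x - b) \<partial>lborel) \<partial>lborel) = 0" if c: "c > 0" for c
    proof -
      have i: "integrable (lborel \<Otimes>\<^sub>M lborel) (\<lambda>(x, b). W x * of_real (k b * heat c (x - b)))"
      proof (rule lborel_pair.Fubini_integrable)
        show "(\<lambda>(x, b). W x * complex_of_real (k b * heat c (x - b))) \<in> borel_measurable (lborel \<Otimes>\<^sub>M lborel)"
          by measurable
        have "integrable lborel (\<lambda>x. cmod (W x) * (\<integral>b. \<bar>k b * heat c (x - b)\<bar> \<partial>lborel))"
        proof (rule Bochner_Integration.integrable_bound)
          show "integrable lborel (\<lambda>x. cmod (W x) * B)" using W_int by auto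
          show "(\<lambda>x. cmod (W x) * (\<integral>b. \<bar>k b * heat c (x - b)\<bar> \<partial>lborel)) \<in> borel_measurable lborel" by measurable
          show "AE x in lborel. norm (cmod (W x) * (\<integral>b. \<bar>k b * heat c (x - b)\<bar> \<partial>lborel)) \<le> norm (cmod (W x) * B)"
            using kh_le(2)[OF c] B0 by (intro AE_I2) (simp add: abs_mult mult_left_mono)
        qed
        then show "integrable lborel (\<lambda>x. \<integral>b. norm (case (x, b) of (x, b) \<Rightarrow> W x * complex_of_real (k b * heat c (x - b))) \<partial>lborel)"
          by (simp add: norm_mult abs_mult)
        show "AE x in lborel. integrable lborel (\<lambda>b. case (x, b) of (x, b) \<Rightarrow> W x * complex_of_real (k b * heat c (x - b)))"
          using kh[OF c] by (intro AE_I2) (auto simp del: of_real_mult)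
      qed
      have "(\<integral>x. W x * of_real (\<integral>b. k b * heat c (x - b) \<partial>lborel) \<partial>lborel)
         = (\<integral>x. \<integral>b. W x * of_real (k b * heat c (x - b)) \<partial>lborel \<partial>lborel)"
        by (simp del: of_real_mult)
      also have "\<dots> = (\<integral>b. \<integral>x. W x * of_real (k b * heat c (x - b)) \<partial>lborel \<partial>lborel)"
        using lborel_pair.Fubini_integral[OF i] by simp
      also have "\<dots> = (\<integral>b. of_real (k b) * (\<integral>x. W x * of_real (heat c (x - b)) \<partial>lborel) \<partial>lborel)"
        by (simp add: mult.left_commute[of "W _"])
      finally show ?thesis by (simp add: heat0[OF c])
    qed
    have "(\<lambda>j. \<integral>x. W x * of_real (\<integral>b. k b * heat (inverse (real (Suc j))) (x - b) \<partial>lborel) \<partial>lborel)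
       \<longlonglongrightarrow> (\<integral>x. W x * of_real (k x) \<partial>lborel)"
    proof (rule integral_dominated_convergence[where w="\<lambda>x. cmod (W x) * B"])
      show "integrable lborel (\<lambda>x. cmod (W x) * B)" using W_int by auto
      show "AE x in lborel. (\<lambda>j. W x * of_real (\<integral>b. k b * heat (inverse (real (Suc j))) (x - b) \<partial>lborel)) \<longlonglongrightarrow> W x * of_real (k x)"
        by (intro AE_I2 tendsto_intros heat_average_tendsto[OF k B])
      show "AE x in lborel. norm (W x * of_real (\<integral>b. k b * heat (inverse (real (Suc j))) (x - b) \<partial>lborel)) \<le> cmod (W x) * B" for j
        using kh_le(1)[of "inverse (real (Suc j))"] by (intro AE_I2) (auto simp: norm_mult intro!: mult_left_mono)
      show "(\<lambda>x. W x * of_real (\<integral>b. k b * heat (inverse (real (Suc j))) (x - b) \<partial>lborel)) \<in> borel_measurable lborel" for j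
        by measurable
    qed measurable
    moreover have "(\<integral>x. W x * of_real (\<integral>b. k b * heat (inverse (real (Suc j))) (x - b) \<partial>lborel) \<partial>lborel) = 0" for j
      by (rule reg) simp
    ultimately show ?thesis by (simp add: LIMSEQ_const_iff)
  qed
  have closed0: "(\<integral>x. indicator C x *\<^sub>R W x \<partial>lborel) = 0" if C: "closed C" for C
  proof (cases "C = {}")
    case False
    \<comment> \<open>Continuous functions with values in [0, 1] that decrease to the indicator of
      the closed set as m grows.\<close>
    define k where "k m x = max 0 (1 - real m * infdist x C)" for m x
    have "(\<lambda>m. \<integral>x. W x * of_real (k m x) \<partial>lborel) \<longlonglongrightarrow> (\<integral>x. indicator C x *\<^sub>R W x \<partial>lborel)"
    proof (rule integral_dominated_convergence[where w="\<lambda>x. cmod (W x)"])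
      show "integrable lborel (\<lambda>x. cmod (W x))" using W_int by auto
      show "AE x in lborel. (\<lambda>m. W x * of_real (k m x)) \<longlonglongrightarrow> indicator C x *\<^sub>R W x"
      proof (rule AE_I2)
        fix x
        have "(\<lambda>m. k m x) \<longlonglongrightarrow> indicator C x"
        proof (cases "x \<in> C")
          case True then show ?thesis by (simp add: k_def)
        next
          case out: False
          then have pos: "infdist x C > 0" using C False infdist_pos_not_in_closed by blast
          obtain N where N: "1 / infdist x C < real N" using reals_Archimedean2 by blast
          have "k m x = 0" if "m \<ge> N" for m
          proof -
            have "1 / infdist x C \<le> real m" using N that by linarith
            then have "1 \<le> real m * infdist x C" using pos by (simp add: pos_divide_le_eq)
            then show ?thesis by (simp add: k_def)
          qed
          then have "eventually (\<lambda>m. k m x = 0) sequentially" by (auto simp: eventually_sequentially)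
          then show ?thesis using out by (simp add: tendsto_eventually)
        qed
        then have "(\<lambda>m. W x * of_real (k m x)) \<longlonglongrightarrow> W x * of_real (indicator C x)" by (intro tendsto_intros)
        then show "(\<lambda>m. W x * of_real (k m x)) \<longlonglongrightarrow> indicator C x *\<^sub>R W x" by (simp add: scaleR_conv_of_real mult.commute)
      qed
      show "AE x in lborel. norm (W x * of_real (k m x)) \<le> cmod (W x)" for m
        by (intro AE_I2) (auto simp: norm_mult k_def infdist_nonneg intro!: mult_left_le)
      show "(\<lambda>x. W x * complex_of_real (k m x)) \<in> borel_measurable lborel" for m
      proof -
        have "continuous_on UNIV (k m)" unfolding k_def by (intro continuous_intros)
        then have [measurable]: "k m \<in> borel_measurable borel" by (rule borel_measurable_continuous_onI)
        show ?thesis by measurable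
      qed
      show "(\<lambda>x. indicator C x *\<^sub>R W x) \<in> borel_measurable lborel"
        using C W_int by (intro borel_measurable_scaleR borel_measurable_indicator) auto
    qed
    moreover have "(\<integral>x. W x * of_real (k m x) \<partial>lborel) = 0" for m
      by (rule cont0[of _ 1]) (auto simp: k_def infdist_nonneg intro!: continuous_intros)
    ultimately show ?thesis by (simp add: LIMSEQ_const_iff)
  qed simp
  have "AE x in lborel. W x = 0"
  proof (rule sigma_finite_measure.density_zero[OF sigma_finite_lborel W_int])
    fix A :: "(real^'n) set" assume "A \<in> sets lborel"
    then have A: "A \<in> sigma_sets UNIV (Collect closed)" by (simp add: borel_eq_closed)
    \<comment> \<open>Closed sets form an intersection-stable generator of the Borel sets, so the
      vanishing extends to all Borel sets, and that forces \<open>W\<close> to vanish almost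
      everywhere.\<close>
    have "Int_stable (Collect closed :: (real^'n) set set)" "Collect closed \<subseteq> Pow (UNIV :: (real^'n) set)"
      by (auto simp: Int_stable_def)
    from this A show "set_lebesgue_integral lborel A W = 0"
    proof (induction rule: sigma_sets_induct_disjoint)
      case (basic A) then show ?case using closed0 by (simp add: set_lebesgue_integral_def)
    next
      case (compl A)
      then have [measurable]: "A \<in> sets borel" by (simp add: borel_eq_closed)
      have "set_lebesgue_integral lborel (UNIV - A) W = (\<integral>x. W x - indicator A x *\<^sub>R W x \<partial>lborel)"
        unfolding set_lebesgue_integral_def by (intro Bochner_Integration.integral_cong) (auto simp: indicator_def)
      also have "\<dots> = (\<integral>x. W x \<partial>lborel) - set_lebesgue_integral lborel A W"
        unfolding set_lebesgue_integral_def
        by (intro Bochner_Integration.integral_diff W_int integrable_mult_indicator) auto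
      also have "(\<integral>x. W x \<partial>lborel) = 0" using closed0[of UNIV] by simp
      finally show ?case using compl by simp
    next
      case (union A)
      then have [measurable]: "A i \<in> sets borel" for i by (auto simp: borel_eq_closed)
      have "set_lebesgue_integral lborel (\<Union>i. A i) W = (\<Sum>i. set_lebesgue_integral lborel (A i) W)"
        by (rule lebesgue_integral_countable_add)
          (use union W_int in \<open>auto simp: disjoint_family_on_def set_integrable_def intro!: integrable_mult_indicator\<close>)
      then show ?case using union by simp
    qed (simp add: set_lebesgue_integral_def)
  qed
  then show ?thesis by eventually_elim (simp add: W_def damp_eq)
qed


text \<open>\<open>fourier_L2\<close> is an arbitrary choice among the functions representing the
  transform. Two such functions agree almost everywhere, so the norm bound and the convergence known
  for the constructed one hold for the chosen one.\<close>

lemma fourier_L2_props: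
  fixes u :: "real^'n \<Rightarrow> complex"
  assumes u: "u \<in> L2"
  shows "fourier_L2 u \<in> L2"
    and "\<And>\<phi>. \<phi> \<in> schwartz \<Longrightarrow> (\<integral>x. u x * fourier \<phi> x \<partial>lborel) = (\<integral>x. fourier_L2 u x * \<phi> x \<partial>lborel)"
    and "(\<integral>x. (cmod (fourier_L2 u x))\<^sup>2 \<partial>lborel) \<le> 2 * (2 * pi) ^ CARD('n) * (\<integral>x. (cmod (u x))\<^sup>2 \<partial>lborel)"
    and "(\<lambda>k. \<integral>x. (cmod (fourier (damp (inverse (real (Suc k))) u) x - fourier_L2 u x))\<^sup>2 \<partial>lborel) \<longlonglongrightarrow> 0"
proof -
  obtain v where v: "v \<in> L2" "distr_eq (distr_fourier (distr_of u)) (distr_of v)"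
    "(\<integral>x. (cmod (v x))\<^sup>2 \<partial>lborel) \<le> 2 * (2 * pi) ^ CARD('n) * (\<integral>x. (cmod (u x))\<^sup>2 \<partial>lborel)"
    "(\<lambda>k. \<integral>x. (cmod (fourier (damp (inverse (real (Suc k))) u) x - v x))\<^sup>2 \<partial>lborel) \<longlonglongrightarrow> 0"
    using fourier_L2_exists[OF u] by blast
  let ?v = "fourier_L2 u"
  have s: "?v \<in> L2 \<and> distr_eq (distr_fourier (distr_of u)) (distr_of ?v)"
    unfolding fourier_L2_def by (rule someI[of _ v]) (use v in blast)
  then show "?v \<in> L2" by blast
  show eq: "(\<integral>x. u x * fourier \<phi> x \<partial>lborel) = (\<integral>x. ?v x * \<phi> x \<partial>lborel)" if "\<phi> \<in> schwartz" for \<phi>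
    using s that by (simp add: distr_eq_def distr_fourier_def distr_of_def)
  have eqv: "(\<integral>x. u x * fourier \<phi> x \<partial>lborel) = (\<integral>x. v x * \<phi> x \<partial>lborel)" if "\<phi> \<in> schwartz" for \<phi>
    using v(2) that by (simp add: distr_eq_def distr_fourier_def distr_of_def)
  have "AE x in lborel. v x - ?v x = 0"
  proof (rule L2_eq_0_of_schwartz)
    show "(\<lambda>x. v x - ?v x) \<in> L2" using v s by (intro L2_diff) auto
    fix \<phi> :: "real^'n \<Rightarrow> complex" assume \<phi>: "\<phi> \<in> schwartz"
    have "(\<integral>x. (v x - ?v x) * \<phi> x \<partial>lborel) = (\<integral>x. v x * \<phi> x \<partial>lborel) - (\<integral>x. ?v x * \<phi> x \<partial>lborel)"
      unfolding left_diff_distrib using v s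
      by (intro Bochner_Integration.integral_diff L2_mult_integrable schwartz_L2[OF \<phi>]) auto
    then show "(\<integral>x. (v x - ?v x) * \<phi> x \<partial>lborel) = 0" using eq[OF \<phi>] eqv[OF \<phi>] by simp
  qed
  then have AE: "AE x in lborel. ?v x = v x" by eventually_elim simp
  note [measurable] = L2D(1)[OF v(1)] L2D(1)[OF conjunct1[OF s]]
  have "(\<integral>x. (cmod (?v x))\<^sup>2 \<partial>lborel) = (\<integral>x. (cmod (v x))\<^sup>2 \<partial>lborel)"
    by (rule integral_cong_AE) (use AE in auto)
  then show "(\<integral>x. (cmod (?v x))\<^sup>2 \<partial>lborel) \<le> 2 * (2 * pi) ^ CARD('n) * (\<integral>x. (cmod (u x))\<^sup>2 \<partial>lborel)"
    using v(3) by simp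
  have "(\<integral>x. (cmod (fourier (damp (inverse (real (Suc k))) u) x - ?v x))\<^sup>2 \<partial>lborel)
      = (\<integral>x. (cmod (fourier (damp (inverse (real (Suc k))) u) x - v x))\<^sup>2 \<partial>lborel)" for k
  proof (rule integral_cong_AE)
    have [measurable]: "fourier (damp (inverse (real (Suc k))) u) \<in> borel_measurable borel"
      by (intro fourier_measurable L2D(1) damp_L2(1)[OF u]) simp
    show "(\<lambda>x. (cmod (fourier (damp (inverse (real (Suc k))) u) x - ?v x))\<^sup>2) \<in> borel_measurable lborel"
      "(\<lambda>x. (cmod (fourier (damp (inverse (real (Suc k))) u) x - v x))\<^sup>2) \<in> borel_measurable lborel" by measurable
  qed (use AE in auto)
  then show "(\<lambda>k. \<integral>x. (cmod (fourier (damp (inverse (real (Suc k))) u) x - ?v x))\<^sup>2 \<partial>lborel) \<longlonglongrightarrow> 0"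
    using v(4) by simp
qed

text \<open>The inverse transform is the forward transform of the reflected function divided by (2
  pi)^n, so existence carries over. The constants leave 2 / (2 pi)^n, which is at most 2.\<close>

lemma distr_inv_fourier_L2:
  fixes w :: "real^'n \<Rightarrow> complex"
  assumes w: "w \<in> L2"
  shows "\<exists>f\<in>L2. distr_eq (distr_inv_fourier (distr_of w)) (distr_of f) \<and>
    (\<integral>x. (cmod (f x))\<^sup>2 \<partial>lborel) \<le> 2 * (\<integral>x. (cmod (w x))\<^sup>2 \<partial>lborel)"
proof -
  let ?P = "(2 * pi) ^ CARD('n)"
  define c where "c = complex_of_real (1 / ?P)"
  have P1: "1 \<le> ?P" using pi_gt3 by (intro one_le_power) simp
  have w': "(\<lambda>x. w (- x)) \<in> L2" by (rule L2_reflect(1)[OF w])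
  note [measurable] = L2D(1)[OF w]
  obtain v where v: "v \<in> L2" "distr_eq (distr_fourier (distr_of (\<lambda>x. w (- x)))) (distr_of v)"
    "(\<integral>x. (cmod (v x))\<^sup>2 \<partial>lborel) \<le> 2 * ?P * (\<integral>x. (cmod (w (- x)))\<^sup>2 \<partial>lborel)"
    using fourier_L2_exists[OF w'] by blast
  have "distr_eq (distr_inv_fourier (distr_of w)) (distr_of (\<lambda>x. c * v x))"
    unfolding distr_eq_def distr_inv_fourier_def distr_of_def
  proof
    fix \<phi> :: "real^'n \<Rightarrow> complex" assume \<phi>: "\<phi> \<in> schwartz"
    have [measurable]: "fourier \<phi> \<in> borel_measurable borel" by (intro fourier_measurable schwartz_measurable \<phi>)
    have "(\<integral>x. w x * inv_fourier \<phi> x \<partial>lborel) = (\<integral>x. c * (w x * fourier \<phi> (- x)) \<partial>lborel)"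
      unfolding inv_fourier_eq_fourier c_def by (simp only: mult.left_commute)
    also have "\<dots> = c * (\<integral>x. w x * fourier \<phi> (- x) \<partial>lborel)" by (rule integral_mult_right_zero)
    also have "(\<integral>x. w x * fourier \<phi> (- x) \<partial>lborel) = (\<integral>x. w (- x) * fourier \<phi> x \<partial>lborel)"
      using lborel_integral_affine[of "\<lambda>x. w x * fourier \<phi> (- x)" "-1" 0] by simp
    also have "\<dots> = (\<integral>x. v x * \<phi> x \<partial>lborel)"
      using v(2) \<phi> by (simp add: distr_eq_def distr_fourier_def distr_of_def)
    also have "c * (\<integral>x. v x * \<phi> x \<partial>lborel) = (\<integral>x. c * v x * \<phi> x \<partial>lborel)"
      unfolding mult.assoc by (rule integral_mult_right_zero[symmetric])
    finally show "(\<integral>x. w x * inv_fourier \<phi> x \<partial>lborel) = (\<integral>x. c * v x * \<phi> x \<partial>lborel)" .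
  qed
  moreover have "(\<integral>x. (cmod (c * v x))\<^sup>2 \<partial>lborel) \<le> 2 * (\<integral>x. (cmod (w x))\<^sup>2 \<partial>lborel)"
  proof -
    have "(\<integral>x. (cmod (c * v x))\<^sup>2 \<partial>lborel) = (1 / ?P)\<^sup>2 * (\<integral>x. (cmod (v x))\<^sup>2 \<partial>lborel)"
      unfolding c_def norm_mult norm_of_real power_mult_distrib power2_abs by (rule integral_mult_right_zero)
    also have "\<dots> \<le> (1 / ?P)\<^sup>2 * (2 * ?P * (\<integral>x. (cmod (w x))\<^sup>2 \<partial>lborel))"
      using v(3) unfolding L2_reflect(2)[OF w] by (intro mult_left_mono) auto
    also have "\<dots> = (1 / ?P) * (2 * (\<integral>x. (cmod (w x))\<^sup>2 \<partial>lborel))"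
      using P1 by (simp add: power2_eq_square)
    also have "\<dots> \<le> 1 * (2 * (\<integral>x. (cmod (w x))\<^sup>2 \<partial>lborel))"
      using P1 by (intro mult_right_mono) auto
    finally show ?thesis by simp
  qed
  ultimately show ?thesis using L2_cmult[OF v(1), of c] by blast
qed

section \<open>The equation after Gaussian regularisation\<close>

lemma fourier_damp: "fourier (damp c u) \<xi> = (\<integral>x. u x * gauss_wave c 0 \<xi> x \<partial>lborel)"
  unfolding fourier_def damp_def mult.assoc[symmetric] cis_gauss_wave by (simp add: mult.commute)

text \<open>Differentiation under the integral with a quantitative remainder: the first-order Taylor
  error of exp (i t) is at most t^2 / 2, so a finite second moment bounds the remainder by a
  multiple of |y - \<xi>|^2. The one moment \<open>D\<close> dominates the value, the derivative and
  the remainder.\<close>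

lemma fourier_has_derivative:
  fixes g :: "real^'n \<Rightarrow> complex"
  assumes g[measurable]: "g \<in> borel_measurable borel"
    and gi: "integrable lborel (\<lambda>x. (1 + norm x)\<^sup>2 * cmod (g x))"
  defines "D \<equiv> (\<integral>x. (1 + norm x)\<^sup>2 * cmod (g x) \<partial>lborel)"
  defines "g' \<equiv> \<lambda>\<xi> h. \<integral>x. - \<i> * of_real (x \<bullet> h) * (cis (- (x \<bullet> \<xi>)) * g x) \<partial>lborel"
  shows "(fourier g has_derivative g' \<xi>) (at \<xi>)" and "cmod (fourier g \<xi>) \<le> D" and "cmod (g' \<xi> h) \<le> D * norm h"
proof -
  have w1: "1 \<le> (1 + norm x)\<^sup>2" "norm x \<le> (1 + norm x)\<^sup>2" "(norm x)\<^sup>2 \<le> (1 + norm x)\<^sup>2" for x :: "real^'n"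
    using norm_ge_zero[of x] zero_le_power2[of "norm x"] by (auto simp: power2_sum simp del: norm_ge_zero)
  have D0: "D \<ge> 0" unfolding D_def by (intro integral_nonneg_AE AE_I2) auto
  have dom: "integrable lborel k \<and> cmod (\<integral>x. k x \<partial>lborel) \<le> D * a"
    if [measurable]: "k \<in> borel_measurable borel" and le: "\<And>x. cmod (k x) \<le> (1 + norm x)\<^sup>2 * cmod (g x) * a" and a: "a \<ge> 0"
    for k :: "real^'n \<Rightarrow> complex" and a
  proof -
    have ia: "integrable lborel (\<lambda>x. (1 + norm x)\<^sup>2 * cmod (g x) * a)" using gi by simp
    have ik: "integrable lborel k"
      by (rule Bochner_Integration.integrable_bound[OF ia]) (use a le in \<open>auto simp: abs_mult\<close>)
    have "cmod (\<integral>x. k x \<partial>lborel) \<le> (\<integral>x. cmod (k x) \<partial>lborel)" by (rule integral_norm_bound)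
    also have "\<dots> \<le> (\<integral>x. (1 + norm x)\<^sup>2 * cmod (g x) * a \<partial>lborel)"
      by (intro integral_mono integrable_norm ik ia le)
    also have "\<dots> = D * a" unfolding D_def by (rule integral_mult_left_zero)
    finally show ?thesis using ik by simp
  qed
  have gint: "integrable lborel g"
  proof -
    have "cmod (g x) \<le> (1 + norm x)\<^sup>2 * cmod (g x) * 1" for x
      using mult_right_mono[OF w1(1)[of x], of "cmod (g x)"] by simp
    from dom[OF g this] show ?thesis by simp
  qed
  have i1: "integrable lborel (\<lambda>x. - \<i> * of_real (x \<bullet> h) * (cis (- (x \<bullet> \<xi>)) * g x))"
    and b1: "cmod (g' \<xi> h) \<le> D * norm h" for \<xi> h
  proof -
    have "cmod (- \<i> * of_real (x \<bullet> h) * (cis (- (x \<bullet> \<xi>)) * g x)) \<le> (1 + norm x)\<^sup>2 * cmod (g x) * norm h" for x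
    proof -
      have "cmod (- \<i> * of_real (x \<bullet> h) * (cis (- (x \<bullet> \<xi>)) * g x)) = \<bar>x \<bullet> h\<bar> * cmod (g x)"
        by (simp add: norm_mult)
      also have "\<dots> \<le> (norm x * norm h) * cmod (g x)" by (intro mult_right_mono Cauchy_Schwarz_ineq2) auto
      also have "\<dots> \<le> ((1 + norm x)\<^sup>2 * norm h) * cmod (g x)" by (intro mult_right_mono w1) auto
      finally show ?thesis by (simp only: mult_ac)
    qed
    from dom[OF _ this] show "integrable lborel (\<lambda>x. - \<i> * of_real (x \<bullet> h) * (cis (- (x \<bullet> \<xi>)) * g x))"
      "cmod (g' \<xi> h) \<le> D * norm h" unfolding g'_def by simp_all
  qed
  show "cmod (g' \<xi> h) \<le> D * norm h" by (rule b1)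
  show "cmod (fourier g \<xi>) \<le> D"
  proof -
    have "cmod (cis (- (x \<bullet> \<xi>)) * g x) \<le> (1 + norm x)\<^sup>2 * cmod (g x) * 1" for x
      using mult_right_mono[OF w1(1)[of x], of "cmod (g x)"] by (simp add: norm_mult)
    from dom[OF _ this] show ?thesis by (simp add: fourier_def)
  qed
  have lin: "bounded_linear (g' \<xi>)"
  proof (rule bounded_linear_intro[of _ D])
    show "g' \<xi> (a + b) = g' \<xi> a + g' \<xi> b" for a b
      unfolding g'_def by (subst Bochner_Integration.integral_add[symmetric, OF i1 i1])
        (simp add: inner_add_right algebra_simps)
    show "g' \<xi> (r *\<^sub>R a) = r *\<^sub>R g' \<xi> a" for r a
      unfolding g'_def
      by (subst integral_scaleR_right[symmetric], rule Bochner_Integration.integral_cong[OF refl])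
        (simp add: scaleR_conv_of_real[of r "_::complex"] mult_ac)
    show "norm (g' \<xi> a) \<le> norm a * D" for a using b1[of \<xi> a] by (simp add: mult.commute)
  qed
  show "(fourier g has_derivative g' \<xi>) (at \<xi>)"
  proof (rule has_derivativeI_sandwich[of 1, where H="\<lambda>y. D * norm (y - \<xi>)"])
    show "bounded_linear (g' \<xi>)" by (rule lin)
    fix y assume y: "y \<noteq> \<xi>"
    let ?k = "\<lambda>x. cis (- (x \<bullet> y)) * g x - cis (- (x \<bullet> \<xi>)) * g x - (- \<i> * of_real (x \<bullet> (y - \<xi>)) * (cis (- (x \<bullet> \<xi>)) * g x))"
    have "cmod (?k x) \<le> (1 + norm x)\<^sup>2 * cmod (g x) * (norm (y - \<xi>))\<^sup>2" for x
    proof -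
      \<comment> \<open>The phase difference between the frequencies y and \<xi>; the integrand
        becomes a unimodular factor times \<open>g x\<close> times the Taylor error of exp (i
        t).\<close>
      define t where "t = - (x \<bullet> (y - \<xi>))"
      have "cis (- (x \<bullet> y)) = cis (- (x \<bullet> \<xi>)) * cis t" by (simp add: t_def cis_mult inner_diff_right)
      then have "?k x = cis (- (x \<bullet> \<xi>)) * g x * (iexp t - (\<Sum>k\<le>1. (\<i> * t) ^ k / fact k))"
        by (simp add: t_def cis_conv_exp algebra_simps)
      then have "cmod (?k x) = cmod (g x) * cmod (iexp t - (\<Sum>k\<le>1. (\<i> * t) ^ k / fact k))"
        by (simp only: norm_mult norm_cis mult_1_left)
      also have "\<dots> \<le> cmod (g x) * (\<bar>t\<bar> ^ Suc 1 / fact (Suc 1))" by (intro mult_left_mono iexp_approx1) auto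
      also have "\<dots> \<le> cmod (g x) * ((1 + norm x)\<^sup>2 * (norm (y - \<xi>))\<^sup>2)"
      proof (rule mult_left_mono)
        have "\<bar>t\<bar> ^ Suc 1 / fact (Suc 1) \<le> \<bar>t\<bar>\<^sup>2" by (simp add: power2_eq_square)
        also have "\<bar>t\<bar>\<^sup>2 \<le> (norm x * norm (y - \<xi>))\<^sup>2"
          unfolding t_def abs_minus_cancel by (intro power_mono Cauchy_Schwarz_ineq2) auto
        also have "\<dots> \<le> (1 + norm x)\<^sup>2 * (norm (y - \<xi>))\<^sup>2"
          unfolding power_mult_distrib by (intro mult_right_mono w1) auto
        finally show "\<bar>t\<bar> ^ Suc 1 / fact (Suc 1) \<le> (1 + norm x)\<^sup>2 * (norm (y - \<xi>))\<^sup>2" .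
      qed simp
      finally show ?thesis by (simp only: mult_ac)
    qed
    from dom[OF _ this] have "cmod (\<integral>x. ?k x \<partial>lborel) \<le> D * (norm (y - \<xi>))\<^sup>2" by simp
    moreover have "(\<integral>x. ?k x \<partial>lborel) = fourier g y - fourier g \<xi> - g' \<xi> (y - \<xi>)"
      unfolding fourier_def g'_def
      by (subst Bochner_Integration.integral_diff, (intro Bochner_Integration.integrable_diff fourier_integrand gint i1)+,
          subst Bochner_Integration.integral_diff, (intro fourier_integrand gint)+, rule refl)
    ultimately have "cmod (fourier g y - fourier g \<xi> - g' \<xi> (y - \<xi>)) \<le> D * norm (y - \<xi>) * norm (y - \<xi>)"
      by (simp add: power2_eq_square)
    then show "norm (fourier g y - fourier g \<xi> - g' \<xi> (y - \<xi>)) / norm (y - \<xi>) \<le> D * norm (y - \<xi>)"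
      using y by (simp add: pos_divide_le_eq)
  next
    have "((\<lambda>y. D * norm (y - \<xi>)) \<longlongrightarrow> D * norm (\<xi> - \<xi>)) (at \<xi>)" by (intro tendsto_intros)
    then show "((\<lambda>y. D * norm (y - \<xi>)) \<longlongrightarrow> 0) (at \<xi>)" by simp
  qed simp
qed

lemma damp_moment:
  fixes u :: "real^'n \<Rightarrow> complex"
  assumes u: "u \<in> L2" and c: "c > 0"
  shows "integrable lborel (\<lambda>x. (1 + norm x)\<^sup>2 * cmod (damp c u x))"
proof -
  note [measurable] = L2D(1)[OF u]
  define h where "h x = complex_of_real ((1 + norm x)\<^sup>2 * exp (- (c / 2) * (norm x)\<^sup>2))" for x :: "real^'n"
  have [measurable]: "h \<in> borel_measurable borel" unfolding h_def by measurable
  have h: "cmod (h x) = (1 + norm x)\<^sup>2 * exp (- (c / 2) * (norm x)\<^sup>2)" for x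
    unfolding h_def norm_of_real by (rule abs_of_nonneg) simp
  have "(cmod (h x))\<^sup>2 = (1 + norm x) ^ 4 * exp (- c * (norm x)\<^sup>2)" for x
  proof -
    have "(cmod (h x))\<^sup>2 = ((1 + norm x)\<^sup>2)\<^sup>2 * (exp (- (c / 2) * (norm x)\<^sup>2) * exp (- (c / 2) * (norm x)\<^sup>2))"
      unfolding h power_mult_distrib power2_eq_square[of "exp _"] ..
    also have "exp (- (c / 2) * (norm x)\<^sup>2) * exp (- (c / 2) * (norm x)\<^sup>2) = exp (- c * (norm x)\<^sup>2)"
      unfolding exp_add[symmetric] by simp
    also have "((1 + norm x)\<^sup>2)\<^sup>2 = (1 + norm x) ^ 4" unfolding power_mult[symmetric] by simp
    finally show ?thesis .
  qed
  then have "h \<in> L2" unfolding L2_def using integrable_poly_gaussian[OF c, of 4, where 'a="real^'n"]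
    by simp
  from integrable_norm[OF L2_mult_integrable[OF this u]] show ?thesis
    unfolding norm_mult h damp_eq by (simp add: mult.assoc)
qed

section \<open>The equation tested against Gaussian waves\<close>

definition dfourier :: "(real^'n \<Rightarrow> complex) \<Rightarrow> real^'n \<Rightarrow> real^'n \<Rightarrow> complex" where
  "dfourier g \<xi> h = (\<integral>x. - \<i> * of_real (x \<bullet> h) * (cis (- (x \<bullet> \<xi>)) * g x) \<partial>lborel)"

lemma fourier_damp_has_derivative:
  fixes u :: "real^'n \<Rightarrow> complex"
  assumes u: "u \<in> L2" and c: "c > 0"
  shows "(fourier (damp c u) has_derivative dfourier (damp c u) \<xi>) (at \<xi>)"
    and "\<exists>D. \<forall>\<xi> h. cmod (fourier (damp c u) \<xi>) \<le> D \<and> cmod (dfourier (damp c u) \<xi> h) \<le> D * norm h"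
  using fourier_has_derivative[OF L2D(1)[OF damp_L2(1)[OF u c]] damp_moment[OF u c]]
  unfolding dfourier_def[abs_def] by blast+

lemma partial_coord_gauss_wave:
  "partial i (\<lambda>x. complex_of_real (x $ j) * gauss_wave c 0 \<xi> x)
   = (\<lambda>x. (of_real (if i = j then 1 else 0) - of_real (c * (x $ i * x $ j)) - \<i> * of_real (\<xi> $ i * x $ j)) * gauss_wave c 0 \<xi> x)"
proof -
  have d: "((\<lambda>x. complex_of_real (x $ j) * gauss_wave c 0 \<xi> x) has_derivative
     (\<lambda>h. of_real (x $ j) * ((of_real (- c * ((x - 0) \<bullet> h)) - \<i> * of_real (h \<bullet> \<xi>)) * gauss_wave c 0 \<xi> x)
        + of_real (h $ j) * gauss_wave c 0 \<xi> x)) (at x)" for x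
    by (intro has_derivative_mult gauss_wave_has_derivative has_derivative_of_real
        bounded_linear.has_derivative[OF bounded_linear_vec_nth] has_derivative_ident)
  have a: "axis i (1::real) $ j = (if i = j then 1 else 0)" by (simp add: axis_def)
  show ?thesis
    unfolding partial_def frechet_derivative_at[OF d, symmetric]
    by (intro ext) (simp add: inner_axis inner_axis' a algebra_simps)
qed

definition matrix_trace :: "real^'n^'n \<Rightarrow> real" where
  "matrix_trace A = (\<Sum>i\<in>UNIV. A $ i $ i)"

text \<open>Moving the derivatives onto x_j times the wave gives three terms: the trace from
  differentiating x_j, the form c <x, B x> from the Gaussian factor, which is the commutator of the
  drift with the damping, and the frequency term, which is the derivative of the transform along B^T
  \<xi>.\<close>

lemma drift_gauss_wave:
  fixes B :: "real^'n^'n"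
  assumes u: "u \<in> L2" and c: "c > 0"
  shows "drift B u (gauss_wave c 0 \<xi>) =
    - of_real (matrix_trace B) * fourier (damp c u) \<xi>
    + fourier (\<lambda>x. of_real (c * (x \<bullet> (B *v x))) * damp c u x) \<xi> - dfourier (damp c u) \<xi> (transpose B *v \<xi>)"
proof -
  define E where "E = gauss_wave c 0 \<xi>"
  have Eeq: "cis (- (x \<bullet> \<xi>)) * damp c u x = u x * E x" for x
    unfolding damp_def E_def mult.assoc[symmetric] cis_gauss_wave by (simp add: mult.commute)
  have pE: "integrable lborel (\<lambda>x. u x * (p x * E x))" if "cpoly p" for p
    unfolding E_def by (intro L2_mult_integrable u schwartz_L2 cpoly_exptype_schwartz that exptype_gauss_wave c)
  define t where "t i j x = (of_real (if i = j then 1 else 0) - of_real (c * (x $ i * x $ j)) - \<i> * of_real (\<xi> $ i * x $ j) :: complex)"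
    for i j :: 'n and x
  have tp: "cpoly (t i j)" for i j
  proof -
    have "cpoly (\<lambda>x. of_real (if i = j then 1 else 0) + (- of_real c) * (complex_of_real (x $ i) * complex_of_real (x $ j))
        + (- \<i> * of_real (\<xi> $ i)) * complex_of_real (x $ j))"
      by (intro cpoly.intros)
    moreover have "t i j = (\<lambda>x. of_real (if i = j then 1 else 0) + (- of_real c) * (complex_of_real (x $ i) * complex_of_real (x $ j))
        + (- \<i> * of_real (\<xi> $ i)) * complex_of_real (x $ j))"
      by (intro ext) (simp add: t_def)
    ultimately show ?thesis by simp
  qed
  define S where "S x = (\<Sum>i\<in>UNIV. \<Sum>j\<in>UNIV. of_real (B $ i $ j) * t i j x)" for x
  have Bx: "(\<Sum>i\<in>UNIV. \<Sum>j\<in>UNIV. B $ i $ j * (y $ i * x $ j)) = y \<bullet> (B *v x)" for x y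
    by (simp add: inner_vec_def matrix_vector_mult_def sum_distrib_left mult_ac)
  have S: "S x = of_real (matrix_trace B) - of_real (c * (x \<bullet> (B *v x))) - \<i> * of_real (\<xi> \<bullet> (B *v x))" for x
  proof -
    have "S x = of_real (\<Sum>i\<in>UNIV. \<Sum>j\<in>UNIV. B $ i $ j * (if i = j then 1 else 0))
       - of_real (c * (\<Sum>i\<in>UNIV. \<Sum>j\<in>UNIV. B $ i $ j * (x $ i * x $ j)))
       - \<i> * of_real (\<Sum>i\<in>UNIV. \<Sum>j\<in>UNIV. B $ i $ j * (\<xi> $ i * x $ j))"
      unfolding S_def t_def
      by (simp add: right_diff_distrib sum_subtractf sum_distrib_left mult.left_commute)
    also have "(\<Sum>i\<in>UNIV. \<Sum>j\<in>UNIV. B $ i $ j * (if i = j then 1 else 0)) = matrix_trace B"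
      by (simp add: matrix_trace_def if_distrib cong: if_cong)
    finally show ?thesis by (simp only: Bx)
  qed
  have "drift B u E = (\<Sum>i\<in>UNIV. \<Sum>j\<in>UNIV. of_real (B $ i $ j) * - (\<integral>x. u x * (t i j x * E x) \<partial>lborel))"
    unfolding drift_def distr_mult_def distr_partial_def distr_of_def E_def
      partial_coord_gauss_wave t_def ..
  also have "\<dots> = - (\<Sum>i\<in>UNIV. \<Sum>j\<in>UNIV. (\<integral>x. of_real (B $ i $ j) * (u x * (t i j x * E x)) \<partial>lborel))"
    by (simp add: sum_negf)
  also have "(\<Sum>i\<in>UNIV. \<Sum>j\<in>UNIV. (\<integral>x. of_real (B $ i $ j) * (u x * (t i j x * E x)) \<partial>lborel))
      = (\<integral>x. (\<Sum>i\<in>UNIV. \<Sum>j\<in>UNIV. of_real (B $ i $ j) * (u x * (t i j x * E x))) \<partial>lborel)"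
    by (simp add: Bochner_Integration.integral_sum integrable_sum pE tp del: integral_mult_right_zero)
  also have "\<dots> = (\<integral>x. of_real (matrix_trace B) * (u x * E x) - of_real (c * (x \<bullet> (B *v x))) * (u x * E x)
      - \<i> * of_real (\<xi> \<bullet> (B *v x)) * (u x * E x) \<partial>lborel)"
  proof (rule Bochner_Integration.integral_cong[OF refl])
    fix x
    have "(\<Sum>i\<in>UNIV. \<Sum>j\<in>UNIV. of_real (B $ i $ j) * (u x * (t i j x * E x))) = S x * (u x * E x)"
      unfolding S_def sum_distrib_right by (intro sum.cong refl) (simp only: mult_ac)
    then show "(\<Sum>i\<in>UNIV. \<Sum>j\<in>UNIV. of_real (B $ i $ j) * (u x * (t i j x * E x)))
      = of_real (matrix_trace B) * (u x * E x) - of_real (c * (x \<bullet> (B *v x))) * (u x * E x) - \<i> * of_real (\<xi> \<bullet> (B *v x)) * (u x * E x)"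
      unfolding S by (simp only: left_diff_distrib)
  qed
  also have "\<dots> = of_real (matrix_trace B) * (\<integral>x. u x * E x \<partial>lborel) - (\<integral>x. of_real (c * (x \<bullet> (B *v x))) * (u x * E x) \<partial>lborel)
      - (\<integral>x. \<i> * of_real (\<xi> \<bullet> (B *v x)) * (u x * E x) \<partial>lborel)"
  proof -
    have sums: "cpoly (\<lambda>x. \<Sum>j\<in>J. f j x)" if "finite J" "\<And>j. j \<in> J \<Longrightarrow> cpoly (f j)" for f :: "'n \<Rightarrow> real^'n \<Rightarrow> complex" and J
      using that by (induction J rule: finite_induct) (auto intro: cpoly.intros)
    have q: "cpoly (\<lambda>x. complex_of_real (c * (x \<bullet> (B *v x))))"
    proof -
      have "cpoly (\<lambda>x. of_real c * (\<Sum>i\<in>UNIV. \<Sum>j\<in>UNIV. of_real (B $ i $ j) * (complex_of_real (x $ i) * of_real (x $ j))))"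
        by (intro cpoly.mult cpoly.const cpoly.coord sums) auto
      then show ?thesis by (simp add: Bx[symmetric])
    qed
    have l: "cpoly (\<lambda>x. \<i> * complex_of_real (\<xi> \<bullet> (B *v x)))"
    proof -
      have "cpoly (\<lambda>x. \<i> * (\<Sum>i\<in>UNIV. \<Sum>j\<in>UNIV. of_real (B $ i $ j) * (of_real (\<xi> $ i) * complex_of_real (x $ j))))"
        by (intro cpoly.mult cpoly.const cpoly.coord sums) auto
      then show ?thesis by (simp add: Bx[symmetric])
    qed
    have i0: "integrable lborel (\<lambda>x. of_real (matrix_trace B) * (u x * E x))"
      using pE[OF cpoly.const[of 1]] by simp
    have i1: "integrable lborel (\<lambda>x. of_real (c * (x \<bullet> (B *v x))) * (u x * E x))"
      using pE[OF q] by (simp only: mult.left_commute)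
    have i2: "integrable lborel (\<lambda>x. \<i> * of_real (\<xi> \<bullet> (B *v x)) * (u x * E x))"
      using pE[OF l] by (simp only: mult.left_commute)
    show ?thesis
      unfolding Bochner_Integration.integral_diff[OF Bochner_Integration.integrable_diff[OF i0 i1] i2]
        Bochner_Integration.integral_diff[OF i0 i1] integral_mult_right_zero[of lborel "of_real (matrix_trace B)"] ..
  qed
  also have "(\<integral>x. u x * E x \<partial>lborel) = fourier (damp c u) \<xi>" by (simp add: fourier_damp E_def)
  also have "(\<integral>x. of_real (c * (x \<bullet> (B *v x))) * (u x * E x) \<partial>lborel)
     = fourier (\<lambda>x. of_real (c * (x \<bullet> (B *v x))) * damp c u x) \<xi>"
    unfolding fourier_def by (simp only: Eeq[symmetric] mult.left_commute)
  also have "(\<integral>x. \<i> * of_real (\<xi> \<bullet> (B *v x)) * (u x * E x) \<partial>lborel) = - dfourier (damp c u) \<xi> (transpose B *v \<xi>)"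
  proof -
    have "x \<bullet> (transpose B *v \<xi>) = \<xi> \<bullet> (B *v x)" for x
      using dot_lmul_matrix[of \<xi> B x] by (simp add: inner_commute)
    then show ?thesis unfolding dfourier_def Eeq by simp
  qed
  finally show ?thesis by (simp add: E_def)
qed

text \<open>The distributional equation evaluated on one Schwartz function for every \<xi> and
  solved for the transport term. It is a genuine pointwise identity, whatever the regularity of
  \<open>u\<close>.\<close>

lemma regularised_equation:
  fixes B Q :: "real^'n^'n"
  assumes u: "u \<in> L2" and f: "f \<in> L2" and eq: "distr_eq (frac_OU s B Q u) (distr_of f)" and c: "c > 0"
  shows "dfourier (damp c u) \<xi> (transpose B *v \<xi>) =
     1/2 * (\<integral>\<zeta>. of_real (((Q *v \<zeta>) \<bullet> \<zeta>) powr s) * fourier_L2 u \<zeta> * of_real (heat c (\<zeta> - \<xi>)) \<partial>lborel)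
     - of_real (matrix_trace B) * fourier (damp c u) \<xi>
     + fourier (\<lambda>x. of_real (c * (x \<bullet> (B *v x))) * damp c u x) \<xi> - fourier (damp c f) \<xi>"
proof -
  have "frac_OU s B Q u (gauss_wave c 0 \<xi>) = distr_of f (gauss_wave c 0 \<xi>)"
    using eq gauss_wave_schwartz[OF c, of 0 \<xi>] by (simp add: distr_eq_def)
  then show ?thesis
    unfolding frac_OU_def drift_gauss_wave[OF u c] frac_diffusion_def fourier_multiplier_def distr_inv_fourier_def
      distr_of_def inv_fourier_gauss_wave[OF c] fourier_damp[of c f]
    by (simp add: algebra_simps)
qed

lemma fourier_damp_heat:
  assumes u: "u \<in> L2" and c: "c > 0"
  shows "fourier (damp c u) \<xi> = (\<integral>\<zeta>. fourier_L2 u \<zeta> * of_real (heat c (\<zeta> - \<xi>)) \<partial>lborel)"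
  using fourier_L2_props(2)[OF u heat_schwartz[OF c, of \<xi>]]
  unfolding fourier_damp fourier_heat[OF c] .

section \<open>Integration by parts along a linear vector field\<close>

lemma tame_linear_component:
  fixes C :: "real^'n^'m"
  shows "tame 1 (\<lambda>x. (C *v x) $ i) (\<lambda>x h. (C *v h) $ i)"
proof -
  obtain a where a: "a > 0" "\<And>x. norm (C *v x) \<le> norm x * a"
    using bounded_linear.pos_bounded[OF matrix_vector_mul_bounded_linear] by metis
  have le: "\<bar>(C *v x) $ i\<bar> \<le> a * norm x" for x
    using component_le_norm_cart[of "C *v x" i] a(2)[of x] by (simp add: mult.commute)
  show ?thesis
  proof (rule tameI[of _ _ a])
    show "((\<lambda>x. (C *v x) $ i) has_derivative (\<lambda>h. (C *v h) $ i)) (at x)" for x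
      by (intro bounded_linear.has_derivative[OF bounded_linear_vec_nth]
          bounded_linear.has_derivative[OF matrix_vector_mul_bounded_linear] has_derivative_ident)
    have pos: "1 + norm x > 0" for x :: "real^'n" by (simp add: add_pos_nonneg)
    show "\<bar>(C *v x) $ i\<bar> \<le> a * (1 + norm x) powr 1" for x
      using le[of x] a pos[of x] by (simp add: distrib_left)
    show "\<bar>(C *v h) $ i\<bar> \<le> a * (1 + norm x) powr 1 * norm h" for x h :: "real^'n"
    proof -
      have "a * (1 * norm h) \<le> a * ((1 + norm x) * norm h)" using a by (intro mult_left_mono mult_right_mono) auto
      then show ?thesis using le[of h] pos[of x] by simp
    qed
  qed
qed

lemma tame_measurable: "tame p f f' \<Longrightarrow> f \<in> borel_measurable borel"
  unfolding tame_def
  by (intro borel_measurable_continuous_onI continuous_at_imp_continuous_on) (auto intro: has_derivative_continuous)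

lemma has_derivative_direction_seq:
  assumes "(f has_derivative f') (at x)"
  shows "(\<lambda>k. (f (x + inverse (real (Suc k)) *\<^sub>R e) - f x) * real (Suc k)) \<longlonglongrightarrow> (f' e :: real)"
proof -
  have "((\<lambda>t. f (x + t *\<^sub>R e)) has_derivative (\<lambda>t. f' (t *\<^sub>R e))) (at 0)"
  proof (rule has_derivative_compose[of "\<lambda>t. x + t *\<^sub>R e" "\<lambda>t. t *\<^sub>R e"])
    show "((\<lambda>t. x + t *\<^sub>R e) has_derivative (\<lambda>t. t *\<^sub>R e)) (at 0)" by (auto intro!: derivative_eq_intros)
    show "(f has_derivative f') (at (x + 0 *\<^sub>R e))" using assms by simp
  qed
  moreover have "(\<lambda>t. f' (t *\<^sub>R e)) = (*) (f' e)"
    using linear_scale[OF has_derivative_linear[OF assms]] by (intro ext) (simp add: mult.commute)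
  ultimately have "DERIV (\<lambda>t. f (x + t *\<^sub>R e)) 0 :> f' e"
    unfolding has_field_derivative_def by simp
  then have "((\<lambda>h. (f (x + h *\<^sub>R e) - f x) / h) \<longlongrightarrow> f' e) (at 0)"
    by (simp add: DERIV_def)
  moreover have "filterlim (\<lambda>k. inverse (real (Suc k))) (at 0) sequentially"
    using LIMSEQ_inverse_real_of_nat by (simp add: filterlim_at)
  ultimately have "(\<lambda>k. (f (x + inverse (real (Suc k)) *\<^sub>R e) - f x) / inverse (real (Suc k))) \<longlonglongrightarrow> f' e"
    by (rule filterlim_compose)
  then show ?thesis by (simp add: divide_inverse)
qed

text \<open>\<open>tame\<close> gives no continuity of the derivative, so measurability comes from
  its being a limit of difference quotients.\<close>

lemma tame_derivative_measurable:
  assumes "tame p f f'"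
  shows "(\<lambda>x. f' x e) \<in> borel_measurable borel"
proof (rule borel_measurable_LIMSEQ_real)
  note [measurable] = tame_measurable[OF assms]
  show "(\<lambda>x. (f (x + inverse (real (Suc k)) *\<^sub>R e) - f x) * real (Suc k)) \<in> borel_measurable borel" for k
    by measurable
  show "(\<lambda>k. (f (x + inverse (real (Suc k)) *\<^sub>R e) - f x) * real (Suc k)) \<longlonglongrightarrow> f' x e" for x
    using assms by (intro has_derivative_direction_seq) (simp add: tame_def)
qed

lemma tame_integrable:
  fixes f :: "'a::euclidean_space \<Rightarrow> real"
  assumes f: "tame p f f'" and p: "p \<le> - 2 * real DIM('a)"
  shows "integrable lborel f" "integrable lborel (\<lambda>x. f' x e)"
proof -
  obtain C where C: "C \<ge> 1" "\<And>x. \<bar>f x\<bar> \<le> C * (1 + norm x) powr p" "\<And>x h. \<bar>f' x h\<bar> \<le> C * (1 + norm x) powr p * norm h"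
    using f unfolding tame_def by blast
  have i: "integrable lborel (\<lambda>x::'a. C * (1 + norm x) powr p)" by (intro integrable_mult_right integrable_decay p)
  show "integrable lborel f"
    by (rule Bochner_Integration.integrable_bound[OF i]) (use C tame_measurable[OF f] in \<open>auto simp: abs_mult\<close>)
  show "integrable lborel (\<lambda>x. f' x e)"
    by (rule Bochner_Integration.integrable_bound[OF integrable_mult_left[OF i, of "norm e"]])
      (use C tame_derivative_measurable[OF f] in \<open>auto simp: abs_mult\<close>)
qed

text \<open>Difference quotients integrate to 0 by translation invariance; the mean value theorem
  bounds them by the decay of the derivative at a nearby point, which permits dominated
  convergence.\<close>

lemma integral_directional_derivative_eq_0:
  fixes f :: "'a::euclidean_space \<Rightarrow> real"
  assumes f: "tame p f f'" and p: "p \<le> - 2 * real DIM('a)" and e: "norm e = 1"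
  shows "(\<integral>x. f' x e \<partial>lborel) = 0"
proof -
  obtain C where C: "C \<ge> 1" "\<And>x. (f has_derivative f' x) (at x)" "\<And>x h. \<bar>f' x h\<bar> \<le> C * (1 + norm x) powr p * norm h"
    using f unfolding tame_def by blast
  note [measurable] = tame_measurable[OF f]
  let ?q = "\<lambda>k x. (f (x + inverse (real (Suc k)) *\<^sub>R e) - f x) * real (Suc k)"
  have bound: "\<bar>?q k x\<bar> \<le> C * 2 powr (- p) * (1 + norm x) powr p" for k x
  proof -
    define t where "t = inverse (real (Suc k))"
    have t: "t > 0" "t \<le> 1" by (auto simp: t_def divide_simps)
    have d: "DERIV (\<lambda>\<tau>. f (x + \<tau> *\<^sub>R e)) \<tau> :> f' (x + \<tau> *\<^sub>R e) e" for \<tau>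
    proof -
      have "((\<lambda>\<tau>. f (x + \<tau> *\<^sub>R e)) has_derivative (\<lambda>h. f' (x + \<tau> *\<^sub>R e) (h *\<^sub>R e))) (at \<tau>)"
      proof (rule has_derivative_compose[of "\<lambda>\<tau>. x + \<tau> *\<^sub>R e" "\<lambda>h. h *\<^sub>R e"])
        show "((\<lambda>\<tau>. x + \<tau> *\<^sub>R e) has_derivative (\<lambda>h. h *\<^sub>R e)) (at \<tau>)" by (auto intro!: derivative_eq_intros)
      qed (rule C(2))
      moreover have "f' (x + \<tau> *\<^sub>R e) (h *\<^sub>R e) = f' (x + \<tau> *\<^sub>R e) e * h" for h
        using linear_scale[OF has_derivative_linear[OF C(2)]] by simp
      ultimately show ?thesis unfolding has_field_derivative_def by simp
    qed
    obtain z where z: "0 < z" "z < t" "f (x + t *\<^sub>R e) - f (x + 0 *\<^sub>R e) = (t - 0) * f' (x + z *\<^sub>R e) e"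
      using MVT2[of 0 t "\<lambda>\<tau>. f (x + \<tau> *\<^sub>R e)" "\<lambda>\<tau>. f' (x + \<tau> *\<^sub>R e) e"] t(1) d by blast
    have "?q k x = (t * f' (x + z *\<^sub>R e) e) * real (Suc k)" using z(3) by (simp add: t_def)
    also have "\<dots> = f' (x + z *\<^sub>R e) e" by (simp add: t_def)
    finally have "\<bar>?q k x\<bar> \<le> C * (1 + norm (x + z *\<^sub>R e)) powr p" using C(3)[of "x + z *\<^sub>R e" e] e by simp
    \<comment> \<open>A shift by at most one changes 1 + |x| by at most a factor 2, and p is
      negative, so the decay at the intermediate point passes to \<open>x\<close>.\<close>
    also have "(1 + norm (x + z *\<^sub>R e)) powr p \<le> ((1 + norm x) / 2) powr p"
    proof (rule powr_mono2')
      have aux: "(1 + n) / 2 \<le> 1 + m" if "n \<le> m + k" "k \<le> 1" "0 \<le> m" for n m k :: real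
        using that by (simp add: field_simps)
      show "(1 + norm x) / 2 \<le> 1 + norm (x + z *\<^sub>R e)"
      proof (rule aux)
        show "norm x \<le> norm (x + z *\<^sub>R e) + norm (z *\<^sub>R e)"
          using norm_triangle_ineq4[of "x + z *\<^sub>R e" "z *\<^sub>R e"] by simp
        have "norm (z *\<^sub>R e) = \<bar>z\<bar>" using e by simp
        then show "norm (z *\<^sub>R e) \<le> 1" using z(1,2) t(2) by simp
      qed simp
      show "0 < (1 + norm x) / 2" by (simp add: add_pos_nonneg)
      have "0 \<le> real DIM('a)" by simp
      then show "p \<le> 0" using p by linarith
    qed
    also have "((1 + norm x) / 2) powr p = 2 powr (- p) * (1 + norm x) powr p"
      unfolding powr_minus_divide by (subst powr_divide) simp_all
    finally show ?thesis using C(1) by (simp add: mult.assoc)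
  qed
  have "(\<lambda>k. \<integral>x. ?q k x \<partial>lborel) \<longlonglongrightarrow> (\<integral>x. f' x e \<partial>lborel)"
  proof (rule integral_dominated_convergence[where w="\<lambda>x. C * 2 powr (- p) * (1 + norm x) powr p"])
    show "(\<lambda>x. f' x e) \<in> borel_measurable lborel" using tame_derivative_measurable[OF f] by simp
    show "(\<lambda>x. ?q k x) \<in> borel_measurable lborel" for k by measurable
    show "integrable lborel (\<lambda>x::'a. C * 2 powr (- p) * (1 + norm x) powr p)" by (intro integrable_mult_right integrable_decay p)
    show "AE x in lborel. (\<lambda>k. ?q k x) \<longlonglongrightarrow> f' x e"
      by (intro AE_I2 has_derivative_direction_seq C)
    show "AE x in lborel. norm (?q k x) \<le> C * 2 powr (- p) * (1 + norm x) powr p" for k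
      using bound by (intro AE_I2) simp
  qed
  moreover have "(\<integral>x. ?q k x \<partial>lborel) = 0" for k
  proof -
    have fi: "integrable lborel f" by (rule tame_integrable(1)[OF f p])
    have "(\<integral>x. f (x + inverse (real (Suc k)) *\<^sub>R e) - f x \<partial>lborel) = 0"
      by (subst Bochner_Integration.integral_diff[OF lborel_integrable_shift[OF fi] fi])
        (simp add: lborel_integral_shift)
    then show ?thesis by (subst integral_mult_left_zero) simp
  qed
  ultimately show ?thesis by (simp add: LIMSEQ_const_iff)
qed

text \<open>The divergence of f times the field C x is tr C f + f' (C x). Each component (C x)_i
  raises the growth of f by one power, hence the additional 1 in the decay required.\<close>

lemma divergence_linear_field:
  fixes f :: "real^'n \<Rightarrow> real" and C :: "real^'n^'n"
  assumes f: "tame p f f'" and p: "p \<le> - 2 * real CARD('n) - 1"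
  shows "integrable lborel f" "integrable lborel (\<lambda>x. f' x (C *v x))"
    and "(\<integral>x. f' x (C *v x) \<partial>lborel) = - matrix_trace C * (\<integral>x. f x \<partial>lborel)"
proof -
  have fi: "integrable lborel f" by (rule tame_integrable(1)[OF f]) (use p in simp)
  then show "integrable lborel f" .
  have lin: "linear (f' x)" for x using f by (auto simp: tame_def intro: has_derivative_linear)
  define G' where "G' i x h = (C *v h) $ i * f x + (C *v x) $ i * f' x h" for i x h
  have G: "tame (1 + p) (\<lambda>x. (C *v x) $ i * f x) (G' i)" for i
    using tame_mult[OF tame_linear_component f] unfolding G'_def[abs_def] .
  have p1: "1 + p \<le> - 2 * real DIM(real^'n)" using p by simp
  have e: "norm (axis i (1::real) :: real^'n) = 1" for i by simp
  have zero: "(\<integral>x. G' i x (axis i 1) \<partial>lborel) = 0" for i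
    by (rule integral_directional_derivative_eq_0[OF G p1 e])
  have Gi: "integrable lborel (\<lambda>x. G' i x (axis i 1))" for i by (rule tame_integrable(2)[OF G p1])
  have sum: "(\<Sum>i\<in>UNIV. G' i x (axis i 1)) = matrix_trace C * f x + f' x (C *v x)" for x
  proof -
    have "(C *v axis i 1) $ i = C $ i $ i" for i
      by (simp add: matrix_vector_mult_basis column_def)
    then have "(\<Sum>i\<in>UNIV. G' i x (axis i 1)) = matrix_trace C * f x + (\<Sum>i\<in>UNIV. (C *v x) $ i * f' x (axis i 1))"
      by (simp add: G'_def sum.distrib matrix_trace_def sum_distrib_right)
    also have "(\<Sum>i\<in>UNIV. (C *v x) $ i * f' x (axis i 1)) = f' x (\<Sum>i\<in>UNIV. (C *v x) $ i *\<^sub>R axis i 1)"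
      by (simp add: linear_sum[OF lin] linear_scale[OF lin])
    also have "(\<Sum>i\<in>UNIV. (C *v x) $ i *\<^sub>R axis i 1) = C *v x"
      by (simp add: vec_eq_iff axis_def if_distrib cong: if_cong)
    finally show ?thesis .
  qed
  have si: "integrable lborel (\<lambda>x. matrix_trace C * f x + f' x (C *v x))"
    unfolding sum[symmetric] by (intro Bochner_Integration.integrable_sum Gi)
  have "integrable lborel (\<lambda>x. (matrix_trace C * f x + f' x (C *v x)) - matrix_trace C * f x)"
    by (intro Bochner_Integration.integrable_diff si integrable_mult_right fi)
  then show f'i: "integrable lborel (\<lambda>x. f' x (C *v x))" by simp
  have "(\<integral>x. matrix_trace C * f x + f' x (C *v x) \<partial>lborel) = 0"
    unfolding sum[symmetric] by (subst Bochner_Integration.integral_sum) (auto simp: zero Gi)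
  then show "(\<integral>x. f' x (C *v x) \<partial>lborel) = - matrix_trace C * (\<integral>x. f x \<partial>lborel)"
    by (subst (asm) Bochner_Integration.integral_add) (use fi f'i in auto)
qed

text \<open>A negative power of 1 + \<delta> |x|^2. Along a linear field |<x, C x>| is at most a
  multiple of |x|^2, so the relative change is bounded by a constant that does not depend on
  \<delta>. For each fixed \<delta> it decays fast enough to control the multiplier and the
  symbol.\<close>

lemma cutoff_exists:
  fixes C :: "real^'n^'n"
  assumes N: "N \<ge> 0"
  shows "\<exists>\<omega> \<omega>' b. (\<forall>j. tame (- N) (\<omega> j) (\<omega>' j)) \<and> (\<forall>j x. 0 < \<omega> j x \<and> \<omega> j x \<le> 1) \<and>
    (\<forall>j x. \<bar>\<omega>' j x (C *v x)\<bar> \<le> b * \<omega> j x) \<and> b \<ge> 0 \<and>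
    (\<forall>x. (\<lambda>j::nat. \<omega> j x) \<longlonglongrightarrow> 1)"
proof -
  define \<delta> where "\<delta> j = inverse (real (Suc j))" for j
  define l where "l j x = 1 + \<delta> j * (x \<bullet> x)" for j and x :: "real^'n"
  define \<omega> where "\<omega> j x = l j x powr (- N / 2)" for j and x :: "real^'n"
  define \<omega>' where "\<omega>' j x h = (- N / 2) * l j x powr (- N / 2 - 1) * (\<delta> j * (h \<bullet> x + x \<bullet> h))" for j and x h :: "real^'n"
  have \<delta>: "0 < \<delta> j" "\<delta> j \<le> 1" for j by (auto simp: \<delta>_def divide_simps)
  have l1: "1 \<le> l j x" for j x using \<delta>[of j] by (simp add: l_def)
  have l0: "0 < l j x" for j x using l1[of j x] by linarith
  obtain a where a: "a > 0" "\<And>x. norm (C *v x) \<le> norm x * a"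
    using bounded_linear.pos_bounded[OF matrix_vector_mul_bounded_linear] by metis
  have \<omega>'_abs: "\<bar>\<omega>' j x h\<bar> = N * (\<delta> j * \<bar>x \<bullet> h\<bar> / l j x) * \<omega> j x" for j x h
    using N \<delta>[of j] l0[of j x] by (simp add: \<omega>'_def \<omega>_def powr_diff abs_mult inner_commute)
  have tame: "tame (- N) (\<omega> j) (\<omega>' j)" for j
  proof (rule tameI[of _ _ "(\<delta> j / 2) powr (- N / 2) * (1 + N)"])
    fix x h :: "real^'n"
    have dl: "(l j has_derivative (\<lambda>h. \<delta> j * (h \<bullet> x + x \<bullet> h))) (at x)"
      unfolding l_def[abs_def] by (auto intro!: derivative_eq_intros simp: algebra_simps)
    show "(\<omega> j has_derivative \<omega>' j x) (at x)"
      using has_derivative_powr[OF dl has_derivative_const[of "- N / 2"] l0[of j x]] l0[of j x]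
      unfolding \<omega>_def[abs_def] \<omega>'_def[abs_def] by (simp add: powr_diff mult_ac)
    have low: "\<delta> j / 2 * (1 + norm x)\<^sup>2 \<le> l j x"
    proof -
      have "(1 + norm x)\<^sup>2 \<le> 2 + 2 * (norm x)\<^sup>2" using sum_squares_bound[of 1 "norm x"] by (simp add: power2_sum)
      then have "\<delta> j / 2 * (1 + norm x)\<^sup>2 \<le> \<delta> j / 2 * (2 + 2 * (norm x)\<^sup>2)" using \<delta>[of j] by (intro mult_left_mono) auto
      also have "\<dots> = \<delta> j + \<delta> j * (norm x)\<^sup>2" by (simp add: algebra_simps)
      also have "\<dots> \<le> l j x" using \<delta>(2)[of j] by (simp add: l_def power2_norm_eq_inner)
      finally show ?thesis .
    qed
    have pos: "1 + norm x > 0" by (simp add: add_pos_nonneg)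
    have "\<omega> j x \<le> (\<delta> j / 2 * (1 + norm x)\<^sup>2) powr (- N / 2)"
      unfolding \<omega>_def using low \<delta>(1)[of j] pos N by (intro powr_mono2') auto
    also have "\<dots> = (\<delta> j / 2) powr (- N / 2) * ((1 + norm x)\<^sup>2) powr (- N / 2)" by (rule powr_mult)
    also have "((1 + norm x)\<^sup>2) powr (- N / 2) = (1 + norm x) powr (- N)"
      using pos by (simp add: powr_numeral[symmetric] powr_powr del: powr_numeral)
    finally have \<omega>_le: "\<omega> j x \<le> (\<delta> j / 2) powr (- N / 2) * (1 + norm x) powr (- N)" .
    have \<omega>0: "\<omega> j x \<ge> 0" by (simp add: \<omega>_def)
    have "\<omega> j x * 1 \<le> ((\<delta> j / 2) powr (- N / 2) * (1 + norm x) powr (- N)) * (1 + N)"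
      using \<omega>_le N \<omega>0 by (intro mult_mono) auto
    then show "\<bar>\<omega> j x\<bar> \<le> (\<delta> j / 2) powr (- N / 2) * (1 + N) * (1 + norm x) powr (- N)"
      using \<omega>0 by (simp add: mult_ac)
    have "\<delta> j * \<bar>x \<bullet> h\<bar> \<le> \<delta> j * (norm x * norm h)" using \<delta>(1)[of j] by (intro mult_left_mono Cauchy_Schwarz_ineq2) auto
    also have "\<dots> \<le> l j x * norm h"
    proof -
      have "norm x \<le> 1 + (norm x)\<^sup>2" using sum_squares_bound[of 1 "norm x"] norm_ge_zero[of x] by (simp del: norm_ge_zero) 
      then have "\<delta> j * norm x \<le> \<delta> j * (1 + (norm x)\<^sup>2)" using \<delta>(1)[of j] by (intro mult_left_mono) auto
      also have "\<dots> \<le> l j x" using \<delta>(2)[of j] by (simp add: l_def power2_norm_eq_inner distrib_left)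
      finally have "\<delta> j * norm x * norm h \<le> l j x * norm h" by (rule mult_right_mono) simp
      then show ?thesis by (simp add: mult.assoc)
    qed
    finally have "\<delta> j * \<bar>x \<bullet> h\<bar> / l j x \<le> norm h" using l0[of j x] by (simp add: pos_divide_le_eq mult.commute)
    then have "\<bar>\<omega>' j x h\<bar> \<le> N * norm h * \<omega> j x"
      unfolding \<omega>'_abs using N \<omega>0 by (intro mult_right_mono mult_left_mono) auto
    also have "\<dots> \<le> (1 + N) * norm h * ((\<delta> j / 2) powr (- N / 2) * (1 + norm x) powr (- N))"
      using \<omega>_le N \<omega>0 by (intro mult_mono) auto
    finally show "\<bar>\<omega>' j x h\<bar> \<le> (\<delta> j / 2) powr (- N / 2) * (1 + N) * (1 + norm x) powr (- N) * norm h"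
      by (simp add: mult_ac)
  qed
  have dir: "\<bar>\<omega>' j x (C *v x)\<bar> \<le> (N * a) * \<omega> j x" for j x
  proof -
    have "\<bar>x \<bullet> (C *v x)\<bar> \<le> norm x * (norm x * a)"
      by (rule order_trans[OF Cauchy_Schwarz_ineq2 mult_left_mono[OF a(2)]]) simp
    then have "\<delta> j * \<bar>x \<bullet> (C *v x)\<bar> \<le> \<delta> j * (norm x * (norm x * a))" using \<delta>(1)[of j] by (intro mult_left_mono) auto
    also have "\<dots> = (\<delta> j * (x \<bullet> x)) * a" by (simp add: power2_norm_eq_inner[symmetric] power2_eq_square)
    also have "\<dots> \<le> l j x * a" using a by (intro mult_right_mono) (auto simp: l_def)
    finally have "\<delta> j * \<bar>x \<bullet> (C *v x)\<bar> / l j x \<le> a" using l0[of j x] by (simp add: pos_divide_le_eq mult.commute)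
    then show ?thesis unfolding \<omega>'_abs using N by (intro mult_right_mono mult_left_mono) (auto simp: \<omega>_def)
  qed
  have lim: "(\<lambda>j. \<omega> j x) \<longlonglongrightarrow> 1" for x
  proof -
    have "(\<lambda>j. l j x) \<longlonglongrightarrow> 1 + 0 * (x \<bullet> x)"
      unfolding l_def \<delta>_def by (intro tendsto_add tendsto_const tendsto_mult_right LIMSEQ_inverse_real_of_nat)
    then have "(\<lambda>j. l j x powr (- N / 2)) \<longlonglongrightarrow> (1 + 0 * (x \<bullet> x)) powr (- N / 2)" by (intro tendsto_powr tendsto_const) auto
    then show ?thesis by (simp add: \<omega>_def)
  qed
  have "\<omega> j x \<le> 1" for j x
  proof -
    have "l j x powr (- N / 2) \<le> l j x powr 0" using l1[of j x] N by (intro powr_mono) auto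
    then show ?thesis using l0[of j x] by (simp add: \<omega>_def)
  qed
  moreover have "0 < \<omega> j x" for j x using l0[of j x] by (simp add: \<omega>_def)
  ultimately show ?thesis using tame dir lim N a
    by (intro exI[of _ \<omega>] exI[of _ \<omega>'] exI[of _ "N * a"]) auto
qed

section \<open>The commutator and the energy estimate\<close>

text \<open>Peetre's inequality: it separates growth at the base point, left to the cutoff, from
  growth in the displacement, left to the heat kernel.\<close>

lemma one_plus_norm_le: "1 + norm (x::'a::real_normed_vector) \<le> (1 + norm y) * (1 + norm (x - y))"
proof -
  have "norm x \<le> norm y + norm (x - y)" using norm_triangle_ineq[of y "x - y"] by simp
  moreover have "0 \<le> norm y * norm (x - y)" by simp
  moreover have "(1 + norm y) * (1 + norm (x - y)) = 1 + norm y + norm (x - y) + norm y * norm (x - y)"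
    by (simp add: algebra_simps)
  ultimately show ?thesis by linarith
qed

lemma heat_nn_integral: "c > 0 \<Longrightarrow> (\<integral>\<^sup>+y. ennreal (heat c (y - x)) \<partial>lborel) = 1"
proof -
  assume c: "c > 0"
  have "(\<integral>\<^sup>+y. ennreal (heat c (y - x)) \<partial>lborel) = ennreal (\<integral>y. heat c (y - x) \<partial>lborel)"
    using lborel_integrable_shift[OF integrable_heat[OF c], of "- x"]
    by (intro nn_integral_eq_integral) (auto simp: heat_nonneg[OF c])
  also have "(\<integral>y. heat c (y - x) \<partial>lborel) = 1"
    using lborel_integral_shift[of "heat c" "- x"] integral_heat[OF c, where 'a='a] by simp
  finally show ?thesis by simp
qed

text \<open>Cauchy-Schwarz against a density of mass one, with the density split into two square
  roots.\<close>

lemma heat_Jensen: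
  fixes g :: "'a::euclidean_space \<Rightarrow> complex"
  assumes [measurable]: "g \<in> borel_measurable borel" and c: "c > 0"
  shows "ennreal ((cmod (\<integral>y. g y * of_real (heat c (y - x)) \<partial>lborel))\<^sup>2) \<le> (\<integral>\<^sup>+y. ennreal ((cmod (g y))\<^sup>2 * heat c (y - x)) \<partial>lborel)"
proof -
  have h0: "heat c (y - x) \<ge> 0" for y by (rule heat_nonneg[OF c])
  have "ennreal (cmod (\<integral>y. g y * of_real (heat c (y - x)) \<partial>lborel)) \<le> (\<integral>\<^sup>+y. ennreal (cmod (g y * of_real (heat c (y - x)))) \<partial>lborel)"
    by (rule norm_integral_le_nn_integral)
  also have "\<dots> = (\<integral>\<^sup>+y. ennreal (cmod (g y) * sqrt (heat c (y - x))) * ennreal (sqrt (heat c (y - x))) \<partial>lborel)"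
  proof (rule nn_integral_cong)
    fix y
    have "sqrt (heat c (y - x)) * sqrt (heat c (y - x)) = heat c (y - x)" using h0[of y] by simp
    then show "ennreal (cmod (g y * of_real (heat c (y - x)))) = ennreal (cmod (g y) * sqrt (heat c (y - x))) * ennreal (sqrt (heat c (y - x)))"
      using h0[of y] by (subst ennreal_mult[symmetric]) (auto simp: norm_mult mult.assoc)
  qed
  finally have "ennreal (cmod (\<integral>y. g y * of_real (heat c (y - x)) \<partial>lborel)) ^ 2
    \<le> (\<integral>\<^sup>+y. ennreal (cmod (g y) * sqrt (heat c (y - x))) * ennreal (sqrt (heat c (y - x))) \<partial>lborel)\<^sup>2"
    by (intro power_mono) auto
  also have "\<dots> \<le> (\<integral>\<^sup>+y. (ennreal (cmod (g y) * sqrt (heat c (y - x))))\<^sup>2 \<partial>lborel) * (\<integral>\<^sup>+y. (ennreal (sqrt (heat c (y - x))))\<^sup>2 \<partial>lborel)"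
    by (rule Cauchy_Schwarz_nn_integral) measurable
  also have "(\<integral>\<^sup>+y. (ennreal (sqrt (heat c (y - x))))\<^sup>2 \<partial>lborel) = 1"
    using h0 heat_nn_integral[OF c, of x] by (simp add: ennreal_power)
  also have "(\<integral>\<^sup>+y. (ennreal (cmod (g y) * sqrt (heat c (y - x))))\<^sup>2 \<partial>lborel) = (\<integral>\<^sup>+y. ennreal ((cmod (g y))\<^sup>2 * heat c (y - x)) \<partial>lborel)"
    using h0 by (intro nn_integral_cong) (simp add: ennreal_power power_mult_distrib)
  finally show ?thesis by (simp add: ennreal_power)
qed

text \<open>The commutator is the heat average of (q \<zeta> - q \<xi>) v \<zeta>. Jensen's
  inequality and Tonelli reduce its weighted norm to the integral of |v|^2 against
  \<open>M c\<close>, the heat average over \<xi> of (\<omega> \<xi> (q \<zeta> - q \<xi>))^2. This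
  function is bounded uniformly in c <= 1 and tends to 0 pointwise, so dominated convergence
  applies.\<close>

lemma commutator_tendsto:
  fixes v :: "real^'n \<Rightarrow> complex" and q \<omega> :: "real^'n \<Rightarrow> real"
  assumes v: "v \<in> L2" and q: "continuous_on UNIV q" and \<omega>: "continuous_on UNIV \<omega>"
    and q_le: "\<And>x. \<bar>q x\<bar> \<le> a * (1 + norm x) ^ m" and \<omega>_le: "\<And>x. \<bar>\<omega> x\<bar> * (1 + norm x) ^ m \<le> b"
  defines "\<rho> \<equiv> \<lambda>c \<xi>. (\<integral>\<zeta>. of_real (q \<zeta>) * v \<zeta> * of_real (heat c (\<zeta> - \<xi>)) \<partial>lborel)
     - of_real (q \<xi>) * (\<integral>\<zeta>. v \<zeta> * of_real (heat c (\<zeta> - \<xi>)) \<partial>lborel)"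
  shows "c > 0 \<Longrightarrow> \<rho> c \<in> borel_measurable borel"
    and "(\<lambda>k. \<integral>\<^sup>+\<xi>. ennreal ((\<omega> \<xi> * cmod (\<rho> (inverse (real (Suc k))) \<xi>))\<^sup>2) \<partial>lborel) \<longlonglongrightarrow> 0"
proof -
  have [measurable]: "q \<in> borel_measurable borel" "\<omega> \<in> borel_measurable borel"
    using q \<omega> by (auto intro: borel_measurable_continuous_onI)
  note [measurable] = L2D(1)[OF v]
  have m1: "(\<lambda>\<xi>. \<integral>\<zeta>. of_real (q \<zeta>) * v \<zeta> * of_real (heat c (\<zeta> - \<xi>)) \<partial>lborel) \<in> borel_measurable lborel" for c
    by (rule lborel.borel_measurable_lebesgue_integral) measurable
  have m2: "(\<lambda>\<xi>. \<integral>\<zeta>. v \<zeta> * of_real (heat c (\<zeta> - \<xi>)) \<partial>lborel) \<in> borel_measurable lborel" for c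
    by (rule lborel.borel_measurable_lebesgue_integral) measurable
  show "\<rho> c \<in> borel_measurable borel" if "c > 0" for c
    using m1[of c] m2[of c] unfolding \<rho>_def by simp
  have a0: "a \<ge> 0" using q_le[of 0] by simp
  have b0: "b \<ge> 0" using \<omega>_le[of 0] abs_ge_zero[of "\<omega> 0"] by simp
  have pw1: "1 \<le> (1 + norm x) ^ m" for x :: "real^'n" by (intro one_le_power) simp
  have \<omega>b: "\<bar>\<omega> x\<bar> \<le> b" for x
    using mult_left_mono[OF pw1[of x], of "\<bar>\<omega> x\<bar>"] \<omega>_le[of x] by simp
  define K where "K \<zeta> \<xi> = (\<omega> \<xi> * (q \<zeta> - q \<xi>))\<^sup>2" for \<zeta> \<xi>
  have K0: "K \<zeta> \<xi> \<ge> 0" for \<zeta> \<xi> by (simp add: K_def)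
  have [measurable]: "(\<lambda>(\<zeta>, \<xi>). K \<zeta> \<xi>) \<in> borel_measurable (borel \<Otimes>\<^sub>M borel)" "\<And>\<zeta>. K \<zeta> \<in> borel_measurable borel"
    unfolding K_def by measurable
  have q_split: "\<bar>q \<zeta>\<bar> \<le> a * (1 + norm \<xi>) ^ m * (1 + norm (\<zeta> - \<xi>)) ^ m" for \<zeta> \<xi>
  proof -
    have "(1 + norm \<zeta>) ^ m \<le> ((1 + norm \<xi>) * (1 + norm (\<zeta> - \<xi>))) ^ m" by (intro power_mono one_plus_norm_le) auto
    then have "a * (1 + norm \<zeta>) ^ m \<le> a * ((1 + norm \<xi>) ^ m * (1 + norm (\<zeta> - \<xi>)) ^ m)"
      unfolding power_mult_distrib using a0 by (rule mult_left_mono)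
    then show ?thesis using q_le[of \<zeta>] by (simp add: mult.assoc)
  qed
  \<comment> \<open>The bound that is uniform in \<zeta>: the cutoff at \<xi> consumes the growth of
    q there, and what remains grows only in the displacement, which \<open>heat 1\<close>
    integrates.\<close>
  have K_le: "K \<zeta> \<xi> \<le> (2 * a * b)\<^sup>2 * (1 + norm (\<zeta> - \<xi>)) ^ (2 * m)" for \<zeta> \<xi>
  proof -
    have "\<bar>q \<zeta> - q \<xi>\<bar> \<le> a * (1 + norm \<xi>) ^ m * (1 + norm (\<zeta> - \<xi>)) ^ m + a * (1 + norm \<xi>) ^ m * 1"
      using q_split[of \<zeta> \<xi>] q_le[of \<xi>] by simp
    also have "\<dots> \<le> a * (1 + norm \<xi>) ^ m * (1 + norm (\<zeta> - \<xi>)) ^ m + a * (1 + norm \<xi>) ^ m * (1 + norm (\<zeta> - \<xi>)) ^ m"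
      using a0 pw1 by (intro add_left_mono mult_left_mono) auto
    finally have "\<bar>q \<zeta> - q \<xi>\<bar> \<le> 2 * a * (1 + norm \<xi>) ^ m * (1 + norm (\<zeta> - \<xi>)) ^ m" by simp
    then have "\<bar>\<omega> \<xi>\<bar> * \<bar>q \<zeta> - q \<xi>\<bar> \<le> \<bar>\<omega> \<xi>\<bar> * (2 * a * (1 + norm \<xi>) ^ m * (1 + norm (\<zeta> - \<xi>)) ^ m)"
      by (intro mult_left_mono) auto
    also have "\<dots> = (\<bar>\<omega> \<xi>\<bar> * (1 + norm \<xi>) ^ m) * (2 * a * (1 + norm (\<zeta> - \<xi>)) ^ m)" by (simp only: mult_ac)
    also have "\<dots> \<le> b * (2 * a * (1 + norm (\<zeta> - \<xi>)) ^ m)" using a0 by (intro mult_right_mono \<omega>_le) auto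
    finally have "\<bar>\<omega> \<xi> * (q \<zeta> - q \<xi>)\<bar> \<le> 2 * a * b * (1 + norm (\<zeta> - \<xi>)) ^ m" by (simp add: abs_mult mult_ac)
    then have "\<bar>\<omega> \<xi> * (q \<zeta> - q \<xi>)\<bar>\<^sup>2 \<le> (2 * a * b * (1 + norm (\<zeta> - \<xi>)) ^ m)\<^sup>2" by (rule power_mono) simp
    then show ?thesis by (simp add: K_def power_mult_distrib power_mult[symmetric] mult.commute[of m])
  qed
  \<comment> \<open>A second bound, uniform in \<xi> but not in \<zeta>: the convergence of heat
    averages at a fixed \<zeta> requires a bounded function.\<close>
  have K_bdd: "\<bar>K \<zeta> \<xi>\<bar> \<le> (b * \<bar>q \<zeta>\<bar> + b * a)\<^sup>2" for \<zeta> \<xi>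
  proof -
    have "\<bar>\<omega> \<xi> * (q \<zeta> - q \<xi>)\<bar> \<le> \<bar>\<omega> \<xi>\<bar> * \<bar>q \<zeta>\<bar> + \<bar>\<omega> \<xi>\<bar> * \<bar>q \<xi>\<bar>"
      using abs_triangle_ineq4[of "\<omega> \<xi> * q \<zeta>" "\<omega> \<xi> * q \<xi>"] by (simp add: abs_mult right_diff_distrib)
    also have "\<bar>\<omega> \<xi>\<bar> * \<bar>q \<zeta>\<bar> \<le> b * \<bar>q \<zeta>\<bar>" by (intro mult_right_mono \<omega>b) auto
    also have "\<bar>\<omega> \<xi>\<bar> * \<bar>q \<xi>\<bar> \<le> b * a"
    proof -
      have "\<bar>\<omega> \<xi>\<bar> * \<bar>q \<xi>\<bar> \<le> \<bar>\<omega> \<xi>\<bar> * (a * (1 + norm \<xi>) ^ m)" by (intro mult_left_mono q_le) auto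
      also have "\<dots> = (\<bar>\<omega> \<xi>\<bar> * (1 + norm \<xi>) ^ m) * a" by (simp only: mult_ac)
      also have "\<dots> \<le> b * a" using a0 by (intro mult_right_mono \<omega>_le)
      finally show ?thesis .
    qed
    finally have "\<bar>\<omega> \<xi> * (q \<zeta> - q \<xi>)\<bar>\<^sup>2 \<le> (b * \<bar>q \<zeta>\<bar> + b * a)\<^sup>2" by (intro power_mono) auto
    then show ?thesis by (simp add: K_def)
  qed
  have K_cont: "continuous_on UNIV (K \<zeta>)" for \<zeta>
    unfolding K_def by (intro continuous_intros q \<omega>)
  define D where "D = (\<integral>y. (2 * a * b)\<^sup>2 * (1 + norm y) ^ (2 * m) * heat 1 (y::real^'n) \<partial>lborel)"
  have Di: "integrable lborel (\<lambda>y. (2 * a * b)\<^sup>2 * (1 + norm y) ^ (2 * m) * heat 1 (y::real^'n))"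
  proof -
    have "integrable lborel (\<lambda>y::real^'n. ((2 * a * b)\<^sup>2 * (1 / sqrt (2 * pi * 1)) ^ DIM(real^'n)) * ((1 + norm y) ^ (2 * m) * exp (- (1/2) * (norm y)\<^sup>2)))"
      by (intro integrable_mult_right integrable_poly_gaussian) simp
    then show ?thesis unfolding heat_def by (simp add: mult_ac)
  qed
  define M where "M c \<zeta> = (\<integral>\<xi>. K \<zeta> \<xi> * heat c (\<zeta> - \<xi>) \<partial>lborel)" for c \<zeta>
  have Ki: "integrable lborel (\<lambda>\<xi>. K \<zeta> \<xi> * heat c (\<zeta> - \<xi>))" if c: "c > 0" for c \<zeta>
  proof (rule Bochner_Integration.integrable_bound)
    show "integrable lborel (\<lambda>\<xi>. (b * \<bar>q \<zeta>\<bar> + b * a)\<^sup>2 * heat c (\<xi> - \<zeta>))"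
      using lborel_integrable_shift[OF integrable_heat[OF c], of "- \<zeta>"] by simp
    show "AE \<xi> in lborel. norm (K \<zeta> \<xi> * heat c (\<zeta> - \<xi>)) \<le> norm ((b * \<bar>q \<zeta>\<bar> + b * a)\<^sup>2 * heat c (\<xi> - \<zeta>))"
      using K_bdd[of \<zeta>] by (intro AE_I2) (auto simp: abs_mult heat_symmetric[of c \<zeta>] intro!: mult_right_mono)
  qed measurable
  have M_le: "M c \<zeta> \<le> D" if c: "c > 0" "c \<le> 1" for c \<zeta>
  proof -
    have "M c \<zeta> = (\<integral>y. K \<zeta> (\<zeta> + sqrt c *\<^sub>R y) * heat 1 y \<partial>lborel)"
      unfolding M_def by (rule heat_average[OF c(1)]) measurable
    also have "\<dots> \<le> D" unfolding D_def
    proof (rule integral_mono')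
      show "K \<zeta> (\<zeta> + sqrt c *\<^sub>R y) * heat 1 y \<le> (2 * a * b)\<^sup>2 * (1 + norm y) ^ (2 * m) * heat 1 y" for y
      proof (rule mult_right_mono)
        have "norm (\<zeta> - (\<zeta> + sqrt c *\<^sub>R y)) = sqrt c * norm y" using c by simp
        also have "\<dots> \<le> 1 * norm y" using c by (intro mult_right_mono) auto
        finally have "(1 + norm (\<zeta> - (\<zeta> + sqrt c *\<^sub>R y))) ^ (2 * m) \<le> (1 + norm y) ^ (2 * m)" by (intro power_mono) auto
        then have "(2 * a * b)\<^sup>2 * (1 + norm (\<zeta> - (\<zeta> + sqrt c *\<^sub>R y))) ^ (2 * m) \<le> (2 * a * b)\<^sup>2 * (1 + norm y) ^ (2 * m)"
          by (intro mult_left_mono) auto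
        then show "K \<zeta> (\<zeta> + sqrt c *\<^sub>R y) \<le> (2 * a * b)\<^sup>2 * (1 + norm y) ^ (2 * m)"
          using K_le order_trans by blast
      qed (rule heat_nonneg, simp)
      show "0 \<le> (2 * a * b)\<^sup>2 * (1 + norm y) ^ (2 * m) * heat 1 y" for y
        by (intro mult_nonneg_nonneg heat_nonneg) auto
    qed (rule Di)
    finally show ?thesis .
  qed
  have M0: "M c \<zeta> \<ge> 0" if "c > 0" for c \<zeta>
    unfolding M_def using heat_nonneg[OF that] K0 by (intro integral_nonneg_AE AE_I2 mult_nonneg_nonneg)
  \<comment> \<open>The average concentrates at \<xi> = \<zeta>, where the continuous function
    \<open>K \<zeta>\<close> vanishes.\<close>
  have M_lim: "(\<lambda>k. M (inverse (real (Suc k))) \<zeta>) \<longlonglongrightarrow> 0" for \<zeta>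
    using heat_average_tendsto[OF K_cont K_bdd, of \<zeta> \<zeta>] by (simp add: M_def K_def)
  have M_meas: "M c \<in> borel_measurable borel" for c
  proof -
    have "(\<lambda>\<zeta>. \<integral>\<xi>. K \<zeta> \<xi> * heat c (\<zeta> - \<xi>) \<partial>lborel) \<in> borel_measurable lborel"
      by (rule lborel.borel_measurable_lebesgue_integral) measurable
    then show ?thesis by (simp add: M_def[abs_def])
  qed
  have bound: "(\<integral>\<^sup>+\<xi>. ennreal ((\<omega> \<xi> * cmod (\<rho> c \<xi>))\<^sup>2) \<partial>lborel) \<le> (\<integral>\<^sup>+\<zeta>. ennreal ((cmod (v \<zeta>))\<^sup>2 * M c \<zeta>) \<partial>lborel)"
    if c: "c > 0" for c
  proof -
    have pt: "ennreal ((\<omega> \<xi> * cmod (\<rho> c \<xi>))\<^sup>2) \<le> (\<integral>\<^sup>+\<zeta>. ennreal ((cmod (v \<zeta>))\<^sup>2) * ennreal (K \<zeta> \<xi> * heat c (\<zeta> - \<xi>)) \<partial>lborel)" for \<xi>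
    proof -
      have hL2: "(\<lambda>\<zeta>. of_real (heat c (\<zeta> - \<xi>))) \<in> L2" by (rule schwartz_L2[OF heat_schwartz[OF c]])
      have qL2: "(\<lambda>\<zeta>. complex_of_real (q \<zeta> * heat c (\<zeta> - \<xi>))) \<in> L2"
      proof -
        let ?Z = "(1 / sqrt (2 * pi * c)) ^ DIM(real^'n)"
        have "integrable lborel (\<lambda>y::real^'n. ((a * (1 + norm \<xi>) ^ m)\<^sup>2 * ?Z\<^sup>2) * ((1 + norm y) ^ (2 * m) * exp (- (1 / c) * (norm y)\<^sup>2)))"
          using c by (intro integrable_mult_right integrable_poly_gaussian) simp
        from lborel_integrable_shift[OF this, of "- \<xi>"]
        have i: "integrable lborel (\<lambda>\<zeta>. ((a * (1 + norm \<xi>) ^ m)\<^sup>2 * ?Z\<^sup>2) * ((1 + norm (\<zeta> - \<xi>)) ^ (2 * m) * exp (- (1 / c) * (norm (\<zeta> - \<xi>))\<^sup>2)))" by simp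
        have le: "(cmod (complex_of_real (q \<zeta> * heat c (\<zeta> - \<xi>))))\<^sup>2 \<le> ((a * (1 + norm \<xi>) ^ m)\<^sup>2 * ?Z\<^sup>2) * ((1 + norm (\<zeta> - \<xi>)) ^ (2 * m) * exp (- (1 / c) * (norm (\<zeta> - \<xi>))\<^sup>2))" for \<zeta>
        proof -
          have "(cmod (complex_of_real (q \<zeta> * heat c (\<zeta> - \<xi>))))\<^sup>2 = \<bar>q \<zeta>\<bar>\<^sup>2 * (heat c (\<zeta> - \<xi>))\<^sup>2"
            unfolding norm_of_real by (simp add: power_mult_distrib)
          also have "\<dots> \<le> (a * (1 + norm \<xi>) ^ m * (1 + norm (\<zeta> - \<xi>)) ^ m)\<^sup>2 * (heat c (\<zeta> - \<xi>))\<^sup>2"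
            by (intro mult_right_mono power_mono q_split) auto
          also have "(heat c (\<zeta> - \<xi>))\<^sup>2 = ?Z\<^sup>2 * exp (- (1 / c) * (norm (\<zeta> - \<xi>))\<^sup>2)"
          proof -
            have "(exp (- (norm (\<zeta> - \<xi>))\<^sup>2 / (2 * c)))\<^sup>2 = exp (- (1 / c) * (norm (\<zeta> - \<xi>))\<^sup>2)"
              using c by (simp add: power2_eq_square[of "exp _"] exp_add[symmetric])
            then show ?thesis unfolding heat_def power_mult_distrib by simp
          qed
          also have "(a * (1 + norm \<xi>) ^ m * (1 + norm (\<zeta> - \<xi>)) ^ m)\<^sup>2 = (a * (1 + norm \<xi>) ^ m)\<^sup>2 * (1 + norm (\<zeta> - \<xi>)) ^ (2 * m)"
            by (simp only: power_mult_distrib[of _ _ 2] power_mult[symmetric] mult.commute[of m])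
          finally show ?thesis by (simp only: mult_ac)
        qed
        have "integrable lborel (\<lambda>\<zeta>. (cmod (complex_of_real (q \<zeta> * heat c (\<zeta> - \<xi>))))\<^sup>2)"
          by (rule Bochner_Integration.integrable_bound[OF i])
            (use le in \<open>auto intro!: AE_I2 order_trans[OF _ abs_ge_self] simp del: of_real_mult\<close>)
        then show ?thesis by (simp add: L2_def)
      qed
      have i1: "integrable lborel (\<lambda>\<zeta>. of_real (q \<zeta>) * v \<zeta> * of_real (heat c (\<zeta> - \<xi>)))"
        using L2_mult_integrable[OF v qL2] by (simp add: mult_ac)
      have i2: "integrable lborel (\<lambda>\<zeta>. of_real (q \<xi>) * (v \<zeta> * of_real (heat c (\<zeta> - \<xi>))))"
        by (intro integrable_mult_right L2_mult_integrable[OF v hL2])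
      have "\<rho> c \<xi> = (\<integral>\<zeta>. of_real (q \<zeta>) * v \<zeta> * of_real (heat c (\<zeta> - \<xi>)) - of_real (q \<xi>) * (v \<zeta> * of_real (heat c (\<zeta> - \<xi>))) \<partial>lborel)"
        unfolding Bochner_Integration.integral_diff[OF i1 i2] \<rho>_def by simp
      also have "\<dots> = (\<integral>\<zeta>. (of_real (q \<zeta> - q \<xi>) * v \<zeta>) * of_real (heat c (\<zeta> - \<xi>)) \<partial>lborel)"
        by (intro Bochner_Integration.integral_cong) (auto simp: algebra_simps)
      finally have \<rho>: "\<rho> c \<xi> = (\<integral>\<zeta>. (of_real (q \<zeta> - q \<xi>) * v \<zeta>) * of_real (heat c (\<zeta> - \<xi>)) \<partial>lborel)" .
      have "ennreal ((cmod (\<rho> c \<xi>))\<^sup>2) \<le> (\<integral>\<^sup>+\<zeta>. ennreal ((cmod (of_real (q \<zeta> - q \<xi>) * v \<zeta>))\<^sup>2 * heat c (\<zeta> - \<xi>)) \<partial>lborel)"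
        unfolding \<rho> by (rule heat_Jensen[OF _ c]) measurable
      then have "ennreal ((\<omega> \<xi>)\<^sup>2) * ennreal ((cmod (\<rho> c \<xi>))\<^sup>2) \<le> ennreal ((\<omega> \<xi>)\<^sup>2) * (\<integral>\<^sup>+\<zeta>. ennreal ((cmod (of_real (q \<zeta> - q \<xi>) * v \<zeta>))\<^sup>2 * heat c (\<zeta> - \<xi>)) \<partial>lborel)"
        by (intro mult_left_mono) auto
      also have "\<dots> = (\<integral>\<^sup>+\<zeta>. ennreal ((\<omega> \<xi>)\<^sup>2) * ennreal ((cmod (of_real (q \<zeta> - q \<xi>) * v \<zeta>))\<^sup>2 * heat c (\<zeta> - \<xi>)) \<partial>lborel)"
        by (rule nn_integral_cmult[symmetric]) measurable
      also have "\<dots> = (\<integral>\<^sup>+\<zeta>. ennreal ((cmod (v \<zeta>))\<^sup>2) * ennreal (K \<zeta> \<xi> * heat c (\<zeta> - \<xi>)) \<partial>lborel)"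
      proof (rule nn_integral_cong)
        fix \<zeta>
        have "(cmod (of_real (q \<zeta> - q \<xi>) * v \<zeta>))\<^sup>2 = (q \<zeta> - q \<xi>)\<^sup>2 * (cmod (v \<zeta>))\<^sup>2"
          unfolding norm_mult norm_of_real power_mult_distrib power2_abs ..
        then have "(\<omega> \<xi>)\<^sup>2 * ((cmod (of_real (q \<zeta> - q \<xi>) * v \<zeta>))\<^sup>2 * heat c (\<zeta> - \<xi>)) = (cmod (v \<zeta>))\<^sup>2 * (K \<zeta> \<xi> * heat c (\<zeta> - \<xi>))"
          unfolding K_def power_mult_distrib by (simp only: mult_ac)
        then show "ennreal ((\<omega> \<xi>)\<^sup>2) * ennreal ((cmod (of_real (q \<zeta> - q \<xi>) * v \<zeta>))\<^sup>2 * heat c (\<zeta> - \<xi>))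
          = ennreal ((cmod (v \<zeta>))\<^sup>2) * ennreal (K \<zeta> \<xi> * heat c (\<zeta> - \<xi>))"
          by (metis ennreal_mult' zero_le_power2)
      qed
      finally show ?thesis by (simp add: power_mult_distrib ennreal_mult)
    qed
    have "(\<integral>\<^sup>+\<xi>. ennreal ((\<omega> \<xi> * cmod (\<rho> c \<xi>))\<^sup>2) \<partial>lborel)
      \<le> (\<integral>\<^sup>+\<xi>. \<integral>\<^sup>+\<zeta>. ennreal ((cmod (v \<zeta>))\<^sup>2) * ennreal (K \<zeta> \<xi> * heat c (\<zeta> - \<xi>)) \<partial>lborel \<partial>lborel)"
      by (intro nn_integral_mono pt)
    also have "\<dots> = (\<integral>\<^sup>+\<zeta>. \<integral>\<^sup>+\<xi>. ennreal ((cmod (v \<zeta>))\<^sup>2) * ennreal (K \<zeta> \<xi> * heat c (\<zeta> - \<xi>)) \<partial>lborel \<partial>lborel)"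
      by (rule lborel_pair.Fubini') measurable
    also have "\<dots> = (\<integral>\<^sup>+\<zeta>. ennreal ((cmod (v \<zeta>))\<^sup>2 * M c \<zeta>) \<partial>lborel)"
    proof (rule nn_integral_cong)
      fix \<zeta>
      have "(\<integral>\<^sup>+\<xi>. ennreal ((cmod (v \<zeta>))\<^sup>2) * ennreal (K \<zeta> \<xi> * heat c (\<zeta> - \<xi>)) \<partial>lborel)
         = ennreal ((cmod (v \<zeta>))\<^sup>2) * (\<integral>\<^sup>+\<xi>. ennreal (K \<zeta> \<xi> * heat c (\<zeta> - \<xi>)) \<partial>lborel)"
        by (rule nn_integral_cmult) measurable
      also have "(\<integral>\<^sup>+\<xi>. ennreal (K \<zeta> \<xi> * heat c (\<zeta> - \<xi>)) \<partial>lborel) = ennreal (M c \<zeta>)"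
        unfolding M_def by (intro nn_integral_eq_integral Ki c AE_I2 mult_nonneg_nonneg K0 heat_nonneg)
      finally show "(\<integral>\<^sup>+\<xi>. ennreal ((cmod (v \<zeta>))\<^sup>2) * ennreal (K \<zeta> \<xi> * heat c (\<zeta> - \<xi>)) \<partial>lborel) = ennreal ((cmod (v \<zeta>))\<^sup>2 * M c \<zeta>)"
        using M0[OF c] by (simp add: ennreal_mult)
    qed
    finally show ?thesis .
  qed
  have "(\<lambda>k. \<integral>\<^sup>+\<zeta>. ennreal ((cmod (v \<zeta>))\<^sup>2 * M (inverse (real (Suc k))) \<zeta>) \<partial>lborel) \<longlonglongrightarrow> (\<integral>\<^sup>+\<zeta>. 0 \<partial>(lborel :: (real^'n) measure))"
  proof (rule nn_integral_dominated_convergence[where w="\<lambda>\<zeta>. ennreal ((cmod (v \<zeta>))\<^sup>2 * D)"])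
    note [measurable] = M_meas
    show "(\<lambda>\<zeta>. ennreal ((cmod (v \<zeta>))\<^sup>2 * M (inverse (real (Suc k))) \<zeta>)) \<in> borel_measurable lborel" for k by measurable
    show "(\<integral>\<^sup>+\<zeta>. ennreal ((cmod (v \<zeta>))\<^sup>2 * D) \<partial>lborel) < \<infinity>"
    proof -
      have "D \<ge> 0" using M0[of 1 0] M_le[of 1 0] by simp
      then show ?thesis using L2D(2)[OF v] by (subst nn_integral_eq_integral) auto
    qed
    show "AE \<zeta> in lborel. ennreal ((cmod (v \<zeta>))\<^sup>2 * M (inverse (real (Suc k))) \<zeta>) \<le> ennreal ((cmod (v \<zeta>))\<^sup>2 * D)" for k
      by (intro AE_I2 ennreal_leI mult_left_mono M_le) (auto simp: divide_simps)
    show "AE \<zeta> in lborel. (\<lambda>k. ennreal ((cmod (v \<zeta>))\<^sup>2 * M (inverse (real (Suc k))) \<zeta>)) \<longlonglongrightarrow> 0"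
    proof (rule AE_I2)
      fix \<zeta>
      have "(\<lambda>k. (cmod (v \<zeta>))\<^sup>2 * M (inverse (real (Suc k))) \<zeta>) \<longlonglongrightarrow> 0"
        using tendsto_mult_left[OF M_lim[of \<zeta>], of "(cmod (v \<zeta>))\<^sup>2"] by simp
      then show "(\<lambda>k. ennreal ((cmod (v \<zeta>))\<^sup>2 * M (inverse (real (Suc k))) \<zeta>)) \<longlonglongrightarrow> 0"
        using tendsto_ennrealI by fastforce
    qed
  qed measurable
  then have lim: "(\<lambda>k. \<integral>\<^sup>+\<zeta>. ennreal ((cmod (v \<zeta>))\<^sup>2 * M (inverse (real (Suc k))) \<zeta>) \<partial>lborel) \<longlonglongrightarrow> 0" by simp
  show "(\<lambda>k. \<integral>\<^sup>+\<xi>. ennreal ((\<omega> \<xi> * cmod (\<rho> (inverse (real (Suc k))) \<xi>))\<^sup>2) \<partial>lborel) \<longlonglongrightarrow> 0"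
  proof (rule tendsto_sandwich[OF always_eventually always_eventually tendsto_const lim])
    show "\<forall>k. (\<integral>\<^sup>+\<xi>. ennreal ((\<omega> \<xi> * cmod (\<rho> (inverse (real (Suc k))) \<xi>))\<^sup>2) \<partial>lborel)
       \<le> (\<integral>\<^sup>+\<zeta>. ennreal ((cmod (v \<zeta>))\<^sup>2 * M (inverse (real (Suc k))) \<zeta>) \<partial>lborel)"
      by (intro allI bound) simp
  qed simp
qed

text \<open>The divergence of M \<omega>^2 |w|^2 times the field integrates to 0, while coercivity
  bounds it below by c0 M^2 \<omega>^2 |w|^2 up to terms at most linear in M. Young's inequality
  spends a quarter of the gain on the trace and the cutoff and a quarter on the source; half of it
  is left.\<close>

lemma energy_estimate:
  fixes C :: "real^'n^'n" and w :: "real^'n \<Rightarrow> complex"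
  assumes M: "tame p M M'" "p \<ge> 0" "\<And>x. M x > 0" and c0: "c0 > 0" and D: "D \<ge> 0"
    and coercive: "\<And>x. c0 * (M x)\<^sup>2 - D \<le> M' x (C *v x) + M x * q x"
    and \<omega>: "tame (- N) \<omega> \<omega>'" "\<And>x. 0 < \<omega> x" "\<And>x. \<omega> x \<le> 1" "\<And>x. \<bar>\<omega>' x (C *v x)\<bar> \<le> b * \<omega> x"
    and N: "N \<ge> p + 2 * real CARD('n) + 1"
    and w: "\<And>x. (w has_derivative w' x) (at x)" "\<And>x. cmod (w x) \<le> E" "\<And>x h. cmod (w' x h) \<le> E * norm h" "w \<in> L2"
    and eq: "\<And>x. w' x (C *v x) = of_real (q x / 2) * w x + \<eta> x"
    and \<eta>: "integrable lborel (\<lambda>x. (\<omega> x * cmod (\<eta> x))\<^sup>2)"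
  shows "(\<integral>x. (\<omega> x * M x * cmod (w x))\<^sup>2 \<partial>lborel)
    \<le> 2 / c0 * ((D + (2 * b + \<bar>matrix_trace C\<bar>)\<^sup>2 / c0) * (\<integral>x. (cmod (w x))\<^sup>2 \<partial>lborel)
        + 4 / c0 * (\<integral>x. (\<omega> x * cmod (\<eta> x))\<^sup>2 \<partial>lborel))"
proof -
  let ?T = "matrix_trace C"
  define W where "W x = w x \<bullet> w x" for x
  define W' where "W' x h = w x \<bullet> w' x h + w' x h \<bullet> w x" for x h
  have E0: "E \<ge> 0" using w(2)[of 0] norm_ge_zero order_trans by blast
  have W: "W x = (cmod (w x))\<^sup>2" for x by (simp add: W_def power2_norm_eq_inner)
  have "tame 0 W W'"
  proof (rule tameI[of _ _ "2 * E * E"])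
    show "(W has_derivative W' x) (at x)" for x
      unfolding W_def[abs_def] W'_def[abs_def] by (intro has_derivative_inner w)
    have pos: "1 + norm x \<noteq> 0" for x :: "real^'n" using norm_ge_zero[of x] by linarith
    show "\<bar>W x\<bar> \<le> 2 * E * E * (1 + norm x) powr 0" for x
    proof -
      have "(cmod (w x))\<^sup>2 \<le> E\<^sup>2" by (intro power_mono w) auto
      also have "E\<^sup>2 \<le> 2 * E * E" using E0 by (simp add: power2_eq_square)
      finally show ?thesis using pos[of x] by (simp add: W)
    qed
    show "\<bar>W' x h\<bar> \<le> 2 * E * E * (1 + norm x) powr 0 * norm h" for x h :: "real^'n"
    proof -
      have "\<bar>w x \<bullet> w' x h\<bar> \<le> cmod (w x) * cmod (w' x h)" by (rule Cauchy_Schwarz_ineq2)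
      also have "\<dots> \<le> E * (E * norm h)" using E0 by (intro mult_mono w) auto
      finally show ?thesis using pos[of x] by (simp add: W'_def inner_commute)
    qed
  qed
  note W_tame = this
  \<comment> \<open>The cutoff enters squared, so that the result is quadratic in \<omega> M w and
    the source appears as \<omega> times \<open>\<eta>\<close>.\<close>
  define F where "F x = M x * (\<omega> x * \<omega> x) * W x" for x
  define F' where "F' x h = (M' x h * (\<omega> x * \<omega> x) + M x * (\<omega>' x h * \<omega> x + \<omega> x * \<omega>' x h)) * W x + M x * (\<omega> x * \<omega> x) * W' x h" for x h
  have "tame (p + (- N + - N) + 0) F F'"
    unfolding F_def[abs_def] F'_def[abs_def] by (intro tame_mult M \<omega> W_tame)
  then have F: "tame (p - 2 * N) F F'" by (simp add: algebra_simps)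
  have p1: "p - 2 * N \<le> - 2 * real CARD('n) - 1" using N M(2) by simp
  note div = divergence_linear_field[OF F p1]
  have G: "integrable lborel (\<lambda>x. (\<omega> x * M x * cmod (w x))\<^sup>2)"
  proof -
    have "tame ((- N + p) + (- N + p) + 0) (\<lambda>x. (\<omega> x * M x) * (\<omega> x * M x) * W x)
      (\<lambda>x h. ((\<omega>' x h * M x + \<omega> x * M' x h) * (\<omega> x * M x) + (\<omega> x * M x) * (\<omega>' x h * M x + \<omega> x * M' x h)) * W x + (\<omega> x * M x) * (\<omega> x * M x) * W' x h)"
      by (intro tame_mult M \<omega> W_tame)
    from tame_integrable(1)[OF this] show ?thesis
      using N M(2) by (simp add: W power_mult_distrib power2_eq_square mult_ac)
  qed
  have wi: "integrable lborel (\<lambda>x. (cmod (w x))\<^sup>2)" by (rule L2D(2)[OF w(4)])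
  define D' where "D' = D + (2 * b + \<bar>?T\<bar>)\<^sup>2 / c0"
  have D'0: "D' \<ge> 0" using D c0 by (simp add: D'_def)
  have pointwise: "c0 / 2 * (\<omega> x * M x * cmod (w x))\<^sup>2
      \<le> F' x (C *v x) + ?T * F x + D' * (cmod (w x))\<^sup>2 + 4 / c0 * (\<omega> x * cmod (\<eta> x))\<^sup>2" for x
  proof -
    define m where "m = M x"
    define y where "y = \<omega> x"
    define n where "n = cmod (w x)"
    define e where "e = cmod (\<eta> x)"
    have pos: "m > 0" "y > 0" "y \<le> 1" "n \<ge> 0" "e \<ge> 0" using M(3) \<omega>(2,3) by (auto simp: m_def y_def n_def e_def)
    \<comment> \<open>Differentiating |w|^2 doubles the factor q / 2 of the equation, which yields
      exactly the M q term of the coercivity hypothesis.\<close>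
    have W'x: "W' x (C *v x) = q x * n\<^sup>2 + 2 * (w x \<bullet> \<eta> x)"
    proof -
      have "w' x (C *v x) = (q x / 2) *\<^sub>R w x + \<eta> x" by (simp only: eq scaleR_conv_of_real)
      then show ?thesis
        unfolding W'_def n_def power2_norm_eq_inner by (simp add: inner_add_left inner_add_right inner_commute)
    qed
    have we: "\<bar>w x \<bullet> \<eta> x\<bar> \<le> n * e" unfolding n_def e_def by (rule Cauchy_Schwarz_ineq2)
    have "F' x (C *v x) + ?T * F x = (M' x (C *v x) + m * q x) * (y\<^sup>2 * n\<^sup>2) + 2 * m * y * \<omega>' x (C *v x) * n\<^sup>2
        + 2 * m * y\<^sup>2 * (w x \<bullet> \<eta> x) + ?T * m * y\<^sup>2 * n\<^sup>2"
      unfolding F'_def F_def W'x W m_def[symmetric] y_def[symmetric] n_def[symmetric]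
      by (simp add: power2_eq_square algebra_simps)
    moreover have "(M' x (C *v x) + m * q x) * (y\<^sup>2 * n\<^sup>2) \<ge> (c0 * m\<^sup>2 - D) * (y\<^sup>2 * n\<^sup>2)"
      using coercive[of x] by (intro mult_right_mono) (auto simp: m_def)
    moreover have "2 * m * y * \<omega>' x (C *v x) * n\<^sup>2 \<ge> - (2 * b * m * (y\<^sup>2 * n\<^sup>2))"
    proof -
      have "- (b * y) \<le> \<omega>' x (C *v x)" using \<omega>(4)[of x] by (simp add: y_def abs_le_iff)
      then have "(2 * m * y * n\<^sup>2) * - (b * y) \<le> (2 * m * y * n\<^sup>2) * \<omega>' x (C *v x)"
        using pos(1,2) by (intro mult_left_mono) auto
      then show ?thesis by (simp add: power2_eq_square mult_ac)
    qed
    moreover have "2 * m * y\<^sup>2 * (w x \<bullet> \<eta> x) \<ge> - (2 * m * y\<^sup>2 * (n * e))"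
    proof -
      have ge: "- (n * e) \<le> w x \<bullet> \<eta> x" using we by linarith
      have "0 \<le> 2 * m * y\<^sup>2" using pos(1) by simp
      from mult_left_mono[OF ge this] show ?thesis unfolding mult_minus_right .
    qed
    moreover have "?T * m * y\<^sup>2 * n\<^sup>2 \<ge> - (\<bar>?T\<bar> * m * (y\<^sup>2 * n\<^sup>2))"
    proof -
      have ge: "- \<bar>?T\<bar> \<le> ?T" by simp
      have "0 \<le> m * (y\<^sup>2 * n\<^sup>2)" using pos(1) by simp
      from mult_right_mono[OF ge this] show ?thesis unfolding mult_minus_left mult.assoc .
    qed
    moreover have "(c0 * m\<^sup>2 - D - (2 * b + \<bar>?T\<bar>) * m) * (y\<^sup>2 * n\<^sup>2)
        = (c0 * m\<^sup>2 - D) * (y\<^sup>2 * n\<^sup>2) - 2 * b * m * (y\<^sup>2 * n\<^sup>2) - \<bar>?T\<bar> * m * (y\<^sup>2 * n\<^sup>2)"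
      by (simp only: left_diff_distrib distrib_right diff_diff_eq)
    ultimately have 1: "F' x (C *v x) + ?T * F x \<ge> (c0 * m\<^sup>2 - D - (2 * b + \<bar>?T\<bar>) * m) * (y\<^sup>2 * n\<^sup>2) - 2 * m * y\<^sup>2 * (n * e)"
      by linarith
    \<comment> \<open>Both inequalities \<open>2\<close> and \<open>3\<close> are Young's inequality
      in the form of a completed square, each with the share c0 / 4.\<close>
    have 2: "(2 * b + \<bar>?T\<bar>) * m \<le> c0 / 4 * m\<^sup>2 + (2 * b + \<bar>?T\<bar>)\<^sup>2 / c0"
    proof -
      have "c0 / 4 * m\<^sup>2 + (2 * b + \<bar>?T\<bar>)\<^sup>2 / c0 - (2 * b + \<bar>?T\<bar>) * m = (c0 * m - 2 * (2 * b + \<bar>?T\<bar>))\<^sup>2 / (4 * c0)"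
        using c0 by (simp add: power2_eq_square field_simps)
      also have "\<dots> \<ge> 0" using c0 by simp
      finally show ?thesis by simp
    qed
    have 3: "2 * m * (n * e) \<le> c0 / 4 * m\<^sup>2 * n\<^sup>2 + 4 / c0 * e\<^sup>2"
    proof -
      have "c0 / 4 * m\<^sup>2 * n\<^sup>2 + 4 / c0 * e\<^sup>2 - 2 * m * (n * e) = (c0 * m * n - 4 * e)\<^sup>2 / (4 * c0)"
        using c0 by (simp add: power2_eq_square field_simps)
      also have "\<dots> \<ge> 0" using c0 by simp
      finally show ?thesis by simp
    qed
    define Z where "Z = y\<^sup>2 * n\<^sup>2"
    define P where "P = m\<^sup>2 * Z"
    have Z0: "Z \<ge> 0" by (simp add: Z_def)
    have "(2 * b + \<bar>?T\<bar>) * m * Z \<le> (c0 / 4 * m\<^sup>2 + (2 * b + \<bar>?T\<bar>)\<^sup>2 / c0) * Z"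
      by (rule mult_right_mono[OF 2 Z0])
    then have "(2 * b + \<bar>?T\<bar>) * m * Z \<le> c0 / 4 * P + (2 * b + \<bar>?T\<bar>)\<^sup>2 / c0 * Z"
      by (simp only: distrib_right P_def mult.assoc)
    moreover have "2 * m * y\<^sup>2 * (n * e) \<le> c0 / 4 * P + 4 / c0 * (e\<^sup>2 * y\<^sup>2)"
    proof -
      have "2 * m * (n * e) * y\<^sup>2 \<le> (c0 / 4 * m\<^sup>2 * n\<^sup>2 + 4 / c0 * e\<^sup>2) * y\<^sup>2" by (rule mult_right_mono[OF 3]) simp
      also have "\<dots> = c0 / 4 * P + 4 / c0 * (e\<^sup>2 * y\<^sup>2)" unfolding P_def Z_def distrib_right by (simp only: mult_ac)
      finally show ?thesis by (simp only: mult_ac)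
    qed
    moreover have "(c0 * m\<^sup>2 - D - (2 * b + \<bar>?T\<bar>) * m) * Z = c0 * P - D * Z - (2 * b + \<bar>?T\<bar>) * m * Z"
      unfolding P_def left_diff_distrib mult.assoc ..
    moreover have "D' * Z = D * Z + (2 * b + \<bar>?T\<bar>)\<^sup>2 / c0 * Z" unfolding D'_def distrib_right ..
    ultimately have "F' x (C *v x) + ?T * F x \<ge> c0 / 2 * P - D' * Z - 4 / c0 * (e\<^sup>2 * y\<^sup>2)"
      using 1[folded Z_def] by linarith
    moreover have "D' * Z \<le> D' * n\<^sup>2"
    proof (rule mult_left_mono[OF _ D'0])
      have "y\<^sup>2 * n\<^sup>2 \<le> 1 * n\<^sup>2" using pos(2,3) by (intro mult_right_mono power_le_one) auto
      then show "Z \<le> n\<^sup>2" by (simp add: Z_def)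
    qed
    moreover have "(y * m * n)\<^sup>2 = P" "(y * e)\<^sup>2 = e\<^sup>2 * y\<^sup>2"
      unfolding P_def Z_def power_mult_distrib by (simp_all only: mult_ac)
    ultimately show ?thesis
      unfolding m_def[symmetric] y_def[symmetric] n_def[symmetric] e_def[symmetric] by simp
  qed
  \<comment> \<open>After integration the sum of the derivative of \<open>F\<close> along the field
    and the trace term vanishes, which leaves only the error terms.\<close>
  have "c0 / 2 * (\<integral>x. (\<omega> x * M x * cmod (w x))\<^sup>2 \<partial>lborel) = (\<integral>x. c0 / 2 * (\<omega> x * M x * cmod (w x))\<^sup>2 \<partial>lborel)" by simp
  also have "\<dots> \<le> (\<integral>x. F' x (C *v x) + ?T * F x + D' * (cmod (w x))\<^sup>2 + 4 / c0 * (\<omega> x * cmod (\<eta> x))\<^sup>2 \<partial>lborel)"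
    by (intro integral_mono pointwise Bochner_Integration.integrable_add integrable_mult_right G div wi \<eta>)
  also have "\<dots> = (\<integral>x. F' x (C *v x) \<partial>lborel) + ?T * (\<integral>x. F x \<partial>lborel) + D' * (\<integral>x. (cmod (w x))\<^sup>2 \<partial>lborel)
      + 4 / c0 * (\<integral>x. (\<omega> x * cmod (\<eta> x))\<^sup>2 \<partial>lborel)"
    using div(1,2) wi \<eta> by (simp add: Bochner_Integration.integral_add)
  also have "(\<integral>x. F' x (C *v x) \<partial>lborel) = - ?T * (\<integral>x. F x \<partial>lborel)" by (rule div(3))
  finally have "c0 / 2 * (\<integral>x. (\<omega> x * M x * cmod (w x))\<^sup>2 \<partial>lborel)
     \<le> D' * (\<integral>x. (cmod (w x))\<^sup>2 \<partial>lborel) + 4 / c0 * (\<integral>x. (\<omega> x * cmod (\<eta> x))\<^sup>2 \<partial>lborel)" by simp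
  then have "2 / c0 * (c0 / 2 * (\<integral>x. (\<omega> x * M x * cmod (w x))\<^sup>2 \<partial>lborel))
     \<le> 2 / c0 * (D' * (\<integral>x. (cmod (w x))\<^sup>2 \<partial>lborel) + 4 / c0 * (\<integral>x. (\<omega> x * cmod (\<eta> x))\<^sup>2 \<partial>lborel))"
    using c0 by (intro mult_left_mono) auto
  then show ?thesis using c0 by (simp add: D'_def)
qed

section \<open>The weighted estimate\<close>

text \<open>The commutator of the drift with the damping: c |x|^2 exp (- c |x|^2 / 2) is at most 1
  for every c > 0, so this term is bounded by \<beta> |u| uniformly in c.\<close>

lemma fourier_damped_quadratic:
  fixes B :: "real^'n^'n"
  assumes u: "u \<in> L2" and c: "c > 0" and \<beta>: "\<And>x. norm (B *v x) \<le> norm x * \<beta>"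
  defines "g \<equiv> \<lambda>x. of_real (c * (x \<bullet> (B *v x))) * damp c u x"
  shows "fourier g \<in> L2"
    and "(\<integral>x. (cmod (fourier g x))\<^sup>2 \<partial>lborel) \<le> (2 * pi) ^ CARD('n) * (\<beta>\<^sup>2 * (\<integral>x. (cmod (u x))\<^sup>2 \<partial>lborel))"
proof -
  note [measurable] = L2D(1)[OF u] L2D(1)[OF damp_L2(1)[OF u c]]
  have [measurable]: "(\<lambda>x. x \<bullet> (B *v x)) \<in> borel_measurable borel"
    by (intro borel_measurable_continuous_onI continuous_intros
        linear_continuous_on[OF matrix_vector_mul_bounded_linear])
  have g_meas: "g \<in> borel_measurable borel" unfolding g_def by measurable
  have quad: "\<bar>x \<bullet> (B *v x)\<bar> \<le> \<beta> * (norm x)\<^sup>2" for x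
  proof -
    have "\<bar>x \<bullet> (B *v x)\<bar> \<le> norm x * (norm x * \<beta>)"
      by (rule order_trans[OF Cauchy_Schwarz_ineq2 mult_left_mono[OF \<beta>]]) simp
    then show ?thesis by (simp add: power2_eq_square mult_ac)
  qed
  have \<beta>0: "\<beta> \<ge> 0"
  proof -
    have "0 \<le> norm (axis undefined (1::real) :: real^'n) * \<beta>" using \<beta> norm_ge_zero order_trans by blast
    then show ?thesis by simp
  qed
  \<comment> \<open>From t <= (1 + t/4)^2, whose difference is the square (1 - t/4)^2, and 1 + t/4
    <= exp (t/4).\<close>
  have exp_le: "t * exp (- (t / 2)) \<le> 1" if t: "t \<ge> 0" for t :: real
  proof -
    have "t \<le> (1 + t / 4)\<^sup>2"
    proof -
      have "(1 + t / 4)\<^sup>2 - t = (1 - t / 4)\<^sup>2" by (simp add: power2_eq_square field_simps)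
      then show ?thesis using zero_le_power2[of "1 - t / 4"] by linarith
    qed
    also have "\<dots> \<le> (exp (t / 4))\<^sup>2" using t exp_ge_add_one_self[of "t / 4"] by (intro power_mono) auto
    also have "\<dots> = exp (t / 2)" by (simp add: power2_eq_square exp_add[symmetric])
    finally have "t * exp (- (t / 2)) \<le> exp (t / 2) * exp (- (t / 2))" by (rule mult_right_mono) simp
    then show ?thesis by (simp add: exp_add[symmetric])
  qed
  have g_le: "cmod (g x) \<le> \<beta> * cmod (u x)" for x
  proof -
    have "cmod (g x) = \<bar>x \<bullet> (B *v x)\<bar> * (c * exp (- (c / 2) * (norm x)\<^sup>2) * cmod (u x))"
      unfolding g_def damp_eq norm_mult norm_of_real using c by (simp add: abs_mult)
    also have "\<dots> \<le> (\<beta> * (norm x)\<^sup>2) * (c * exp (- (c / 2) * (norm x)\<^sup>2) * cmod (u x))"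
      using c by (intro mult_right_mono quad) auto
    also have "\<dots> = \<beta> * ((c * (norm x)\<^sup>2) * exp (- ((c * (norm x)\<^sup>2) / 2))) * cmod (u x)" by simp
    also have "\<dots> \<le> \<beta> * 1 * cmod (u x)"
      using c \<beta>0 by (intro mult_right_mono mult_left_mono exp_le) auto
    finally show ?thesis by simp
  qed
  have gL2: "g \<in> L2" by (rule L2_dominated(1)[OF u g_meas g_le])
  have gi: "integrable lborel g"
  proof (rule Bochner_Integration.integrable_bound)
    show "integrable lborel (\<lambda>x. c * \<beta> * ((1 + norm x)\<^sup>2 * cmod (damp c u x)))"
      by (intro integrable_mult_right damp_moment u c)
    show "AE x in lborel. norm (g x) \<le> norm (c * \<beta> * ((1 + norm x)\<^sup>2 * cmod (damp c u x)))"
    proof (rule AE_I2)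
      fix x
      have "norm (g x) = c * \<bar>x \<bullet> (B *v x)\<bar> * cmod (damp c u x)"
        unfolding g_def norm_mult norm_of_real using c by (simp add: abs_mult)
      also have "\<dots> \<le> c * (\<beta> * (1 + norm x)\<^sup>2) * cmod (damp c u x)"
      proof (intro mult_right_mono mult_left_mono)
        have "(norm x)\<^sup>2 \<le> (1 + norm x)\<^sup>2" by (intro power_mono) auto
        then have "\<beta> * (norm x)\<^sup>2 \<le> \<beta> * (1 + norm x)\<^sup>2" using \<beta>0 by (rule mult_left_mono)
        then show "\<bar>x \<bullet> (B *v x)\<bar> \<le> \<beta> * (1 + norm x)\<^sup>2" using quad order_trans by blast
      qed (use c in auto)
      finally show "norm (g x) \<le> norm (c * \<beta> * ((1 + norm x)\<^sup>2 * cmod (damp c u x)))"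
        using c \<beta>0 by (simp add: abs_mult mult_ac)
    qed
  qed (use g_meas in simp)
  show "fourier g \<in> L2" by (rule Plancherel_inequality(1)[OF gL2 gi])
  have "(\<integral>x. (cmod (fourier g x))\<^sup>2 \<partial>lborel) \<le> (2 * pi) ^ CARD('n) * (\<integral>x. (cmod (g x))\<^sup>2 \<partial>lborel)"
    by (rule Plancherel_inequality(2)[OF gL2 gi])
  also have "\<dots> \<le> (2 * pi) ^ CARD('n) * (\<beta>\<^sup>2 * (\<integral>x. (cmod (u x))\<^sup>2 \<partial>lborel))"
    by (intro mult_left_mono L2_dominated(2)[OF u g_meas g_le]) auto
  finally show "(\<integral>x. (cmod (fourier g x))\<^sup>2 \<partial>lborel) \<le> (2 * pi) ^ CARD('n) * (\<beta>\<^sup>2 * (\<integral>x. (cmod (u x))\<^sup>2 \<partial>lborel))" .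
qed

text \<open>For a fixed cutoff, the damping index is taken so large that both the weighted
  commutator and the distance of the damped transform from \<open>fourier_L2 u\<close> are
  negligible. The resulting bound does not involve the cutoff, which Fatou's lemma then
  removes.\<close>

theorem weighted_L2_estimate:
  fixes B Q :: "real^'n^'n" and M :: "real^'n \<Rightarrow> real"
  assumes s: "s > 0" and Q: "pos_semidef Q"
    and M: "tame p M M'" "p \<ge> 0" "\<And>x. M x > 0" and c0: "c0 > 0"
    and coercive: "\<And>x. c0 * (M x)\<^sup>2 - D \<le> M' x (transpose B *v x) + M x * norm (mat_sqrt Q *v x) powr (2 * s)"
  shows "\<exists>K\<ge>0. \<forall>u f. u \<in> L2 \<longrightarrow> f \<in> L2 \<longrightarrow> distr_eq (frac_OU s B Q u) (distr_of f) \<longrightarrow>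
    (\<integral>\<^sup>+x. ennreal ((M x * cmod (fourier_L2 u x))\<^sup>2) \<partial>lborel)
      \<le> ennreal (K * ((\<integral>x. (cmod (u x))\<^sup>2 \<partial>lborel) + (\<integral>x. (cmod (f x))\<^sup>2 \<partial>lborel)))"
proof -
  let ?n = "CARD('n)" and ?C = "transpose B" and ?P = "(2 * pi) ^ CARD('n)"
  let ?T = "matrix_trace B" and ?T' = "matrix_trace (transpose B)"
  \<comment> \<open>\<open>energy_estimate\<close> is stated for a nonnegative constant.\<close>
  define D1 where "D1 = max 0 D"
  define q where "q x = norm (mat_sqrt Q *v x) powr (2 * s)" for x
  have q_eq: "((Q *v x) \<bullet> x) powr s = q x" for x
    unfolding q_def quadratic_form_mat_sqrt[OF Q] by (simp add: powr_powr flip: powr_numeral)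
  have coercive1: "c0 * (M x)\<^sup>2 - D1 \<le> M' x (?C *v x) + M x * q x" for x
    using coercive[of x] by (simp add: q_def D1_def)
  define m where "m = nat \<lceil>2 * s\<rceil>"
  obtain \<alpha> where \<alpha>: "\<alpha> > 0" "\<And>x. norm (mat_sqrt Q *v x) \<le> norm x * \<alpha>"
    using bounded_linear.pos_bounded[OF matrix_vector_mul_bounded_linear] by metis
  obtain \<beta> where \<beta>: "\<And>x. norm (B *v x) \<le> norm x * \<beta>"
    using bounded_linear.pos_bounded[OF matrix_vector_mul_bounded_linear] by metis
  have q_le: "\<bar>q x\<bar> \<le> \<alpha> powr (2 * s) * (1 + norm x) ^ m" for x
  proof -
    have pos: "1 + norm x > 0" by (simp add: add_pos_nonneg)
    have "q x \<le> (\<alpha> * (1 + norm x)) powr (2 * s)" unfolding q_def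
    proof (rule powr_mono2)
      have "norm x * \<alpha> \<le> (1 + norm x) * \<alpha>" using \<alpha> by (intro mult_right_mono) auto
      then show "norm (mat_sqrt Q *v x) \<le> \<alpha> * (1 + norm x)" using \<alpha>(2)[of x] by (simp add: mult.commute)
    qed (use s in auto)
    also have "\<dots> = \<alpha> powr (2 * s) * (1 + norm x) powr (2 * s)" by (rule powr_mult)
    also have "(1 + norm x) powr (2 * s) \<le> (1 + norm x) powr real m"
      unfolding m_def by (intro powr_mono real_nat_ceiling_ge) simp
    also have "(1 + norm x) powr real m = (1 + norm x) ^ m" by (rule powr_realpow[OF pos])
    finally show ?thesis by (simp add: q_def mult_left_mono)
  qed
  have q_cont: "continuous_on UNIV q"
    unfolding q_def using s
    by (intro continuous_on_powr' continuous_intros linear_continuous_on[OF matrix_vector_mul_bounded_linear]) auto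
  \<comment> \<open>The decay has three tasks: p for the growth of the multiplier, 2 n + 1 for the
    divergence theorem, and \<open>m\<close> for the growth of the symbol in the commutator.\<close>
  define N where "N = p + 2 * real ?n + 1 + real m"
  have N0: "N \<ge> 0" using M(2) by (simp add: N_def)
  obtain \<omega> :: "nat \<Rightarrow> real^'n \<Rightarrow> real" and \<omega>' b where
    \<omega>: "\<And>j. tame (- N) (\<omega> j) (\<omega>' j)" "\<And>j x. 0 < \<omega> j x" "\<And>j x. \<omega> j x \<le> 1"
      "\<And>j x. \<bar>\<omega>' j x (?C *v x)\<bar> \<le> b * \<omega> j x" "b \<ge> 0" "\<And>x. (\<lambda>j. \<omega> j x) \<longlonglongrightarrow> 1"
    using cutoff_exists[OF N0, of ?C] by blast
  define D2 where "D2 = 2 / c0 * (D1 + (2 * b + \<bar>?T'\<bar>)\<^sup>2 / c0)"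
  define D3 where "D3 = 2 / c0 * (4 / c0)"
  have D23: "D2 \<ge> 0" "D3 \<ge> 0" using c0 by (auto simp: D2_def D3_def D1_def)
  define K2 where "K2 = 2 * (2 * ?T\<^sup>2 * ?P + 2 * (?P * \<beta>\<^sup>2)) + 2 * ?P"
  have K2: "K2 \<ge> 0" by (simp add: K2_def)
  define K where "K = 2 * (D2 * ?P + D3 * (2 * K2))"
  have K0: "K \<ge> 0" using D23 K2 by (simp add: K_def)
  show ?thesis
  proof (intro exI[of _ K] conjI allI impI K0)
    fix u f :: "real^'n \<Rightarrow> complex"
    assume u: "u \<in> L2" and f: "f \<in> L2" and eq: "distr_eq (frac_OU s B Q u) (distr_of f)"
    define U where "U = (\<integral>x. (cmod (u x))\<^sup>2 \<partial>lborel)"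
    define F where "F = (\<integral>x. (cmod (f x))\<^sup>2 \<partial>lborel)"
    have UF: "U \<ge> 0" "F \<ge> 0" by (auto simp: U_def F_def)
    define v where "v = fourier_L2 u"
    have v: "v \<in> L2" unfolding v_def by (rule fourier_L2_props(1)[OF u])
    note [measurable] = L2D(1)[OF v] tame_measurable[OF M(1)] tame_measurable[OF \<omega>(1)]
    define c where "c k = inverse (real (Suc k))" for k
    have c: "c k > 0" for k by (simp add: c_def)
    define w where "w k = fourier (damp (c k) u)" for k
    have wL2: "w k \<in> L2" for k
      unfolding w_def by (intro Plancherel_inequality(1) damp_L2 u c)
    have w_norm: "(\<integral>x. (cmod (w k x))\<^sup>2 \<partial>lborel) \<le> ?P * U" for k
    proof -
      have "(\<integral>x. (cmod (w k x))\<^sup>2 \<partial>lborel) \<le> ?P * (\<integral>x. (cmod (damp (c k) u x))\<^sup>2 \<partial>lborel)"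
        unfolding w_def by (intro Plancherel_inequality(2) damp_L2 u c)
      also have "\<dots> \<le> ?P * U" unfolding U_def by (intro mult_left_mono damp_L2 u c) auto
      finally show ?thesis .
    qed
    define \<rho> where "\<rho> k \<xi> = (\<integral>\<zeta>. of_real (q \<zeta>) * v \<zeta> * of_real (heat (c k) (\<zeta> - \<xi>)) \<partial>lborel)
       - of_real (q \<xi>) * (\<integral>\<zeta>. v \<zeta> * of_real (heat (c k) (\<zeta> - \<xi>)) \<partial>lborel)" for k \<xi>
    define g where "g k x = complex_of_real (c k * (x \<bullet> (B *v x))) * damp (c k) u x" for k x
    \<comment> \<open>The source is split by size: \<open>e\<close> gathers the trace, the drift
      commutator and the right-hand side, all bounded in L2 uniformly in \<open>k\<close>, whereas
      \<open>\<rho>\<close> becomes small only after multiplication by the cutoff.\<close>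
    define e where "e k \<xi> = (- of_real ?T * w k \<xi> + fourier (g k) \<xi>) - fourier (damp (c k) f) \<xi>" for k \<xi>
    define \<eta> where "\<eta> k \<xi> = 1/2 * \<rho> k \<xi> + e k \<xi>" for k \<xi>
    have Fg: "fourier (g k) \<in> L2" "(\<integral>x. (cmod (fourier (g k) x))\<^sup>2 \<partial>lborel) \<le> ?P * (\<beta>\<^sup>2 * U)" for k
      using fourier_damped_quadratic[OF u c \<beta>] by (auto simp: g_def[abs_def] U_def)
    have Ff: "fourier (damp (c k) f) \<in> L2" "(\<integral>x. (cmod (fourier (damp (c k) f) x))\<^sup>2 \<partial>lborel) \<le> ?P * F" for k
    proof -
      show "fourier (damp (c k) f) \<in> L2" by (intro Plancherel_inequality(1) damp_L2 f c)
      have "(\<integral>x. (cmod (fourier (damp (c k) f) x))\<^sup>2 \<partial>lborel) \<le> ?P * (\<integral>x. (cmod (damp (c k) f x))\<^sup>2 \<partial>lborel)"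
        by (intro Plancherel_inequality(2) damp_L2 f c)
      also have "\<dots> \<le> ?P * F" unfolding F_def by (intro mult_left_mono damp_L2 f c) auto
      finally show "(\<integral>x. (cmod (fourier (damp (c k) f) x))\<^sup>2 \<partial>lborel) \<le> ?P * F" .
    qed
    have eL2: "e k \<in> L2" for k
      unfolding e_def by (intro L2_diff L2_add(1) L2_cmult wL2 Fg Ff)
    have e_norm: "(\<integral>x. (cmod (e k x))\<^sup>2 \<partial>lborel) \<le> K2 * (U + F)" for k
    proof -
      have Tw: "(\<integral>x. (cmod (- of_real ?T * w k x))\<^sup>2 \<partial>lborel) = ?T\<^sup>2 * (\<integral>x. (cmod (w k x))\<^sup>2 \<partial>lborel)"
        unfolding norm_mult power_mult_distrib by simp
      have "(\<integral>x. (cmod (- of_real ?T * w k x + fourier (g k) x))\<^sup>2 \<partial>lborel)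
         \<le> 2 * (?T\<^sup>2 * (\<integral>x. (cmod (w k x))\<^sup>2 \<partial>lborel)) + 2 * (\<integral>x. (cmod (fourier (g k) x))\<^sup>2 \<partial>lborel)"
        using L2_add(2)[OF L2_cmult[OF wL2, of "- of_real ?T" k] Fg(1)[of k]] unfolding Tw .
      also have "\<dots> \<le> 2 * (?T\<^sup>2 * (?P * U)) + 2 * (?P * (\<beta>\<^sup>2 * U))"
        by (intro add_mono mult_left_mono w_norm Fg) auto
      finally have 1: "(\<integral>x. (cmod (- of_real ?T * w k x + fourier (g k) x))\<^sup>2 \<partial>lborel) \<le> (2 * ?T\<^sup>2 * ?P + 2 * (?P * \<beta>\<^sup>2)) * U"
        by (simp add: algebra_simps)
      have "(\<integral>x. (cmod (e k x))\<^sup>2 \<partial>lborel)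
         = (\<integral>x. (cmod ((- of_real ?T * w k x + fourier (g k) x) + (-1) * fourier (damp (c k) f) x))\<^sup>2 \<partial>lborel)"
        by (simp add: e_def)
      also have "\<dots> \<le> 2 * (\<integral>x. (cmod (- of_real ?T * w k x + fourier (g k) x))\<^sup>2 \<partial>lborel)
          + 2 * (\<integral>x. (cmod ((-1) * fourier (damp (c k) f) x))\<^sup>2 \<partial>lborel)"
        by (intro L2_add(2) L2_add(1) L2_cmult wL2 Fg Ff)
      also have "(\<integral>x. (cmod ((-1) * fourier (damp (c k) f) x))\<^sup>2 \<partial>lborel) = (\<integral>x. (cmod (fourier (damp (c k) f) x))\<^sup>2 \<partial>lborel)" by simp
      also have "2 * (\<integral>x. (cmod (- of_real ?T * w k x + fourier (g k) x))\<^sup>2 \<partial>lborel) + 2 * (\<integral>x. (cmod (fourier (damp (c k) f) x))\<^sup>2 \<partial>lborel)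
         \<le> 2 * ((2 * ?T\<^sup>2 * ?P + 2 * (?P * \<beta>\<^sup>2)) * U) + 2 * (?P * F)"
        using 1 Ff(2)[of k] by linarith
      also have "\<dots> \<le> K2 * (U + F)"
      proof -
        have "0 \<le> 2 * ((2 * ?T\<^sup>2 * ?P + 2 * (?P * \<beta>\<^sup>2)) * F) + 2 * (?P * U)" using UF by simp
        then show ?thesis by (simp add: K2_def algebra_simps)
      qed
      finally show ?thesis .
    qed
    have w_eq: "dfourier (damp (c k) u) \<xi> (?C *v \<xi>) = of_real (q \<xi> / 2) * w k \<xi> + \<eta> k \<xi>" for k \<xi>
    proof -
      have "of_real (q \<xi> / 2) * w k \<xi> + \<eta> k \<xi>
         = 1/2 * (\<rho> k \<xi> + of_real (q \<xi>) * w k \<xi>) + e k \<xi>" by (simp add: \<eta>_def algebra_simps)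
      also have "\<rho> k \<xi> + of_real (q \<xi>) * w k \<xi> = (\<integral>\<zeta>. of_real (q \<zeta>) * v \<zeta> * of_real (heat (c k) (\<zeta> - \<xi>)) \<partial>lborel)"
        unfolding \<rho>_def w_def v_def fourier_damp_heat[OF u c] by simp
      finally show ?thesis
        unfolding regularised_equation[OF u f eq c] q_eq by (simp add: v_def e_def w_def g_def[abs_def])
    qed
    define R where "R j k = (\<integral>\<^sup>+\<xi>. ennreal ((\<omega> j \<xi> * cmod (\<rho> k \<xi>))\<^sup>2) \<partial>lborel)" for j k
    have \<omega>M_bound: "\<exists>E. \<forall>x. \<bar>\<omega> j x * M x\<bar> \<le> E" for j
    proof -
      have "tame 0 (\<lambda>x. \<omega> j x * M x) (\<lambda>x h. \<omega>' j x h * M x + \<omega> j x * M' x h)"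
        by (rule tame_mono[OF tame_mult[OF \<omega>(1) M(1)]]) (simp add: N_def)
      then obtain E where E: "\<And>x. \<bar>\<omega> j x * M x\<bar> \<le> E * (1 + norm x) powr 0" unfolding tame_def by blast
      have "1 + norm x \<noteq> 0" for x :: "real^'n" using norm_ge_zero[of x] by linarith
      with E show ?thesis by (intro exI[of _ E]) simp
    qed
    have \<rho>_meas: "\<rho> k \<in> borel_measurable borel" and R_lim: "(\<lambda>k. R j k) \<longlonglongrightarrow> 0" for j k
    proof -
      have \<omega>_cont: "continuous_on UNIV (\<omega> j)"
        using \<omega>(1)[of j] unfolding tame_def
        by (intro continuous_at_imp_continuous_on) (auto intro: has_derivative_continuous)
      obtain E where E: "E \<ge> 1" "\<And>x. \<bar>\<omega> j x\<bar> \<le> E * (1 + norm x) powr (- N)" using \<omega>(1)[of j] unfolding tame_def by blast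
      have \<omega>_le: "\<bar>\<omega> j x\<bar> * (1 + norm x) ^ m \<le> E" for x
      proof -
        have pos: "1 + norm x > 0" by (simp add: add_pos_nonneg)
        have "\<bar>\<omega> j x\<bar> * (1 + norm x) ^ m \<le> (E * (1 + norm x) powr (- N)) * (1 + norm x) powr real m"
          unfolding powr_realpow[OF pos] using E pos by (intro mult_right_mono) auto
        also have "\<dots> = E * (1 + norm x) powr (real m - N)" by (simp add: powr_add[symmetric] mult.assoc)
        also have "\<dots> \<le> E * (1 + norm x) powr 0" using E M(2) by (intro mult_left_mono powr_mono) (auto simp: N_def)
        finally show ?thesis using pos by simp
      qed
      show "\<rho> k \<in> borel_measurable borel"
        unfolding \<rho>_def using commutator_tendsto(1)[OF v q_cont \<omega>_cont q_le \<omega>_le c[of k]] .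
      show "(\<lambda>k. R j k) \<longlonglongrightarrow> 0"
        unfolding R_def \<rho>_def c_def using commutator_tendsto(2)[OF v q_cont \<omega>_cont q_le \<omega>_le] .
    qed
    note [measurable] = \<rho>_meas
    \<comment> \<open>\<open>r\<close> stays a parameter because the commutator tends to 0 in
      \<open>k\<close> at a rate that depends on the cutoff index \<open>j\<close>.\<close>
    have est: "(\<integral>x. (\<omega> j x * M x * cmod (w k x))\<^sup>2 \<partial>lborel) \<le> D2 * (?P * U) + D3 * (1/2 * r + 2 * (K2 * (U + F)))"
      if R: "R j k \<le> ennreal r" and r: "r \<ge> 0" for j k r
    proof -
      note [measurable] = L2D(1)[OF eL2]
      have \<rho>L2: "(\<lambda>x. of_real (\<omega> j x) * \<rho> k x) \<in> L2" and \<rho>r: "(\<integral>x. (cmod (of_real (\<omega> j x) * \<rho> k x))\<^sup>2 \<partial>lborel) \<le> r"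
      proof -
        have "(\<integral>\<^sup>+x. ennreal ((cmod (of_real (\<omega> j x) * \<rho> k x))\<^sup>2) \<partial>lborel) \<le> ennreal r"
          using R less_imp_le[OF \<omega>(2)] by (simp add: R_def norm_mult)
        from L2I[OF _ this] r show "(\<lambda>x. of_real (\<omega> j x) * \<rho> k x) \<in> L2" "(\<integral>x. (cmod (of_real (\<omega> j x) * \<rho> k x))\<^sup>2 \<partial>lborel) \<le> r"
          by auto
      qed
      have \<omega>e_le: "cmod (of_real (\<omega> j x) * e k x) \<le> 1 * cmod (e k x)" for x
        unfolding norm_mult norm_of_real using \<omega>(2,3)[of j x] by (intro mult_right_mono) auto
      have \<omega>e: "(\<lambda>x. of_real (\<omega> j x) * e k x) \<in> L2" "(\<integral>x. (cmod (of_real (\<omega> j x) * e k x))\<^sup>2 \<partial>lborel) \<le> K2 * (U + F)"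
        using L2_dominated[OF eL2 _ \<omega>e_le] e_norm[of k] by auto
      have half: "(\<lambda>x. 1/2 * (of_real (\<omega> j x) * \<rho> k x)) \<in> L2" by (rule L2_cmult[OF \<rho>L2])
      have half_le: "(\<integral>x. (cmod (1/2 * (of_real (\<omega> j x) * \<rho> k x)))\<^sup>2 \<partial>lborel) \<le> r / 4"
      proof -
        have "(\<integral>x. (cmod (1/2 * (of_real (\<omega> j x) * \<rho> k x)))\<^sup>2 \<partial>lborel) = (\<integral>x. 1/4 * (cmod (of_real (\<omega> j x) * \<rho> k x))\<^sup>2 \<partial>lborel)"
          by (intro Bochner_Integration.integral_cong) (auto simp: norm_mult norm_divide power_mult_distrib power_divide)
        also have "\<dots> = 1/4 * (\<integral>x. (cmod (of_real (\<omega> j x) * \<rho> k x))\<^sup>2 \<partial>lborel)" by (rule integral_mult_right_zero)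
        finally show ?thesis using \<rho>r by linarith
      qed
      have \<eta>_split: "(\<omega> j x * cmod (\<eta> k x))\<^sup>2 = (cmod (1/2 * (of_real (\<omega> j x) * \<rho> k x) + of_real (\<omega> j x) * e k x))\<^sup>2" for x
      proof -
        have "1/2 * (of_real (\<omega> j x) * \<rho> k x) + of_real (\<omega> j x) * e k x = of_real (\<omega> j x) * \<eta> k x"
          by (simp add: \<eta>_def algebra_simps)
        then show ?thesis using less_imp_le[OF \<omega>(2)[of j x]] by (simp only: norm_mult norm_of_real abs_of_nonneg)
      qed
      have \<eta>L2: "integrable lborel (\<lambda>x. (\<omega> j x * cmod (\<eta> k x))\<^sup>2)"
        unfolding \<eta>_split by (rule L2D(2)[OF L2_add(1)[OF half \<omega>e(1)]])
      have \<eta>_norm: "(\<integral>x. (\<omega> j x * cmod (\<eta> k x))\<^sup>2 \<partial>lborel) \<le> 1/2 * r + 2 * (K2 * (U + F))"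
        unfolding \<eta>_split using L2_add(2)[OF half \<omega>e(1)] half_le \<omega>e(2) by linarith
      obtain E where E: "\<And>\<xi> h. cmod (w k \<xi>) \<le> E \<and> cmod (dfourier (damp (c k) u) \<xi> h) \<le> E * norm h"
        using fourier_damp_has_derivative(2)[OF u c[of k]] unfolding w_def by blast
      have wd: "(w k has_derivative dfourier (damp (c k) u) \<xi>) (at \<xi>)" for \<xi>
        unfolding w_def by (rule fourier_damp_has_derivative(1)[OF u c])
      have "(\<integral>x. (\<omega> j x * M x * cmod (w k x))\<^sup>2 \<partial>lborel)
        \<le> 2 / c0 * ((D1 + (2 * b + \<bar>?T'\<bar>)\<^sup>2 / c0) * (\<integral>x. (cmod (w k x))\<^sup>2 \<partial>lborel)
            + 4 / c0 * (\<integral>x. (\<omega> j x * cmod (\<eta> k x))\<^sup>2 \<partial>lborel))"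
        by (rule energy_estimate[OF M c0 _ coercive1 \<omega>(1,2,3,4) _ wd _ _ wL2 w_eq \<eta>L2, where E=E])
          (use E in \<open>auto simp: D1_def N_def\<close>)
      also have "\<dots> = D2 * (\<integral>x. (cmod (w k x))\<^sup>2 \<partial>lborel) + D3 * (\<integral>x. (\<omega> j x * cmod (\<eta> k x))\<^sup>2 \<partial>lborel)"
        by (simp add: D2_def D3_def algebra_simps)
      also have "\<dots> \<le> D2 * (?P * U) + D3 * (1/2 * r + 2 * (K2 * (U + F)))"
        by (intro add_mono mult_left_mono w_norm \<eta>_norm D23)
      finally show ?thesis .
    qed
    have cut: "(\<integral>\<^sup>+x. ennreal ((\<omega> j x * (M x * cmod (v x)))\<^sup>2) \<partial>lborel) \<le> ennreal (K * (U + F))" for j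
    proof -
      obtain E where E: "\<And>x. \<bar>\<omega> j x * M x\<bar> \<le> E" using \<omega>M_bound by blast
      define a where "a x = complex_of_real (\<omega> j x * M x)" for x
      have [measurable]: "a \<in> borel_measurable borel" unfolding a_def by measurable
      have a_le: "cmod (a x * z) \<le> E * cmod z" for x z
        unfolding a_def norm_mult norm_of_real using E[of x] by (intro mult_right_mono) auto
      have av: "(\<lambda>x. a x * v x) \<in> L2" by (rule L2_dominated(1)[OF v _ a_le]) measurable
      have a_abs: "(cmod (a x * z))\<^sup>2 = (\<omega> j x * M x * cmod z)\<^sup>2" for x z
        unfolding a_def norm_mult norm_of_real power_mult_distrib power2_abs by simp
      have wv: "(\<lambda>k. \<integral>x. (cmod (w k x - v x))\<^sup>2 \<partial>lborel) \<longlonglongrightarrow> 0"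
        using fourier_L2_props(4)[OF u] unfolding w_def v_def c_def .
      have "(\<integral>x. (cmod (a x * v x))\<^sup>2 \<partial>lborel) \<le> K * (U + F)"
      proof (rule field_le_epsilon)
        fix \<epsilon> :: real assume \<epsilon>: "\<epsilon> > 0"
        \<comment> \<open>Both errors, D3 r from the commutator and 2 E^2 r from replacing
          \<open>v\<close> by \<open>w k\<close>, together stay below \<epsilon>; the added 1 keeps
          the denominator positive.\<close>
        define r where "r = \<epsilon> / (2 * (D3 + E\<^sup>2 + 1))"
        have den: "D3 + E\<^sup>2 + 1 > 0" using D23 by (intro add_nonneg_pos add_nonneg_nonneg) auto
        have r: "r > 0" using \<epsilon> den by (simp add: r_def)
        have "eventually (\<lambda>k. R j k < ennreal r) sequentially"
          using R_lim[of j] r by (intro order_tendstoD(2)) auto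
        moreover have "eventually (\<lambda>k. (\<integral>x. (cmod (w k x - v x))\<^sup>2 \<partial>lborel) < r) sequentially"
          using wv r by (intro order_tendstoD(2)) auto
        ultimately have "eventually (\<lambda>k. R j k < ennreal r \<and> (\<integral>x. (cmod (w k x - v x))\<^sup>2 \<partial>lborel) < r) sequentially"
          by (rule eventually_conj)
        then obtain k where k: "R j k < ennreal r" "(\<integral>x. (cmod (w k x - v x))\<^sup>2 \<partial>lborel) < r"
          by (auto simp: eventually_sequentially)
        note [measurable] = L2D(1)[OF wL2]
        have aw: "(\<lambda>x. a x * w k x) \<in> L2" by (rule L2_dominated(1)[OF wL2 _ a_le]) measurable
        have vw: "(\<lambda>x. v x - w k x) \<in> L2" by (rule L2_diff[OF v wL2])
        have avw: "(\<lambda>x. a x * (v x - w k x)) \<in> L2"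
          "(\<integral>x. (cmod (a x * (v x - w k x)))\<^sup>2 \<partial>lborel) \<le> E\<^sup>2 * (\<integral>x. (cmod (v x - w k x))\<^sup>2 \<partial>lborel)"
          by (rule L2_dominated[OF vw _ a_le], measurable)+
        have "(\<integral>x. (cmod (a x * v x))\<^sup>2 \<partial>lborel) = (\<integral>x. (cmod (a x * w k x + a x * (v x - w k x)))\<^sup>2 \<partial>lborel)"
          by (simp add: algebra_simps)
        also have "\<dots> \<le> 2 * (\<integral>x. (cmod (a x * w k x))\<^sup>2 \<partial>lborel) + 2 * (\<integral>x. (cmod (a x * (v x - w k x)))\<^sup>2 \<partial>lborel)"
          by (rule L2_add(2)[OF aw avw(1)])
        also have "\<dots> \<le> 2 * (D2 * (?P * U) + D3 * (1/2 * r + 2 * (K2 * (U + F)))) + 2 * (E\<^sup>2 * r)"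
        proof (intro add_mono mult_left_mono)
          show "(\<integral>x. (cmod (a x * w k x))\<^sup>2 \<partial>lborel) \<le> D2 * (?P * U) + D3 * (1/2 * r + 2 * (K2 * (U + F)))"
            unfolding a_abs using est[of j k r] k(1) r by simp
          have "E\<^sup>2 * (\<integral>x. (cmod (v x - w k x))\<^sup>2 \<partial>lborel) \<le> E\<^sup>2 * r"
            using k(2) by (intro mult_left_mono) (auto simp: norm_minus_commute)
          then show "(\<integral>x. (cmod (a x * (v x - w k x)))\<^sup>2 \<partial>lborel) \<le> E\<^sup>2 * r" using avw(2) by linarith
        qed auto
        also have "\<dots> = 2 * (D2 * (?P * U) + D3 * (2 * K2) * (U + F)) + (D3 + 2 * E\<^sup>2) * r"
          by (simp add: algebra_simps)
        also have "\<dots> \<le> K * (U + F) + \<epsilon>"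
        proof (rule add_mono)
          have "D2 * (?P * U) \<le> D2 * (?P * (U + F))" using D23 UF by (intro mult_left_mono) auto
          then show "2 * (D2 * (?P * U) + D3 * (2 * K2) * (U + F)) \<le> K * (U + F)" by (simp add: K_def algebra_simps)
          have "(D3 + 2 * E\<^sup>2) * r \<le> (2 * (D3 + E\<^sup>2 + 1)) * r" using D23 r by (intro mult_right_mono) auto
          also have "\<dots> = \<epsilon>" using den by (simp add: r_def)
          finally show "(D3 + 2 * E\<^sup>2) * r \<le> \<epsilon>" .
        qed
        finally show "(\<integral>x. (cmod (a x * v x))\<^sup>2 \<partial>lborel) \<le> K * (U + F) + \<epsilon>" .
      qed
      then have "(\<integral>\<^sup>+x. ennreal ((cmod (a x * v x))\<^sup>2) \<partial>lborel) \<le> ennreal (K * (U + F))"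
        unfolding L2_nn_integral[OF av] by (rule ennreal_leI)
      then show ?thesis by (simp add: a_abs mult.assoc)
    qed
    \<comment> \<open>The bound \<open>cut\<close> is the same for all \<open>j\<close> and the
      cutoffs tend to 1 pointwise, so Fatou's lemma also yields the finiteness of the left
      side.\<close>
    have "(\<integral>\<^sup>+x. ennreal ((M x * cmod (v x))\<^sup>2) \<partial>lborel)
      = (\<integral>\<^sup>+x. liminf (\<lambda>j. ennreal ((\<omega> j x * (M x * cmod (v x)))\<^sup>2)) \<partial>lborel)"
    proof (rule nn_integral_cong)
      fix x
      have "(\<lambda>j. (\<omega> j x * (M x * cmod (v x)))\<^sup>2) \<longlonglongrightarrow> (1 * (M x * cmod (v x)))\<^sup>2"
        by (intro tendsto_power tendsto_mult \<omega>(6) tendsto_const)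
      then have "(\<lambda>j. ennreal ((\<omega> j x * (M x * cmod (v x)))\<^sup>2)) \<longlonglongrightarrow> ennreal ((1 * (M x * cmod (v x)))\<^sup>2)"
        by (rule tendsto_ennrealI)
      from lim_imp_Liminf[OF sequentially_bot this]
      show "ennreal ((M x * cmod (v x))\<^sup>2) = liminf (\<lambda>j. ennreal ((\<omega> j x * (M x * cmod (v x)))\<^sup>2))" by simp
    qed
    also have "\<dots> \<le> liminf (\<lambda>j. \<integral>\<^sup>+x. ennreal ((\<omega> j x * (M x * cmod (v x)))\<^sup>2) \<partial>lborel)"
      by (intro nn_integral_liminf) measurable
    also have "\<dots> \<le> ennreal (K * (U + F))"
      by (intro Liminf_le always_eventually allI cut) simp
    finally show "(\<integral>\<^sup>+x. ennreal ((M x * cmod (fourier_L2 u x))\<^sup>2) \<partial>lborel)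
      \<le> ennreal (K * ((\<integral>x. (cmod (u x))\<^sup>2 \<partial>lborel) + (\<integral>x. (cmod (f x))\<^sup>2 \<partial>lborel)))"
      by (simp add: v_def U_def F_def)
  qed
qed

text \<open>A symbol dominated by \<open>M\<close> inherits the weighted bound. Since
  \<open>distr_L2_norm\<close> is an infimum, exhibiting one representative suffices; the factor
  sqrt 2 is that of \<open>distr_inv_fourier_L2\<close>.\<close>

lemma fourier_multiplier_L2_norm:
  assumes u: "u \<in> L2" and G[measurable]: "G \<in> borel_measurable borel"
    and le: "\<And>x. cmod (G x) \<le> c * M x" and c: "c \<ge> 0" and M: "\<And>x. M x \<ge> 0"
    and S: "(\<integral>\<^sup>+x. ennreal ((M x * cmod (fourier_L2 u x))\<^sup>2) \<partial>lborel) \<le> ennreal S" and S0: "S \<ge> 0"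
  shows "distr_L2_norm (fourier_multiplier G u) \<le> ennreal (sqrt 2 * c * sqrt S)"
proof -
  let ?v = "fourier_L2 u"
  note [measurable] = L2D(1)[OF fourier_L2_props(1)[OF u]]
  have "(\<integral>\<^sup>+x. ennreal ((cmod (G x * ?v x))\<^sup>2) \<partial>lborel) \<le> ennreal (c\<^sup>2 * S)"
  proof -
    have le2: "(cmod (G x * ?v x))\<^sup>2 \<le> c\<^sup>2 * (M x * cmod (?v x))\<^sup>2" for x
    proof -
      have "cmod (G x * ?v x) \<le> (c * M x) * cmod (?v x)" unfolding norm_mult by (intro mult_right_mono le) auto
      then have "(cmod (G x * ?v x))\<^sup>2 \<le> ((c * M x) * cmod (?v x))\<^sup>2" by (rule power_mono) simp
      then show ?thesis by (simp add: power_mult_distrib)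
    qed
    show ?thesis
    proof (cases "c = 0")
      \<comment> \<open>Treated apart, because the other case divides by the square of
        \<open>c\<close>.\<close>
      case True
      then have z: "(cmod (G x * ?v x))\<^sup>2 = 0" for x using le2[of x] by simp
      show ?thesis unfolding z by simp
    next
      case False
      then have cpos: "c > 0" using c by simp
      have "(\<integral>\<^sup>+x. ennreal ((cmod (G x * ?v x))\<^sup>2 * (1 / c\<^sup>2)) \<partial>lborel) \<le> (\<integral>\<^sup>+x. ennreal ((M x * cmod (?v x))\<^sup>2) \<partial>lborel)"
        using le2 cpos by (intro nn_integral_mono ennreal_leI) (simp add: pos_divide_le_eq mult.commute)
      also have "\<dots> \<le> ennreal S" by (rule S)
      finally have "ennreal (c\<^sup>2) * (\<integral>\<^sup>+x. ennreal ((cmod (G x * ?v x))\<^sup>2 * (1 / c\<^sup>2)) \<partial>lborel) \<le> ennreal (c\<^sup>2) * ennreal S"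
        by (intro mult_left_mono) auto
      also have "ennreal (c\<^sup>2) * (\<integral>\<^sup>+x. ennreal ((cmod (G x * ?v x))\<^sup>2 * (1 / c\<^sup>2)) \<partial>lborel)
          = (\<integral>\<^sup>+x. ennreal (c\<^sup>2) * ennreal ((cmod (G x * ?v x))\<^sup>2 * (1 / c\<^sup>2)) \<partial>lborel)"
        by (rule nn_integral_cmult[symmetric]) measurable
      also have "\<dots> = (\<integral>\<^sup>+x. ennreal ((cmod (G x * ?v x))\<^sup>2) \<partial>lborel)"
        using cpos by (intro nn_integral_cong) (simp add: ennreal_mult[symmetric])
      also have "ennreal (c\<^sup>2) * ennreal S = ennreal (c\<^sup>2 * S)" using S0 by (simp add: ennreal_mult)
      finally show ?thesis .
    qed
  qed
  from L2I[OF _ this] S0 have Gv: "(\<lambda>x. G x * ?v x) \<in> L2" "(\<integral>x. (cmod (G x * ?v x))\<^sup>2 \<partial>lborel) \<le> c\<^sup>2 * S" by auto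
  obtain f where f: "f \<in> L2" "distr_eq (distr_inv_fourier (distr_of (\<lambda>x. G x * ?v x))) (distr_of f)"
    "(\<integral>x. (cmod (f x))\<^sup>2 \<partial>lborel) \<le> 2 * (\<integral>x. (cmod (G x * ?v x))\<^sup>2 \<partial>lborel)"
    using distr_inv_fourier_L2[OF Gv(1)] by blast
  have "distr_L2_norm (fourier_multiplier G u) \<le> ennreal (L2_norm f)"
    unfolding distr_L2_norm_def fourier_multiplier_def using f by (intro INF_lower) auto
  also have "\<dots> \<le> ennreal (sqrt 2 * c * sqrt S)"
  proof (rule ennreal_leI)
    have "L2_norm f \<le> sqrt (2 * (c\<^sup>2 * S))" unfolding L2_norm_def using f(3) Gv(2) by simp
    also have "\<dots> = sqrt 2 * c * sqrt S" using c by (simp add: real_sqrt_mult)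
    finally show "L2_norm f \<le> sqrt 2 * c * sqrt S" .
  qed
  finally show ?thesis .
qed

theorem theorem2p4:
  fixes s :: real and B Q :: "real^'n^'n" and S :: "(real^'n) set" and r :: nat
  assumes "s > 0"
    and "pos_semidef Q"
    and "S = (\<Inter>j\<in>{0..CARD('n) - 1}. mat_ker (mat_sqrt Q ** mat_pow (transpose B) j))"
    and "r = (LEAST m. m \<le> CARD('n) - 1 \<and>
                S = (\<Inter>j\<in>{0..m}. mat_ker (mat_sqrt Q ** mat_pow (transpose B) j)))"
  shows "\<exists>c>0. \<forall>u\<in>frac_OU_domain s B Q.
    (\<Sum>k=0..r. distr_L2_norm (fourier_multiplier
       (\<lambda>\<xi>. complex_of_real
          (japanese ((mat_sqrt Q ** mat_pow (transpose B) k) *v \<xi>)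
             powr (2 * s / (1 + 2 * real k * s)))) u))
    \<le> ennreal c * (distr_L2_norm (frac_OU s B Q u) + ennreal (L2_norm u))"
proof -
  define A where "A k = mat_sqrt Q ** mat_pow (transpose B) k" for k
  \<comment> \<open>The only place where the choice of \<open>r\<close> enters: it bounds the next
    member of the chain by the previous ones.\<close>
  have "(\<Inter>j\<in>{0..r}. mat_ker (A j)) \<subseteq> mat_ker (A (Suc r))"
    using kernel_chain_stabilises[of "mat_sqrt Q" "transpose B"] unfolding A_def assms(3,4) .
  then obtain c1 where c1: "\<And>x. norm (A (Suc r) *v x) \<le> c1 * (\<Sum>j=0..r. norm (A j *v x))"
    using norm_le_sum_norm_of_kernel[of A r "A (Suc r)"] by blast
  have step: "A (Suc k) = A k ** transpose B" for k
    unfolding A_def mat_pow_Suc_right matrix_mul_assoc ..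
  obtain M M' p c D where p: "p \<ge> 0" and c: "c > 0" and M: "tame p M M'" and M0: "\<And>x. M x > 0"
    and low: "\<And>k x. k \<le> r \<Longrightarrow> c * japanese (A k *v x) powr (2 * s / (1 + 2 * real k * s)) \<le> M x"
    and coercive: "\<And>x. c * (M x)\<^sup>2 - D \<le> M' x (transpose B *v x) + M x * norm (A 0 *v x) powr (2 * s)"
    using hypocoercive_multiplier[OF assms(1) step c1] by blast
  have A0: "A 0 = mat_sqrt Q" by (simp add: A_def)
  obtain K where K: "K \<ge> 0" and est: "\<And>u f. u \<in> L2 \<Longrightarrow> f \<in> L2 \<Longrightarrow> distr_eq (frac_OU s B Q u) (distr_of f) \<Longrightarrow>
    (\<integral>\<^sup>+x. ennreal ((M x * cmod (fourier_L2 u x))\<^sup>2) \<partial>lborel)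
      \<le> ennreal (K * ((\<integral>x. (cmod (u x))\<^sup>2 \<partial>lborel) + (\<integral>x. (cmod (f x))\<^sup>2 \<partial>lborel)))"
    using weighted_L2_estimate[OF assms(1,2) M p M0 c coercive[unfolded A0]] by blast
  define G where "G k \<xi> = complex_of_real (japanese (A k *v \<xi>) powr (2 * s / (1 + 2 * real k * s)))" for k \<xi>
  have G_meas: "G k \<in> borel_measurable borel" for k
  proof -
    have [measurable]: "(\<lambda>\<xi>. A k *v \<xi>) \<in> borel_measurable borel"
      by (intro borel_measurable_continuous_onI linear_continuous_on matrix_vector_mul_bounded_linear)
    show ?thesis unfolding G_def japanese_def by measurable
  qed
  have G_le: "cmod (G k x) \<le> 1 / c * M x" if "k \<le> r" for k x
    using low[OF that, of x] c by (simp add: G_def field_simps)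
  \<comment> \<open>There are r + 1 summands with the same bound; the added 1 makes the constant
    positive even if K = 0.\<close>
  define c' where "c' = (real r + 1) * (sqrt 2 * (1 / c) * sqrt K) + 1"
  have c': "c' > 0" using c K by (simp add: c'_def add_nonneg_pos)
  have "(\<Sum>k=0..r. distr_L2_norm (fourier_multiplier (G k) u)) \<le> ennreal c' * (distr_L2_norm (frac_OU s B Q u) + ennreal (L2_norm u))"
    if u: "u \<in> frac_OU_domain s B Q" for u
  proof -
    have uL2: "u \<in> L2" using u by (simp add: frac_OU_domain_def)
    \<comment> \<open>First with an arbitrary function \<open>f\<close> representing the image of
      \<open>u\<close> in place of its distributional norm.\<close>
    have single: "(\<Sum>k=0..r. distr_L2_norm (fourier_multiplier (G k) u)) \<le> ennreal c' * (ennreal (L2_norm f) + ennreal (L2_norm u))"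
      if f: "f \<in> L2" "distr_eq (frac_OU s B Q u) (distr_of f)" for f
    proof -
      define U where "U = (\<integral>x. (cmod (u x))\<^sup>2 \<partial>lborel)"
      define F where "F = (\<integral>x. (cmod (f x))\<^sup>2 \<partial>lborel)"
      have UF: "U \<ge> 0" "F \<ge> 0" by (auto simp: U_def F_def)
      have "(\<Sum>k=0..r. distr_L2_norm (fourier_multiplier (G k) u)) \<le> (\<Sum>k=0..r. ennreal (sqrt 2 * (1 / c) * sqrt (K * (U + F))))"
      proof (rule sum_mono)
        fix k assume "k \<in> {0..r}"
        then have k: "k \<le> r" by simp
        show "distr_L2_norm (fourier_multiplier (G k) u) \<le> ennreal (sqrt 2 * (1 / c) * sqrt (K * (U + F)))"
          using est[OF uL2 f] K UF c less_imp_le[OF M0] unfolding U_def[symmetric] F_def[symmetric]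
          by (intro fourier_multiplier_L2_norm[OF uL2 G_meas G_le[OF k]]) auto
      qed
      also have "\<dots> = ennreal ((real r + 1) * (sqrt 2 * (1 / c) * sqrt (K * (U + F))))"
      proof -
        have "(\<Sum>k=0..r. ennreal (sqrt 2 * (1 / c) * sqrt (K * (U + F)))) = ennreal (\<Sum>k=0..r. sqrt 2 * (1 / c) * sqrt (K * (U + F)))"
          using c K UF by (intro sum_ennreal) auto
        then show ?thesis by (simp add: add.commute)
      qed
      also have "\<dots> \<le> ennreal (c' * (sqrt F + sqrt U))"
      proof (rule ennreal_leI)
        have "sqrt (K * (U + F)) = sqrt K * sqrt (F + U)" by (simp add: real_sqrt_mult add.commute)
        also have "\<dots> \<le> sqrt K * (sqrt F + sqrt U)" using UF K by (intro mult_left_mono sqrt_add_le_add_sqrt) auto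
        finally have "(real r + 1) * (sqrt 2 * (1 / c) * sqrt (K * (U + F))) \<le> (real r + 1) * (sqrt 2 * (1 / c) * (sqrt K * (sqrt F + sqrt U)))"
          using c by (intro mult_left_mono) auto
        also have "\<dots> = (c' - 1) * (sqrt F + sqrt U)" by (simp add: c'_def)
        also have "\<dots> \<le> c' * (sqrt F + sqrt U)" using UF by (intro mult_right_mono) auto
        finally show "(real r + 1) * (sqrt 2 * (1 / c) * sqrt (K * (U + F))) \<le> c' * (sqrt F + sqrt U)" .
      qed
      also have "\<dots> = ennreal c' * (ennreal (L2_norm f) + ennreal (L2_norm u))"
        using c' UF by (simp add: L2_norm_def U_def F_def ennreal_mult)
      finally show ?thesis .
    qed
    let ?S = "{f \<in> L2. distr_eq (frac_OU s B Q u) (distr_of f)}"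
    show ?thesis
    \<comment> \<open>The distributional norm is an infimum over representatives; taking one within
      e / c' of it suffices, with no comparison between different representatives.\<close>
    proof (rule ennreal_le_epsilon)
      fix e :: real
      assume fin: "ennreal c' * (distr_L2_norm (frac_OU s B Q u) + ennreal (L2_norm u)) < top" and e: "0 < e"
      have "distr_L2_norm (frac_OU s B Q u) \<noteq> \<infinity>"
        using fin c' by (auto simp: ennreal_mult_eq_top_iff)
      moreover have "e / c' > 0" using e c' by simp
      ultimately obtain f where f: "f \<in> ?S" "ennreal (L2_norm f) < distr_L2_norm (frac_OU s B Q u) + ennreal (e / c')"
        using INF_approx_ennreal[OF _ distr_L2_norm_def] by blast
      have "(\<Sum>k=0..r. distr_L2_norm (fourier_multiplier (G k) u)) \<le> ennreal c' * (ennreal (L2_norm f) + ennreal (L2_norm u))"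
        using single f(1) by blast
      also have "\<dots> \<le> ennreal c' * ((distr_L2_norm (frac_OU s B Q u) + ennreal (e / c')) + ennreal (L2_norm u))"
        by (rule mult_left_mono[OF add_right_mono[OF less_imp_le[OF f(2)]]]) simp
      also have "\<dots> = ennreal c' * (distr_L2_norm (frac_OU s B Q u) + ennreal (L2_norm u)) + ennreal c' * ennreal (e / c')"
        by (simp only: distrib_left ac_simps)
      also have "ennreal c' * ennreal (e / c') = ennreal e" using c' e by (simp add: ennreal_mult[symmetric])
      finally show "(\<Sum>k=0..r. distr_L2_norm (fourier_multiplier (G k) u))
        \<le> ennreal c' * (distr_L2_norm (frac_OU s B Q u) + ennreal (L2_norm u)) + ennreal e" .
    qed
  qed
  then show ?thesis unfolding G_def A_def using c' by blast
qed

end
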